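(* Let $\Lambda$ be an artin algebra and let $\mathcal{E}$ be a functorially finite torsionfree class, or a functorially finite torsion class, of $\mathsf{mod}\,\Lambda$. Then $\mathcal{E}$ is of finite type if and only if $\mathsf{AR}(\mathcal{E})=\mathsf{Ex}(\mathcal{E})$ holds.
   Context: All categories are additive, and all subcategories are additive, full and closed under isomorphisms. An artin algebra is an algebra over a commutative artinian local ring $R$ which is finitely generated as an $R$-module; $\mathsf{mod}\,\Lambda$ is the category of finitely generated $\Lambda$-modules. A torsionfree class (resp. torsion class) of $\mathsf{mod}\,\Lambda$ is a subcategory closed under submodules and extensions (resp. quotients and extensions). A subcategory $\mathcal{E}$ of $\mathsf{mod}\,\Lambda$ is contravariantly finite if every $X \in \mathsf{mod}\,\Lambda$ admits a morphism $E_X \to X$ with $E_X\in\mathcal{E}$ through which every morphism $E\to X$ with $E\in\mathcal{E}$ factors; covariantly finite is the dual notion; functorially finite means both. $\mathcal{E}$ is regarded as an exact category whose conflations are the short exact sequences of $\mathsf{mod}\,\Lambda$ with all terms in $\mathcal{E}$; it is Krull-Schmidt. $\mathcal{E}$ is of finite type if $\mathcal{E}=\mathsf{add}\,G$ for some $G\in\mathcal{E}$, where $\mathsf{add}\,G$ consists of all direct summands of finite direct sums of $G$; equivalently here, there are only finitely many indecomposable objects up to isomorphism. For a Krull-Schmidt exact category $\mathcal{E}$ with Jacobson radical $\mathcal{J}$: a morphism $g:Y\to Z$ is right almost split if $Z$ is indecomposable, $g\in\mathcal{J}$, and any $h: W\to Z$ in $\mathcal{J}$ factors through $g$; left almost split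 is the dual notion. A conflation $0\to X\xrightarrow{f}Y\xrightarrow{g}Z\to 0$ is an AR conflation if $f$ is left almost split and $g$ is right almost split. $\mathsf{K}_0(\mathcal{E},0)$ is the free abelian group on the set of isomorphism classes of indecomposable objects, where for $X\cong\bigoplus X_i$ with $X_i$ indecomposable one puts $[X]=\sum [X_i]$. $\mathsf{Ex}(\mathcal{E})$ (resp. $\mathsf{AR}(\mathcal{E})$) is the subgroup of $\mathsf{K}_0(\mathcal{E},0)$ generated by $[X]-[Y]+[Z]$ for all conflations (resp. all AR conflations) $0\to X\to Y\to Z\to 0$ in $\mathcal{E}$. *)

theory Defs
  imports "HOL-Algebra.Module" "HOL-Algebra.Ideal" "HOL-Algebra.Generated_Groups"
    "HOL-Algebra.Free_Abelian_Groups"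
begin

section \<open>Artin algebras\<close>

locale left_module = R?: ring A + M?: abelian_group M
  for A :: "('a, 'k) ring_scheme" (structure) and M :: "('a, 'b, 'l) module_scheme" (structure) +
  assumes smult_closed [simp, intro]:
      "\<lbrakk>a \<in> carrier A; x \<in> carrier M\<rbrakk> \<Longrightarrow> a \<odot>\<^bsub>M\<^esub> x \<in> carrier M"
    and smult_l_distr:
      "\<lbrakk>a \<in> carrier A; b \<in> carrier A; x \<in> carrier M\<rbrakk> \<Longrightarrow>
        (a \<oplus>\<^bsub>A\<^esub> b) \<odot>\<^bsub>M\<^esub> x = a \<odot>\<^bsub>M\<^esub> x \<oplus>\<^bsub>M\<^esub> b \<odot>\<^bsub>M\<^esub> x"
    and smult_r_distr:
      "\<lbrakk>a \<in> carrier A; x \<in> carrier M; y \<in> carrier M\<rbrakk> \<Longrightarrow>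
        a \<odot>\<^bsub>M\<^esub> (x \<oplus>\<^bsub>M\<^esub> y) = a \<odot>\<^bsub>M\<^esub> x \<oplus>\<^bsub>M\<^esub> a \<odot>\<^bsub>M\<^esub> y"
    and smult_assoc:
      "\<lbrakk>a \<in> carrier A; b \<in> carrier A; x \<in> carrier M\<rbrakk> \<Longrightarrow>
        (a \<otimes>\<^bsub>A\<^esub> b) \<odot>\<^bsub>M\<^esub> x = a \<odot>\<^bsub>M\<^esub> (b \<odot>\<^bsub>M\<^esub> x)"
    and smult_one [simp]: "x \<in> carrier M \<Longrightarrow> \<one>\<^bsub>A\<^esub> \<odot>\<^bsub>M\<^esub> x = x"

definition fin_gen :: "('a, 'k) ring_scheme \<Rightarrow> ('a, 'b, 'l) module_scheme \<Rightarrow> bool" where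
  "fin_gen A M \<longleftrightarrow> (\<exists>S. finite S \<and> S \<subseteq> carrier M \<and>
     (\<forall>x\<in>carrier M. \<exists>c\<in>S \<rightarrow> carrier A. x = (\<Oplus>\<^bsub>M\<^esub>s\<in>S. c s \<odot>\<^bsub>M\<^esub> s)))"

locale artinian_local_ring = cring R for R (structure) +
  assumes descending_chain_condition:
      "\<lbrakk>\<And>i::nat. ideal (I i) R; \<And>i. I (Suc i) \<subseteq> I i\<rbrakk> \<Longrightarrow> \<exists>n. \<forall>m\<ge>n. I m = I n"
    and unique_maximal_ideal: "\<exists>!I. maximalideal I R"

text \<open>The library locale \<open>algebra\<close> requires the algebra to be commutative.\<close>

locale artin_algebra =
  R?: artinian_local_ring R + module R \<Lambda> + ring \<Lambda>
  for R :: "('r, 'k) ring_scheme" (structure) and \<Lambda> :: "('r, 'a) module" (structure) +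
  assumes smult_mult_left:
      "\<lbrakk>r \<in> carrier R; a \<in> carrier \<Lambda>; b \<in> carrier \<Lambda>\<rbrakk> \<Longrightarrow>
        (r \<odot>\<^bsub>\<Lambda>\<^esub> a) \<otimes>\<^bsub>\<Lambda>\<^esub> b = r \<odot>\<^bsub>\<Lambda>\<^esub> (a \<otimes>\<^bsub>\<Lambda>\<^esub> b)"
    and smult_mult_right:
      "\<lbrakk>r \<in> carrier R; a \<in> carrier \<Lambda>; b \<in> carrier \<Lambda>\<rbrakk> \<Longrightarrow>
        a \<otimes>\<^bsub>\<Lambda>\<^esub> (r \<odot>\<^bsub>\<Lambda>\<^esub> b) = r \<odot>\<^bsub>\<Lambda>\<^esub> (a \<otimes>\<^bsub>\<Lambda>\<^esub> b)"
    and fin_gen: "fin_gen R \<Lambda>"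


section \<open>The category of finitely generated modules\<close>

definition mod_hom ::
    "('a, 'k) ring_scheme \<Rightarrow> ('a, 'b, 'l) module_scheme \<Rightarrow> ('a, 'c, 'm) module_scheme \<Rightarrow> ('b \<Rightarrow> 'c) set" where
  "mod_hom A M N = {h \<in> carrier M \<rightarrow> carrier N.
     (\<forall>x\<in>carrier M. \<forall>y\<in>carrier M. h (x \<oplus>\<^bsub>M\<^esub> y) = h x \<oplus>\<^bsub>N\<^esub> h y) \<and>
     (\<forall>a\<in>carrier A. \<forall>x\<in>carrier M. h (a \<odot>\<^bsub>M\<^esub> x) = a \<odot>\<^bsub>N\<^esub> h x)}"

definition mod_iso ::
    "('a, 'k) ring_scheme \<Rightarrow> ('a, 'b, 'l) module_scheme \<Rightarrow> ('a, 'c, 'm) module_scheme \<Rightarrow> bool" where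
  "mod_iso A M N \<longleftrightarrow> (\<exists>h\<in>mod_hom A M N. bij_betw h (carrier M) (carrier N))"

text \<open>
  The objects of \<open>mod A\<close> are the finitely generated left \<open>A\<close>-modules carried by some set of
  lists over the type of \<open>A\<close>. By \<open>fin_gen_representable\<close> below, every finitely generated left
  module over \<open>A\<close>, of whatever carrier type, is isomorphic to one of these. The fields
  \<open>mult\<close> and \<open>one\<close>, which module records inherit from rings, carry no information.
\<close>

type_synonym 'a modobj = "('a, 'a list) module"

definition mods :: "('a, 'k) ring_scheme \<Rightarrow> 'a modobj set" where
  "mods A = {M. left_module A M \<and> fin_gen A M}"

text \<open>
  Finite direct sums are biproducts: \<open>X\<close> is the direct sum of the list \<open>Ys\<close> if there are
  injections and projections satisfying the usual identities. The empty list describes the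
  zero modules.
\<close>

definition is_direct_sum ::
    "('a, 'k) ring_scheme \<Rightarrow> ('a, 'b) module \<Rightarrow> ('a, 'b) module list \<Rightarrow> bool" where
  "is_direct_sum A X Ys \<longleftrightarrow> (\<exists>\<iota> \<pi>.
     (\<forall>i<length Ys. \<iota> i \<in> mod_hom A (Ys ! i) X \<and> \<pi> i \<in> mod_hom A X (Ys ! i)) \<and>
     (\<forall>i<length Ys. \<forall>j<length Ys. \<forall>y\<in>carrier (Ys ! i).
        \<pi> j (\<iota> i y) = (if i = j then y else \<zero>\<^bsub>Ys ! j\<^esub>)) \<and>
     (\<forall>x\<in>carrier X. (\<Oplus>\<^bsub>X\<^esub>i\<in>{..<length Ys}. \<iota> i (\<pi> i x)) = x))"

definition short_exact ::
    "('a, 'k) ring_scheme \<Rightarrow> ('a, 'b) module \<Rightarrow> ('b \<Rightarrow> 'b) \<Rightarrow> ('a, 'b) module \<Rightarrow> ('b \<Rightarrow> 'b)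
      \<Rightarrow> ('a, 'b) module \<Rightarrow> bool" where
  "short_exact A X f Y g Z \<longleftrightarrow> f \<in> mod_hom A X Y \<and> g \<in> mod_hom A Y Z \<and>
     inj_on f (carrier X) \<and> f ` carrier X = a_kernel Y Z g \<and> g ` carrier Y = carrier Z"


section \<open>Subcategories\<close>

text \<open>All subcategories are full, so they are given by their sets of objects.\<close>

definition additive_subcategory :: "('a, 'k) ring_scheme \<Rightarrow> 'a modobj set \<Rightarrow> bool" where
  "additive_subcategory A \<E> \<longleftrightarrow> \<E> \<subseteq> mods A \<and>
     (\<forall>X\<in>\<E>. \<forall>Y\<in>mods A. mod_iso A X Y \<longrightarrow> Y \<in> \<E>) \<and>
     (\<forall>X\<in>mods A. \<forall>Ys. set Ys \<subseteq> \<E> \<and> is_direct_sum A X Ys \<longrightarrow> X \<in> \<E>)"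

definition extension_closed :: "('a, 'k) ring_scheme \<Rightarrow> 'a modobj set \<Rightarrow> bool" where
  "extension_closed A \<E> \<longleftrightarrow>
     (\<forall>X\<in>\<E>. \<forall>Y\<in>mods A. \<forall>Z\<in>\<E>. (\<exists>f g. short_exact A X f Y g Z) \<longrightarrow> Y \<in> \<E>)"

definition torsionfree_class :: "('a, 'k) ring_scheme \<Rightarrow> 'a modobj set \<Rightarrow> bool" where
  "torsionfree_class A \<E> \<longleftrightarrow> additive_subcategory A \<E> \<and> extension_closed A \<E> \<and>
     (\<forall>X\<in>mods A. \<forall>Y\<in>\<E>. (\<exists>f\<in>mod_hom A X Y. inj_on f (carrier X)) \<longrightarrow> X \<in> \<E>)"

definition torsion_class :: "('a, 'k) ring_scheme \<Rightarrow> 'a modobj set \<Rightarrow> bool" where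
  "torsion_class A \<E> \<longleftrightarrow> additive_subcategory A \<E> \<and> extension_closed A \<E> \<and>
     (\<forall>X\<in>\<E>. \<forall>Y\<in>mods A. (\<exists>f\<in>mod_hom A X Y. f ` carrier X = carrier Y) \<longrightarrow> Y \<in> \<E>)"

definition contravariantly_finite :: "('a, 'k) ring_scheme \<Rightarrow> 'a modobj set \<Rightarrow> bool" where
  "contravariantly_finite A \<E> \<longleftrightarrow> (\<forall>X\<in>mods A. \<exists>E\<^sub>X\<in>\<E>. \<exists>p\<in>mod_hom A E\<^sub>X X.
     \<forall>E\<in>\<E>. \<forall>h\<in>mod_hom A E X. \<exists>k\<in>mod_hom A E E\<^sub>X. \<forall>x\<in>carrier E. h x = p (k x))"

definition covariantly_finite :: "('a, 'k) ring_scheme \<Rightarrow> 'a modobj set \<Rightarrow> bool" where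
  "covariantly_finite A \<E> \<longleftrightarrow> (\<forall>X\<in>mods A. \<exists>E\<^sub>X\<in>\<E>. \<exists>p\<in>mod_hom A X E\<^sub>X.
     \<forall>E\<in>\<E>. \<forall>h\<in>mod_hom A X E. \<exists>k\<in>mod_hom A E\<^sub>X E. \<forall>x\<in>carrier X. h x = k (p x))"

definition functorially_finite :: "('a, 'k) ring_scheme \<Rightarrow> 'a modobj set \<Rightarrow> bool" where
  "functorially_finite A \<E> \<longleftrightarrow> contravariantly_finite A \<E> \<and> covariantly_finite A \<E>"

definition add_closure :: "('a, 'k) ring_scheme \<Rightarrow> 'a modobj \<Rightarrow> 'a modobj set" where
  "add_closure A G = {X \<in> mods A. \<exists>n. \<exists>S\<in>mods A. \<exists>X'\<in>mods A.
     is_direct_sum A S (replicate n G) \<and> is_direct_sum A S [X, X']}"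

definition finite_type :: "('a, 'k) ring_scheme \<Rightarrow> 'a modobj set \<Rightarrow> bool" where
  "finite_type A \<E> \<longleftrightarrow> (\<exists>G\<in>\<E>. \<E> = add_closure A G)"

definition indecomposable :: "('a, 'k) ring_scheme \<Rightarrow> 'a modobj set \<Rightarrow> 'a modobj \<Rightarrow> bool" where
  "indecomposable A \<E> X \<longleftrightarrow> X \<in> \<E> \<and> carrier X \<noteq> {\<zero>\<^bsub>X\<^esub>} \<and>
     (\<forall>Y\<in>\<E>. \<forall>Z\<in>\<E>. is_direct_sum A X [Y, Z] \<longrightarrow> carrier Y = {\<zero>\<^bsub>Y\<^esub>} \<or> carrier Z = {\<zero>\<^bsub>Z\<^esub>})"


section \<open>Auslander--Reiten conflations\<close>

text \<open>
  The Jacobson radical of an additive category consists of those \<open>f : X \<rightarrow> Y\<close> for which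
  \<open>1 - g f\<close> is an automorphism of \<open>X\<close> for all \<open>g : Y \<rightarrow> X\<close>. As all subcategories are full, it
  depends on \<open>X\<close> and \<open>Y\<close> only.
\<close>

definition radical ::
    "('a, 'k) ring_scheme \<Rightarrow> ('a, 'b) module \<Rightarrow> ('a, 'b) module \<Rightarrow> ('b \<Rightarrow> 'b) set" where
  "radical A X Y = {f \<in> mod_hom A X Y. \<forall>g\<in>mod_hom A Y X.
     bij_betw (\<lambda>x. x \<ominus>\<^bsub>X\<^esub> g (f x)) (carrier X) (carrier X)}"

definition right_almost_split ::
    "('a, 'k) ring_scheme \<Rightarrow> 'a modobj set \<Rightarrow> 'a modobj \<Rightarrow> ('a list \<Rightarrow> 'a list) \<Rightarrow> 'a modobj \<Rightarrow> bool" where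
  "right_almost_split A \<E> Y g Z \<longleftrightarrow> Y \<in> \<E> \<and> indecomposable A \<E> Z \<and> g \<in> radical A Y Z \<and>
     (\<forall>W\<in>\<E>. \<forall>h\<in>radical A W Z. \<exists>k\<in>mod_hom A W Y. \<forall>x\<in>carrier W. h x = g (k x))"

definition left_almost_split ::
    "('a, 'k) ring_scheme \<Rightarrow> 'a modobj set \<Rightarrow> 'a modobj \<Rightarrow> ('a list \<Rightarrow> 'a list) \<Rightarrow> 'a modobj \<Rightarrow> bool" where
  "left_almost_split A \<E> X f Y \<longleftrightarrow> Y \<in> \<E> \<and> indecomposable A \<E> X \<and> f \<in> radical A X Y \<and>
     (\<forall>W\<in>\<E>. \<forall>h\<in>radical A X W. \<exists>k\<in>mod_hom A Y W. \<forall>x\<in>carrier X. h x = k (f x))"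

definition conflation ::
    "('a, 'k) ring_scheme \<Rightarrow> 'a modobj set \<Rightarrow> 'a modobj \<Rightarrow> ('a list \<Rightarrow> 'a list) \<Rightarrow> 'a modobj
      \<Rightarrow> ('a list \<Rightarrow> 'a list) \<Rightarrow> 'a modobj \<Rightarrow> bool" where
  "conflation A \<E> X f Y g Z \<longleftrightarrow> X \<in> \<E> \<and> Y \<in> \<E> \<and> Z \<in> \<E> \<and> short_exact A X f Y g Z"

definition AR_conflation ::
    "('a, 'k) ring_scheme \<Rightarrow> 'a modobj set \<Rightarrow> 'a modobj \<Rightarrow> ('a list \<Rightarrow> 'a list) \<Rightarrow> 'a modobj
      \<Rightarrow> ('a list \<Rightarrow> 'a list) \<Rightarrow> 'a modobj \<Rightarrow> bool" where
  "AR_conflation A \<E> X f Y g Z \<longleftrightarrow> conflation A \<E> X f Y g Z \<and>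
     left_almost_split A \<E> X f Y \<and> right_almost_split A \<E> Y g Z"


section \<open>The relation subgroups\<close>

definition iso_class :: "('a, 'k) ring_scheme \<Rightarrow> 'a modobj set \<Rightarrow> 'a modobj \<Rightarrow> 'a modobj set" where
  "iso_class A \<E> X = {Y \<in> \<E>. mod_iso A X Y}"

definition K0_split :: "('a, 'k) ring_scheme \<Rightarrow> 'a modobj set \<Rightarrow> ('a modobj set \<Rightarrow>\<^sub>0 int) monoid" where
  "K0_split A \<E> = free_Abelian_group (iso_class A \<E> ` {X. indecomposable A \<E> X})"

text \<open>Well defined by the Krull--Schmidt theorem.\<close>

definition K0_class ::
    "('a, 'k) ring_scheme \<Rightarrow> 'a modobj set \<Rightarrow> 'a modobj \<Rightarrow> 'a modobj set \<Rightarrow>\<^sub>0 int" where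
  "K0_class A \<E> X = (THE c. \<exists>Xs. (\<forall>Y\<in>set Xs. indecomposable A \<E> Y) \<and> is_direct_sum A X Xs \<and>
     c = (\<Sum>Y\<leftarrow>Xs. frag_of (iso_class A \<E> Y)))"

definition Ex_subgroup :: "('a, 'k) ring_scheme \<Rightarrow> 'a modobj set \<Rightarrow> ('a modobj set \<Rightarrow>\<^sub>0 int) set" where
  "Ex_subgroup A \<E> = generate (K0_split A \<E>)
     {K0_class A \<E> X - K0_class A \<E> Y + K0_class A \<E> Z | X f Y g Z. conflation A \<E> X f Y g Z}"

definition AR_subgroup :: "('a, 'k) ring_scheme \<Rightarrow> 'a modobj set \<Rightarrow> ('a modobj set \<Rightarrow>\<^sub>0 int) set" where
  "AR_subgroup A \<E> = generate (K0_split A \<E>)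
     {K0_class A \<E> X - K0_class A \<E> Y + K0_class A \<E> Z | X f Y g Z. AR_conflation A \<E> X f Y g Z}"


section \<open>Adequacy of the chosen universe of modules\<close>

lemma mod_hom_finsum:
  assumes "abelian_group M" "abelian_group N" "h \<in> mod_hom A M N" "f \<in> S \<rightarrow> carrier M" "finite S"
  shows "h (\<Oplus>\<^bsub>M\<^esub>s\<in>S. f s) = (\<Oplus>\<^bsub>N\<^esub>s\<in>S. h (f s))"
proof -
  interpret M: abelian_group M by fact
  interpret N: abelian_group N by fact
  have h: "h x \<in> carrier N" "h (x \<oplus>\<^bsub>M\<^esub> y) = h x \<oplus>\<^bsub>N\<^esub> h y"
    if "x \<in> carrier M" "y \<in> carrier M" for x y
    using assms(3) that by (auto simp: mod_hom_def)
  have "h \<zero>\<^bsub>M\<^esub> \<oplus>\<^bsub>N\<^esub> h \<zero>\<^bsub>M\<^esub> = h \<zero>\<^bsub>M\<^esub>"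
    using h(2)[of "\<zero>\<^bsub>M\<^esub>" "\<zero>\<^bsub>M\<^esub>"] by simp
  then have h0: "h \<zero>\<^bsub>M\<^esub> = \<zero>\<^bsub>N\<^esub>"
    using h(1)[of "\<zero>\<^bsub>M\<^esub>" "\<zero>\<^bsub>M\<^esub>"] by (simp add: N.add.l_cancel_one)
  show ?thesis
    using assms(5,4)
  proof (induction S)
    case empty
    then show ?case using h0 by simp
  next
    case (insert s S)
    then have "f \<in> S \<rightarrow> carrier M" "f s \<in> carrier M" by auto
    moreover from this have "(\<lambda>s. h (f s)) \<in> S \<rightarrow> carrier N" "h (f s) \<in> carrier N"
      using h(1) by auto
    ultimately show ?case
      using insert h by simp
  qed
qed

proposition fin_gen_representable:
  fixes A :: "('a, 'k) ring_scheme" and N :: "('a, 'b, 'l) module_scheme"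
  assumes N: "left_module A N" and fg: "fin_gen A N"
  shows "\<exists>M\<in>mods A. mod_iso A N M"
proof -
  interpret N: left_module A N by (rule N)
  obtain S where S: "finite S" "S \<subseteq> carrier N"
    and gen: "\<forall>x\<in>carrier N. \<exists>c\<in>S \<rightarrow> carrier A. x = (\<Oplus>\<^bsub>N\<^esub>s\<in>S. c s \<odot>\<^bsub>N\<^esub> s)"
    using fg unfolding fin_gen_def by blast
  obtain ss where ss: "set ss = S" using S(1) finite_list by blast
  obtain c where c: "\<And>x. x \<in> carrier N \<Longrightarrow> c x \<in> S \<rightarrow> carrier A"
    "\<And>x. x \<in> carrier N \<Longrightarrow> x = (\<Oplus>\<^bsub>N\<^esub>s\<in>S. c x s \<odot>\<^bsub>N\<^esub> s)"
    using gen by metis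
  define e where "e x = map (c x) ss" for x
  have inj: "inj_on e (carrier N)"
  proof (rule inj_onI)
    fix x y assume xy: "x \<in> carrier N" "y \<in> carrier N" "e x = e y"
    then have "\<forall>s\<in>S. c x s = c y s" using ss by (auto simp: e_def)
    then have "(\<Oplus>\<^bsub>N\<^esub>s\<in>S. c x s \<odot>\<^bsub>N\<^esub> s) = (\<Oplus>\<^bsub>N\<^esub>s\<in>S. c y s \<odot>\<^bsub>N\<^esub> s)"
      using S(2) c(1)[OF xy(2)] by (intro N.finsum_cong') auto
    then show "x = y" using c(2) xy by metis
  qed
  define d where "d = inv_into (carrier N) e"
  have de [simp]: "d (e x) = x" if "x \<in> carrier N" for x
    using inj that by (simp add: d_def)
  define M :: "'a modobj" where "M = \<lparr>carrier = e ` carrier N, monoid.mult = (\<lambda>x y. x), monoid.one = [],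
    ring.zero = e \<zero>\<^bsub>N\<^esub>, ring.add = (\<lambda>x y. e (d x \<oplus>\<^bsub>N\<^esub> d y)), smult = (\<lambda>a x. e (a \<odot>\<^bsub>N\<^esub> d x))\<rparr>"
  have M_abelian: "abelian_group M"
  proof (rule abelian_groupI)
    fix x assume "x \<in> carrier M"
    then obtain x' where "x' \<in> carrier N" "x = e x'" by (auto simp: M_def)
    then show "\<exists>y\<in>carrier M. y \<oplus>\<^bsub>M\<^esub> x = \<zero>\<^bsub>M\<^esub>"
      by (intro bexI[of _ "e (\<ominus>\<^bsub>N\<^esub> x')"]) (auto simp: M_def N.M.l_neg)
  qed (auto simp: M_def N.M.a_ac)
  have M: "left_module A M"
    unfolding left_module_def left_module_axioms_def
    using M_abelian N.R.ring_axioms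
    by (auto simp: M_def N.smult_l_distr N.smult_r_distr N.smult_assoc)
  have hom: "e \<in> mod_hom A N M"
    by (auto simp: mod_hom_def M_def)
  have "fin_gen A M"
    unfolding fin_gen_def
  proof (intro exI[of _ "e ` S"] conjI ballI)
    fix x assume "x \<in> carrier M"
    then obtain x' where x': "x' \<in> carrier N" "x = e x'" by (auto simp: M_def)
    have cl: "c x' s \<in> carrier A" "s \<in> carrier N" if "s \<in> S" for s
      using that c(1)[OF x'(1)] S(2) by auto
    have "x = e (\<Oplus>\<^bsub>N\<^esub>s\<in>S. c x' s \<odot>\<^bsub>N\<^esub> s)"
      unfolding x'(2) by (rule arg_cong[OF c(2)[OF x'(1)]])
    also have "\<dots> = (\<Oplus>\<^bsub>M\<^esub>s\<in>S. e (c x' s \<odot>\<^bsub>N\<^esub> s))"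
      using cl by (intro mod_hom_finsum[OF N.abelian_group_axioms M_abelian hom _ S(1)]) auto
    also have "\<dots> = (\<Oplus>\<^bsub>M\<^esub>s\<in>S. c x' (d (e s)) \<odot>\<^bsub>M\<^esub> e s)"
      using cl by (intro abelian_monoid.finsum_cong' abelian_group.axioms(1)[OF M_abelian])
        (auto simp: M_def)
    also have "\<dots> = (\<Oplus>\<^bsub>M\<^esub>t\<in>e ` S. c x' (d t) \<odot>\<^bsub>M\<^esub> t)"
      using cl S inj by (intro abelian_monoid.finsum_reindex[symmetric] abelian_group.axioms(1)[OF M_abelian])
        (auto simp: M_def intro: inj_on_subset)
    finally show "\<exists>k\<in>e ` S \<rightarrow> carrier A. x = (\<Oplus>\<^bsub>M\<^esub>t\<in>e ` S. k t \<odot>\<^bsub>M\<^esub> t)"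
      using cl by (intro bexI[of _ "\<lambda>t. c x' (d t)"]) auto
  qed (use S in \<open>auto simp: M_def\<close>)
  moreover have "bij_betw e (carrier N) (carrier M)"
    using inj by (simp add: M_def bij_betw_def)
  ultimately show ?thesis
    using M hom by (auto simp: mods_def mod_iso_def)
qed

end

theory Submission
  imports Defs
begin

text \<open>
  Suppose \<open>\<E> = add G\<close>. The defect \<open>coker (Hom(G, Y) \<rightarrow> Hom(G, Z))\<close> of a conflation \<open>X \<rightarrow> Y \<rightarrow> Z\<close> has finite
  length over \<open>R\<close>. If it is nonzero, a pullback writes the class of the conflation as the class of an almost
  split one plus the class of one with a shorter defect; so \<open>Ex(\<E>) \<subseteq> AR(\<E>)\<close> by induction.

  Conversely, for indecomposable \<open>W\<close> the lengths of \<open>Hom(W, -)\<close> and \<open>Hom(-, W)\<close> are additive functions on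
  \<open>K\<^sub>0(\<E>, 0)\<close>. On the class of a conflation they vanish only if all maps from \<open>W\<close> lift along the deflation, or
  all maps to \<open>W\<close> extend along the inflation; on an AR conflation they do vanish unless \<open>W\<close> is one of its end
  terms. So if \<open>AR(\<E>) = Ex(\<E>)\<close>, every conflation is split by all but finitely many \<open>W\<close> in this sense. It
  remains to exhibit finitely many conflations that no \<open>W\<close> outside a finite set splits. For torsionfree
  classes, pull back \<open>P \<rightarrow> P/rad P\<close> along a right approximation of its simple target, for each
  indecomposable direct summand \<open>P\<close> of the largest quotient of \<open>\<Lambda>\<close> in \<open>\<E>\<close>. For torsion classes, push out
  \<open>S \<rightarrow> I\<close> along a left approximation of the simple module \<open>S\<close>, where \<open>I\<close> is an essential extension of \<open>S\<close> in
  \<open>\<E>\<close> of maximal length, which exists because these lengths are bounded.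
\<close>

section \<open>Submodules and length\<close>

text \<open>The simple modules that test an object may lie outside \<open>\<E>\<close>, so the short
  exact sequences ending or starting in them need not be conflations; pulling back or pushing out
  along an approximation moves these sequences into \<open>\<E>\<close>. The tests reach every
  indecomposable because a nonzero module has a simple quotient and a simple submodule. The two
  cases are not linked by a duality: the quotients of \<open>\<Lambda>\<close> in
  \<open>\<E>\<close> are bounded by the length of \<open>\<Lambda>\<close>, whereas the lengths of
  essential extensions of a simple module are bounded by an argument with socle series over
  \<open>R\<close>.

  Finiteness in the converse comes from the fact that an element of \<open>AR_subgroup\<close>
  involves only finitely many AR conflations, hence finitely many end terms. In the other direction
  AR conflations are constructed: a map \<open>W \<rightarrow> Z\<close> that is minimal among those
  not factoring through the deflation has a pullback that is almost split, and the search for it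
  stops because images of \<open>Hom(G, -)\<close> shrink inside an \<open>R\<close>-module of
  finite length. Lengths are taken over \<open>R\<close> throughout these arguments, as Hom groups
  are only \<open>R\<close>-modules.\<close>

definition submod :: "('a, 'k) ring_scheme \<Rightarrow> ('a, 'b, 'l) module_scheme \<Rightarrow> 'b set \<Rightarrow> bool" where
  "submod A M U \<longleftrightarrow> U \<subseteq> carrier M \<and> \<zero>\<^bsub>M\<^esub> \<in> U \<and> (\<forall>x\<in>U. \<forall>y\<in>U. x \<oplus>\<^bsub>M\<^esub> y \<in> U) \<and>
     (\<forall>a\<in>carrier A. \<forall>x\<in>U. a \<odot>\<^bsub>M\<^esub> x \<in> U)"

lemma submodD:
  assumes "submod A M U"
  shows "U \<subseteq> carrier M" "\<zero>\<^bsub>M\<^esub> \<in> U" "x \<in> U \<Longrightarrow> y \<in> U \<Longrightarrow> x \<oplus>\<^bsub>M\<^esub> y \<in> U"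
    "a \<in> carrier A \<Longrightarrow> x \<in> U \<Longrightarrow> a \<odot>\<^bsub>M\<^esub> x \<in> U" "x \<in> U \<Longrightarrow> x \<in> carrier M"
  using assms by (auto simp: submod_def)

lemma submod_Int: "submod A M U \<Longrightarrow> submod A M V \<Longrightarrow> submod A M (U \<inter> V)"
  by (auto simp: submod_def)

context left_module
begin

lemma smult_zero [simp]: "a \<in> carrier A \<Longrightarrow> a \<odot>\<^bsub>M\<^esub> \<zero>\<^bsub>M\<^esub> = \<zero>\<^bsub>M\<^esub>"
  using smult_r_distr[of a "\<zero>\<^bsub>M\<^esub>" "\<zero>\<^bsub>M\<^esub>"] M.add.l_cancel_one[of "a \<odot>\<^bsub>M\<^esub> \<zero>\<^bsub>M\<^esub>" "a \<odot>\<^bsub>M\<^esub> \<zero>\<^bsub>M\<^esub>"]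
  by simp

lemma zero_smult [simp]: "x \<in> carrier M \<Longrightarrow> \<zero>\<^bsub>A\<^esub> \<odot>\<^bsub>M\<^esub> x = \<zero>\<^bsub>M\<^esub>"
  using smult_l_distr[of "\<zero>\<^bsub>A\<^esub>" "\<zero>\<^bsub>A\<^esub>" x] M.add.l_cancel_one[of "\<zero>\<^bsub>A\<^esub> \<odot>\<^bsub>M\<^esub> x" "\<zero>\<^bsub>A\<^esub> \<odot>\<^bsub>M\<^esub> x"]
  by simp

lemma smult_minus_one: "x \<in> carrier M \<Longrightarrow> (\<ominus>\<^bsub>A\<^esub> \<one>\<^bsub>A\<^esub>) \<odot>\<^bsub>M\<^esub> x = \<ominus>\<^bsub>M\<^esub> x"
proof -
  assume x: "x \<in> carrier M"
  have "(\<ominus>\<^bsub>A\<^esub> \<one>\<^bsub>A\<^esub>) \<odot>\<^bsub>M\<^esub> x \<oplus>\<^bsub>M\<^esub> x = (\<ominus>\<^bsub>A\<^esub> \<one>\<^bsub>A\<^esub> \<oplus>\<^bsub>A\<^esub> \<one>\<^bsub>A\<^esub>) \<odot>\<^bsub>M\<^esub> x"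
    using x smult_l_distr[of "\<ominus>\<^bsub>A\<^esub> \<one>\<^bsub>A\<^esub>" "\<one>\<^bsub>A\<^esub>" x] by simp
  also have "\<dots> = \<zero>\<^bsub>M\<^esub>"
    using x by (simp add: R.l_neg)
  finally show ?thesis
    using x by (simp add: M.minus_equality)
qed

lemma smult_minus_r:
  assumes "a \<in> carrier A" "x \<in> carrier M"
  shows "a \<odot>\<^bsub>M\<^esub> (\<ominus>\<^bsub>M\<^esub> x) = \<ominus>\<^bsub>M\<^esub> (a \<odot>\<^bsub>M\<^esub> x)"
proof -
  have "a \<odot>\<^bsub>M\<^esub> (\<ominus>\<^bsub>M\<^esub> x) \<oplus>\<^bsub>M\<^esub> a \<odot>\<^bsub>M\<^esub> x = a \<odot>\<^bsub>M\<^esub> (\<ominus>\<^bsub>M\<^esub> x \<oplus>\<^bsub>M\<^esub> x)"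
    using assms smult_r_distr[of a "\<ominus>\<^bsub>M\<^esub> x" x] by simp
  also have "\<dots> = \<zero>\<^bsub>M\<^esub>"
    using assms by (simp add: M.l_neg)
  finally show ?thesis
    using assms by (simp add: M.minus_equality)
qed

lemma submod_neg: "submod A M U \<Longrightarrow> x \<in> U \<Longrightarrow> \<ominus>\<^bsub>M\<^esub> x \<in> U"
  using submodD[of A M U] smult_minus_one[of x] by (metis R.add.inv_closed R.one_closed)

lemma submod_diff: "submod A M U \<Longrightarrow> x \<in> U \<Longrightarrow> y \<in> U \<Longrightarrow> x \<ominus>\<^bsub>M\<^esub> y \<in> U"
  using submodD[of A M U] submod_neg[of U y] by (simp add: a_minus_def)

lemma submod_carrier [simp]: "submod A M (carrier M)"
  by (auto simp: submod_def)

lemma submod_zero [simp]: "submod A M {\<zero>\<^bsub>M\<^esub>}"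
  by (auto simp: submod_def)

lemma left_module_submod:
  assumes U: "submod A M U"
  shows "left_module A (M\<lparr>carrier := U\<rparr>)"
proof -
  note [simp] = submodD[OF U]
  have "abelian_group (M\<lparr>carrier := U\<rparr>)"
  proof (rule abelian_groupI)
    fix x assume "x \<in> carrier (M\<lparr>carrier := U\<rparr>)"
    then show "\<exists>y\<in>carrier (M\<lparr>carrier := U\<rparr>). y \<oplus>\<^bsub>M\<lparr>carrier := U\<rparr>\<^esub> x = \<zero>\<^bsub>M\<lparr>carrier := U\<rparr>\<^esub>"
      using submod_neg[OF U, of x] by (intro bexI[of _ "\<ominus>\<^bsub>M\<^esub> x"]) (auto simp: M.l_neg)
  qed (auto simp: M.a_ac)
  then show ?thesis
    unfolding left_module_def left_module_axioms_def using R.ring_axioms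
    by (auto simp: smult_l_distr smult_r_distr smult_assoc)
qed

lemma diff_add: "x \<in> carrier M \<Longrightarrow> y \<in> carrier M \<Longrightarrow> (x \<ominus>\<^bsub>M\<^esub> y) \<oplus>\<^bsub>M\<^esub> y = x"
  by (simp add: a_minus_def M.a_assoc M.l_neg)

lemma diff_zero_iff: "x \<in> carrier M \<Longrightarrow> y \<in> carrier M \<Longrightarrow> x \<ominus>\<^bsub>M\<^esub> y = \<zero>\<^bsub>M\<^esub> \<longleftrightarrow> x = y"
  using diff_add[of x y] by (auto simp: a_minus_def M.r_neg)

lemma add_diff: "x \<in> carrier M \<Longrightarrow> y \<in> carrier M \<Longrightarrow> (x \<oplus>\<^bsub>M\<^esub> y) \<ominus>\<^bsub>M\<^esub> y = x"
  by (simp add: a_minus_def M.a_assoc M.r_neg)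

lemma diff_zero_right [simp]: "x \<in> carrier M \<Longrightarrow> x \<ominus>\<^bsub>M\<^esub> \<zero>\<^bsub>M\<^esub> = x"
  using add_diff[of x "\<zero>\<^bsub>M\<^esub>"] by simp

end

locale module_hom = M: left_module A M + N: left_module A N
  for A :: "('a, 'k) ring_scheme" and M :: "('a, 'b, 'l) module_scheme"
    and N :: "('a, 'c, 'm) module_scheme" +
  fixes f
  assumes hom: "f \<in> mod_hom A M N"
begin

lemma closed [simp]: "x \<in> carrier M \<Longrightarrow> f x \<in> carrier N"
  using hom by (auto simp: mod_hom_def)

lemma add: "x \<in> carrier M \<Longrightarrow> y \<in> carrier M \<Longrightarrow> f (x \<oplus>\<^bsub>M\<^esub> y) = f x \<oplus>\<^bsub>N\<^esub> f y"
  using hom by (auto simp: mod_hom_def)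

lemma smult: "a \<in> carrier A \<Longrightarrow> x \<in> carrier M \<Longrightarrow> f (a \<odot>\<^bsub>M\<^esub> x) = a \<odot>\<^bsub>N\<^esub> f x"
  using hom by (auto simp: mod_hom_def)

lemma zero [simp]: "f \<zero>\<^bsub>M\<^esub> = \<zero>\<^bsub>N\<^esub>"
  using smult[of "\<zero>\<^bsub>A\<^esub>" "\<zero>\<^bsub>M\<^esub>"] by simp

lemma neg: "x \<in> carrier M \<Longrightarrow> f (\<ominus>\<^bsub>M\<^esub> x) = \<ominus>\<^bsub>N\<^esub> f x"
  using smult[of "\<ominus>\<^bsub>A\<^esub> \<one>\<^bsub>A\<^esub>" x] by (simp add: M.smult_minus_one N.smult_minus_one)

lemma diff: "x \<in> carrier M \<Longrightarrow> y \<in> carrier M \<Longrightarrow> f (x \<ominus>\<^bsub>M\<^esub> y) = f x \<ominus>\<^bsub>N\<^esub> f y"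
  by (simp add: a_minus_def add neg)

lemma submod_image: "submod A M U \<Longrightarrow> submod A N (f ` U)"
  by (auto simp: submod_def subset_iff Bex_def image_iff intro: zero[symmetric] add[symmetric] smult[symmetric])
     (metis add smult subset_iff)+

lemma submod_vimage: "submod A N V \<Longrightarrow> submod A M {x \<in> carrier M. f x \<in> V}"
  by (auto simp: submod_def add smult)

lemma submod_ker: "submod A M {x \<in> carrier M. f x = \<zero>\<^bsub>N\<^esub>}"
  using submod_vimage[OF N.submod_zero] by simp

lemma eq_iff: "x \<in> carrier M \<Longrightarrow> y \<in> carrier M \<Longrightarrow> f x = f y \<longleftrightarrow> f (x \<ominus>\<^bsub>M\<^esub> y) = \<zero>\<^bsub>N\<^esub>"
  by (simp add: diff N.diff_zero_iff)

lemma inj_onI_ker: "(\<And>x. x \<in> carrier M \<Longrightarrow> f x = \<zero>\<^bsub>N\<^esub> \<Longrightarrow> x = \<zero>\<^bsub>M\<^esub>) \<Longrightarrow> inj_on f (carrier M)"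
  by (rule inj_onI) (metis eq_iff M.diff_zero_iff M.M.minus_closed)

lemma inj_onD_ker: "inj_on f (carrier M) \<Longrightarrow> x \<in> carrier M \<Longrightarrow> f x = \<zero>\<^bsub>N\<^esub> \<Longrightarrow> x = \<zero>\<^bsub>M\<^esub>"
  using inj_onD[of f "carrier M" x "\<zero>\<^bsub>M\<^esub>"] by simp

end

section \<open>Length as the greatest number of steps in a chain of submodules\<close>

definition subchain ::
    "('a, 'k) ring_scheme \<Rightarrow> ('a, 'b, 'l) module_scheme \<Rightarrow> 'b set \<Rightarrow> nat \<Rightarrow> bool" where
  "subchain A M U n \<longleftrightarrow> (\<exists>c. (\<forall>i\<le>n. submod A M (c i) \<and> c i \<subseteq> U) \<and> (\<forall>i<n. c i \<subset> c (Suc i)))"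

text \<open>Length is attached to a subset \<open>U\<close> of a fixed module, so that kernels,
  images and submodules are compared without forming new records. The value \<open>len\<close> is
  meaningful only under \<open>finlen\<close>, which bounds the set whose \<open>Max\<close> is
  taken.\<close>

definition finlen :: "('a, 'k) ring_scheme \<Rightarrow> ('a, 'b, 'l) module_scheme \<Rightarrow> 'b set \<Rightarrow> bool" where
  "finlen A M U \<longleftrightarrow> (\<exists>B. \<forall>n. subchain A M U n \<longrightarrow> n \<le> B)"

definition len :: "('a, 'k) ring_scheme \<Rightarrow> ('a, 'b, 'l) module_scheme \<Rightarrow> 'b set \<Rightarrow> nat" where
  "len A M U = Max {n. subchain A M U n}"

lemma subchain_0: "submod A M U \<Longrightarrow> subchain A M U 0"
  by (auto simp: subchain_def)

lemma finite_subchain: "finlen A M U \<Longrightarrow> finite {n. subchain A M U n}"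
  unfolding finlen_def by (metis finite_nat_set_iff_bounded_le mem_Collect_eq)

lemma subchain_le_len: "finlen A M U \<Longrightarrow> subchain A M U n \<Longrightarrow> n \<le> len A M U"
  unfolding len_def using finite_subchain by (intro Max_ge) auto

lemma subchain_len: "finlen A M U \<Longrightarrow> submod A M U \<Longrightarrow> subchain A M U (len A M U)"
  unfolding len_def using finite_subchain subchain_0 Max_in by (metis empty_iff mem_Collect_eq)

lemma subchain_subset: "subchain A M U n \<Longrightarrow> U \<subseteq> V \<Longrightarrow> subchain A M V n"
  unfolding subchain_def by (meson order_trans)

lemma finlen_subset: "finlen A M V \<Longrightarrow> U \<subseteq> V \<Longrightarrow> finlen A M U"
  unfolding finlen_def using subchain_subset by blast

lemma len_strict:
  assumes "finlen A M V" "submod A M U" "submod A M V" "U \<subset> V"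
  shows "len A M U < len A M V"
proof -
  have "subchain A M U (len A M U)"
    using assms finlen_subset subchain_len by (metis psubset_imp_subset)
  then obtain c where c: "\<forall>i\<le>len A M U. submod A M (c i) \<and> c i \<subseteq> U"
      "\<forall>i<len A M U. c i \<subset> c (Suc i)"
    by (auto simp: subchain_def)
  define c' where "c' i = (if i \<le> len A M U then c i else V)" for i
  have "c' i \<subset> c' (Suc i)" if "i < Suc (len A M U)" for i
  proof (cases "i = len A M U")
    case True
    then show ?thesis using c(1)[rule_format, of i] assms(4) by (auto simp: c'_def)
  next
    case False
    then show ?thesis using that c(2)[rule_format, of i] by (auto simp: c'_def)
  qed
  moreover have "\<forall>i\<le>Suc (len A M U). submod A M (c' i) \<and> c' i \<subseteq> V"
    using c(1) assms by (auto simp: c'_def)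
  ultimately have "subchain A M V (Suc (len A M U))"
    unfolding subchain_def by blast
  then show ?thesis
    using subchain_le_len assms(1) by (metis Suc_le_eq)
qed

lemma len_mono:
  assumes "finlen A M V" "submod A M U" "submod A M V" "U \<subseteq> V"
  shows "len A M U \<le> len A M V"
  using len_strict[OF assms(1,2,3)] assms(4) by (metis less_imp_le order_refl psubsetI)

lemma len_eqD:
  assumes "finlen A M V" "submod A M U" "submod A M V" "U \<subseteq> V" "len A M V \<le> len A M U"
  shows "U = V"
  using len_strict[OF assms(1,2,3)] assms(4,5) by (metis linorder_not_le psubsetI)

text \<open>A natural-valued measure that grows along strict inclusions is at least \<open>i\<close>
  at the \<open>i\<close>-th member of a chain. The basic finiteness proofs come down to choosing
  \<open>g\<close>.\<close>

lemma subchain_bound: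
  assumes "\<And>W W'. \<lbrakk>submod A M W; submod A M W'; W \<subset> W'; W' \<subseteq> U\<rbrakk> \<Longrightarrow> (g W :: nat) < g W'"
    and "\<And>W. submod A M W \<Longrightarrow> W \<subseteq> U \<Longrightarrow> g W \<le> B" and "subchain A M U n"
  shows "n \<le> B"
proof -
  obtain c where c: "\<forall>i\<le>n. submod A M (c i) \<and> c i \<subseteq> U" "\<forall>i<n. c i \<subset> c (Suc i)"
    using assms(3) by (auto simp: subchain_def)
  have "i \<le> g (c i)" if "i \<le> n" for i
    using that
  proof (induction i)
    case (Suc i)
    then have "g (c i) < g (c (Suc i))"
      using c by (intro assms(1)) auto
    then show ?case using Suc by auto
  qed auto
  then show ?thesis
    using assms(2)[of "c n"] c(1) by (meson order_refl order_trans)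
qed

lemma (in left_module) finlen_zero: "finlen A M {\<zero>\<^bsub>M\<^esub>}" and len_zero: "len A M {\<zero>\<^bsub>M\<^esub>} = 0"
proof -
  have *: "n \<le> 0" if "subchain A M {\<zero>\<^bsub>M\<^esub>} n" for n
  proof (rule subchain_bound[OF _ _ that, where g = "\<lambda>_. 0"])
    fix W W' assume "submod A M W" "submod A M W'" "W \<subset> W'" "W' \<subseteq> {\<zero>\<^bsub>M\<^esub>}"
    then show "(0::nat) < 0" using submodD(2)[of A M W] by auto
  qed auto
  then show fin: "finlen A M {\<zero>\<^bsub>M\<^esub>}"
    unfolding finlen_def by blast
  show "len A M {\<zero>\<^bsub>M\<^esub>} = 0"
    using * subchain_len[OF fin] by simp
qed

lemma (in left_module) len_eq_0D:
  assumes "finlen A M U" "submod A M U" "len A M U = 0"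
  shows "U = {\<zero>\<^bsub>M\<^esub>}"
  using len_eqD[OF assms(1) submod_zero assms(2)] assms(2,3) submodD(2)[OF assms(2)] by auto

context module_hom
begin

text \<open>An element \<open>x\<close> of \<open>W'\<close> with the same image as some
  \<open>w\<close> in \<open>W\<close> differs from \<open>w\<close> by an element of the kernel; if
  \<open>W\<close> and \<open>W'\<close> have the same kernel part, this difference is in
  \<open>W\<close>, and so is \<open>x\<close>.\<close>

lemma ker_image_strict:
  assumes W: "submod A M W" "submod A M W'" "W \<subset> W'"
  shows "W \<inter> {x \<in> carrier M. f x = \<zero>\<^bsub>N\<^esub>} \<subset> W' \<inter> {x \<in> carrier M. f x = \<zero>\<^bsub>N\<^esub>} \<or> f ` W \<subset> f ` W'"
proof (rule ccontr)
  assume "\<not> ?thesis"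
  then have eq: "W \<inter> {x \<in> carrier M. f x = \<zero>\<^bsub>N\<^esub>} = W' \<inter> {x \<in> carrier M. f x = \<zero>\<^bsub>N\<^esub>}" "f ` W = f ` W'"
    using W(3) by blast+
  have "x \<in> W" if x: "x \<in> W'" for x
  proof -
    obtain w where w: "w \<in> W" "f x = f w" using eq(2) x by blast
    have car: "x \<in> carrier M" "w \<in> carrier M" "w \<in> W'" using W w x submodD by blast+
    have "x \<ominus>\<^bsub>M\<^esub> w \<in> W"
      using eq(1) eq_iff[of x w] w(2) car M.submod_diff[OF W(2) x car(3)] submodD(1)[OF W(2)] by blast
    then show "x \<in> W"
      using M.diff_add[OF car(1,2)] submodD(3)[OF W(1), of "x \<ominus>\<^bsub>M\<^esub> w" w] w(1) by simp
  qed
  then show False using W(3) by blast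
qed

text \<open>By \<open>ker_image_strict\<close> the sum of the two lengths is a strictly increasing
  measure, which gives finiteness and one inequality. A chain in the kernel part, continued by
  preimages of a chain in the image, gives the other.\<close>

lemma
  assumes U: "submod A M U" and ker: "finlen A M (U \<inter> {x \<in> carrier M. f x = \<zero>\<^bsub>N\<^esub>})"
    and img: "finlen A N (f ` U)"
  shows finlen_hom: "finlen A M U"
    and len_hom: "len A M U = len A M (U \<inter> {x \<in> carrier M. f x = \<zero>\<^bsub>N\<^esub>}) + len A N (f ` U)"
proof -
  let ?K = "{x \<in> carrier M. f x = \<zero>\<^bsub>N\<^esub>}"
  let ?g = "\<lambda>W. len A M (W \<inter> ?K) + len A N (f ` W)"
  have mono: "len A M (W \<inter> ?K) \<le> len A M (W' \<inter> ?K)" "len A N (f ` W) \<le> len A N (f ` W')"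
    if "submod A M W" "submod A M W'" "W \<subseteq> W'" "W' \<subseteq> U" for W W'
    using that submod_image submod_ker
    by (auto intro!: len_mono submod_Int finlen_subset[OF ker] finlen_subset[OF img])
  have le: "n \<le> ?g U" if "subchain A M U n" for n
  proof (rule subchain_bound[OF _ _ that])
    fix W W' assume W: "submod A M W" "submod A M W'" "W \<subset> W'" "W' \<subseteq> U"
    have "len A M (W \<inter> ?K) < len A M (W' \<inter> ?K) \<or> len A N (f ` W) < len A N (f ` W')"
      using ker_image_strict[OF W(1-3)]
    proof
      assume "W \<inter> ?K \<subset> W' \<inter> ?K"
      then show ?thesis
        using W submod_ker by (intro disjI1 len_strict submod_Int finlen_subset[OF ker]) auto
    next
      assume "f ` W \<subset> f ` W'"
      then show ?thesis
        using W by (intro disjI2 len_strict submod_image finlen_subset[OF img]) auto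
    qed
    then show "?g W < ?g W'"
      using mono[of W W'] W by fastforce
  next
    fix W assume "submod A M W" "W \<subseteq> U"
    then show "?g W \<le> ?g U" using mono[of W U] U by fastforce
  qed
  then show fin: "finlen A M U" unfolding finlen_def by blast
  obtain c where c: "\<forall>i\<le>len A M (U \<inter> ?K). submod A M (c i) \<and> c i \<subseteq> U \<inter> ?K"
      "\<forall>i<len A M (U \<inter> ?K). c i \<subset> c (Suc i)"
    using subchain_len[OF ker submod_Int[OF U submod_ker]] by (auto simp: subchain_def)
  obtain d where d: "\<forall>i\<le>len A N (f ` U). submod A N (d i) \<and> d i \<subseteq> f ` U"
      "\<forall>i<len A N (f ` U). d i \<subset> d (Suc i)"
    using subchain_len[OF img submod_image[OF U]] unfolding subchain_def by blast
  define p where "p = len A M (U \<inter> ?K)"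
  \<comment> \<open>The preimage of \<open>d 0\<close> contains the kernel part and is skipped:
    \<open>c p\<close> takes its place, so that the number of steps is exactly \<open>p\<close> plus
    the length of the image.\<close>
  define e where "e i = (if i \<le> p then c i else U \<inter> {x \<in> carrier M. f x \<in> d (i - p)})" for i
  have "e i \<subset> e (Suc i)" if i: "i < ?g U" for i
  proof -
    consider "i < p" | "i = p" | "i > p" by linarith
    then show ?thesis
    proof cases
      case 1
      then show ?thesis using c(2) by (auto simp: e_def p_def)
    next
      case 2
      then have d1: "submod A N (d 0)" "submod A N (d 1)" "d 1 \<subseteq> f ` U" "d 0 \<subset> d 1"
        using i d by (auto simp: p_def)
      then obtain y where y: "y \<in> d 1" "y \<notin> d 0" "y \<in> f ` U" by blast
      then obtain x where x: "x \<in> U" "f x = y" by blast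
      have "x \<in> e (Suc i)" using 2 x y submodD(5)[OF U] by (auto simp: e_def)
      moreover have "x \<notin> e i"
        using 2 x y submodD(2)[OF d1(1)] c(1)[rule_format, of p] by (auto simp: e_def p_def)
      moreover have "e i \<subseteq> e (Suc i)"
        using 2 submodD(2)[OF d1(2)] c(1)[rule_format, of p] by (auto simp: e_def p_def)
      ultimately show ?thesis by blast
    next
      case 3
      then have dd: "d (i - p) \<subset> d (Suc (i - p))" "d (Suc (i - p)) \<subseteq> f ` U"
        using i d by (auto simp: p_def)
      then obtain y where y: "y \<in> d (Suc (i - p))" "y \<notin> d (i - p)" "y \<in> f ` U" by blast
      then obtain x where x: "x \<in> U" "f x = y" by blast
      have "Suc i - p = Suc (i - p)" using 3 by simp
      then show ?thesis using 3 x y dd submodD(5)[OF U] by (auto simp: e_def)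
    qed
  qed
  moreover have "submod A M (e i) \<and> e i \<subseteq> U" if "i \<le> ?g U" for i
    using that c(1) d(1) U submod_vimage by (auto simp: e_def p_def intro!: submod_Int)
  ultimately have "subchain A M U (?g U)"
    unfolding subchain_def by blast
  then show "len A M U = ?g U"
    using le subchain_len[OF fin U] subchain_le_len[OF fin] by (meson order_antisym)
qed

text \<open>Preimages inside \<open>U\<close> turn a strict chain below the image into a strict
  chain below \<open>U\<close>, so the length of the preimage serves as the measure.\<close>

lemma finlen_image:
  assumes U: "submod A M U" "finlen A M U"
  shows "finlen A N (f ` U)"
proof -
  have "n \<le> len A M U" if "subchain A N (f ` U) n" for n
  proof (rule subchain_bound[OF _ _ that, where g = "\<lambda>V. len A M (U \<inter> {x \<in> carrier M. f x \<in> V})"])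
    fix W W' assume W: "submod A N W" "submod A N W'" "W \<subset> W'" "W' \<subseteq> f ` U"
    then obtain y where y: "y \<in> W'" "y \<notin> W" "y \<in> f ` U" by blast
    then obtain x where x: "x \<in> U" "f x = y" by blast
    then show "len A M (U \<inter> {x \<in> carrier M. f x \<in> W}) < len A M (U \<inter> {x \<in> carrier M. f x \<in> W'})"
      using W U y submodD(5)[OF U(1)]
      by (intro len_strict submod_Int submod_vimage finlen_subset[OF U(2)]) auto
  next
    fix W assume "submod A N W" "W \<subseteq> f ` U"
    then show "len A M (U \<inter> {x \<in> carrier M. f x \<in> W}) \<le> len A M U"
      using U by (intro len_mono submod_Int submod_vimage) auto
  qed
  then show ?thesis unfolding finlen_def by blast
qed

lemma len_hom':
  assumes U: "submod A M U" "finlen A M U"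
  shows "len A M U = len A M (U \<inter> {x \<in> carrier M. f x = \<zero>\<^bsub>N\<^esub>}) + len A N (f ` U)"
  using U by (intro len_hom finlen_image finlen_subset[OF U(2)]) auto

lemma len_inj_image:
  assumes U: "submod A M U" "finlen A N (f ` U)" and inj: "inj_on f U"
  shows "finlen A M U" "len A M U = len A N (f ` U)"
proof -
  have *: "U \<inter> {x \<in> carrier M. f x = \<zero>\<^bsub>N\<^esub>} = {\<zero>\<^bsub>M\<^esub>}"
    using inj_onD[OF inj, of _ "\<zero>\<^bsub>M\<^esub>"] submodD(1,2)[OF U(1)] by auto
  show "finlen A M U" "len A M U = len A N (f ` U)"
    using finlen_hom[OF U(1)] len_hom[OF U(1)] U(2) unfolding * by (simp_all add: M.finlen_zero M.len_zero)
qed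

lemma len_inj_image':
  assumes U: "submod A M U" "finlen A M U" and inj: "inj_on f U"
  shows "len A N (f ` U) = len A M U"
  using len_inj_image(2)[OF U(1) finlen_image[OF U] inj] by simp

end

subsection \<open>Quotients, sums and finite generation\<close>

text \<open>The quotient is carried by chosen representatives \<open>\<rho> x\<close> of the cosets
  instead of the cosets. It thereby keeps the carrier type, and a quotient of an object of
  \<open>mods\<close> is again an object of \<open>mods\<close>.\<close>

lemma (in left_module) quotient_module_exists:
  assumes K: "submod A M K"
  shows "\<exists>Q :: ('a, 'b) module. left_module A Q \<and> (\<exists>q \<in> mod_hom A M Q. q ` carrier M = carrier Q \<and>
    {x \<in> carrier M. q x = \<zero>\<^bsub>Q\<^esub>} = K)"
proof -
  define P where "P x y \<longleftrightarrow> y \<in> carrier M \<and> x \<ominus>\<^bsub>M\<^esub> y \<in> K" for x y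
  define \<rho> where "\<rho> x = (SOME y. P x y)" for x
  have diffs: "x \<ominus>\<^bsub>M\<^esub> z = (x \<ominus>\<^bsub>M\<^esub> y) \<oplus>\<^bsub>M\<^esub> (y \<ominus>\<^bsub>M\<^esub> z)" "y \<ominus>\<^bsub>M\<^esub> x = \<ominus>\<^bsub>M\<^esub> (x \<ominus>\<^bsub>M\<^esub> y)"
    "(x \<oplus>\<^bsub>M\<^esub> z) \<ominus>\<^bsub>M\<^esub> (y \<oplus>\<^bsub>M\<^esub> w) = (x \<ominus>\<^bsub>M\<^esub> y) \<oplus>\<^bsub>M\<^esub> (z \<ominus>\<^bsub>M\<^esub> w)"
    if "x \<in> carrier M" "y \<in> carrier M" "z \<in> carrier M" "w \<in> carrier M" for x y z w
    using that by (simp_all add: a_minus_def M.a_ac M.minus_add M.l_neg M.r_neg1 M.r_neg2)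
  have P_refl: "P x x" if "x \<in> carrier M" for x
    using that submodD(2)[OF K] by (simp add: P_def a_minus_def M.r_neg)
  have P\<rho>: "P x (\<rho> x)" if "x \<in> carrier M" for x
    unfolding \<rho>_def using P_refl[OF that] by (rule someI)
  have P_sym: "P y x" if "P x y" "x \<in> carrier M" for x y
    using that diffs(2)[of x y] submod_neg[OF K] by (auto simp: P_def)
  have P_trans: "P x z" if "P x y" "P y z" "x \<in> carrier M" for x y z
    using that diffs(1)[of x y z] submodD(3)[OF K] by (auto simp: P_def)
  have \<rho>_car [simp]: "\<rho> x \<in> carrier M" if "x \<in> carrier M" for x
    using P\<rho>[OF that] by (simp add: P_def)
  have \<rho>_eq: "\<rho> x = \<rho> y \<longleftrightarrow> x \<ominus>\<^bsub>M\<^esub> y \<in> K" if "x \<in> carrier M" "y \<in> carrier M" for x y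
  proof
    assume "\<rho> x = \<rho> y"
    then have "P x y" using P\<rho> P_sym P_trans that by metis
    then show "x \<ominus>\<^bsub>M\<^esub> y \<in> K" by (simp add: P_def)
  next
    assume "x \<ominus>\<^bsub>M\<^esub> y \<in> K"
    then have "P x y" using that by (simp add: P_def)
    then have "P x = P y" using P_sym P_trans that by blast
    then show "\<rho> x = \<rho> y" by (simp add: \<rho>_def)
  qed
  have \<rho>\<rho>_add: "\<rho> (\<rho> x \<oplus>\<^bsub>M\<^esub> \<rho> y) = \<rho> (x \<oplus>\<^bsub>M\<^esub> y)" if "x \<in> carrier M" "y \<in> carrier M" for x y
    using that P\<rho>[of x] P\<rho>[of y] P_sym[of x "\<rho> x"] P_sym[of y "\<rho> y"] submodD(3)[OF K]
    by (subst \<rho>_eq) (auto simp: P_def diffs(3))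
  have \<rho>\<rho>_smult: "\<rho> (a \<odot>\<^bsub>M\<^esub> \<rho> x) = \<rho> (a \<odot>\<^bsub>M\<^esub> x)" if "a \<in> carrier A" "x \<in> carrier M" for a x
  proof -
    have "a \<odot>\<^bsub>M\<^esub> \<rho> x \<ominus>\<^bsub>M\<^esub> a \<odot>\<^bsub>M\<^esub> x = a \<odot>\<^bsub>M\<^esub> (\<rho> x \<ominus>\<^bsub>M\<^esub> x)"
      using that by (simp add: a_minus_def smult_r_distr smult_minus_r)
    then show ?thesis
      using that P_sym[OF P\<rho>] submodD(4)[OF K] by (subst \<rho>_eq) (auto simp: P_def)
  qed
  define Q where "Q = \<lparr>carrier = \<rho> ` carrier M, monoid.mult = monoid.mult M, monoid.one = monoid.one M,
    ring.zero = \<rho> \<zero>\<^bsub>M\<^esub>, ring.add = (\<lambda>x y. \<rho> (x \<oplus>\<^bsub>M\<^esub> y)), smult = (\<lambda>a x. \<rho> (a \<odot>\<^bsub>M\<^esub> x))\<rparr>"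
  have Q_simps [simp]: "carrier Q = \<rho> ` carrier M" "\<zero>\<^bsub>Q\<^esub> = \<rho> \<zero>\<^bsub>M\<^esub>" "x \<oplus>\<^bsub>Q\<^esub> y = \<rho> (x \<oplus>\<^bsub>M\<^esub> y)"
    "a \<odot>\<^bsub>Q\<^esub> x = \<rho> (a \<odot>\<^bsub>M\<^esub> x)" for a x y
    by (simp_all add: Q_def)
  have \<rho>\<rho>_left: "\<rho> (\<rho> x \<oplus>\<^bsub>M\<^esub> y) = \<rho> (x \<oplus>\<^bsub>M\<^esub> y)" if "x \<in> carrier M" "y \<in> carrier M" for x y
    using \<rho>\<rho>_add[of x y] \<rho>\<rho>_add[of "\<rho> x" y] \<rho>\<rho>_add[of x "\<rho> y"] that \<rho>_eq P\<rho> P_sym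
    by (metis P_def \<rho>_car)
  have \<rho>\<rho>_right: "\<rho> (x \<oplus>\<^bsub>M\<^esub> \<rho> y) = \<rho> (x \<oplus>\<^bsub>M\<^esub> y)" if "x \<in> carrier M" "y \<in> carrier M" for x y
    using \<rho>\<rho>_left[of y x] that by (simp add: M.a_comm)
  have \<rho>\<rho>: "\<rho> (\<rho> x) = \<rho> x" if "x \<in> carrier M" for x
    using that P_sym[OF P\<rho>[OF that] that] by (simp add: \<rho>_eq P_def)
  have "abelian_group Q"
  proof (rule abelian_groupI)
    fix x assume "x \<in> carrier Q"
    then obtain x' where "x' \<in> carrier M" "x = \<rho> x'" by auto
    then show "\<exists>y\<in>carrier Q. y \<oplus>\<^bsub>Q\<^esub> x = \<zero>\<^bsub>Q\<^esub>"
      by (intro bexI[of _ "\<rho> (\<ominus>\<^bsub>M\<^esub> x')"]) (auto simp: \<rho>\<rho>_add M.l_neg)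
  next
    fix x y assume "x \<in> carrier Q" "y \<in> carrier Q"
    then show "x \<oplus>\<^bsub>Q\<^esub> y = y \<oplus>\<^bsub>Q\<^esub> x" by (auto simp: M.a_comm)
  next
    fix x y z assume "x \<in> carrier Q" "y \<in> carrier Q" "z \<in> carrier Q"
    then show "(x \<oplus>\<^bsub>Q\<^esub> y) \<oplus>\<^bsub>Q\<^esub> z = x \<oplus>\<^bsub>Q\<^esub> (y \<oplus>\<^bsub>Q\<^esub> z)"
      by (auto simp: \<rho>\<rho>_left \<rho>\<rho>_right M.a_assoc)
  qed (auto simp: \<rho>\<rho> \<rho>\<rho>_left \<rho>\<rho>_right)
  then have Q: "left_module A Q"
    unfolding left_module_def left_module_axioms_def using R.ring_axioms
    by (auto simp: \<rho>\<rho> \<rho>\<rho>_left \<rho>\<rho>_right \<rho>\<rho>_smult smult_l_distr[symmetric] smult_r_distr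
        smult_assoc[symmetric])
  have "\<rho> \<in> mod_hom A M Q"
    by (auto simp: mod_hom_def \<rho>\<rho>_add \<rho>\<rho>_smult)
  moreover have "{x \<in> carrier M. \<rho> x = \<zero>\<^bsub>Q\<^esub>} = K"
    using submodD(5)[OF K] \<rho>_eq[of _ "\<zero>\<^bsub>M\<^esub>"] by auto
  ultimately show ?thesis
    using Q by (intro exI[of _ Q] conjI bexI[of _ \<rho>]) auto
qed

text \<open>Modulo \<open>K\<close> the submodule \<open>U\<close> falls into the image of
  \<open>V\<close>; hence both its kernel part and its image under the quotient map have finite
  length.\<close>

lemma finlen_vimage:
  fixes M :: "('a, 'b, 'l) module_scheme"
  assumes "left_module A M" "submod A M K" "submod A M U" "K \<subseteq> U" "finlen A M K"
    and V: "submod A M V" "finlen A M V" and U: "U \<subseteq> {x \<in> carrier M. \<exists>k\<in>K. \<exists>v\<in>V. x = k \<oplus>\<^bsub>M\<^esub> v}"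
  shows "finlen A M U"
proof -
  interpret M: left_module A M by fact
  obtain Q :: "('a, 'b) module" and q where Q: "left_module A Q" "q \<in> mod_hom A M Q"
      "{x \<in> carrier M. q x = \<zero>\<^bsub>Q\<^esub>} = K"
    using M.quotient_module_exists[OF assms(2)] by (elim exE conjE bexE)
  interpret q: module_hom A M Q q
    using assms(1) Q by (simp add: module_hom_def module_hom_axioms_def)
  have "q ` U \<subseteq> q ` V"
  proof
    fix y assume "y \<in> q ` U"
    then obtain k v where kv: "k \<in> K" "v \<in> V" "y = q (k \<oplus>\<^bsub>M\<^esub> v)" using U by blast
    have "q k = \<zero>\<^bsub>Q\<^esub>" "k \<in> carrier M" "v \<in> carrier M" using Q(3) kv submodD(5)[OF V(1)] by auto
    then have "y = q v" using kv by (simp add: q.add)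
    then show "y \<in> q ` V" using kv by blast
  qed
  then have "finlen A Q (q ` U)"
    using q.finlen_image[OF V] finlen_subset by blast
  then show ?thesis
    using assms(3) finlen_subset[OF assms(5) Int_lower2] unfolding Q(3)[symmetric] by (rule q.finlen_hom[rotated 2])
qed

definition submod_sum :: "('a, 'b, 'l) module_scheme \<Rightarrow> 'b set \<Rightarrow> 'b set \<Rightarrow> 'b set" where
  "submod_sum M U V = {u \<oplus>\<^bsub>M\<^esub> v | u v. u \<in> U \<and> v \<in> V}"

lemma (in left_module) submod_sum:
  assumes U: "submod A M U" and V: "submod A M V"
  shows "submod A M (submod_sum M U V)" "U \<subseteq> submod_sum M U V" "V \<subseteq> submod_sum M U V"
proof -
  note UV = submodD[OF U] submodD[OF V]
  show sub: "U \<subseteq> submod_sum M U V"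
  proof
    fix x assume "x \<in> U"
    then show "x \<in> submod_sum M U V"
      unfolding submod_sum_def using UV by (intro CollectI exI[of _ x] exI[of _ "\<zero>\<^bsub>M\<^esub>"]) simp
  qed
  show "V \<subseteq> submod_sum M U V"
  proof
    fix x assume "x \<in> V"
    then show "x \<in> submod_sum M U V"
      unfolding submod_sum_def using UV by (intro CollectI exI[of _ "\<zero>\<^bsub>M\<^esub>"] exI[of _ x]) simp
  qed
  show "submod A M (submod_sum M U V)"
    unfolding submod_def
  proof (intro conjI ballI)
    show "submod_sum M U V \<subseteq> carrier M" using UV by (auto simp: submod_sum_def)
    show "\<zero>\<^bsub>M\<^esub> \<in> submod_sum M U V" using sub UV by blast
    show "x \<oplus>\<^bsub>M\<^esub> y \<in> submod_sum M U V" if xy: "x \<in> submod_sum M U V" "y \<in> submod_sum M U V" for x y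
    proof -
      obtain u v u' v' where *: "x = u \<oplus>\<^bsub>M\<^esub> v" "y = u' \<oplus>\<^bsub>M\<^esub> v'" "u \<in> U" "u' \<in> U" "v \<in> V" "v' \<in> V"
        using xy by (auto simp: submod_sum_def)
      then have "x \<oplus>\<^bsub>M\<^esub> y = (u \<oplus>\<^bsub>M\<^esub> u') \<oplus>\<^bsub>M\<^esub> (v \<oplus>\<^bsub>M\<^esub> v')"
        using UV by (simp add: M.a_ac)
      then show ?thesis
        unfolding submod_sum_def using submodD(3)[OF U *(3,4)] submodD(3)[OF V *(5,6)] by blast
    qed
    show "a \<odot>\<^bsub>M\<^esub> x \<in> submod_sum M U V" if x: "x \<in> submod_sum M U V" and a: "a \<in> carrier A" for a x
    proof -
      obtain u v where *: "x = u \<oplus>\<^bsub>M\<^esub> v" "u \<in> U" "v \<in> V"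
        using x by (auto simp: submod_sum_def)
      then have "a \<odot>\<^bsub>M\<^esub> x = a \<odot>\<^bsub>M\<^esub> u \<oplus>\<^bsub>M\<^esub> a \<odot>\<^bsub>M\<^esub> v"
        using UV a by (simp add: smult_r_distr)
      then show ?thesis
        unfolding submod_sum_def using submodD(4)[OF U a *(2)] submodD(4)[OF V a *(3)] by blast
    qed
  qed
qed

lemma (in left_module) finlen_sum:
  assumes "submod A M U" "submod A M V" "finlen A M U" "finlen A M V"
  shows "finlen A M (submod_sum M U V)"
  using submod_sum[OF assms(1,2)] assms left_module_axioms submodD(5)[OF assms(1)] submodD(5)[OF assms(2)]
  by (intro finlen_vimage[of A M U "submod_sum M U V" V]) (auto simp: submod_sum_def)

text \<open>This form hides linear combinations: later facts on images, products and submodules only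
  need closure arguments for submodules.\<close>

lemma (in left_module) fin_gen_iff:
  "fin_gen A M \<longleftrightarrow> (\<exists>S. finite S \<and> S \<subseteq> carrier M \<and> (\<forall>U. submod A M U \<longrightarrow> S \<subseteq> U \<longrightarrow> U = carrier M))"
proof
  assume "fin_gen A M"
  then obtain S where S: "finite S" "S \<subseteq> carrier M"
      "\<And>x. x \<in> carrier M \<Longrightarrow> \<exists>c\<in>S \<rightarrow> carrier A. x = (\<Oplus>\<^bsub>M\<^esub>s\<in>S. c s \<odot>\<^bsub>M\<^esub> s)"
    unfolding fin_gen_def by blast
  have "U = carrier M" if U: "submod A M U" "S \<subseteq> U" for U
  proof -
    have "(\<Oplus>\<^bsub>M\<^esub>s\<in>T. c s \<odot>\<^bsub>M\<^esub> s) \<in> U" if "c \<in> S \<rightarrow> carrier A" "T \<subseteq> S" for c T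
      using finite_subset[OF that(2) S(1)] that
    proof (induction T)
      case empty
      then show ?case using submodD(2)[OF U(1)] by simp
    next
      case (insert t T)
      then have "c t \<in> carrier A" "t \<in> U" "t \<in> carrier M" using U S by auto
      moreover have "(\<lambda>s. c s \<odot>\<^bsub>M\<^esub> s) \<in> T \<rightarrow> carrier M"
        using insert.prems S(2) by (auto simp: Pi_iff subset_iff)
      ultimately show ?case
        using insert submodD(3,4)[OF U(1)] by (simp add: M.finsum_insert)
    qed
    then show ?thesis
      using S(3) submodD(1)[OF U(1)] by blast
  qed
  then show "\<exists>S. finite S \<and> S \<subseteq> carrier M \<and> (\<forall>U. submod A M U \<longrightarrow> S \<subseteq> U \<longrightarrow> U = carrier M)"
    using S by blast
next
  assume "\<exists>S. finite S \<and> S \<subseteq> carrier M \<and> (\<forall>U. submod A M U \<longrightarrow> S \<subseteq> U \<longrightarrow> U = carrier M)"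
  then obtain S where S: "finite S" "S \<subseteq> carrier M"
    "\<And>U. submod A M U \<Longrightarrow> S \<subseteq> U \<Longrightarrow> U = carrier M" by blast
  let ?U = "{\<Oplus>\<^bsub>M\<^esub>s\<in>S. c s \<odot>\<^bsub>M\<^esub> s | c. c \<in> S \<rightarrow> carrier A}"
  have fS: "(\<lambda>s. c s \<odot>\<^bsub>M\<^esub> s) \<in> S \<rightarrow> carrier M" if "c \<in> S \<rightarrow> carrier A" for c
    using that S(2) by auto
  have "submod A M ?U"
    unfolding submod_def
  proof (intro conjI ballI)
    show "?U \<subseteq> carrier M" using fS by auto
    have "(\<Oplus>\<^bsub>M\<^esub>s\<in>S. \<zero>\<^bsub>A\<^esub> \<odot>\<^bsub>M\<^esub> s) = (\<Oplus>\<^bsub>M\<^esub>s\<in>S. \<zero>\<^bsub>M\<^esub>)"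
      using S(2) by (intro M.finsum_cong') auto
    then have "\<zero>\<^bsub>M\<^esub> = (\<Oplus>\<^bsub>M\<^esub>s\<in>S. \<zero>\<^bsub>A\<^esub> \<odot>\<^bsub>M\<^esub> s)" by (simp add: M.finsum_zero)
    then show "\<zero>\<^bsub>M\<^esub> \<in> ?U" by (intro CollectI exI[of _ "\<lambda>_. \<zero>\<^bsub>A\<^esub>"]) auto
  next
    fix x y assume "x \<in> ?U" "y \<in> ?U"
    then obtain c d where cd: "c \<in> S \<rightarrow> carrier A" "d \<in> S \<rightarrow> carrier A"
      "x = (\<Oplus>\<^bsub>M\<^esub>s\<in>S. c s \<odot>\<^bsub>M\<^esub> s)" "y = (\<Oplus>\<^bsub>M\<^esub>s\<in>S. d s \<odot>\<^bsub>M\<^esub> s)" by blast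
    have "x \<oplus>\<^bsub>M\<^esub> y = (\<Oplus>\<^bsub>M\<^esub>s\<in>S. c s \<odot>\<^bsub>M\<^esub> s \<oplus>\<^bsub>M\<^esub> d s \<odot>\<^bsub>M\<^esub> s)"
      using cd fS by (simp add: M.finsum_addf)
    also have "\<dots> = (\<Oplus>\<^bsub>M\<^esub>s\<in>S. (c s \<oplus>\<^bsub>A\<^esub> d s) \<odot>\<^bsub>M\<^esub> s)"
      using cd S(2) by (intro M.finsum_cong') (auto simp: smult_l_distr Pi_iff subset_iff)
    finally show "x \<oplus>\<^bsub>M\<^esub> y \<in> ?U"
      using cd by (intro CollectI exI[of _ "\<lambda>s. c s \<oplus>\<^bsub>A\<^esub> d s"]) auto
  next
    fix a x assume "a \<in> carrier A" "x \<in> ?U"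
    then obtain c where c: "c \<in> S \<rightarrow> carrier A" "x = (\<Oplus>\<^bsub>M\<^esub>s\<in>S. c s \<odot>\<^bsub>M\<^esub> s)" by blast
    have "(\<lambda>x. a \<odot>\<^bsub>M\<^esub> x) (\<Oplus>\<^bsub>M\<^esub>s\<in>S. c s \<odot>\<^bsub>M\<^esub> s) = (\<Oplus>\<^bsub>M\<^esub>s\<in>S. a \<odot>\<^bsub>M\<^esub> (c s \<odot>\<^bsub>M\<^esub> s))" if "T \<subseteq> S" for T
      using S(1) fS[OF c(1)]
    proof (induction S)
      case empty
      then show ?case using \<open>a \<in> carrier A\<close> by simp
    next
      case (insert t T)
      then have "c t \<odot>\<^bsub>M\<^esub> t \<in> carrier M" "(\<lambda>s. c s \<odot>\<^bsub>M\<^esub> s) \<in> T \<rightarrow> carrier M" by auto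
      moreover from this have "(\<lambda>s. a \<odot>\<^bsub>M\<^esub> (c s \<odot>\<^bsub>M\<^esub> s)) \<in> T \<rightarrow> carrier M"
        using \<open>a \<in> carrier A\<close> by auto
      ultimately show ?case
        using insert \<open>a \<in> carrier A\<close> by (simp add: M.finsum_insert smult_r_distr)
    qed
    also have "(\<Oplus>\<^bsub>M\<^esub>s\<in>S. a \<odot>\<^bsub>M\<^esub> (c s \<odot>\<^bsub>M\<^esub> s)) = (\<Oplus>\<^bsub>M\<^esub>s\<in>S. (a \<otimes>\<^bsub>A\<^esub> c s) \<odot>\<^bsub>M\<^esub> s)"
      using c S(2) \<open>a \<in> carrier A\<close> by (intro M.finsum_cong') (auto simp: smult_assoc Pi_iff subset_iff)
    finally show "a \<odot>\<^bsub>M\<^esub> x \<in> ?U"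
      using c \<open>a \<in> carrier A\<close> by (intro CollectI exI[of _ "\<lambda>s. a \<otimes>\<^bsub>A\<^esub> c s"]) auto
  qed
  moreover have "S \<subseteq> ?U"
  proof
    fix t assume t: "t \<in> S"
    define c where "c s = (if s = t then \<one>\<^bsub>A\<^esub> else \<zero>\<^bsub>A\<^esub>)" for s
    have "(\<Oplus>\<^bsub>M\<^esub>s\<in>S. c s \<odot>\<^bsub>M\<^esub> s) = (\<Oplus>\<^bsub>M\<^esub>s\<in>S. if t = s then s else \<zero>\<^bsub>M\<^esub>)"
      using S(2) by (intro M.finsum_cong') (auto simp: c_def)
    also have "\<dots> = t"
      using M.finsum_singleton[OF t S(1), of "\<lambda>s. s"] S(2) by auto
    finally show "t \<in> ?U"
      by (intro CollectI exI[of _ c]) (auto simp: c_def)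
  qed
  ultimately have U: "?U = carrier M" by (rule S(3))
  show "fin_gen A M"
    unfolding fin_gen_def
  proof (intro exI[of _ S] conjI ballI S)
    fix x assume "x \<in> carrier M"
    then have "x \<in> ?U" by (simp only: U)
    then show "\<exists>c\<in>S \<rightarrow> carrier A. x = (\<Oplus>\<^bsub>M\<^esub>s\<in>S. c s \<odot>\<^bsub>M\<^esub> s)" by (elim CollectE exE conjE) (rule bexI)
  qed
qed

subsection \<open>Homomorphisms\<close>

lemma hom_closed: "f \<in> mod_hom A X Y \<Longrightarrow> x \<in> carrier X \<Longrightarrow> f x \<in> carrier Y"
  by (auto simp: mod_hom_def)

lemma hom_id: "(\<lambda>x. x) \<in> mod_hom A X X"
  by (auto simp: mod_hom_def)

lemma hom_comp: "f \<in> mod_hom A X Y \<Longrightarrow> g \<in> mod_hom A Y Z \<Longrightarrow> (\<lambda>x. g (f x)) \<in> mod_hom A X Z"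
  by (auto simp: mod_hom_def Pi_iff)

lemma hom_cong:
  assumes "left_module A X" "f \<in> mod_hom A X Y" "\<And>x. x \<in> carrier X \<Longrightarrow> g x = f x"
  shows "g \<in> mod_hom A X Y"
proof -
  interpret X: left_module A X by fact
  show ?thesis using assms(2,3) by (auto simp: mod_hom_def Pi_iff)
qed

lemma hom_restrict: "left_module A X \<Longrightarrow> f \<in> mod_hom A X Y \<Longrightarrow> restrict f (carrier X) \<in> mod_hom A X Y"
  by (rule hom_cong) auto

lemma hom_zero: "left_module A Y \<Longrightarrow> (\<lambda>x. \<zero>\<^bsub>Y\<^esub>) \<in> mod_hom A X Y"
proof -
  assume "left_module A Y"
  then interpret left_module A Y .
  show ?thesis by (auto simp: mod_hom_def)
qed

lemma hom_add:
  assumes "left_module A Y" "f \<in> mod_hom A X Y" "g \<in> mod_hom A X Y"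
  shows "(\<lambda>x. f x \<oplus>\<^bsub>Y\<^esub> g x) \<in> mod_hom A X Y"
proof -
  interpret left_module A Y by fact
  show ?thesis using assms(2,3) by (auto simp: mod_hom_def Pi_iff M.a_ac smult_r_distr)
qed

lemma hom_neg:
  assumes "left_module A Y" "f \<in> mod_hom A X Y"
  shows "(\<lambda>x. \<ominus>\<^bsub>Y\<^esub> f x) \<in> mod_hom A X Y"
proof -
  interpret left_module A Y by fact
  show ?thesis using assms(2) by (auto simp: mod_hom_def Pi_iff M.minus_add smult_minus_r)
qed

lemma hom_diff:
  assumes "left_module A Y" "f \<in> mod_hom A X Y" "g \<in> mod_hom A X Y"
  shows "(\<lambda>x. f x \<ominus>\<^bsub>Y\<^esub> g x) \<in> mod_hom A X Y"
  using hom_add[OF assms(1,2) hom_neg[OF assms(1,3)]] by (simp add: a_minus_def)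

lemma hom_inclusion: "(\<lambda>x. x) \<in> mod_hom A (M\<lparr>carrier := U\<rparr>) M" if "submod A M U"
  using submodD[OF that] by (auto simp: mod_hom_def)

lemma hom_into_submod:
  assumes "f \<in> mod_hom A X M" "\<And>x. x \<in> carrier X \<Longrightarrow> f x \<in> U"
  shows "f \<in> mod_hom A X (M\<lparr>carrier := U\<rparr>)"
  using assms by (auto simp: mod_hom_def)

lemma hom_on_submod:
  assumes "f \<in> mod_hom A M Y" "submod A M U"
  shows "f \<in> mod_hom A (M\<lparr>carrier := U\<rparr>) Y"
  using hom_comp[OF hom_inclusion[OF assms(2)] assms(1)] by simp

lemma module_homI: "left_module A X \<Longrightarrow> left_module A Y \<Longrightarrow> f \<in> mod_hom A X Y \<Longrightarrow> module_hom A X Y f"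
  by (simp add: module_hom_def module_hom_axioms_def)

text \<open>Evaluating \<open>k\<close> at a chosen preimage is independent of the choice, because
  two preimages differ by an element of the kernel of \<open>g\<close>.\<close>

lemma hom_factor_surj:
  assumes "left_module A Y" "left_module A Z" "left_module A V"
    and g: "g \<in> mod_hom A Y Z" "g ` carrier Y = carrier Z" and k: "k \<in> mod_hom A Y V"
    and ker: "\<And>y. y \<in> carrier Y \<Longrightarrow> g y = \<zero>\<^bsub>Z\<^esub> \<Longrightarrow> k y = \<zero>\<^bsub>V\<^esub>"
  shows "\<exists>u\<in>mod_hom A Z V. \<forall>y\<in>carrier Y. u (g y) = k y"
proof -
  interpret g: module_hom A Y Z g by (intro module_homI assms)
  interpret k: module_hom A Y V k by (intro module_homI assms)
  define u where "u z = k (SOME y. y \<in> carrier Y \<and> g y = z)" for z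
  have u: "u (g y) = k y" if "y \<in> carrier Y" for y
  proof -
    have *: "(SOME y'. y' \<in> carrier Y \<and> g y' = g y) \<in> carrier Y \<and> g (SOME y'. y' \<in> carrier Y \<and> g y' = g y) = g y"
      by (rule someI[of _ y]) (use that in auto)
    let ?y = "SOME y'. y' \<in> carrier Y \<and> g y' = g y"
    have "g (?y \<ominus>\<^bsub>Y\<^esub> y) = \<zero>\<^bsub>Z\<^esub>" using * that g.eq_iff[of ?y y] by simp
    then have "k (?y \<ominus>\<^bsub>Y\<^esub> y) = \<zero>\<^bsub>V\<^esub>" using * that ker by simp
    then show ?thesis
      unfolding u_def using * that k.eq_iff[of ?y y] by simp
  qed
  have "u \<in> mod_hom A Z V"
    unfolding mod_hom_def
  proof (intro CollectI conjI ballI)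
    show "u \<in> carrier Z \<rightarrow> carrier V"
      using u g(2) by (auto simp: g(2)[symmetric])
    show "u (x \<oplus>\<^bsub>Z\<^esub> y) = u x \<oplus>\<^bsub>V\<^esub> u y" if xy: "x \<in> carrier Z" "y \<in> carrier Z" for x y
    proof -
      obtain x' y' where "x' \<in> carrier Y" "y' \<in> carrier Y" "x = g x'" "y = g y'" using xy g(2) by blast
      then show ?thesis using u[of "x' \<oplus>\<^bsub>Y\<^esub> y'"] by (simp add: g.add k.add u)
    qed
    show "u (a \<odot>\<^bsub>Z\<^esub> x) = a \<odot>\<^bsub>V\<^esub> u x" if xy: "a \<in> carrier A" "x \<in> carrier Z" for a x
    proof -
      obtain x' where "x' \<in> carrier Y" "x = g x'" using xy g(2) by blast
      then show ?thesis using u[of "a \<odot>\<^bsub>Y\<^esub> x'"] xy(1) by (simp add: g.smult k.smult u)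
    qed
  qed
  then show ?thesis using u by blast
qed

lemma hom_factor_inj:
  assumes "left_module A X" "left_module A Y" "left_module A V"
    and f: "f \<in> mod_hom A X Y" "inj_on f (carrier X)" and k: "k \<in> mod_hom A V Y"
    and im: "\<And>v. v \<in> carrier V \<Longrightarrow> k v \<in> f ` carrier X"
  shows "\<exists>u\<in>mod_hom A V X. \<forall>v\<in>carrier V. f (u v) = k v"
proof -
  interpret f: module_hom A X Y f by (intro module_homI assms)
  interpret k: module_hom A V Y k by (intro module_homI assms)
  define u where "u v = inv_into (carrier X) f (k v)" for v
  have u: "u v \<in> carrier X" "f (u v) = k v" if "v \<in> carrier V" for v
    using im[OF that] by (simp_all add: u_def inv_into_into f_inv_into_f)
  have "u \<in> mod_hom A V X"
    unfolding mod_hom_def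
  proof (intro CollectI conjI ballI)
    show "u \<in> carrier V \<rightarrow> carrier X" using u by auto
    show "u (x \<oplus>\<^bsub>V\<^esub> y) = u x \<oplus>\<^bsub>X\<^esub> u y" if "x \<in> carrier V" "y \<in> carrier V" for x y
      using that u by (intro inj_onD[OF f(2)]) (simp_all add: f.add k.add)
    show "u (a \<odot>\<^bsub>V\<^esub> x) = a \<odot>\<^bsub>X\<^esub> u x" if "a \<in> carrier A" "x \<in> carrier V" for a x
      using that u by (intro inj_onD[OF f(2)]) (simp_all add: f.smult k.smult)
  qed
  then show ?thesis using u by blast
qed

lemma hom_inverse:
  assumes "left_module A X" "left_module A Y" "f \<in> mod_hom A X Y" "bij_betw f (carrier X) (carrier Y)"
  shows "\<exists>u\<in>mod_hom A Y X. (\<forall>y\<in>carrier Y. f (u y) = y) \<and> (\<forall>x\<in>carrier X. u (f x) = x)"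
proof -
  have f: "inj_on f (carrier X)" "f ` carrier X = carrier Y" using assms(4) by (auto simp: bij_betw_def)
  obtain u where u: "u \<in> mod_hom A Y X" "\<forall>y\<in>carrier Y. f (u y) = y"
    using hom_factor_inj[OF assms(1,2,2,3) f(1) hom_id] f(2) by auto
  have "u (f x) = x" if "x \<in> carrier X" for x
    using u that f by (intro inj_onD[OF f(1)]) (auto intro: hom_closed[OF u(1)])
  then show ?thesis using u by blast
qed

section \<open>Modules over an artinian local ring\<close>

lemma submod_Union_chain:
  assumes "subset.chain {U. submod A M U \<and> P U} \<C>" "\<C> \<noteq> {}"
  shows "submod A M (\<Union>\<C>)"
proof -
  have C: "submod A M U" if "U \<in> \<C>" for U using assms(1) that by (auto simp: subset.chain_def)
  have total: "U \<subseteq> V \<or> V \<subseteq> U" if "U \<in> \<C>" "V \<in> \<C>" for U V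
    using assms(1) that by (auto simp: subset.chain_def)
  show ?thesis
    unfolding submod_def
  proof (intro conjI ballI)
    show "\<Union>\<C> \<subseteq> carrier M" using submodD(1)[OF C] by blast
    show "\<zero>\<^bsub>M\<^esub> \<in> \<Union>\<C>" using submodD(2)[OF C] assms(2) by blast
  next
    fix x y assume "x \<in> \<Union>\<C>" "y \<in> \<Union>\<C>"
    then obtain U V where UV: "U \<in> \<C>" "V \<in> \<C>" "x \<in> U" "y \<in> V" by blast
    then show "x \<oplus>\<^bsub>M\<^esub> y \<in> \<Union>\<C>"
      using total[of U V] submodD(3)[OF C] by blast
  next
    fix a x assume "a \<in> carrier A" "x \<in> \<Union>\<C>"
    then show "a \<odot>\<^bsub>M\<^esub> x \<in> \<Union>\<C>" using submodD(4)[OF C] by blast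
  qed
qed

text \<open>Zorn's lemma is used in place of a length argument, since this is applied to ideals of
  \<open>R\<close> before \<open>R\<close> is known to have finite length.\<close>

lemma maximal_submod_avoiding:
  assumes "submod A M K" "x \<notin> K"
  obtains L where "submod A M L" "K \<subseteq> L" "x \<notin> L"
    "\<And>U. submod A M U \<Longrightarrow> L \<subseteq> U \<Longrightarrow> x \<notin> U \<Longrightarrow> U = L"
proof -
  let ?A = "{U. submod A M U \<and> (K \<subseteq> U \<and> x \<notin> U)}"
  have "\<exists>L\<in>?A. \<forall>X\<in>?A. L \<subseteq> X \<longrightarrow> X = L"
  proof (rule subset_Zorn_nonempty)
    show "?A \<noteq> {}" using assms by blast
    fix \<C> assume C: "\<C> \<noteq> {}" "subset.chain ?A \<C>"
    then have "\<And>U. U \<in> \<C> \<Longrightarrow> K \<subseteq> U \<and> x \<notin> U" by (auto simp: subset.chain_def)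
    then show "\<Union>\<C> \<in> ?A" using submod_Union_chain[OF C(2,1)] C(1) by blast
  qed
  then obtain L where "L \<in> ?A" "\<forall>X\<in>?A. L \<subseteq> X \<longrightarrow> X = L" by (elim bexE)
  then show ?thesis by (intro that[of L]) auto
qed

definition regular_module :: "('a, 'k) ring_scheme \<Rightarrow> ('a, 'a) module" where
  "regular_module A = \<lparr>carrier = carrier A, monoid.mult = monoid.mult A, monoid.one = monoid.one A,
     ring.zero = \<zero>\<^bsub>A\<^esub>, ring.add = ring.add A, smult = monoid.mult A\<rparr>"

lemma regular_module_simps [simp]:
  "carrier (regular_module A) = carrier A" "\<zero>\<^bsub>regular_module A\<^esub> = \<zero>\<^bsub>A\<^esub>"
  "x \<oplus>\<^bsub>regular_module A\<^esub> y = x \<oplus>\<^bsub>A\<^esub> y" "a \<odot>\<^bsub>regular_module A\<^esub> x = a \<otimes>\<^bsub>A\<^esub> x"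
  by (simp_all add: regular_module_def)

lemma (in ring) left_module_regular: "left_module R (regular_module R)"
proof -
  have "abelian_group (regular_module R)"
  proof (rule abelian_groupI)
    fix x assume "x \<in> carrier (regular_module R)"
    then show "\<exists>y\<in>carrier (regular_module R). y \<oplus>\<^bsub>regular_module R\<^esub> x = \<zero>\<^bsub>regular_module R\<^esub>"
      by (intro bexI[of _ "\<ominus> x"]) (auto simp: l_neg)
  qed (auto simp: a_ac)
  then show ?thesis
    unfolding left_module_def left_module_axioms_def using ring_axioms
    by (auto simp: l_distr r_distr m_assoc)
qed

lemma hom_orbit:
  assumes "left_module A M" "x \<in> carrier M"
  shows "(\<lambda>a. a \<odot>\<^bsub>M\<^esub> x) \<in> mod_hom A (regular_module A) M"
proof -
  interpret left_module A M by fact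
  show ?thesis using assms(2) by (auto simp: mod_hom_def smult_l_distr smult_assoc)
qed

lemma (in left_module) orbit_submod:
  assumes x: "x \<in> carrier M"
  shows "submod A M ((\<lambda>a. a \<odot>\<^bsub>M\<^esub> x) ` carrier A)" "x \<in> (\<lambda>a. a \<odot>\<^bsub>M\<^esub> x) ` carrier A"
proof -
  interpret h: module_hom A "regular_module A" M "\<lambda>a. a \<odot>\<^bsub>M\<^esub> x"
    by (intro module_homI R.left_module_regular left_module_axioms hom_orbit x)
  show "submod A M ((\<lambda>a. a \<odot>\<^bsub>M\<^esub> x) ` carrier A)"
    using h.submod_image[OF h.M.submod_carrier] by simp
  show "x \<in> (\<lambda>a. a \<odot>\<^bsub>M\<^esub> x) ` carrier A" using x by (intro image_eqI[of _ _ "\<one>\<^bsub>A\<^esub>"]) auto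
qed

text \<open>A finitely generated submodule of \<open>U\<close> of greatest length is all of
  \<open>U\<close>: adjoining one more element would lengthen it. This is how submodules of objects
  of \<open>mods\<close> are seen to be finitely generated.\<close>

lemma (in left_module) finlen_imp_generated:
  assumes U: "submod A M U" and fin: "finlen A M U"
  obtains S where "finite S" "S \<subseteq> U" "\<And>V. submod A M V \<Longrightarrow> S \<subseteq> V \<Longrightarrow> U \<subseteq> V"
proof -
  define \<W> where "\<W> = {W. submod A M W \<and> W \<subseteq> U \<and> (\<exists>S. finite S \<and> S \<subseteq> W \<and> (\<forall>V. submod A M V \<longrightarrow> S \<subseteq> V \<longrightarrow> W \<subseteq> V))}"
  have "{\<zero>\<^bsub>M\<^esub>} \<in> \<W>" using submodD(2)[OF U] by (auto simp: \<W>_def submodD(2) intro!: exI[of _ "{}"])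
  moreover have "\<forall>W. W \<in> \<W> \<longrightarrow> len A M W \<le> len A M U"
    using len_mono[OF fin _ U] by (auto simp: \<W>_def)
  ultimately obtain W where W: "W \<in> \<W>" "\<And>W'. W' \<in> \<W> \<Longrightarrow> len A M W' \<le> len A M W"
    using ex_has_greatest_nat[of "\<lambda>W. W \<in> \<W>" "{\<zero>\<^bsub>M\<^esub>}" "len A M" "Suc (len A M U)"]
    by (metis le_imp_less_Suc)
  then obtain S where S: "submod A M W" "W \<subseteq> U" "finite S" "S \<subseteq> W" "\<And>V. submod A M V \<Longrightarrow> S \<subseteq> V \<Longrightarrow> W \<subseteq> V"
    unfolding \<W>_def by blast
  have "W = U"
  proof (rule ccontr)
    assume "W \<noteq> U"
    then obtain x where x: "x \<in> U" "x \<notin> W" using S(2) by blast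
    note O = orbit_submod[OF submodD(5)[OF U x(1)]]
    let ?W = "submod_sum M W ((\<lambda>a. a \<odot>\<^bsub>M\<^esub> x) ` carrier A)"
    note sum = submod_sum[OF S(1) O(1)]
    have "?W \<subseteq> V" if V: "submod A M V" "insert x S \<subseteq> V" for V
      using S(5)[OF V(1)] V(2) submodD(3,4)[OF V(1)] by (auto simp: submod_sum_def subset_iff)
    moreover have WU: "?W \<subseteq> U"
      using S(2) x(1) submodD(3,4)[OF U] by (auto simp: submod_sum_def subset_iff)
    moreover have "insert x S \<subseteq> ?W" using sum O(2) S(4) by blast
    moreover have "finite (insert x S)" using S(3) by simp
    ultimately have "?W \<in> \<W>" using sum(1) unfolding \<W>_def by blast
    moreover have "W \<subset> ?W" using sum O(2) x(2) by blast
    ultimately show False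
      using len_strict[OF finlen_subset[OF fin WU] S(1) sum(1)] W(2)[of ?W] by simp
  qed
  then show thesis using that S(3-5) by blast
qed

section \<open>Nilpotency of the maximal ideal and finite length of the ring\<close>

context artinian_local_ring
begin

interpretation reg: left_module R "regular_module R"
  by (rule left_module_regular)

lemma submod_regular_iff: "submod R (regular_module R) I \<longleftrightarrow> ideal I R"
proof
  assume I: "submod R (regular_module R) I"
  note I' = submodD[OF I, simplified]
  show "ideal I R"
  proof (rule idealI)
    show "subgroup I (add_monoid R)"
    proof (rule subgroup.intro)
      fix x assume x: "x \<in> I"
      then have "(\<ominus> \<one>) \<otimes> x \<in> I" using I'(4) by simp
      then show "inv\<^bsub>add_monoid R\<^esub> x \<in> I"
        using x I'(1) l_minus[of \<one> x] by (auto simp: a_inv_def)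
    qed (use I' in auto)
  next
    fix a x assume "a \<in> I" "x \<in> carrier R"
    then show "x \<otimes> a \<in> I" "a \<otimes> x \<in> I" using I'(4)[of x a] I'(5)[of a] m_comm[of x a] by simp_all
  qed (rule ring_axioms)
next
  assume "ideal I R"
  then interpret ideal I R .
  show "submod R (regular_module R) I"
    using a_subset zero_closed a_closed I_l_closed by (auto simp: submod_def)
qed

lemma wf_ideals: "wf {(I, J). ideal I R \<and> ideal J R \<and> I \<subset> J}"
proof -
  have False if "\<forall>i. (f (Suc i), f i) \<in> {(I, J). ideal I R \<and> ideal J R \<and> I \<subset> J}" for f :: "nat \<Rightarrow> 'a set"
  proof -
    have f: "ideal (f i) R" "f (Suc i) \<subset> f i" for i using that by auto
    have "\<exists>n. \<forall>m\<ge>n. f m = f n"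
      by (rule descending_chain_condition) (use f in auto)
    then obtain n where n: "\<forall>m\<ge>n. f m = f n" ..
    have "f (Suc n) = f n" by (rule n[rule_format]) simp
    then show False using f(2)[of n] by blast
  qed
  then show ?thesis
    by (auto simp only: wf_iff_no_infinite_down_chain)
qed

definition maxi :: "'a set" where
  "maxi = (THE I. maximalideal I R)"

lemma maximalideal_maxi: "maximalideal maxi R"
  unfolding maxi_def by (rule theI'[OF unique_maximal_ideal])

lemma maximalideal_eq_maxi: "maximalideal I R \<Longrightarrow> I = maxi"
  using unique_maximal_ideal maximalideal_maxi by blast

lemma maxi_submod: "submod R (regular_module R) maxi"
  using maximalideal.axioms(1)[OF maximalideal_maxi] by (simp add: submod_regular_iff)

lemma maxi_carrier: "r \<in> maxi \<Longrightarrow> r \<in> carrier R"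
  using submodD(5)[OF maxi_submod] by simp

lemma one_notin_maxi: "\<one> \<notin> maxi"
  using maximalideal.I_notcarr[OF maximalideal_maxi] maximalideal.axioms(1)[OF maximalideal_maxi]
    ideal.one_imp_carrier by metis

text \<open>If \<open>r\<close> generated a proper ideal, an ideal above it that is maximal among
  those without \<open>\<one>\<close> would be a maximal ideal, hence equal to \<open>maxi\<close>,
  and would contain \<open>r\<close>.\<close>

lemma notin_maxi_unit:
  assumes r: "r \<in> carrier R" "r \<notin> maxi"
  shows "\<exists>s\<in>carrier R. s \<otimes> r = \<one>"
proof (rule ccontr)
  assume not: "\<not> ?thesis"
  interpret h: module_hom R "regular_module R" "regular_module R" "\<lambda>a. a \<otimes> r"
    using hom_orbit[OF reg.left_module_axioms, of r] r by (intro module_homI reg.left_module_axioms) simp_all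
  have U: "submod R (regular_module R) ((\<lambda>a. a \<otimes> r) ` carrier R)"
    using h.submod_image[OF reg.submod_carrier] by simp
  have "\<one> \<notin> (\<lambda>a. a \<otimes> r) ` carrier R" using not by (metis imageE)
  from maximal_submod_avoiding[OF U this] obtain L where L: "submod R (regular_module R) L" "(\<lambda>a. a \<otimes> r) ` carrier R \<subseteq> L" "\<one> \<notin> L"
      "\<And>U. submod R (regular_module R) U \<Longrightarrow> L \<subseteq> U \<Longrightarrow> \<one> \<notin> U \<Longrightarrow> U = L"
    by metis
  have "maximalideal L R"
  proof (rule maximalidealI)
    show "ideal L R" using L(1) by (simp add: submod_regular_iff)
    show "carrier R \<noteq> L" using L(3) by blast
    fix J assume J: "ideal J R" "L \<subseteq> J" "J \<subseteq> carrier R"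
    then show "J = L \<or> J = carrier R"
      using L(4)[of J] ideal.one_imp_carrier[OF J(1)] by (auto simp: submod_regular_iff)
  qed
  then have "L = maxi" by (rule maximalideal_eq_maxi)
  moreover have "r \<in> L" using L(2) r(1) by (metis image_subset_iff l_one one_closed)
  ultimately show False using r by simp
qed

lemma one_diff_maxi_unit:
  assumes "r \<in> maxi"
  shows "\<exists>s\<in>carrier R. s \<otimes> (\<one> \<ominus> r) = \<one>"
proof (rule notin_maxi_unit)
  have r: "r \<in> carrier R" using assms by (rule maxi_carrier)
  then show "\<one> \<ominus> r \<in> carrier R" by simp
  show "\<one> \<ominus> r \<notin> maxi"
  proof
    assume "\<one> \<ominus> r \<in> maxi"
    then have "(\<one> \<ominus> r) \<oplus> r \<in> maxi" using submodD(3)[OF maxi_submod] assms by simp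
    then show False using one_notin_maxi reg.diff_add[of \<one> r] r
      by (simp add: a_minus_def a_assoc l_neg)
  qed
qed

text \<open>The product of the maximal ideal with \<open>U\<close>, written as an intersection so
  that finite sums do not occur.\<close>

definition maxi_smult :: "('a, 'c, 'l) module_scheme \<Rightarrow> 'c set \<Rightarrow> 'c set" where
  "maxi_smult V U = \<Inter>{W. submod R V W \<and> (\<forall>r\<in>maxi. \<forall>u\<in>U. r \<odot>\<^bsub>V\<^esub> u \<in> W)}"

lemma maxi_smult_least: "submod R V W \<Longrightarrow> (\<And>r u. r \<in> maxi \<Longrightarrow> u \<in> U \<Longrightarrow> r \<odot>\<^bsub>V\<^esub> u \<in> W) \<Longrightarrow> maxi_smult V U \<subseteq> W"
  unfolding maxi_smult_def by blast

lemma maxi_smult_memb: "r \<in> maxi \<Longrightarrow> u \<in> U \<Longrightarrow> r \<odot>\<^bsub>V\<^esub> u \<in> maxi_smult V U"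
  unfolding maxi_smult_def by blast

lemma submod_maxi_smult:
  assumes "left_module R V" "submod R V U"
  shows "submod R V (maxi_smult V U)" "maxi_smult V U \<subseteq> U"
proof -
  interpret V: left_module R V by fact
  show le: "maxi_smult V U \<subseteq> U"
    using submodD(4)[OF assms(2)] maxi_carrier by (intro maxi_smult_least assms(2)) auto
  show "submod R V (maxi_smult V U)"
    unfolding submod_def
  proof (intro conjI)
    show "maxi_smult V U \<subseteq> carrier V" using le submodD(1)[OF assms(2)] by blast
  qed (auto simp: maxi_smult_def dest: submodD)
qed

primrec maxi_pow :: "nat \<Rightarrow> 'a set" where
  "maxi_pow 0 = carrier R"
| "maxi_pow (Suc i) = maxi_smult (regular_module R) (maxi_pow i)"

lemma submod_maxi_pow: "submod R (regular_module R) (maxi_pow i)"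
  using reg.submod_carrier by (induction i) (auto intro: submod_maxi_smult reg.left_module_axioms)

text \<open>The powers become stationary at some \<open>K\<close> that equals \<open>maxi\<close>
  times \<open>K\<close>. That the annihilator \<open>Z\<close> of \<open>K\<close> is the whole
  ring follows by looking at a minimal ideal \<open>L\<close> strictly above \<open>Z\<close> and
  arguing as in Nakayama's lemma.\<close>

lemma maxi_pow_nilpotent: "\<exists>n. maxi_pow n = {\<zero>}"
proof -
  have "maxi_pow (Suc i) \<subseteq> maxi_pow i" for i
    using submod_maxi_smult(2)[OF reg.left_module_axioms submod_maxi_pow[of i]] by simp
  then obtain n where n: "\<forall>m\<ge>n. maxi_pow m = maxi_pow n"
    using descending_chain_condition[of maxi_pow] submod_maxi_pow by (auto simp: submod_regular_iff)
  define K where "K = maxi_pow n"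
  have KK: "maxi_smult (regular_module R) K = K"
    using n[rule_format, of "Suc n"] by (simp add: K_def)
  have K: "submod R (regular_module R) K" "K \<subseteq> carrier R"
    using submod_maxi_pow submodD(1)[OF submod_maxi_pow] by (auto simp: K_def)
  define Z where "Z = {x \<in> carrier R. \<forall>k\<in>K. x \<otimes> k = \<zero>}"
  have Z: "submod R (regular_module R) Z"
    using K(2) by (auto simp: submod_def Z_def l_distr m_assoc subset_iff)
  have "Z = carrier R"
  proof (rule ccontr)
    assume "Z \<noteq> carrier R"
    then have "carrier R \<in> {L. ideal L R \<and> Z \<subset> L}"
      using submodD(1)[OF Z] oneideal by auto
    then obtain L where L: "ideal L R" "Z \<subset> L"
        and min: "\<And>L'. ideal L' R \<Longrightarrow> L' \<subset> L \<Longrightarrow> \<not> Z \<subset> L'"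
      using wfE_min[OF wf_ideals, of "carrier R" "{L. ideal L R \<and> Z \<subset> L}"] by (smt (verit) case_prodI mem_Collect_eq)
    obtain x where x: "x \<in> L" "x \<notin> Z" using L(2) by blast
    have Ls: "submod R (regular_module R) L" using L by (simp add: submod_regular_iff)
    have xR: "x \<in> carrier R" using x(1) submodD(5)[OF Ls] by simp
    \<comment> \<open>Otherwise \<open>Z\<close> together with the multiples of
      \<open>r \<otimes> x\<close> fills \<open>L\<close> by minimality, so
      \<open>x = z \<oplus> s \<otimes> (r \<otimes> x)\<close> with \<open>z\<close> in
      \<open>Z\<close>. As \<open>\<one> \<ominus> s \<otimes> r\<close> is a unit, \<open>x\<close>
      is a multiple of \<open>z\<close>.\<close>
    have rx: "r \<otimes> x \<in> Z" if r: "r \<in> maxi" for r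
    proof (rule ccontr)
      assume rx: "r \<otimes> x \<notin> Z"
      have rR: "r \<in> carrier R" using r by (rule maxi_carrier)
      interpret h: module_hom R "regular_module R" "regular_module R" "\<lambda>a. a \<otimes> (r \<otimes> x)"
        using hom_orbit[OF reg.left_module_axioms, of "r \<otimes> x"] rR xR
        by (intro module_homI reg.left_module_axioms) simp_all
      let ?O = "(\<lambda>a. a \<otimes> (r \<otimes> x)) ` carrier R"
      have O: "submod R (regular_module R) ?O" using h.submod_image[OF reg.submod_carrier] by simp
      let ?S = "submod_sum (regular_module R) Z ?O"
      note S = reg.submod_sum[OF Z O]
      have "r \<otimes> x \<in> ?O" using rR xR by (intro image_eqI[of _ _ \<one>]) auto
      then have "Z \<subset> ?S" using S rx by blast
      moreover have "?S \<subseteq> L"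
        using submodD(3,4)[OF Ls] L(2) x(1) rR by (auto simp: submod_sum_def)
      ultimately have "?S = L"
        using min[of ?S] S(1) by (auto simp: submod_regular_iff)
      then obtain z s where zs: "z \<in> Z" "s \<in> carrier R" "x = z \<oplus> s \<otimes> (r \<otimes> x)"
        using x(1) by (auto simp: submod_sum_def)
      have sr: "s \<otimes> r \<in> maxi" using submodD(4)[OF maxi_submod, of s r] zs(2) r by simp
      then obtain t where t: "t \<in> carrier R" "t \<otimes> (\<one> \<ominus> s \<otimes> r) = \<one>"
        using one_diff_maxi_unit by blast
      have zR: "z \<in> carrier R" using zs(1) by (simp add: Z_def)
      have "(\<one> \<ominus> s \<otimes> r) \<otimes> x = x \<ominus> s \<otimes> (r \<otimes> x)"
        using zs(2) rR xR by (simp add: a_minus_def l_distr l_minus m_assoc)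
      also have "\<dots> = z"
        using zs rR xR zR reg.add_diff[of z "s \<otimes> (r \<otimes> x)"]
        by (metis (no_types, lifting) a_assoc a_inv_closed a_minus_def m_closed r_neg r_zero)
      finally have "x = t \<otimes> z" using t zs(2) rR xR by (metis l_one m_assoc m_closed minus_closed one_closed)
      then show False using x(2) submodD(4)[OF Z, of t z] zs(1) t(1) by simp
    qed
    \<comment> \<open>Since \<open>K\<close> equals \<open>maxi\<close> times \<open>K\<close>, it
      is enough that \<open>x\<close> kills the products \<open>r \<otimes> k\<close> with
      \<open>r\<close> in \<open>maxi\<close>; it does, because \<open>r \<otimes> x\<close>
      annihilates \<open>K\<close>.\<close>
    have "maxi_smult (regular_module R) K \<subseteq> {k \<in> carrier R. x \<otimes> k = \<zero>}"
    proof (rule maxi_smult_least)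
      show "submod R (regular_module R) {k \<in> carrier R. x \<otimes> k = \<zero>}"
        using xR by (auto simp: submod_def r_distr m_lcomm)
      fix r k assume rk: "r \<in> maxi" "k \<in> K"
      then have "r \<in> carrier R" "k \<in> carrier R" using maxi_carrier K(2) by auto
      then show "r \<odot>\<^bsub>regular_module R\<^esub> k \<in> {k \<in> carrier R. x \<otimes> k = \<zero>}"
        using rx[OF rk(1)] rk(2) xR by (auto simp: Z_def m_ac)
    qed
    then have "x \<in> Z" using xR by (auto simp: Z_def KK)
    then show False using x(2) by simp
  qed
  then have "\<one> \<in> Z" by simp
  then have "K \<subseteq> {\<zero>}" using K(2) by (auto simp: Z_def subset_iff)
  then have "K = {\<zero>}" using submodD(2)[OF K(1)] by auto
  then show ?thesis unfolding K_def by blast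
qed

text \<open>The socle series over \<open>R\<close>: level \<open>j\<close> consists of the elements
  killed by all products of \<open>j\<close> elements of \<open>maxi\<close>.\<close>

primrec soc :: "('a, 'c, 'l) module_scheme \<Rightarrow> nat \<Rightarrow> 'c set" where
  "soc V 0 = {\<zero>\<^bsub>V\<^esub>}"
| "soc V (Suc j) = {x \<in> carrier V. \<forall>r\<in>maxi. r \<odot>\<^bsub>V\<^esub> x \<in> soc V j}"

lemma submod_soc: "left_module R V \<Longrightarrow> submod R V (soc V j)"
proof (induction j)
  case 0
  then interpret left_module R V .
  show ?case by simp
next
  case (Suc j)
  then interpret left_module R V by blast
  show ?case
    using submodD[OF Suc.IH[OF Suc.prems]] maxi_carrier
    by (auto simp: submod_def smult_r_distr smult_assoc[symmetric] m_comm) (metis m_comm smult_assoc)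
qed

text \<open>With \<open>n\<close> the nilpotency exponent of \<open>maxi\<close>, the unit lies in
  level \<open>n\<close> of the series of the ring, and multiplying an element \<open>x\<close> by
  it transfers this to every module. That \<open>n\<close> is independent of the module is what
  later makes the bound on essential extensions uniform.\<close>

lemma soc_exhausts: "\<exists>n. \<forall>V. left_module R (V :: ('a, 'c, 'l) module_scheme) \<longrightarrow> soc V n = carrier V"
proof -
  obtain n where n: "maxi_pow n = {\<zero>}" using maxi_pow_nilpotent by blast
  have step: "maxi_pow (n - j) \<subseteq> soc (regular_module R) j" if "j \<le> n" for j
    using that
  proof (induction j)
    case (Suc j)
    have "r \<otimes> p \<in> soc (regular_module R) j" if rp: "r \<in> maxi" "p \<in> maxi_pow (n - Suc j)" for r p
    proof -
      have "r \<otimes> p \<in> maxi_pow (Suc (n - Suc j))"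
        using maxi_smult_memb[OF rp, of "regular_module R"] by simp
      moreover have "Suc (n - Suc j) = n - j" using Suc.prems by simp
      ultimately show ?thesis using Suc.IH Suc.prems by auto
    qed
    then show ?case using submodD(1)[OF submod_maxi_pow] by auto
  qed (use n in auto)
  have one: "\<one> \<in> soc (regular_module R) n" using step[of n] by auto
  have "soc V n = carrier V" if V: "left_module R V" for V :: "('a, 'c, 'l) module_scheme"
  proof -
    interpret V: left_module R V by fact
    have "r \<odot>\<^bsub>V\<^esub> x \<in> soc V j" if "r \<in> soc (regular_module R) j" "x \<in> carrier V" for r x j
      using that
    proof (induction j arbitrary: r)
      case (Suc j)
      then show ?case using maxi_carrier by (auto simp: V.smult_assoc[symmetric])
    qed auto
    then have "carrier V \<subseteq> soc V n" using one by (metis V.smult_one subsetI)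
    then show ?thesis using submodD(1)[OF submod_soc[OF V]] by blast
  qed
  then show ?thesis by blast
qed

text \<open>Well-founded induction along the descending chain condition: a nonzero ideal
  \<open>I\<close> has a subideal \<open>J\<close> with simple quotient, and the length grows by at
  most one from \<open>J\<close> to \<open>I\<close>.\<close>

lemma finlen_ideal: "ideal I R \<Longrightarrow> finlen R (regular_module R) I"
proof (induction I rule: wf_induct_rule[OF wf_ideals])
  case (1 I)
  have I: "submod R (regular_module R) I" using 1(2) by (simp add: submod_regular_iff)
  let ?U = "maxi_smult (regular_module R) I"
  show ?case
  proof (cases "I = {\<zero>}")
    case True
    then show ?thesis using reg.finlen_zero by simp
  next
    case False
    \<comment> \<open>An ideal contained in \<open>maxi\<close> times itself would lie in every
      power of \<open>maxi\<close>, hence be zero.\<close>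
    have "\<not> I \<subseteq> ?U"
    proof
      assume IU: "I \<subseteq> ?U"
      have "I \<subseteq> maxi_pow j" for j
      proof (induction j)
        case 0 then show ?case using submodD(1)[OF I] by simp
      next
        case (Suc j)
        then have "?U \<subseteq> maxi_pow (Suc j)"
          using submod_maxi_pow[of "Suc j"] maxi_smult_memb[of _ _ "maxi_pow j" "regular_module R"]
          by (intro maxi_smult_least) auto
        then show ?case using IU by blast
      qed
      then show False using maxi_pow_nilpotent False submodD(2)[OF I] by auto
    qed
    then obtain x where x: "x \<in> I" "x \<notin> ?U" by blast
    obtain L where L: "submod R (regular_module R) L" "?U \<subseteq> L" "x \<notin> L"
        "\<And>W. submod R (regular_module R) W \<Longrightarrow> L \<subseteq> W \<Longrightarrow> x \<notin> W \<Longrightarrow> W = L"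
      by (rule maximal_submod_avoiding[OF submod_maxi_smult(1)[OF reg.left_module_axioms I] x(2)]) metis
    \<comment> \<open>As \<open>L\<close> is maximal among the submodules that contain
      \<open>maxi\<close> times \<open>I\<close> and avoid \<open>x\<close>, the quotient of
      \<open>I\<close> by \<open>J\<close> is one-dimensional over the residue field;
      \<open>x_dec\<close> and \<open>dec\<close> express this by elements.\<close>
    define J where "J = L \<inter> I"
    have J: "submod R (regular_module R) J" using L(1) I by (simp add: J_def submod_Int)
    have "J \<subset> I" using x(1) L(3) by (auto simp: J_def)
    then have finJ: "finlen R (regular_module R) J"
      using 1(1)[of J] 1(2) J by (auto simp: submod_regular_iff)
    have car: "y \<in> carrier R" if "y \<in> I" for y using that submodD(5)[OF I] by simp
    have x_dec: "\<exists>c\<in>carrier R. \<exists>l\<in>L. x = l \<oplus> c \<otimes> y \<and> c \<notin> maxi" if y: "y \<in> I" "y \<notin> L" for y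
    proof -
      interpret h: module_hom R "regular_module R" "regular_module R" "\<lambda>a. a \<otimes> y"
        using hom_orbit[OF reg.left_module_axioms, of y] car[OF y(1)]
        by (intro module_homI reg.left_module_axioms) simp_all
      let ?O = "(\<lambda>a. a \<otimes> y) ` carrier R"
      have O: "submod R (regular_module R) ?O" using h.submod_image[OF reg.submod_carrier] by simp
      note S = reg.submod_sum[OF L(1) O]
      have "y \<in> ?O" using car[OF y(1)] by (intro image_eqI[of _ _ \<one>]) auto
      then have "x \<in> submod_sum (regular_module R) L ?O"
        using L(4)[OF S(1,2)] S(3) y(2) by blast
      then obtain l c where lc: "l \<in> L" "c \<in> carrier R" "x = l \<oplus> c \<otimes> y" by (auto simp: submod_sum_def)
      \<comment> \<open>For \<open>c\<close> in \<open>maxi\<close> the product with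
        \<open>y\<close> would lie in \<open>?U\<close>, hence in \<open>L\<close>, and would put
        \<open>x\<close> into \<open>L\<close>. So \<open>c\<close> is a unit and \<open>y\<close>
        can be expressed by \<open>x\<close> modulo \<open>L\<close>.\<close>
      have "c \<notin> maxi"
      proof
        assume "c \<in> maxi"
        then have "c \<otimes> y \<in> L" using maxi_smult_memb[of c y I "regular_module R"] y(1) L(2) by auto
        then show False using lc submodD(3)[OF L(1), of l "c \<otimes> y"] L(3) by simp
      qed
      then show ?thesis using lc by blast
    qed
    have dec: "\<exists>s\<in>carrier R. \<exists>j\<in>J. y = j \<oplus> s \<otimes> w" if yw: "y \<in> I" "w \<in> I" "w \<notin> L" for y w
    proof -
      have x_y: "\<exists>s\<in>carrier R. \<exists>j\<in>L. y = j \<oplus> s \<otimes> x"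
      proof (cases "y \<in> L")
        case True
        then show ?thesis using car[OF yw(1)] car[OF x(1)] by (intro bexI[of _ \<zero>] bexI[of _ y]) auto
      next
        case False
        obtain c l where cl: "c \<in> carrier R" "l \<in> L" "x = l \<oplus> c \<otimes> y" "c \<notin> maxi"
          using x_dec[OF yw(1) False] by blast
        obtain s where s: "s \<in> carrier R" "s \<otimes> c = \<one>" using notin_maxi_unit cl by blast
        have lR: "l \<in> carrier R" using cl(2) submodD(5)[OF L(1)] by simp
        have "s \<otimes> x = s \<otimes> l \<oplus> (s \<otimes> c) \<otimes> y"
          unfolding cl(3) using s(1) cl(1) lR car[OF yw(1)] by (simp add: r_distr m_assoc)
        then have "y = (\<ominus> s) \<otimes> l \<oplus> s \<otimes> x"
          using s lR car[OF yw(1)] car[OF x(1)] by (simp add: l_minus r_neg1)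
        moreover have "(\<ominus> s) \<otimes> l \<in> L" using submodD(4)[OF L(1), of "\<ominus> s" l] s cl(2) by simp
        ultimately show ?thesis using s(1) by blast
      qed
      then obtain s j where sj: "s \<in> carrier R" "j \<in> L" "y = j \<oplus> s \<otimes> x" by blast
      obtain c l where cl: "c \<in> carrier R" "l \<in> L" "x = l \<oplus> c \<otimes> w" using x_dec[OF yw(2,3)] by blast
      have R': "l \<in> carrier R" "j \<in> carrier R" "w \<in> carrier R"
        using cl(2) sj(2) submodD(5)[OF L(1)] car[OF yw(2)] by simp_all
      have eq: "y = (j \<oplus> s \<otimes> l) \<oplus> (s \<otimes> c) \<otimes> w"
        using sj(1,3) cl(1,3) R' by (simp add: r_distr m_assoc a_assoc)
      have jl: "j \<oplus> s \<otimes> l \<in> L"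
        using submodD(3)[OF L(1), of j "s \<otimes> l"] submodD(4)[OF L(1), of s l] sj cl by simp
      have "j \<oplus> s \<otimes> l = y \<ominus> (s \<otimes> c) \<otimes> w"
        unfolding eq using R' sj(1) cl(1) by (simp add: a_minus_def a_assoc r_neg)
      also have "\<dots> = y \<oplus> (\<ominus> (s \<otimes> c)) \<otimes> w"
        using R' sj(1) cl(1) by (simp add: a_minus_def l_minus)
      also have "\<dots> \<in> I"
        using submodD(3)[OF I, of y "(\<ominus> (s \<otimes> c)) \<otimes> w"] submodD(4)[OF I, of "\<ominus> (s \<otimes> c)" w] yw sj(1) cl(1) by simp
      finally have "j \<oplus> s \<otimes> l \<in> J" using jl by (simp add: J_def)
      then show ?thesis using eq sj(1) cl(1) by (intro bexI[of _ "s \<otimes> c"] bexI[of _ "j \<oplus> s \<otimes> l"]) auto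
    qed
    \<comment> \<open>The second summand counts the one step at which a chain may leave
      \<open>J\<close>; by \<open>dec\<close> a submodule of \<open>I\<close> not contained in
      \<open>J\<close> is determined among larger ones by its intersection with
      \<open>J\<close>.\<close>
    let ?g = "\<lambda>W. len R (regular_module R) (W \<inter> J) + (if W \<subseteq> J then 0 else 1)"
    have "n \<le> len R (regular_module R) J + 1" if "subchain R (regular_module R) I n" for n
    proof (rule subchain_bound[OF _ _ that])
      fix W W' assume W: "submod R (regular_module R) W" "submod R (regular_module R) W'" "W \<subset> W'" "W' \<subseteq> I"
      note strict = len_strict[OF finlen_subset[OF finJ Int_lower2] submod_Int[OF W(1) J] submod_Int[OF W(2) J]]
      show "?g W < ?g W'"
      proof (cases "W \<inter> J = W' \<inter> J")
        case False
        then have "W \<inter> J \<subset> W' \<inter> J" using W(3) by blast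
        then show ?thesis using strict W(3) by auto
      next
        case True
        have "W \<subseteq> J"
        proof (rule ccontr)
          assume "\<not> W \<subseteq> J"
          then obtain w where w: "w \<in> W" "w \<notin> L" "w \<in> I" using W(3,4) by (auto simp: J_def)
          have "W' \<subseteq> W"
          proof
            fix y assume y: "y \<in> W'"
            then obtain s j where sj: "s \<in> carrier R" "j \<in> J" "y = j \<oplus> s \<otimes> w" using dec w W(4) by blast
            have R': "j \<in> carrier R" "w \<in> carrier R" using sj(2) submodD(5)[OF J] car[OF w(3)] by simp_all
            have "j = y \<oplus> (\<ominus> s) \<otimes> w"
              unfolding sj(3) using sj(1) R' by (simp add: a_assoc l_minus r_neg)
            also have "\<dots> \<in> W'"
              using submodD(3)[OF W(2), of y "(\<ominus> s) \<otimes> w"] submodD(4)[OF W(2), of "\<ominus> s" w] sj(1) y w(1) W(3)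
              by auto
            finally have "j \<in> W" using True sj(2) by blast
            then show "y \<in> W"
              using submodD(3)[OF W(1), of j "s \<otimes> w"] submodD(4)[OF W(1), of s w] sj w(1) by simp
          qed
          then show False using W(3) by blast
        qed
        then have "\<not> W' \<subseteq> J" using True W(3) by blast
        then show ?thesis using True \<open>W \<subseteq> J\<close> by simp
      qed
    next
      fix W assume "submod R (regular_module R) W" "W \<subseteq> I"
      then show "?g W \<le> len R (regular_module R) J + 1"
        using len_mono[OF finJ submod_Int[OF _ J, of W] J] by (auto intro: le_SucI)
    qed
    then show ?thesis unfolding finlen_def by blast
  qed
qed

lemma finlen_regular: "finlen R (regular_module R) (carrier R)"
  using finlen_ideal[OF oneideal] .

end

text \<open>The bounding submodule is the sum of the \<open>T s\<close>. Its stability under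
  endomorphisms that preserve each \<open>T s\<close> is recorded because an
  \<open>R\<close>-submodule built here must later be recognised as stable under multiplication by
  \<open>\<Lambda>\<close>.\<close>

lemma (in left_module) finlen_Union_bound:
  assumes "finite S" "\<And>s. s \<in> S \<Longrightarrow> submod A M (T s) \<and> finlen A M (T s)"
  shows "\<exists>U. submod A M U \<and> finlen A M U \<and> (\<forall>s\<in>S. T s \<subseteq> U) \<and>
    (\<forall>\<phi>\<in>mod_hom A M M. (\<forall>s\<in>S. \<phi> ` T s \<subseteq> T s) \<longrightarrow> \<phi> ` U \<subseteq> U)"
  using assms
proof (induction S)
  case empty
  have "\<phi> ` {\<zero>\<^bsub>M\<^esub>} \<subseteq> {\<zero>\<^bsub>M\<^esub>}" if "\<phi> \<in> mod_hom A M M" for \<phi>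
    using module_hom.zero[OF module_homI[OF left_module_axioms left_module_axioms that]] by simp
  then show ?case using submod_zero finlen_zero by blast
next
  case (insert s S)
  then have "\<exists>U. submod A M U \<and> finlen A M U \<and> (\<forall>s\<in>S. T s \<subseteq> U) \<and>
    (\<forall>\<phi>\<in>mod_hom A M M. (\<forall>s\<in>S. \<phi> ` T s \<subseteq> T s) \<longrightarrow> \<phi> ` U \<subseteq> U)" by simp
  then obtain U where U: "submod A M U" "finlen A M U" "\<forall>s\<in>S. T s \<subseteq> U"
    "\<forall>\<phi>\<in>mod_hom A M M. (\<forall>s\<in>S. \<phi> ` T s \<subseteq> T s) \<longrightarrow> \<phi> ` U \<subseteq> U" by (elim exE conjE)
  have s: "submod A M (T s)" "finlen A M (T s)" using insert by auto
  have "\<phi> ` submod_sum M U (T s) \<subseteq> submod_sum M U (T s)"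
    if \<phi>: "\<phi> \<in> mod_hom A M M" and *: "\<forall>s\<in>insert s S. \<phi> ` T s \<subseteq> T s" for \<phi>
  proof -
    interpret \<phi>: module_hom A M M \<phi> using \<phi> by (intro module_homI left_module_axioms)
    show ?thesis
      unfolding submod_sum_def
    proof clarify
      fix u v assume uv: "u \<in> U" "v \<in> T s"
      then have "\<phi> (u \<oplus>\<^bsub>M\<^esub> v) = \<phi> u \<oplus>\<^bsub>M\<^esub> \<phi> v" using submodD(5)[OF U(1)] submodD(5)[OF s(1)] by (simp add: \<phi>.add)
      moreover have "\<phi> u \<in> U" "\<phi> v \<in> T s" using U(4)[rule_format, OF \<phi>] * uv by auto
      ultimately show "\<exists>u' v'. \<phi> (u \<oplus>\<^bsub>M\<^esub> v) = u' \<oplus>\<^bsub>M\<^esub> v' \<and> u' \<in> U \<and> v' \<in> T s" by blast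
    qed
  qed
  then show ?case
    using submod_sum[OF U(1) s(1)] finlen_sum[OF U(1) s(1) U(2) s(2)] U(3)
    by (intro exI[of _ "submod_sum M U (T s)"] conjI ballI impI) (simp_all, blast)
qed

lemma (in artinian_local_ring) finlen_fin_gen:
  assumes "left_module R V" "fin_gen R V"
  shows "finlen R V (carrier V)"
proof -
  interpret V: left_module R V by fact
  obtain S where S: "finite S" "S \<subseteq> carrier V" "\<And>U. submod R V U \<Longrightarrow> S \<subseteq> U \<Longrightarrow> U = carrier V"
    using assms(2) unfolding V.fin_gen_iff by blast
  have "submod R V ((\<lambda>a. a \<odot>\<^bsub>V\<^esub> s) ` carrier R) \<and> finlen R V ((\<lambda>a. a \<odot>\<^bsub>V\<^esub> s) ` carrier R)" if "s \<in> S" for s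
  proof -
    have "s \<in> carrier V" using that S by blast
    then interpret h: module_hom R "regular_module R" V "\<lambda>a. a \<odot>\<^bsub>V\<^esub> s"
      by (intro module_homI left_module_regular hom_orbit assms(1))
    show ?thesis using h.submod_image[OF h.M.submod_carrier] h.finlen_image[OF h.M.submod_carrier] finlen_regular
      by simp
  qed
  then obtain U where U: "submod R V U" "finlen R V U" "\<forall>s\<in>S. (\<lambda>a. a \<odot>\<^bsub>V\<^esub> s) ` carrier R \<subseteq> U"
    using V.finlen_Union_bound[OF S(1), of "\<lambda>s. (\<lambda>a. a \<odot>\<^bsub>V\<^esub> s) ` carrier R"] by blast
  have "S \<subseteq> U"
  proof
    fix s assume s: "s \<in> S"
    then have "\<one> \<odot>\<^bsub>V\<^esub> s \<in> U" using U(3) by blast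
    then show "s \<in> U" using s S(2) by auto
  qed
  then show ?thesis using S(3) U by metis
qed

section \<open>The category of finitely generated modules\<close>

lemma submod_submod_iff:
  assumes "submod A M U"
  shows "submod A (M\<lparr>carrier := U\<rparr>) V \<longleftrightarrow> submod A M V \<and> V \<subseteq> U"
  using submodD(1)[OF assms] by (auto simp: submod_def)

lemma fin_gen_image:
  assumes "left_module A M" "left_module A N" "f \<in> mod_hom A M N" "f ` carrier M = carrier N" "fin_gen A M"
  shows "fin_gen A N"
proof -
  interpret f: module_hom A M N f by (intro module_homI assms)
  obtain S where S: "finite S" "S \<subseteq> carrier M" "\<And>U. submod A M U \<Longrightarrow> S \<subseteq> U \<Longrightarrow> U = carrier M"
    using assms(5) unfolding f.M.fin_gen_iff by metis
  have "U = carrier N" if U: "submod A N U" "f ` S \<subseteq> U" for U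
  proof -
    have "{x \<in> carrier M. f x \<in> U} = carrier M"
      using S(2) U by (intro S(3) f.submod_vimage) auto
    then have "f ` carrier M \<subseteq> U" by auto
    then show ?thesis using assms(4) submodD(1)[OF U(1)] by auto
  qed
  then show ?thesis
    unfolding f.N.fin_gen_iff using S assms(4) by (intro exI[of _ "f ` S"]) auto
qed

section \<open>Biproducts with named maps, and direct sums of lists\<close>

definition biprod where
  "biprod A X i p Y j q Z \<longleftrightarrow> i \<in> mod_hom A Y X \<and> p \<in> mod_hom A X Y \<and> j \<in> mod_hom A Z X \<and> q \<in> mod_hom A X Z \<and>
    (\<forall>y\<in>carrier Y. p (i y) = y) \<and> (\<forall>z\<in>carrier Z. q (j z) = z) \<and>
    (\<forall>y\<in>carrier Y. q (i y) = \<zero>\<^bsub>Z\<^esub>) \<and> (\<forall>z\<in>carrier Z. p (j z) = \<zero>\<^bsub>Y\<^esub>) \<and>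
    (\<forall>x\<in>carrier X. i (p x) \<oplus>\<^bsub>X\<^esub> j (q x) = x)"

lemma biprodD:
  assumes "biprod A X i p Y j q Z"
  shows "i \<in> mod_hom A Y X" "p \<in> mod_hom A X Y" "j \<in> mod_hom A Z X" "q \<in> mod_hom A X Z"
    "y \<in> carrier Y \<Longrightarrow> p (i y) = y" "z \<in> carrier Z \<Longrightarrow> q (j z) = z"
    "y \<in> carrier Y \<Longrightarrow> q (i y) = \<zero>\<^bsub>Z\<^esub>" "z \<in> carrier Z \<Longrightarrow> p (j z) = \<zero>\<^bsub>Y\<^esub>"
    "x \<in> carrier X \<Longrightarrow> i (p x) \<oplus>\<^bsub>X\<^esub> j (q x) = x"
  using assms by (auto simp: biprod_def)

lemma biprod_closed:
  assumes "biprod A X i p Y j q Z"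
  shows "y \<in> carrier Y \<Longrightarrow> i y \<in> carrier X" "x \<in> carrier X \<Longrightarrow> p x \<in> carrier Y"
    "z \<in> carrier Z \<Longrightarrow> j z \<in> carrier X" "x \<in> carrier X \<Longrightarrow> q x \<in> carrier Z"
  using biprodD(1-4)[OF assms] by (auto dest: hom_closed)

lemma biprod_swap:
  assumes "left_module A X" "biprod A X i p Y j q Z"
  shows "biprod A X j q Z i p Y"
proof -
  interpret left_module A X by fact
  show ?thesis
    using assms(2) biprod_closed[OF assms(2)] by (auto simp: biprod_def M.a_comm)
qed

text \<open>The complement is the kernel of the retraction, realised as \<open>X\<close> with a
  smaller carrier; \<open>1 - i p\<close> projects onto it.\<close>

lemma retract_biprod:
  assumes X: "left_module A X" and Y: "left_module A Y"
    and i: "i \<in> mod_hom A Y X" and p: "p \<in> mod_hom A X Y" and pi: "\<And>y. y \<in> carrier Y \<Longrightarrow> p (i y) = y"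
  shows "submod A X {x \<in> carrier X. p x = \<zero>\<^bsub>Y\<^esub>}"
    "biprod A X i p Y (\<lambda>x. x) (\<lambda>x. x \<ominus>\<^bsub>X\<^esub> i (p x)) (X\<lparr>carrier := {x \<in> carrier X. p x = \<zero>\<^bsub>Y\<^esub>}\<rparr>)"
proof -
  interpret X: left_module A X by fact
  interpret Y: left_module A Y by fact
  interpret i: module_hom A Y X i by (intro module_homI assms)
  interpret p: module_hom A X Y p by (intro module_homI assms)
  show K: "submod A X {x \<in> carrier X. p x = \<zero>\<^bsub>Y\<^esub>}" by (rule p.submod_ker)
  have "(\<lambda>x. x \<ominus>\<^bsub>X\<^esub> i (p x)) \<in> mod_hom A X (X\<lparr>carrier := {x \<in> carrier X. p x = \<zero>\<^bsub>Y\<^esub>}\<rparr>)"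
  proof (rule hom_into_submod)
    show "(\<lambda>x. x \<ominus>\<^bsub>X\<^esub> i (p x)) \<in> mod_hom A X X"
      by (intro hom_diff X hom_id hom_comp[OF p i])
    show "x \<ominus>\<^bsub>X\<^esub> i (p x) \<in> {x \<in> carrier X. p x = \<zero>\<^bsub>Y\<^esub>}" if "x \<in> carrier X" for x
      using that pi[of "p x"] by (simp add: p.diff Y.diff_zero_iff)
  qed
  moreover have "i (p x) \<oplus>\<^bsub>X\<^esub> (x \<ominus>\<^bsub>X\<^esub> i (p x)) = x" if "x \<in> carrier X" for x
    using that X.diff_add[of x "i (p x)"] by (simp add: X.M.a_comm)
  ultimately show "biprod A X i p Y (\<lambda>x. x) (\<lambda>x. x \<ominus>\<^bsub>X\<^esub> i (p x)) (X\<lparr>carrier := {x \<in> carrier X. p x = \<zero>\<^bsub>Y\<^esub>}\<rparr>)"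
    unfolding biprod_def using i p pi hom_inclusion[OF K] by (auto simp: X.diff_zero_iff)
qed

lemma is_direct_sum_Nil:
  assumes "left_module A X"
  shows "is_direct_sum A X [] \<longleftrightarrow> carrier X \<subseteq> {\<zero>\<^bsub>X\<^esub>}"
proof -
  interpret X: left_module A X by fact
  show ?thesis by (auto simp: is_direct_sum_def)
qed

lemma is_direct_sumE:
  assumes "is_direct_sum A X Ys"
  obtains \<iota> \<pi> where "\<And>i. i < length Ys \<Longrightarrow> \<iota> i \<in> mod_hom A (Ys ! i) X"
      "\<And>i. i < length Ys \<Longrightarrow> \<pi> i \<in> mod_hom A X (Ys ! i)"
      "\<And>i j y. i < length Ys \<Longrightarrow> j < length Ys \<Longrightarrow> y \<in> carrier (Ys ! i) \<Longrightarrow>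
        \<pi> j (\<iota> i y) = (if i = j then y else \<zero>\<^bsub>Ys ! j\<^esub>)"
      "\<And>x. x \<in> carrier X \<Longrightarrow> (\<Oplus>\<^bsub>X\<^esub>i\<in>{..<length Ys}. \<iota> i (\<pi> i x)) = x"
proof -
  from assms[unfolded is_direct_sum_def] obtain \<iota> \<pi> where
     "\<forall>i<length Ys. \<iota> i \<in> mod_hom A (Ys ! i) X \<and> \<pi> i \<in> mod_hom A X (Ys ! i)"
     "\<forall>i<length Ys. \<forall>j<length Ys. \<forall>y\<in>carrier (Ys ! i). \<pi> j (\<iota> i y) = (if i = j then y else \<zero>\<^bsub>Ys ! j\<^esub>)"
     "\<forall>x\<in>carrier X. (\<Oplus>\<^bsub>X\<^esub>i\<in>{..<length Ys}. \<iota> i (\<pi> i x)) = x"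
    by (elim exE conjE)
  then show thesis by (intro that[of \<iota> \<pi>]) simp_all
qed

lemma (in abelian_monoid) finsum_lessThan_Suc_shift:
  fixes n :: nat
  assumes "\<And>i. i < Suc n \<Longrightarrow> f i \<in> carrier G"
  shows "(\<Oplus>\<^bsub>G\<^esub>i\<in>{..<Suc n}. f i) = f 0 \<oplus>\<^bsub>G\<^esub> (\<Oplus>\<^bsub>G\<^esub>i\<in>{..<n}. f (Suc i))"
proof -
  have "{..<Suc n} = insert 0 (Suc ` {..<n})" by (rule lessThan_Suc_eq_insert_0)
  moreover have "(\<Oplus>\<^bsub>G\<^esub>i\<in>Suc ` {..<n}. f i) = (\<Oplus>\<^bsub>G\<^esub>i\<in>{..<n}. f (Suc i))"
    using assms by (subst finsum_reindex) auto
  moreover have "(\<Oplus>\<^bsub>G\<^esub>i\<in>insert 0 (Suc ` {..<n}). f i) = f 0 \<oplus>\<^bsub>G\<^esub> (\<Oplus>\<^bsub>G\<^esub>i\<in>Suc ` {..<n}. f i)"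
    using assms by (subst finsum_insert) auto
  ultimately show ?thesis by simp
qed

text \<open>Splitting off the first summand leaves the kernel of its projection, which is the direct
  sum of the remaining list. Together with \<open>is_direct_sum_ConsI\<close> this reduces lists to
  biprods and permits induction on the list.\<close>

lemma is_direct_sum_ConsD:
  fixes X :: "('a, 'b) module"
  assumes X: "left_module A X" and Ys: "\<And>Y'. Y' \<in> set (Y # Ys) \<Longrightarrow> left_module A Y'"
    and ds: "is_direct_sum A X (Y # Ys)"
  obtains U i p j q where "submod A X U" "biprod A X i p Y j q (X\<lparr>carrier := U\<rparr>)"
    "is_direct_sum A (X\<lparr>carrier := U\<rparr>) Ys"
proof -
  interpret X: left_module A X by fact
  obtain \<iota> \<pi> where \<iota>\<pi>: "\<And>i. i < Suc (length Ys) \<Longrightarrow> \<iota> i \<in> mod_hom A ((Y # Ys) ! i) X"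
      "\<And>i. i < Suc (length Ys) \<Longrightarrow> \<pi> i \<in> mod_hom A X ((Y # Ys) ! i)"
      "\<And>i j y. i < Suc (length Ys) \<Longrightarrow> j < Suc (length Ys) \<Longrightarrow> y \<in> carrier ((Y # Ys) ! i) \<Longrightarrow>
        \<pi> j (\<iota> i y) = (if i = j then y else \<zero>\<^bsub>(Y # Ys) ! j\<^esub>)"
      "\<And>x. x \<in> carrier X \<Longrightarrow> (\<Oplus>\<^bsub>X\<^esub>i\<in>{..<Suc (length Ys)}. \<iota> i (\<pi> i x)) = x"
    by (rule is_direct_sumE[OF ds, unfolded length_Cons]) (rule that)
  have Y: "left_module A Y" using Ys by simp
  let ?U = "{x \<in> carrier X. \<pi> 0 x = \<zero>\<^bsub>Y\<^esub>}"
  have h0: "\<iota> 0 \<in> mod_hom A Y X" "\<pi> 0 \<in> mod_hom A X Y" using \<iota>\<pi>(1)[of 0] \<iota>\<pi>(2)[of 0] by simp_all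
  have "\<pi> 0 (\<iota> 0 y) = y" if "y \<in> carrier Y" for y using \<iota>\<pi>(3)[of 0 0 y] that by simp
  note r = retract_biprod[OF X Y h0 this]
  have U: "submod A X ?U" "biprod A X (\<iota> 0) (\<pi> 0) Y (\<lambda>x. x) (\<lambda>x. x \<ominus>\<^bsub>X\<^esub> \<iota> 0 (\<pi> 0 x)) (X\<lparr>carrier := ?U\<rparr>)"
    using r by simp_all
  let ?X' = "X\<lparr>carrier := ?U\<rparr>"
  have X': "left_module A ?X'" by (rule X.left_module_submod[OF U(1)])
  interpret X': left_module A ?X' by (rule X')
  interpret \<iota>0: module_hom A Y X "\<iota> 0" using \<iota>\<pi>(1)[of 0] by (intro module_homI X Y) simp
  have in1: "\<iota> (Suc i) \<in> mod_hom A (Ys ! i) ?X'" if "i < length Ys" for i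
  proof (rule hom_into_submod)
    show "\<iota> (Suc i) \<in> mod_hom A (Ys ! i) X" using \<iota>\<pi>(1)[of "Suc i"] that by simp
    then show "\<iota> (Suc i) y \<in> ?U" if "y \<in> carrier (Ys ! i)" for y
      using \<iota>\<pi>(3)[of "Suc i" 0 y] that \<open>i < length Ys\<close> by (auto dest: hom_closed)
  qed
  have in2: "\<pi> (Suc i) \<in> mod_hom A ?X' (Ys ! i)" if "i < length Ys" for i
    using \<iota>\<pi>(2)[of "Suc i"] that by (intro hom_on_submod[OF _ U(1)]) simp
  have "(\<Oplus>\<^bsub>?X'\<^esub>i\<in>{..<length Ys}. \<iota> (Suc i) (\<pi> (Suc i) x)) = x" if x: "x \<in> ?U" for x
  proof -
    have cl': "\<iota> (Suc i) (\<pi> (Suc i) x) \<in> ?U" if "i < length Ys" for i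
      using hom_closed[OF in1[OF that] hom_closed[OF in2[OF that]], of x] x by simp
    have cl: "\<iota> i (\<pi> i x) \<in> carrier X" if "i < Suc (length Ys)" for i
      using hom_closed[OF \<iota>\<pi>(1)[OF that] hom_closed[OF \<iota>\<pi>(2)[OF that]], of x] x by simp
    have "(\<Oplus>\<^bsub>?X'\<^esub>i\<in>{..<length Ys}. \<iota> (Suc i) (\<pi> (Suc i) x)) = (\<Oplus>\<^bsub>X\<^esub>i\<in>{..<length Ys}. \<iota> (Suc i) (\<pi> (Suc i) x))"
      using mod_hom_finsum[OF X'.M.abelian_group_axioms X.M.abelian_group_axioms hom_inclusion[OF U(1)],
        of "\<lambda>i. \<iota> (Suc i) (\<pi> (Suc i) x)" "{..<length Ys}"] cl' by auto
    also have "\<dots> = \<iota> 0 (\<pi> 0 x) \<oplus>\<^bsub>X\<^esub> (\<Oplus>\<^bsub>X\<^esub>i\<in>{..<length Ys}. \<iota> (Suc i) (\<pi> (Suc i) x))"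
      using x cl by (simp add: Pi_iff)
    also have "\<dots> = x"
      using X.M.finsum_lessThan_Suc_shift[OF cl] \<iota>\<pi>(4)[of x] x by simp
    finally show ?thesis .
  qed
  then have "is_direct_sum A ?X' Ys"
    unfolding is_direct_sum_def using in1 in2 \<iota>\<pi>(3)[of "Suc _" "Suc _"]
    by (intro exI[of _ "\<lambda>i. \<iota> (Suc i)"] exI[of _ "\<lambda>i. \<pi> (Suc i)"]) auto
  then show thesis using U that by blast
qed

lemma is_direct_sum_ConsI:
  fixes X :: "('a, 'b) module"
  assumes X: "left_module A X" and X': "left_module A X'" and Ys: "\<And>Y'. Y' \<in> set (Y # Ys) \<Longrightarrow> left_module A Y'"
    and b: "biprod A X i p Y j q X'" and ds: "is_direct_sum A X' Ys"
  shows "is_direct_sum A X (Y # Ys)"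
proof -
  have Y: "left_module A Y" using Ys by simp
  interpret X: left_module A X by fact
  interpret X': left_module A X' by fact
  interpret j: module_hom A X' X j using biprodD(3)[OF b] by (intro module_homI X X')
  interpret q: module_hom A X X' q using biprodD(4)[OF b] by (intro module_homI X X')
  obtain \<iota> \<pi> where \<iota>\<pi>: "\<And>i. i < length Ys \<Longrightarrow> \<iota> i \<in> mod_hom A (Ys ! i) X'"
      "\<And>i. i < length Ys \<Longrightarrow> \<pi> i \<in> mod_hom A X' (Ys ! i)"
      "\<And>i j y. i < length Ys \<Longrightarrow> j < length Ys \<Longrightarrow> y \<in> carrier (Ys ! i) \<Longrightarrow>
        \<pi> j (\<iota> i y) = (if i = j then y else \<zero>\<^bsub>Ys ! j\<^esub>)"
      "\<And>x. x \<in> carrier X' \<Longrightarrow> (\<Oplus>\<^bsub>X'\<^esub>i\<in>{..<length Ys}. \<iota> i (\<pi> i x)) = x"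
    by (rule is_direct_sumE[OF ds]) (rule that)
  have \<pi>0: "\<pi> k \<zero>\<^bsub>X'\<^esub> = \<zero>\<^bsub>Ys ! k\<^esub>" if "k < length Ys" for k
    using module_hom.zero[OF module_homI[OF X' _ \<iota>\<pi>(2)[OF that]]] Ys that by simp
  define \<iota>' where "\<iota>' n = (case n of 0 \<Rightarrow> i | Suc k \<Rightarrow> (\<lambda>x. j (\<iota> k x)))" for n
  define \<pi>' where "\<pi>' n = (case n of 0 \<Rightarrow> p | Suc k \<Rightarrow> (\<lambda>x. \<pi> k (q x)))" for n
  have 1: "\<iota>' n \<in> mod_hom A ((Y # Ys) ! n) X" if "n < Suc (length Ys)" for n
    using that biprodD(1)[OF b] hom_comp[OF \<iota>\<pi>(1) biprodD(3)[OF b]] by (cases n) (auto simp: \<iota>'_def)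
  have 2: "\<pi>' n \<in> mod_hom A X ((Y # Ys) ! n)" if "n < Suc (length Ys)" for n
    using that biprodD(2)[OF b] hom_comp[OF biprodD(4)[OF b] \<iota>\<pi>(2)] by (cases n) (auto simp: \<pi>'_def)
  have 3: "\<pi>' m (\<iota>' n y) = (if n = m then y else \<zero>\<^bsub>(Y # Ys) ! m\<^esub>)"
    if "n < Suc (length Ys)" "m < Suc (length Ys)" "y \<in> carrier ((Y # Ys) ! n)" for n m y
    using that biprodD(5-8)[OF b] \<iota>\<pi>(3) \<pi>0 hom_closed[OF \<iota>\<pi>(1)]
    by (cases n; cases m) (auto simp: \<iota>'_def \<pi>'_def)
  have 4: "(\<Oplus>\<^bsub>X\<^esub>n\<in>{..<Suc (length Ys)}. \<iota>' n (\<pi>' n x)) = x" if x: "x \<in> carrier X" for x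
  proof -
    have cl: "\<iota>' n (\<pi>' n x) \<in> carrier X" if "n < Suc (length Ys)" for n
      using hom_closed[OF 1[OF that] hom_closed[OF 2[OF that] x]] .
    have cl': "\<iota> k (\<pi> k (q x)) \<in> carrier X'" if "k < length Ys" for k
      using hom_closed[OF \<iota>\<pi>(1)[OF that] hom_closed[OF \<iota>\<pi>(2)[OF that]], of "q x"] x by simp
    have "(\<Oplus>\<^bsub>X\<^esub>n\<in>{..<Suc (length Ys)}. \<iota>' n (\<pi>' n x)) = i (p x) \<oplus>\<^bsub>X\<^esub> (\<Oplus>\<^bsub>X\<^esub>k\<in>{..<length Ys}. j (\<iota> k (\<pi> k (q x))))"
      using X.M.finsum_lessThan_Suc_shift[OF cl] by (simp add: \<iota>'_def \<pi>'_def)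
    also have "(\<Oplus>\<^bsub>X\<^esub>k\<in>{..<length Ys}. j (\<iota> k (\<pi> k (q x)))) = j (\<Oplus>\<^bsub>X'\<^esub>k\<in>{..<length Ys}. \<iota> k (\<pi> k (q x)))"
      using mod_hom_finsum[OF X'.M.abelian_group_axioms X.M.abelian_group_axioms j.hom,
        of "\<lambda>k. \<iota> k (\<pi> k (q x))" "{..<length Ys}"] cl' by auto
    also have "\<dots> = j (q x)" using \<iota>\<pi>(4) x by simp
    also have "i (p x) \<oplus>\<^bsub>X\<^esub> j (q x) = x" using biprodD(9)[OF b x] .
    finally show ?thesis .
  qed
  show ?thesis
    unfolding is_direct_sum_def using 1 2 3 4
    by (intro exI[of _ \<iota>'] exI[of _ \<pi>']) auto
qed

lemma is_direct_sum_two_iff: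
  fixes X :: "('a, 'b) module"
  assumes X: "left_module A X" and Y: "left_module A Y" and Z: "left_module A Z"
  shows "is_direct_sum A X [Y, Z] \<longleftrightarrow> (\<exists>i p j q. biprod A X i p Y j q Z)"
proof
  assume ds: "is_direct_sum A X [Y, Z]"
  obtain \<iota> \<pi> where "\<And>i. i < Suc (Suc 0) \<Longrightarrow> \<iota> i \<in> mod_hom A ([Y, Z] ! i) X"
      "\<And>i. i < Suc (Suc 0) \<Longrightarrow> \<pi> i \<in> mod_hom A X ([Y, Z] ! i)"
      "\<And>i j y. i < Suc (Suc 0) \<Longrightarrow> j < Suc (Suc 0) \<Longrightarrow> y \<in> carrier ([Y, Z] ! i) \<Longrightarrow>
        \<pi> j (\<iota> i y) = (if i = j then y else \<zero>\<^bsub>[Y, Z] ! j\<^esub>)"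
      "\<And>x. x \<in> carrier X \<Longrightarrow> (\<Oplus>\<^bsub>X\<^esub>i\<in>{..<Suc (Suc 0)}. \<iota> i (\<pi> i x)) = x"
    by (rule is_direct_sumE[OF ds, unfolded length_Cons list.size(3)]) (rule that)
  note * = this(1)[of 0] this(1)[of "Suc 0"] this(2)[of 0] this(2)[of "Suc 0"] this(3)[of 0 0] this(3)[of 0 "Suc 0"]
    this(3)[of "Suc 0" 0] this(3)[of "Suc 0" "Suc 0"] this(4)
  interpret X: left_module A X by fact
  have "\<iota> 0 (\<pi> 0 x) \<oplus>\<^bsub>X\<^esub> \<iota> (Suc 0) (\<pi> (Suc 0) x) = x" if x: "x \<in> carrier X" for x
  proof -
    have "\<iota> 0 (\<pi> 0 x) \<in> carrier X" "\<iota> (Suc 0) (\<pi> (Suc 0) x) \<in> carrier X"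
      using hom_closed[OF *(1) hom_closed[OF *(3)]] hom_closed[OF *(2) hom_closed[OF *(4)]] x by auto
    then show ?thesis
      using *(9)[OF x] X.M.a_comm by (simp add: lessThan_Suc)
  qed
  then have "biprod A X (\<iota> 0) (\<pi> 0) Y (\<iota> (Suc 0)) (\<pi> (Suc 0)) Z"
    unfolding biprod_def using * by simp
  then show "\<exists>i p j q. biprod A X i p Y j q Z" by blast
next
  assume "\<exists>i p j q. biprod A X i p Y j q Z"
  then obtain i p j q where b: "biprod A X i p Y j q Z" by blast
  interpret X: left_module A X by fact
  interpret Z: left_module A Z by fact
  have "is_direct_sum A Z [Z]"
    unfolding is_direct_sum_def
    by (intro exI[of _ "\<lambda>_ x. x"]) (auto simp: hom_id lessThan_Suc)
  then show "is_direct_sum A X [Y, Z]"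
    using Y Z by (intro is_direct_sum_ConsI[OF X Z _ b]) auto
qed

text \<open>The product has pairs as elements; \<open>sum_mods\<close> moves it into the universe of
  lists through an isomorphic copy.\<close>

lemma product_module_exists:
  fixes X :: "('a, 'b) module" and Y :: "('a, 'c) module"
  assumes X: "left_module A X" and Y: "left_module A Y"
  shows "\<exists>P :: ('a, 'b \<times> 'c) module. left_module A P \<and> carrier P = carrier X \<times> carrier Y \<and>
    \<zero>\<^bsub>P\<^esub> = (\<zero>\<^bsub>X\<^esub>, \<zero>\<^bsub>Y\<^esub>) \<and> (\<forall>u v. u \<oplus>\<^bsub>P\<^esub> v = (fst u \<oplus>\<^bsub>X\<^esub> fst v, snd u \<oplus>\<^bsub>Y\<^esub> snd v)) \<and>
    (\<forall>a u. a \<odot>\<^bsub>P\<^esub> u = (a \<odot>\<^bsub>X\<^esub> fst u, a \<odot>\<^bsub>Y\<^esub> snd u)) \<and> (fin_gen A X \<longrightarrow> fin_gen A Y \<longrightarrow> fin_gen A P)"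
proof -
  interpret X: left_module A X by fact
  interpret Y: left_module A Y by fact
  define P :: "('a, 'b \<times> 'c) module" where "P = \<lparr>carrier = carrier X \<times> carrier Y, monoid.mult = undefined, monoid.one = undefined,
    ring.zero = (\<zero>\<^bsub>X\<^esub>, \<zero>\<^bsub>Y\<^esub>), ring.add = (\<lambda>u v. (fst u \<oplus>\<^bsub>X\<^esub> fst v, snd u \<oplus>\<^bsub>Y\<^esub> snd v)),
    smult = (\<lambda>a u. (a \<odot>\<^bsub>X\<^esub> fst u, a \<odot>\<^bsub>Y\<^esub> snd u))\<rparr>"
  have [simp]: "carrier P = carrier X \<times> carrier Y" "\<zero>\<^bsub>P\<^esub> = (\<zero>\<^bsub>X\<^esub>, \<zero>\<^bsub>Y\<^esub>)"
    "u \<oplus>\<^bsub>P\<^esub> v = (fst u \<oplus>\<^bsub>X\<^esub> fst v, snd u \<oplus>\<^bsub>Y\<^esub> snd v)" "a \<odot>\<^bsub>P\<^esub> u = (a \<odot>\<^bsub>X\<^esub> fst u, a \<odot>\<^bsub>Y\<^esub> snd u)" for u v a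
    by (simp_all add: P_def)
  have "abelian_group P"
  proof (rule abelian_groupI)
    fix u assume "u \<in> carrier P"
    then show "\<exists>v\<in>carrier P. v \<oplus>\<^bsub>P\<^esub> u = \<zero>\<^bsub>P\<^esub>"
      by (intro bexI[of _ "(\<ominus>\<^bsub>X\<^esub> fst u, \<ominus>\<^bsub>Y\<^esub> snd u)"]) (auto simp: X.M.l_neg Y.M.l_neg)
  qed (auto simp: X.M.a_ac Y.M.a_ac)
  then have P: "left_module A P"
    unfolding left_module_def left_module_axioms_def using X.R.ring_axioms
    by (auto simp: X.smult_l_distr X.smult_r_distr X.smult_assoc Y.smult_l_distr Y.smult_r_distr Y.smult_assoc)
  interpret P: left_module A P by (rule P)
  have "fin_gen A P" if fg: "fin_gen A X" "fin_gen A Y"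
  proof -
    obtain S where S: "finite S" "S \<subseteq> carrier X" "\<And>U. submod A X U \<Longrightarrow> S \<subseteq> U \<Longrightarrow> U = carrier X"
      using fg(1) unfolding X.fin_gen_iff by metis
    obtain T where T: "finite T" "T \<subseteq> carrier Y" "\<And>U. submod A Y U \<Longrightarrow> T \<subseteq> U \<Longrightarrow> U = carrier Y"
      using fg(2) unfolding Y.fin_gen_iff by metis
    have "U = carrier P" if U: "submod A P U" "S \<times> {\<zero>\<^bsub>Y\<^esub>} \<union> {\<zero>\<^bsub>X\<^esub>} \<times> T \<subseteq> U" for U
    proof -
      note U' = submodD[OF U(1), simplified]
      have "{x \<in> carrier X. (x, \<zero>\<^bsub>Y\<^esub>) \<in> U} = carrier X"
        using U(2) S(2) U'(2) U'(3)[of "(_, \<zero>\<^bsub>Y\<^esub>)" "(_, \<zero>\<^bsub>Y\<^esub>)"] U'(4)[of _ "(_, \<zero>\<^bsub>Y\<^esub>)"]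
        by (intro S(3)) (auto simp: submod_def)
      moreover have "{y \<in> carrier Y. (\<zero>\<^bsub>X\<^esub>, y) \<in> U} = carrier Y"
        using U(2) T(2) U'(2) U'(3)[of "(\<zero>\<^bsub>X\<^esub>, _)" "(\<zero>\<^bsub>X\<^esub>, _)"] U'(4)[of _ "(\<zero>\<^bsub>X\<^esub>, _)"]
        by (intro T(3)) (auto simp: submod_def)
      ultimately have "(x, y) \<in> U" if "x \<in> carrier X" "y \<in> carrier Y" for x y
        using that U'(3)[of "(x, \<zero>\<^bsub>Y\<^esub>)" "(\<zero>\<^bsub>X\<^esub>, y)"] by auto
      then show ?thesis using U'(1) by auto
    qed
    then show ?thesis
      unfolding P.fin_gen_iff using S T by (intro exI[of _ "S \<times> {\<zero>\<^bsub>Y\<^esub>} \<union> {\<zero>\<^bsub>X\<^esub>} \<times> T"]) auto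
  qed
  then show ?thesis using P by (intro exI[of _ P]) simp
qed

section \<open>The algebra: restriction of scalars and closure properties of
  \<open>mods\<close>\<close>

locale artin =
  fixes R :: "('r, 'k) ring_scheme" and \<Lambda> :: "('r, 'a) module"
  assumes artin_algebra: "artin_algebra R \<Lambda>"
begin

sublocale AR: artinian_local_ring R
  using artin_algebra by (rule artin_algebra.axioms(1))

sublocale L: ring \<Lambda>
  using artin_algebra by (rule artin_algebra.axioms(3))

sublocale RL: module R \<Lambda>
  using artin_algebra by (rule artin_algebra.axioms(2))

lemma left_module_R\<Lambda>: "left_module R \<Lambda>"
  unfolding left_module_def left_module_axioms_def
  using RL.smult_l_distr RL.smult_r_distr RL.smult_assoc1 AR.ring_axioms L.abelian_group_axioms by auto

lemma finlen_\<Lambda>: "finlen R \<Lambda> (carrier \<Lambda>)"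
  using artin_algebra by (intro AR.finlen_fin_gen left_module_R\<Lambda> artin_algebra.fin_gen)

text \<open>The structure map of the algebra. By \<open>scal_mult\<close> and
  \<open>mult_scal\<close> its image is central, which makes multiplication by \<open>scal r\<close>
  a module homomorphism.\<close>

definition scal :: "'r \<Rightarrow> 'a" where
  "scal r = r \<odot>\<^bsub>\<Lambda>\<^esub> \<one>\<^bsub>\<Lambda>\<^esub>"

lemma scal_closed [simp]: "r \<in> carrier R \<Longrightarrow> scal r \<in> carrier \<Lambda>"
  by (simp add: scal_def)

lemma scal_mult: "r \<in> carrier R \<Longrightarrow> a \<in> carrier \<Lambda> \<Longrightarrow> scal r \<otimes>\<^bsub>\<Lambda>\<^esub> a = r \<odot>\<^bsub>\<Lambda>\<^esub> a"
  unfolding scal_def using artin_algebra.smult_mult_left[OF artin_algebra, of r "\<one>\<^bsub>\<Lambda>\<^esub>" a] by simp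

lemma mult_scal: "r \<in> carrier R \<Longrightarrow> a \<in> carrier \<Lambda> \<Longrightarrow> a \<otimes>\<^bsub>\<Lambda>\<^esub> scal r = r \<odot>\<^bsub>\<Lambda>\<^esub> a"
  unfolding scal_def using artin_algebra.smult_mult_right[OF artin_algebra, of r a "\<one>\<^bsub>\<Lambda>\<^esub>"] by simp

lemma scal_simps:
  "r \<in> carrier R \<Longrightarrow> s \<in> carrier R \<Longrightarrow> scal (r \<oplus>\<^bsub>R\<^esub> s) = scal r \<oplus>\<^bsub>\<Lambda>\<^esub> scal s"
  "r \<in> carrier R \<Longrightarrow> s \<in> carrier R \<Longrightarrow> scal (r \<otimes>\<^bsub>R\<^esub> s) = scal r \<otimes>\<^bsub>\<Lambda>\<^esub> scal s"
  "scal \<one>\<^bsub>R\<^esub> = \<one>\<^bsub>\<Lambda>\<^esub>"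
  using scal_mult[of r "scal s"] by (simp_all add: scal_def RL.smult_l_distr RL.smult_assoc1)

text \<open>Restriction of scalars along \<open>scal\<close>. Lengths are measured over
  \<open>R\<close>, where modules over \<open>\<Lambda>\<close> and Hom modules can be
  compared.\<close>

definition res :: "('a, 'b) module \<Rightarrow> ('r, 'b) module" where
  "res X = \<lparr>carrier = carrier X, monoid.mult = monoid.mult X, monoid.one = monoid.one X,
     ring.zero = \<zero>\<^bsub>X\<^esub>, ring.add = ring.add X, smult = (\<lambda>r x. scal r \<odot>\<^bsub>X\<^esub> x)\<rparr>"

lemma res_simps [simp]:
  "carrier (res X) = carrier X" "\<zero>\<^bsub>res X\<^esub> = \<zero>\<^bsub>X\<^esub>" "x \<oplus>\<^bsub>res X\<^esub> y = x \<oplus>\<^bsub>X\<^esub> y"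
  "r \<odot>\<^bsub>res X\<^esub> x = scal r \<odot>\<^bsub>X\<^esub> x"
  by (simp_all add: res_def)

lemma left_module_res:
  assumes "left_module \<Lambda> X"
  shows "left_module R (res X)"
proof -
  interpret X: left_module \<Lambda> X by fact
  have "abelian_group (res X)"
  proof (rule abelian_groupI)
    fix x assume "x \<in> carrier (res X)"
    then show "\<exists>y\<in>carrier (res X). y \<oplus>\<^bsub>res X\<^esub> x = \<zero>\<^bsub>res X\<^esub>"
      by (intro bexI[of _ "\<ominus>\<^bsub>X\<^esub> x"]) (auto simp: X.M.l_neg)
  qed (auto simp: X.M.a_ac)
  then show ?thesis
    unfolding left_module_def left_module_axioms_def using AR.ring_axioms
    by (auto simp: scal_simps X.smult_l_distr X.smult_r_distr X.smult_assoc)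
qed

lemma submod_res: "submod \<Lambda> X U \<Longrightarrow> submod R (res X) U"
  by (auto simp: submod_def)

lemma hom_res: "f \<in> mod_hom \<Lambda> X Y \<Longrightarrow> f \<in> mod_hom R (res X) (res Y)"
  by (auto simp: mod_hom_def)

lemma module_hom_res: "module_hom \<Lambda> X Y f \<Longrightarrow> module_hom R (res X) (res Y) f"
  by (auto simp: module_hom_def module_hom_axioms_def left_module_res hom_res)

lemma scal_hom:
  assumes "left_module \<Lambda> X" "r \<in> carrier R"
  shows "(\<lambda>x. scal r \<odot>\<^bsub>X\<^esub> x) \<in> mod_hom \<Lambda> X X"
proof -
  interpret left_module \<Lambda> X by fact
  show ?thesis
    using assms(2) by (auto simp: mod_hom_def smult_r_distr smult_assoc[symmetric] scal_mult mult_scal)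
qed

lemma mult_hom_res:
  assumes "left_module \<Lambda> X" "a \<in> carrier \<Lambda>"
  shows "(\<lambda>x. a \<odot>\<^bsub>X\<^esub> x) \<in> mod_hom R (res X) (res X)"
proof -
  interpret left_module \<Lambda> X by fact
  show ?thesis
    using assms(2) by (auto simp: mod_hom_def smult_r_distr smult_assoc[symmetric] scal_mult mult_scal)
qed

lemma orbit_hom_res:
  assumes "left_module \<Lambda> X" "x \<in> carrier X"
  shows "(\<lambda>a. a \<odot>\<^bsub>X\<^esub> x) \<in> mod_hom R \<Lambda> (res X)"
proof -
  interpret left_module \<Lambda> X by fact
  show ?thesis
    using assms(2) by (auto simp: mod_hom_def smult_l_distr smult_assoc[symmetric] scal_mult)
qed

lemma modsD: "X \<in> mods \<Lambda> \<Longrightarrow> left_module \<Lambda> X" "X \<in> mods \<Lambda> \<Longrightarrow> fin_gen \<Lambda> X"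
  by (auto simp: mods_def)

lemma finlen_fin_gen:
  assumes X: "left_module \<Lambda> X" "fin_gen \<Lambda> X"
  shows "finlen R (res X) (carrier X)"
proof -
  interpret X: left_module \<Lambda> X by fact
  interpret rX: left_module R "res X" using X(1) by (rule left_module_res)
  obtain S where S: "finite S" "S \<subseteq> carrier X" "\<And>U. submod \<Lambda> X U \<Longrightarrow> S \<subseteq> U \<Longrightarrow> U = carrier X"
    using X(2) unfolding X.fin_gen_iff by metis
  let ?T = "\<lambda>s. (\<lambda>a. a \<odot>\<^bsub>X\<^esub> s) ` carrier \<Lambda>"
  have T: "submod R (res X) (?T s) \<and> finlen R (res X) (?T s)" if s_S: "s \<in> S" for s
  proof -
    have s: "s \<in> carrier X" using s_S S by blast
    interpret h: module_hom R \<Lambda> "res X" "\<lambda>a. a \<odot>\<^bsub>X\<^esub> s"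
      by (intro module_homI left_module_R\<Lambda> orbit_hom_res rX.left_module_axioms X s)
    show ?thesis using h.submod_image[OF h.M.submod_carrier] h.finlen_image[OF h.M.submod_carrier finlen_\<Lambda>]
      by simp
  qed
  \<comment> \<open>The cyclic submodules \<open>?T s\<close> have finite length as images of
    \<open>\<Lambda>\<close>, and multiplication by an element of \<open>\<Lambda>\<close> is an
    \<open>R\<close>-endomorphism that preserves each of them. So the bounding submodule is closed
    under \<open>\<Lambda>\<close> and contains all generators.\<close>
  note bnd = rX.finlen_Union_bound[OF S(1), of ?T]
  have "\<exists>U. submod R (res X) U \<and> finlen R (res X) U \<and> (\<forall>s\<in>S. ?T s \<subseteq> U) \<and>
    (\<forall>\<phi>\<in>mod_hom R (res X) (res X). (\<forall>s\<in>S. \<phi> ` ?T s \<subseteq> ?T s) \<longrightarrow> \<phi> ` U \<subseteq> U)"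
    by (rule bnd) (rule T)
  then
  obtain U where U: "submod R (res X) U" "finlen R (res X) U" "\<forall>s\<in>S. ?T s \<subseteq> U"
    "\<forall>\<phi>\<in>mod_hom R (res X) (res X). (\<forall>s\<in>S. \<phi> ` ?T s \<subseteq> ?T s) \<longrightarrow> \<phi> ` U \<subseteq> U"
    by (elim exE conjE) (rule that)
  have "a \<odot>\<^bsub>X\<^esub> x \<in> U" if a: "a \<in> carrier \<Lambda>" and x: "x \<in> U" for a x
  proof -
    have "(\<lambda>x. a \<odot>\<^bsub>X\<^esub> x) ` ?T s \<subseteq> ?T s" if "s \<in> S" for s
      using submodD(4)[OF X.orbit_submod(1)[of s] a] that S(2) by blast
    then show ?thesis using U(4)[rule_format, OF mult_hom_res[OF X(1) a]] x by blast
  qed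
  then have "submod \<Lambda> X U" using submodD[OF U(1)] by (auto simp: submod_def)
  moreover have "S \<subseteq> U" using X.orbit_submod(2) S(2) U(3) by blast
  ultimately have "U = carrier X" by (rule S(3))
  then show ?thesis using U(2) by simp
qed

lemma finlen_mods: "X \<in> mods \<Lambda> \<Longrightarrow> U \<subseteq> carrier X \<Longrightarrow> finlen R (res X) U"
  using finlen_subset finlen_fin_gen modsD by blast

text \<open>A chain of submodules over \<open>\<Lambda>\<close> is also one over \<open>R\<close>,
  so the submodule has finite length over \<open>\<Lambda>\<close> and is finitely
  generated.\<close>

lemma sub_mods:
  assumes X: "X \<in> mods \<Lambda>" and U: "submod \<Lambda> X U"
  shows "X\<lparr>carrier := U\<rparr> \<in> mods \<Lambda>"
proof -
  interpret X: left_module \<Lambda> X using modsD X by blast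
  interpret U: left_module \<Lambda> "X\<lparr>carrier := U\<rparr>" by (rule X.left_module_submod[OF U])
  have "finlen \<Lambda> X U"
    using finlen_mods[OF X submodD(1)[OF U]] submod_res unfolding finlen_def subchain_def by meson
  from X.finlen_imp_generated[OF U this] obtain S where S: "finite S" "S \<subseteq> U"
      "\<And>V. submod \<Lambda> X V \<Longrightarrow> S \<subseteq> V \<Longrightarrow> U \<subseteq> V"
    by metis
  then have "fin_gen \<Lambda> (X\<lparr>carrier := U\<rparr>)"
    unfolding U.fin_gen_iff submod_submod_iff[OF U] using S by (intro exI[of _ S]) (simp, blast)
  then show ?thesis using U.left_module_axioms by (simp add: mods_def)
qed

lemma mods_iso_closed:
  assumes "left_module \<Lambda> (N :: ('a, 'b) module)" "fin_gen \<Lambda> N"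
  obtains M f g where "M \<in> mods \<Lambda>" "f \<in> mod_hom \<Lambda> N M" "g \<in> mod_hom \<Lambda> M N"
    "\<And>x. x \<in> carrier N \<Longrightarrow> g (f x) = x" "\<And>x. x \<in> carrier M \<Longrightarrow> f (g x) = x"
proof -
  obtain M where M: "M \<in> mods \<Lambda>" "mod_iso \<Lambda> N M" using fin_gen_representable[OF assms] by blast
  then obtain f where f: "f \<in> mod_hom \<Lambda> N M" "bij_betw f (carrier N) (carrier M)" by (auto simp: mod_iso_def)
  obtain g where "g \<in> mod_hom \<Lambda> M N" "\<forall>y\<in>carrier M. f (g y) = y" "\<forall>x\<in>carrier N. g (f x) = x"
    using hom_inverse[OF assms(1) modsD(1)[OF M(1)] f] by blast
  then show thesis using that M(1) f(1) by blast
qed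

lemma quo_mods:
  assumes X: "X \<in> mods \<Lambda>" and K: "submod \<Lambda> X K"
  obtains Q q where "Q \<in> mods \<Lambda>" "q \<in> mod_hom \<Lambda> X Q" "q ` carrier X = carrier Q"
    "\<And>x. x \<in> carrier X \<Longrightarrow> q x = \<zero>\<^bsub>Q\<^esub> \<longleftrightarrow> x \<in> K"
proof -
  interpret X: left_module \<Lambda> X using modsD X by blast
  from X.quotient_module_exists[OF K]
  obtain Q :: "'a modobj" and q where Q: "left_module \<Lambda> Q" "q \<in> mod_hom \<Lambda> X Q" "q ` carrier X = carrier Q"
    "{x \<in> carrier X. q x = \<zero>\<^bsub>Q\<^esub>} = K"
    by (elim exE conjE bexE)
  then have "Q \<in> mods \<Lambda>"
    using fin_gen_image[OF X.left_module_axioms Q(1-3) modsD(2)[OF X]] by (simp add: mods_def)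
  then show thesis using Q(2-4) by (intro that) auto
qed

lemma sum_mods:
  assumes X: "X \<in> mods \<Lambda>" and Y: "Y \<in> mods \<Lambda>"
  obtains S i p j q where "S \<in> mods \<Lambda>" "biprod \<Lambda> S i p X j q Y"
proof -
  interpret X: left_module \<Lambda> X using modsD X by blast
  interpret Y: left_module \<Lambda> Y using modsD Y by blast
  from product_module_exists[OF X.left_module_axioms Y.left_module_axioms]
  obtain P :: "('a, 'a list \<times> 'a list) module" where P: "left_module \<Lambda> P" "carrier P = carrier X \<times> carrier Y"
    "\<zero>\<^bsub>P\<^esub> = (\<zero>\<^bsub>X\<^esub>, \<zero>\<^bsub>Y\<^esub>)" "\<forall>u v. u \<oplus>\<^bsub>P\<^esub> v = (fst u \<oplus>\<^bsub>X\<^esub> fst v, snd u \<oplus>\<^bsub>Y\<^esub> snd v)"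
    "\<forall>a u. a \<odot>\<^bsub>P\<^esub> u = (a \<odot>\<^bsub>X\<^esub> fst u, a \<odot>\<^bsub>Y\<^esub> snd u)" "fin_gen \<Lambda> P"
    using modsD(2)[OF X] modsD(2)[OF Y] by metis
  obtain S f g where S: "S \<in> mods \<Lambda>" "f \<in> mod_hom \<Lambda> P S" "g \<in> mod_hom \<Lambda> S P"
    "\<And>x. x \<in> carrier P \<Longrightarrow> g (f x) = x" "\<And>x. x \<in> carrier S \<Longrightarrow> f (g x) = x"
    by (rule mods_iso_closed[OF P(1,6)]) metis
  interpret S: left_module \<Lambda> S using modsD S by blast
  have h: "(\<lambda>x. (x, \<zero>\<^bsub>Y\<^esub>)) \<in> mod_hom \<Lambda> X P" "(\<lambda>y. (\<zero>\<^bsub>X\<^esub>, y)) \<in> mod_hom \<Lambda> Y P"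
    "fst \<in> mod_hom \<Lambda> P X" "snd \<in> mod_hom \<Lambda> P Y"
    using P by (auto simp: mod_hom_def)
  have cl: "g x \<in> carrier X \<times> carrier Y" if "x \<in> carrier S" for x
    using hom_closed[OF S(3) that] P(2) by simp
  have "f (fst (g x), \<zero>\<^bsub>Y\<^esub>) \<oplus>\<^bsub>S\<^esub> f (\<zero>\<^bsub>X\<^esub>, snd (g x)) = x" if x: "x \<in> carrier S" for x
  proof -
    obtain u v where uv: "g x = (u, v)" "u \<in> carrier X" "v \<in> carrier Y" using cl[OF x] by auto
    have "f (u, \<zero>\<^bsub>Y\<^esub>) \<oplus>\<^bsub>S\<^esub> f (\<zero>\<^bsub>X\<^esub>, v) = f ((u, \<zero>\<^bsub>Y\<^esub>) \<oplus>\<^bsub>P\<^esub> (\<zero>\<^bsub>X\<^esub>, v))"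
      using S(2) P(2) uv by (simp add: mod_hom_def)
    also have "\<dots> = f (g x)" using uv P(4) by simp
    finally show ?thesis using S(5)[OF x] uv by simp
  qed
  then have "biprod \<Lambda> S (\<lambda>x. f (x, \<zero>\<^bsub>Y\<^esub>)) (\<lambda>s. fst (g s)) X (\<lambda>y. f (\<zero>\<^bsub>X\<^esub>, y)) (\<lambda>s. snd (g s)) Y"
    unfolding biprod_def using hom_comp[OF h(1) S(2)] hom_comp[OF h(2) S(2)] hom_comp[OF S(3) h(3)] hom_comp[OF S(3) h(4)]
      S(4) P(2) by auto
  then show thesis using S(1) that by blast
qed

lemma zero_mods: obtains Z where "Z \<in> mods \<Lambda>" "carrier Z = {\<zero>\<^bsub>Z\<^esub>}"
proof -
  have fg: "fin_gen \<Lambda> (regular_module \<Lambda>)"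
  proof -
    interpret rg: left_module \<Lambda> "regular_module \<Lambda>" by (rule L.left_module_regular)
    have "U = carrier \<Lambda>" if "submod \<Lambda> (regular_module \<Lambda>) U" "{\<one>\<^bsub>\<Lambda>\<^esub>} \<subseteq> U" for U
      using submodD(1,4)[OF that(1)] that(2) L.r_one by (auto simp: subset_iff) (metis L.r_one)
    then show ?thesis unfolding rg.fin_gen_iff by (intro exI[of _ "{\<one>\<^bsub>\<Lambda>\<^esub>}"]) simp
  qed
  obtain M where M: "M \<in> mods \<Lambda>" using fin_gen_representable[OF L.left_module_regular fg] by blast
  interpret M: left_module \<Lambda> M using modsD M by blast
  show thesis using sub_mods[OF M M.submod_zero] by (intro that[of "M\<lparr>carrier := {\<zero>\<^bsub>M\<^esub>}\<rparr>"]) auto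
qed

end

context artin
begin

subsection \<open>Hom modules\<close>

definition homM :: "('a, 'b) module \<Rightarrow> ('a, 'c) module \<Rightarrow> ('r, 'b \<Rightarrow> 'c) module" where
  "homM X Y = \<lparr>carrier = {h \<in> mod_hom \<Lambda> X Y. h \<in> extensional (carrier X)}, monoid.mult = undefined, monoid.one = undefined,
     ring.zero = restrict (\<lambda>x. \<zero>\<^bsub>Y\<^esub>) (carrier X), ring.add = (\<lambda>f g. restrict (\<lambda>x. f x \<oplus>\<^bsub>Y\<^esub> g x) (carrier X)),
     smult = (\<lambda>r f. restrict (\<lambda>x. scal r \<odot>\<^bsub>Y\<^esub> f x) (carrier X))\<rparr>"

lemma homM_simps [simp]:
  "carrier (homM X Y) = {h \<in> mod_hom \<Lambda> X Y. h \<in> extensional (carrier X)}"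
  "\<zero>\<^bsub>homM X Y\<^esub> = restrict (\<lambda>x. \<zero>\<^bsub>Y\<^esub>) (carrier X)"
  "f \<oplus>\<^bsub>homM X Y\<^esub> g = restrict (\<lambda>x. f x \<oplus>\<^bsub>Y\<^esub> g x) (carrier X)"
  "r \<odot>\<^bsub>homM X Y\<^esub> f = restrict (\<lambda>x. scal r \<odot>\<^bsub>Y\<^esub> f x) (carrier X)"
  by (simp_all add: homM_def)

lemma homM_eqI:
  "f \<in> extensional (carrier X) \<Longrightarrow> g \<in> extensional (carrier X) \<Longrightarrow> (\<And>x. x \<in> carrier X \<Longrightarrow> f x = g x) \<Longrightarrow> f = g"
  by (rule extensionalityI)

lemma restrict_homM:
  "left_module \<Lambda> X \<Longrightarrow> f \<in> mod_hom \<Lambda> X Y \<Longrightarrow> restrict f (carrier X) \<in> carrier (homM X Y)"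
  by (simp add: hom_restrict)

lemma left_module_homM:
  assumes X: "left_module \<Lambda> X" and Y: "left_module \<Lambda> Y"
  shows "left_module R (homM X Y)"
proof -
  interpret X: left_module \<Lambda> X by fact
  interpret Y: left_module \<Lambda> Y by fact
  have cl: "f x \<in> carrier Y" if "f \<in> mod_hom \<Lambda> X Y" "x \<in> carrier X" for f x using hom_closed that .
  have "abelian_group (homM X Y)"
  proof (rule abelian_groupI)
    fix f g assume "f \<in> carrier (homM X Y)" "g \<in> carrier (homM X Y)"
    then show "f \<oplus>\<^bsub>homM X Y\<^esub> g \<in> carrier (homM X Y)"
      using restrict_homM[OF X hom_add[OF Y, of f X g]] by simp
  next
    show "\<zero>\<^bsub>homM X Y\<^esub> \<in> carrier (homM X Y)" using restrict_homM[OF X hom_zero[OF Y]] by simp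
  next
    fix f assume f: "f \<in> carrier (homM X Y)"
    then show "\<exists>g\<in>carrier (homM X Y). g \<oplus>\<^bsub>homM X Y\<^esub> f = \<zero>\<^bsub>homM X Y\<^esub>"
      using restrict_homM[OF X hom_neg[OF Y, of f X]] cl[of f]
      by (intro bexI[of _ "restrict (\<lambda>x. \<ominus>\<^bsub>Y\<^esub> f x) (carrier X)"])
        (auto simp: Y.M.l_neg intro!: homM_eqI)
  qed (auto simp: cl Y.M.a_ac intro!: homM_eqI)
  moreover have "restrict (\<lambda>x. scal r \<odot>\<^bsub>Y\<^esub> f x) (carrier X) \<in> carrier (homM X Y)"
    if "r \<in> carrier R" "f \<in> carrier (homM X Y)" for r f
    using that restrict_homM[OF X hom_comp[OF _ scal_hom[OF Y that(1)]], of f] by simp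
  ultimately show ?thesis
    unfolding left_module_def left_module_axioms_def using AR.ring_axioms
    by (auto simp: scal_simps Y.smult_l_distr Y.smult_r_distr Y.smult_assoc cl intro!: homM_eqI)
qed

lemma eval_homM:
  assumes "x \<in> carrier X" shows "(\<lambda>h. h x) \<in> mod_hom R (homM X Y) (res Y)"
  using assms by (auto simp: mod_hom_def)

definition post :: "('a, 'b) module \<Rightarrow> ('c \<Rightarrow> 'd) \<Rightarrow> ('b \<Rightarrow> 'c) \<Rightarrow> 'b \<Rightarrow> 'd" where
  "post W g h = restrict (\<lambda>x. g (h x)) (carrier W)"

definition pre :: "('a, 'b) module \<Rightarrow> ('b \<Rightarrow> 'c) \<Rightarrow> ('c \<Rightarrow> 'd) \<Rightarrow> 'b \<Rightarrow> 'd" where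
  "pre X f h = restrict (\<lambda>x. h (f x)) (carrier X)"

lemma post_apply [simp]: "x \<in> carrier W \<Longrightarrow> post W g h x = g (h x)"
  by (simp add: post_def)

lemma pre_apply [simp]: "x \<in> carrier X \<Longrightarrow> pre X f h x = h (f x)"
  by (simp add: pre_def)

lemma post_ext [simp]: "post W g h \<in> extensional (carrier W)" and pre_ext [simp]: "pre X f h \<in> extensional (carrier X)"
  by (simp_all add: post_def pre_def)

lemma post_in: "left_module \<Lambda> W \<Longrightarrow> h \<in> mod_hom \<Lambda> W Y \<Longrightarrow> g \<in> mod_hom \<Lambda> Y Z \<Longrightarrow> post W g h \<in> mod_hom \<Lambda> W Z"
  unfolding post_def by (rule hom_restrict[OF _ hom_comp])

lemma pre_in: "left_module \<Lambda> X \<Longrightarrow> h \<in> mod_hom \<Lambda> Y W \<Longrightarrow> f \<in> mod_hom \<Lambda> X Y \<Longrightarrow> pre X f h \<in> mod_hom \<Lambda> X W"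
  unfolding pre_def by (rule hom_restrict[OF _ hom_comp])

lemma post_hom:
  assumes "left_module \<Lambda> W" "left_module \<Lambda> Y" "left_module \<Lambda> Z" "g \<in> mod_hom \<Lambda> Y Z"
  shows "module_hom R (homM W Y) (homM W Z) (post W g)"
proof (intro module_homI left_module_homM assms)
  interpret g: module_hom \<Lambda> Y Z g by (intro module_homI assms)
  show "post W g \<in> mod_hom R (homM W Y) (homM W Z)"
    unfolding mod_hom_def[of R]
  proof (intro CollectI conjI ballI funcsetI)
    show "post W g h \<in> carrier (homM W Z)" if "h \<in> carrier (homM W Y)" for h
      using that by (simp add: post_in[OF assms(1) _ assms(4)])
    show "post W g (h \<oplus>\<^bsub>homM W Y\<^esub> h') = post W g h \<oplus>\<^bsub>homM W Z\<^esub> post W g h'"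
      if "h \<in> carrier (homM W Y)" "h' \<in> carrier (homM W Y)" for h h'
      using that by (intro homM_eqI[where X = W]) (auto simp: g.add hom_closed[of _ \<Lambda> W Y])
    show "post W g (r \<odot>\<^bsub>homM W Y\<^esub> h) = r \<odot>\<^bsub>homM W Z\<^esub> post W g h"
      if "r \<in> carrier R" "h \<in> carrier (homM W Y)" for r h
      using that by (intro homM_eqI[where X = W]) (auto simp: g.smult hom_closed[of h \<Lambda> W Y])
  qed
qed

lemma pre_hom:
  assumes "left_module \<Lambda> X" "left_module \<Lambda> Y" "left_module \<Lambda> W" "f \<in> mod_hom \<Lambda> X Y"
  shows "module_hom R (homM Y W) (homM X W) (pre X f)"
proof (intro module_homI left_module_homM assms)
  interpret f: module_hom \<Lambda> X Y f by (intro module_homI assms)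
  show "pre X f \<in> mod_hom R (homM Y W) (homM X W)"
    unfolding mod_hom_def[of R]
  proof (intro CollectI conjI ballI funcsetI)
    show "pre X f h \<in> carrier (homM X W)" if "h \<in> carrier (homM Y W)" for h
      using that by (simp add: pre_in[OF assms(1) _ assms(4)])
    show "pre X f (h \<oplus>\<^bsub>homM Y W\<^esub> h') = pre X f h \<oplus>\<^bsub>homM X W\<^esub> pre X f h'"
      if "h \<in> carrier (homM Y W)" "h' \<in> carrier (homM Y W)" for h h'
      using that by (intro homM_eqI[where X = X]) (simp_all add: hom_closed[OF assms(4)])
    show "pre X f (r \<odot>\<^bsub>homM Y W\<^esub> h) = r \<odot>\<^bsub>homM X W\<^esub> pre X f h"
      if "r \<in> carrier R" "h \<in> carrier (homM Y W)" for r h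
      using that by (intro homM_eqI[where X = X]) (simp_all add: hom_closed[OF assms(4)])
  qed
qed

text \<open>A homomorphism is determined by its values on a finite generating set, and evaluation at
  one generator maps into \<open>Y\<close>, which has finite length. The generators are imposed one
  after another as vanishing conditions.\<close>

lemma finlen_homM:
  assumes X: "X \<in> mods \<Lambda>" and Y: "Y \<in> mods \<Lambda>"
  shows "finlen R (homM X Y) (carrier (homM X Y))"
proof -
  interpret X: left_module \<Lambda> X using modsD X by blast
  interpret Y: left_module \<Lambda> Y using modsD Y by blast
  interpret H: left_module R "homM X Y" by (intro left_module_homM X.left_module_axioms Y.left_module_axioms)
  let ?K = "\<lambda>T. {h \<in> carrier (homM X Y). \<forall>s\<in>T. h s = \<zero>\<^bsub>Y\<^esub>}"
  have step: "finlen R (homM X Y) (carrier (homM X Y))"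
    if "finite T" "T \<subseteq> carrier X" "finlen R (homM X Y) (?K T)" for T
    using that
  proof (induction T)
    case empty
    then show ?case by simp
  next
    case (insert s T)
    interpret ev: module_hom R "homM X Y" "res Y" "\<lambda>h. h s"
      using insert by (intro module_homI H.left_module_axioms left_module_res Y.left_module_axioms eval_homM) auto
    have K: "submod R (homM X Y) (?K T)"
      using insert.prems(1) submodD[OF H.submod_carrier] by (auto simp: submod_def subset_iff)
    have "?K T \<inter> {h \<in> carrier (homM X Y). h s = \<zero>\<^bsub>res Y\<^esub>} = ?K (insert s T)" by auto
    moreover have "finlen R (res Y) ((\<lambda>h. h s) ` ?K T)"
      using submodD(1)[OF ev.submod_image[OF K]] by (intro finlen_mods Y) simp
    ultimately have "finlen R (homM X Y) (?K T)"
      using ev.finlen_hom[OF K] insert.prems(2) by simp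
    then show ?case using insert by simp
  qed
  obtain S where S: "finite S" "S \<subseteq> carrier X" "\<And>U. submod \<Lambda> X U \<Longrightarrow> S \<subseteq> U \<Longrightarrow> U = carrier X"
    using modsD(2)[OF X] unfolding X.fin_gen_iff by metis
  have "?K S \<subseteq> {\<zero>\<^bsub>homM X Y\<^esub>}"
  proof
    fix h assume h: "h \<in> ?K S"
    interpret h: module_hom \<Lambda> X Y h
      using h by (intro module_homI X.left_module_axioms Y.left_module_axioms) simp
    have "{x \<in> carrier X. h x = \<zero>\<^bsub>Y\<^esub>} = carrier X"
      using h S(2) by (intro S(3) h.submod_ker) auto
    then show "h \<in> {\<zero>\<^bsub>homM X Y\<^esub>}" using h by (auto intro!: homM_eqI)
  qed
  then have "finlen R (homM X Y) (?K S)" using H.finlen_zero finlen_subset by blast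
  then show ?thesis using step S by blast
qed

lemma finlen_homM': "X \<in> mods \<Lambda> \<Longrightarrow> Y \<in> mods \<Lambda> \<Longrightarrow> U \<subseteq> carrier (homM X Y) \<Longrightarrow> finlen R (homM X Y) U"
  using finlen_homM finlen_subset by blast

definition hl :: "'a modobj \<Rightarrow> 'a modobj \<Rightarrow> nat" where
  "hl X Y = len R (homM X Y) (carrier (homM X Y))"

definition additive_fn :: "('a modobj \<Rightarrow> nat) \<Rightarrow> bool" where
  "additive_fn d \<longleftrightarrow> (\<forall>X\<in>mods \<Lambda>. \<forall>Y\<in>mods \<Lambda>. \<forall>Z\<in>mods \<Lambda>. \<forall>i p j q. biprod \<Lambda> X i p Y j q Z \<longrightarrow> d X = d Y + d Z)"

lemma additive_fnD: "additive_fn d \<Longrightarrow> biprod \<Lambda> X i p Y j q Z \<Longrightarrow> X \<in> mods \<Lambda> \<Longrightarrow> Y \<in> mods \<Lambda> \<Longrightarrow> Z \<in> mods \<Lambda> \<Longrightarrow> d X = d Y + d Z"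
  unfolding additive_fn_def by blast

text \<open>On a biproduct, composition with the projection \<open>p\<close> maps \<open>J X\<close>
  onto \<open>J Y\<close>, and its kernel is a copy of \<open>J Z\<close>. The family
  \<open>J\<close> is kept general because two instances are needed: all homomorphisms, and the
  radical ones.\<close>

lemma additive_len_hom_ideal:
  assumes W: "W \<in> mods \<Lambda>" and J: "\<And>X. X \<in> mods \<Lambda> \<Longrightarrow> submod R (homM W X) (J X)"
    and comp: "\<And>X Y h g. X \<in> mods \<Lambda> \<Longrightarrow> Y \<in> mods \<Lambda> \<Longrightarrow> h \<in> J X \<Longrightarrow> g \<in> mod_hom \<Lambda> X Y \<Longrightarrow> post W g h \<in> J Y"
  shows "additive_fn (\<lambda>X. len R (homM W X) (J X))"
  unfolding additive_fn_def
proof (intro ballI allI impI)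
  fix X Y Z i p j q
  assume XYZ: "X \<in> mods \<Lambda>" "Y \<in> mods \<Lambda>" "Z \<in> mods \<Lambda>" and b: "biprod \<Lambda> X i p Y j q Z"
  note B = biprodD[OF b]
  interpret X: left_module \<Lambda> X using modsD XYZ by blast
  interpret Y: left_module \<Lambda> Y using modsD XYZ by blast
  interpret P: module_hom R "homM W X" "homM W Y" "post W p"
    using W XYZ by (intro post_hom modsD B(1-4))
  interpret Q: module_hom R "homM W Z" "homM W X" "post W j"
    using W XYZ by (intro post_hom modsD B(1-4))
  interpret i: module_hom \<Lambda> Y X i using XYZ by (intro module_homI modsD B(1-4))
  have car: "h w \<in> carrier M" if "h \<in> J M" "w \<in> carrier W" "M \<in> mods \<Lambda>" for h w M
    using submodD(5)[OF J[OF that(3)] that(1)] that(2) hom_closed by auto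
  have ext: "h \<in> extensional (carrier W)" if "h \<in> J M" "M \<in> mods \<Lambda>" for h M
    using submodD(5)[OF J[OF that(2)] that(1)] by auto
  have fin: "finlen R (homM W M) (J M)" if "M \<in> mods \<Lambda>" for M
    using submodD(1)[OF J] that W by (intro finlen_homM') auto
  have "post W p ` J X = J Y"
  proof
    show "post W p ` J X \<subseteq> J Y" using comp XYZ B(2) by auto
    show "J Y \<subseteq> post W p ` J X"
    proof
      fix h assume h: "h \<in> J Y"
      have "post W p (post W i h) = h"
        using car[OF h] ext[OF h] XYZ B(5) by (intro homM_eqI[where X = W]) auto
      then show "h \<in> post W p ` J X" using comp[OF XYZ(2,1) h B(1)] by (metis imageI)
    qed
  qed
  moreover have "post W j ` J Z = J X \<inter> {h \<in> carrier (homM W X). post W p h = \<zero>\<^bsub>homM W Y\<^esub>}"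
  proof
    have "post W p (post W j h) = \<zero>\<^bsub>homM W Y\<^esub>" if h: "h \<in> J Z" for h
      using car[OF h] ext[OF h] XYZ B(8) by (intro homM_eqI[where X = W]) auto
    then show "post W j ` J Z \<subseteq> J X \<inter> {h \<in> carrier (homM W X). post W p h = \<zero>\<^bsub>homM W Y\<^esub>}"
      using comp XYZ B(3) submodD(5)[OF J[OF XYZ(1)]] by blast
    show "J X \<inter> {h \<in> carrier (homM W X). post W p h = \<zero>\<^bsub>homM W Y\<^esub>} \<subseteq> post W j ` J Z"
    proof
      fix h assume "h \<in> J X \<inter> {h \<in> carrier (homM W X). post W p h = \<zero>\<^bsub>homM W Y\<^esub>}"
      then have h: "h \<in> J X" "post W p h = \<zero>\<^bsub>homM W Y\<^esub>" by auto
      have "p (h w) = \<zero>\<^bsub>Y\<^esub>" if "w \<in> carrier W" for w using fun_cong[OF h(2), of w] that by simp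
      moreover have "j (q (h w)) \<in> carrier X" if "w \<in> carrier W" for w
        using biprod_closed[OF b] car[OF h(1) that XYZ(1)] by blast
      ultimately have "post W j (post W q h) = h"
        using car[OF h(1)] ext[OF h(1)] XYZ B(9) by (intro homM_eqI[where X = W]) (auto, metis X.M.l_zero i.zero)
      then show "h \<in> post W j ` J Z" using comp[OF XYZ(1,3) h(1) B(4)] by (metis imageI)
    qed
  qed
  moreover have "inj_on (post W j) (J Z)"
  proof (rule inj_onI)
    fix h h' assume h: "h \<in> J Z" "h' \<in> J Z" "post W j h = post W j h'"
    show "h = h'"
    proof (rule homM_eqI[where X = W])
      fix w assume w: "w \<in> carrier W"
      then have "j (h w) = j (h' w)" using fun_cong[OF h(3), of w] by simp
      then show "h w = h' w" using B(6)[OF car[OF h(1) w]] B(6)[OF car[OF h(2) w]] XYZ by metis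
    qed (rule ext[OF h(1) XYZ(3)] ext[OF h(2) XYZ(3)])+
  qed
  ultimately show "len R (homM W X) (J X) = len R (homM W Y) (J Y) + len R (homM W Z) (J Z)"
    using P.len_hom'[OF J[OF XYZ(1)] fin[OF XYZ(1)]] Q.len_inj_image'[OF J[OF XYZ(3)] fin[OF XYZ(3)]] by simp
qed

lemma hl_additive: "W \<in> mods \<Lambda> \<Longrightarrow> additive_fn (hl W)"
  unfolding hl_def
proof (rule additive_len_hom_ideal)
  fix X assume "W \<in> mods \<Lambda>" "X \<in> mods \<Lambda>"
  then show "submod R (homM W X) (carrier (homM W X))"
    by (intro left_module.submod_carrier left_module_homM modsD)
qed (auto intro: post_in modsD)

lemma hl_additive': 
  assumes W: "W \<in> mods \<Lambda>"
  shows "additive_fn (\<lambda>X. hl X W)"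
  unfolding additive_fn_def
proof (intro ballI allI impI)
  fix X Y Z i p j q
  assume XYZ: "X \<in> mods \<Lambda>" "Y \<in> mods \<Lambda>" "Z \<in> mods \<Lambda>" and b: "biprod \<Lambda> X i p Y j q Z"
  note B = biprodD[OF b]
  note cl = biprod_closed[OF b]
  interpret P: module_hom R "homM X W" "homM Y W" "pre Y i"
    using W XYZ by (intro pre_hom modsD B(1-4))
  interpret Q: module_hom R "homM Z W" "homM X W" "pre X q"
    using W XYZ by (intro pre_hom modsD B(1-4))
  interpret W: left_module \<Lambda> W using modsD W by blast
  have "pre Y i ` carrier (homM X W) = carrier (homM Y W)"
  proof
    show "pre Y i ` carrier (homM X W) \<subseteq> carrier (homM Y W)" using P.closed by blast
    show "carrier (homM Y W) \<subseteq> pre Y i ` carrier (homM X W)"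
    proof
      fix h assume h: "h \<in> carrier (homM Y W)"
      then have "pre Y i (pre X p h) = h" using B(5) cl by (intro homM_eqI[where X = Y]) auto
      moreover have "pre X p h \<in> carrier (homM X W)"
        using h by (simp add: pre_in[OF modsD(1)[OF XYZ(1)] _ B(2)])
      ultimately show "h \<in> pre Y i ` carrier (homM X W)" by (metis imageI)
    qed
  qed
  moreover have "pre X q ` carrier (homM Z W) = carrier (homM X W) \<inter> {h \<in> carrier (homM X W). pre Y i h = \<zero>\<^bsub>homM Y W\<^esub>}"
  proof
    have "pre Y i (pre X q h) = \<zero>\<^bsub>homM Y W\<^esub>" if h: "h \<in> carrier (homM Z W)" for h
    proof (rule homM_eqI[where X = Y])
      interpret h: module_hom \<Lambda> Z W h using h W XYZ by (intro module_homI modsD) auto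
      show "pre Y i (pre X q h) y = \<zero>\<^bsub>homM Y W\<^esub> y" if "y \<in> carrier Y" for y
        using that cl B(7) by simp
    qed simp_all
    then show "pre X q ` carrier (homM Z W) \<subseteq> carrier (homM X W) \<inter> {h \<in> carrier (homM X W). pre Y i h = \<zero>\<^bsub>homM Y W\<^esub>}"
      using Q.closed by blast
    show "carrier (homM X W) \<inter> {h \<in> carrier (homM X W). pre Y i h = \<zero>\<^bsub>homM Y W\<^esub>} \<subseteq> pre X q ` carrier (homM Z W)"
    proof
      fix h assume "h \<in> carrier (homM X W) \<inter> {h \<in> carrier (homM X W). pre Y i h = \<zero>\<^bsub>homM Y W\<^esub>}"
      then have h: "h \<in> carrier (homM X W)" "pre Y i h = \<zero>\<^bsub>homM Y W\<^esub>" by auto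
      interpret h: module_hom \<Lambda> X W h using h W XYZ by (intro module_homI modsD) auto
      have "h (i y) = \<zero>\<^bsub>W\<^esub>" if "y \<in> carrier Y" for y using fun_cong[OF h(2), of y] that by simp
      then have "h (j (q x)) = h x" if "x \<in> carrier X" for x
        using h.add[of "i (p x)" "j (q x)"] B(9)[OF that] cl that by simp
      then have "pre X q (pre Z j h) = h" using h(1) cl by (intro homM_eqI[where X = X]) auto
      moreover have "pre Z j h \<in> carrier (homM Z W)"
        using h(1) by (simp add: pre_in[OF modsD(1)[OF XYZ(3)] _ B(3)])
      ultimately show "h \<in> pre X q ` carrier (homM Z W)" by (metis imageI)
    qed
  qed
  moreover have "inj_on (pre X q) (carrier (homM Z W))"
  proof (rule inj_onI)
    fix h h' assume h: "h \<in> carrier (homM Z W)" "h' \<in> carrier (homM Z W)" "pre X q h = pre X q h'"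
    show "h = h'"
    proof (rule homM_eqI[where X = Z])
      fix z assume z: "z \<in> carrier Z"
      then show "h z = h' z" using fun_cong[OF h(3), of "j z"] cl B(6) by simp
    qed (use h in auto)
  qed
  ultimately show "hl X W = hl Y W + hl Z W"
    using P.len_hom'[OF P.M.submod_carrier finlen_homM[OF XYZ(1) W]]
      Q.len_inj_image'[OF Q.M.submod_carrier finlen_homM[OF XYZ(3) W]] by (simp add: hl_def)
qed

lemma short_exactD:
  assumes "short_exact A X f Y g Z"
  shows "f \<in> mod_hom A X Y" "g \<in> mod_hom A Y Z" "inj_on f (carrier X)" "g ` carrier Y = carrier Z"
    "y \<in> carrier Y \<Longrightarrow> g y = \<zero>\<^bsub>Z\<^esub> \<longleftrightarrow> y \<in> f ` carrier X" "x \<in> carrier X \<Longrightarrow> g (f x) = \<zero>\<^bsub>Z\<^esub>"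
  using assms unfolding short_exact_def a_kernel_def' by blast+

text \<open>Left exactness of \<open>Hom(W, -)\<close>. The failure of additivity on a conflation is
  therefore exactly the length of the cokernel of \<open>Hom(W, Y) \<rightarrow> Hom(W, Z)\<close>;
  \<open>hl_exact'\<close> is the contravariant counterpart.\<close>

lemma hl_exact:
  assumes XYZ: "X \<in> mods \<Lambda>" "Y \<in> mods \<Lambda>" "Z \<in> mods \<Lambda>" and W: "W \<in> mods \<Lambda>" and ex: "short_exact \<Lambda> X f Y g Z"
  shows "hl W Y = hl W X + len R (homM W Z) (post W g ` carrier (homM W Y))"
proof -
  note E = short_exactD[OF ex]
  interpret P: module_hom R "homM W Y" "homM W Z" "post W g"
    using W XYZ by (intro post_hom modsD E(1,2))
  interpret Q: module_hom R "homM W X" "homM W Y" "post W f"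
    using W XYZ by (intro post_hom modsD E(1,2))
  have "post W f ` carrier (homM W X) = carrier (homM W Y) \<inter> {h \<in> carrier (homM W Y). post W g h = \<zero>\<^bsub>homM W Z\<^esub>}"
  proof
    have "post W g (post W f h) = \<zero>\<^bsub>homM W Z\<^esub>" if h: "h \<in> carrier (homM W X)" for h
      using h E(6) hom_closed by (intro homM_eqI[where X = W]) fastforce+
    then show "post W f ` carrier (homM W X) \<subseteq> carrier (homM W Y) \<inter> {h \<in> carrier (homM W Y). post W g h = \<zero>\<^bsub>homM W Z\<^esub>}"
      using Q.closed by blast
    show "carrier (homM W Y) \<inter> {h \<in> carrier (homM W Y). post W g h = \<zero>\<^bsub>homM W Z\<^esub>} \<subseteq> post W f ` carrier (homM W X)"
    proof
      fix h assume "h \<in> carrier (homM W Y) \<inter> {h \<in> carrier (homM W Y). post W g h = \<zero>\<^bsub>homM W Z\<^esub>}"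
      then have h: "h \<in> mod_hom \<Lambda> W Y" "h \<in> extensional (carrier W)" "post W g h = \<zero>\<^bsub>homM W Z\<^esub>" by auto
      have "g (h w) = \<zero>\<^bsub>Z\<^esub>" if "w \<in> carrier W" for w using fun_cong[OF h(3), of w] that by simp
      then have "h w \<in> f ` carrier X" if "w \<in> carrier W" for w using E(5) hom_closed[OF h(1)] that by blast
      then obtain u where u: "u \<in> mod_hom \<Lambda> W X" "\<forall>w\<in>carrier W. f (u w) = h w"
        using hom_factor_inj[OF modsD(1)[OF XYZ(1)] modsD(1)[OF XYZ(2)] modsD(1)[OF W] E(1,3) h(1)] by blast
      then have "post W f (restrict u (carrier W)) = h" using h(2) by (intro homM_eqI[where X = W]) auto
      then show "h \<in> post W f ` carrier (homM W X)"
        using restrict_homM[OF modsD(1)[OF W] u(1)] by (metis imageI)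
    qed
  qed
  moreover have "inj_on (post W f) (carrier (homM W X))"
  proof (rule inj_onI)
    fix h h' assume h: "h \<in> carrier (homM W X)" "h' \<in> carrier (homM W X)" "post W f h = post W f h'"
    show "h = h'"
    proof (rule homM_eqI[where X = W])
      fix w assume w: "w \<in> carrier W"
      then have "f (h w) = f (h' w)" using fun_cong[OF h(3), of w] by simp
      then show "h w = h' w" using h(1,2) w hom_closed[of h \<Lambda> W X w] hom_closed[of h' \<Lambda> W X w] inj_onD[OF E(3), of "h w" "h' w"] by simp
    qed (use h in auto)
  qed
  ultimately show ?thesis
    using P.len_hom'[OF P.M.submod_carrier finlen_homM[OF W XYZ(2)]]
      Q.len_inj_image'[OF Q.M.submod_carrier finlen_homM[OF W XYZ(1)]] by (simp add: hl_def)
qed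

lemma hl_exact':
  assumes XYZ: "X \<in> mods \<Lambda>" "Y \<in> mods \<Lambda>" "Z \<in> mods \<Lambda>" and W: "W \<in> mods \<Lambda>" and ex: "short_exact \<Lambda> X f Y g Z"
  shows "hl Y W = hl Z W + len R (homM X W) (pre X f ` carrier (homM Y W))"
proof -
  note E = short_exactD[OF ex]
  interpret P: module_hom R "homM Y W" "homM X W" "pre X f"
    using W XYZ by (intro pre_hom modsD E(1,2))
  interpret Q: module_hom R "homM Z W" "homM Y W" "pre Y g"
    using W XYZ by (intro pre_hom modsD E(1,2))
  have "pre Y g ` carrier (homM Z W) = carrier (homM Y W) \<inter> {h \<in> carrier (homM Y W). pre X f h = \<zero>\<^bsub>homM X W\<^esub>}"
  proof
    have "pre X f (pre Y g h) = \<zero>\<^bsub>homM X W\<^esub>" if h: "h \<in> carrier (homM Z W)" for h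
    proof (rule homM_eqI[where X = X])
      interpret h: module_hom \<Lambda> Z W h using h W XYZ by (intro module_homI modsD) auto
      show "pre X f (pre Y g h) x = \<zero>\<^bsub>homM X W\<^esub> x" if "x \<in> carrier X" for x
        using that E(6) hom_closed[OF E(1)] by simp
    qed simp_all
    then show "pre Y g ` carrier (homM Z W) \<subseteq> carrier (homM Y W) \<inter> {h \<in> carrier (homM Y W). pre X f h = \<zero>\<^bsub>homM X W\<^esub>}"
      using Q.closed by blast
    show "carrier (homM Y W) \<inter> {h \<in> carrier (homM Y W). pre X f h = \<zero>\<^bsub>homM X W\<^esub>} \<subseteq> pre Y g ` carrier (homM Z W)"
    proof
      fix h assume "h \<in> carrier (homM Y W) \<inter> {h \<in> carrier (homM Y W). pre X f h = \<zero>\<^bsub>homM X W\<^esub>}"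
      then have h: "h \<in> mod_hom \<Lambda> Y W" "h \<in> extensional (carrier Y)" "pre X f h = \<zero>\<^bsub>homM X W\<^esub>" by auto
      have "h (f x) = \<zero>\<^bsub>W\<^esub>" if "x \<in> carrier X" for x using fun_cong[OF h(3), of x] that by simp
      then have "h y = \<zero>\<^bsub>W\<^esub>" if "y \<in> carrier Y" "g y = \<zero>\<^bsub>Z\<^esub>" for y using E(5)[OF that(1)] that(2) by auto
      then obtain u where u: "u \<in> mod_hom \<Lambda> Z W" "\<forall>y\<in>carrier Y. u (g y) = h y"
        using hom_factor_surj[OF modsD(1)[OF XYZ(2)] modsD(1)[OF XYZ(3)] modsD(1)[OF W] E(2,4) h(1)] by blast
      then have "pre Y g (restrict u (carrier Z)) = h" using h(2) hom_closed[OF E(2)] by (intro homM_eqI[where X = Y]) auto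
      then show "h \<in> pre Y g ` carrier (homM Z W)"
        using restrict_homM[OF modsD(1)[OF XYZ(3)] u(1)] by (metis imageI)
    qed
  qed
  moreover have "inj_on (pre Y g) (carrier (homM Z W))"
  proof (rule inj_onI)
    fix h h' assume h: "h \<in> carrier (homM Z W)" "h' \<in> carrier (homM Z W)" "pre Y g h = pre Y g h'"
    show "h = h'"
    proof (rule homM_eqI[where X = Z])
      fix z assume z: "z \<in> carrier Z"
      then obtain y where "y \<in> carrier Y" "z = g y" using E(4) by blast
      then show "h z = h' z" using fun_cong[OF h(3), of y] by simp
    qed (use h in auto)
  qed
  ultimately show ?thesis
    using P.len_hom'[OF P.M.submod_carrier finlen_homM[OF XYZ(2) W]]
      Q.len_inj_image'[OF Q.M.submod_carrier finlen_homM[OF XYZ(3) W]] by (simp add: hl_def)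
qed

subsection \<open>Endomorphisms and Fitting's lemma\<close>

abbreviation rl :: "('a, 'b) module \<Rightarrow> 'b set \<Rightarrow> nat" where
  "rl X U \<equiv> len R (res X) U"

lemma endo_inj_imp_bij:
  assumes X: "X \<in> mods \<Lambda>" and \<theta>: "\<theta> \<in> mod_hom \<Lambda> X X" "inj_on \<theta> (carrier X)"
  shows "bij_betw \<theta> (carrier X) (carrier X)"
proof -
  interpret \<theta>: module_hom R "res X" "res X" \<theta>
    using X \<theta>(1) by (intro module_homI left_module_res modsD hom_res)
  have "rl X (\<theta> ` carrier X) = rl X (carrier X)"
    using \<theta>.len_inj_image'[OF \<theta>.M.submod_carrier] finlen_mods[OF X order_refl] \<theta>(2) by simp
  then have "\<theta> ` carrier X = carrier X"
    using len_eqD[OF finlen_mods[OF X order_refl] \<theta>.submod_image[OF \<theta>.M.submod_carrier]] \<theta>.M.submod_carrier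
      hom_closed[OF \<theta>(1)] by auto
  then show ?thesis using \<theta>(2) by (simp add: bij_betw_def)
qed

lemma one_minus_bijI:
  assumes X: "X \<in> mods \<Lambda>" and \<theta>: "\<theta> \<in> mod_hom \<Lambda> X X"
    and "\<And>x. x \<in> carrier X \<Longrightarrow> \<theta> x = x \<Longrightarrow> x = \<zero>\<^bsub>X\<^esub>"
  shows "bij_betw (\<lambda>x. x \<ominus>\<^bsub>X\<^esub> \<theta> x) (carrier X) (carrier X)"
proof (rule endo_inj_imp_bij[OF X])
  interpret X: left_module \<Lambda> X using modsD X by blast
  show h: "(\<lambda>x. x \<ominus>\<^bsub>X\<^esub> \<theta> x) \<in> mod_hom \<Lambda> X X" by (intro hom_diff hom_id \<theta> X.left_module_axioms)
  interpret h: module_hom \<Lambda> X X "\<lambda>x. x \<ominus>\<^bsub>X\<^esub> \<theta> x" by (intro module_homI X.left_module_axioms h)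
  show "inj_on (\<lambda>x. x \<ominus>\<^bsub>X\<^esub> \<theta> x) (carrier X)"
    using assms(3) hom_closed[OF \<theta>] by (intro h.inj_onI_ker) (auto simp: X.diff_zero_iff)
qed

lemma bij_trivial_ker:
  assumes "left_module \<Lambda> X" "left_module \<Lambda> Y" "f \<in> mod_hom \<Lambda> X Y" "bij_betw f (carrier X) (carrier Y)"
    "x \<in> carrier X" "f x = \<zero>\<^bsub>Y\<^esub>"
  shows "x = \<zero>\<^bsub>X\<^esub>"
  using module_hom.inj_onD_ker[OF module_homI[OF assms(1-3)]] assms(4-6) by (auto simp: bij_betw_def)

lemma hom_funpow: "\<theta> \<in> mod_hom \<Lambda> X X \<Longrightarrow> (\<theta> ^^ n) \<in> mod_hom \<Lambda> X X"
  by (induction n) (auto simp: id_def comp_def intro: hom_id hom_comp)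

text \<open>Once the kernels of the powers of \<open>\<theta>\<close> have become stationary, a
  power is injective, hence bijective, on its own image \<open>U\<close>. Composing it with the
  inverse of this bijection gives a projection onto \<open>U\<close> with the same kernel as the
  power.\<close>

lemma fitting:
  assumes X: "X \<in> mods \<Lambda>" and \<theta>: "\<theta> \<in> mod_hom \<Lambda> X X"
  obtains N U p where "N > 0" "U = (\<theta> ^^ N) ` carrier X" "submod \<Lambda> X U" "p \<in> mod_hom \<Lambda> X (X\<lparr>carrier := U\<rparr>)"
    "\<And>x. x \<in> U \<Longrightarrow> p x = x" "\<And>x. x \<in> carrier X \<Longrightarrow> p x = \<zero>\<^bsub>X\<^esub> \<longleftrightarrow> (\<theta> ^^ N) x = \<zero>\<^bsub>X\<^esub>"
proof -
  interpret X: left_module \<Lambda> X using modsD X by blast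
  note X' = X.left_module_axioms
  have pw: "module_hom \<Lambda> X X (\<theta> ^^ n)" for n using hom_funpow[OF \<theta>] by (intro module_homI X')
  define K where "K n = {x \<in> carrier X. (\<theta> ^^ n) x = \<zero>\<^bsub>X\<^esub>}" for n
  have K: "submod \<Lambda> X (K n)" for n unfolding K_def by (rule module_hom.submod_ker[OF pw])
  have K_mono: "K n \<subseteq> K (m + n)" for m n
    using module_hom.zero[OF pw] by (auto simp: K_def funpow_add)
  have bound: "\<forall>n. True \<longrightarrow> rl X (K n) < Suc (rl X (carrier X))"
    using len_mono[OF finlen_mods[OF X order_refl] submod_res[OF K] submod_res[OF X.submod_carrier] submodD(1)[OF K]]
    by (simp add: le_imp_less_Suc)
  obtain n where n: "\<And>m. rl X (K m) \<le> rl X (K n)"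
    using ex_has_greatest_nat[of "\<lambda>_. True" 0 "\<lambda>n. rl X (K n)", OF _ bound] by auto
  have stable: "K (m + n) = K n" for m
    using len_eqD[OF finlen_mods[OF X submodD(1)[OF K]] submod_res[OF K] submod_res[OF K] K_mono n] by simp
  \<comment> \<open>The kernel is stationary already at \<open>n\<close>; the successor only ensures
    that the exponent is positive.\<close>
  define N where "N = Suc n"
  define U where "U = (\<theta> ^^ N) ` carrier X"
  have KN: "K (N + N) = K N" using stable[of "Suc N"] stable[of 1] by (simp add: N_def)
  interpret g: module_hom \<Lambda> X X "\<theta> ^^ N" by (rule pw)
  have U: "submod \<Lambda> X U" unfolding U_def by (rule g.submod_image[OF X.submod_carrier])
  let ?U = "X\<lparr>carrier := U\<rparr>"
  have Um: "?U \<in> mods \<Lambda>" by (rule sub_mods[OF X U])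
  have gU: "(\<theta> ^^ N) \<in> mod_hom \<Lambda> X ?U" by (rule hom_into_submod[OF g.hom]) (simp add: U_def)
  have gUU: "(\<theta> ^^ N) \<in> mod_hom \<Lambda> ?U ?U" by (rule hom_on_submod[OF gU U])
  interpret gU: module_hom \<Lambda> ?U ?U "\<theta> ^^ N" using modsD(1)[OF Um] gUU by (intro module_homI)
  have "inj_on (\<theta> ^^ N) (carrier ?U)"
  proof (rule gU.inj_onI_ker)
    fix x assume x: "x \<in> carrier ?U" "(\<theta> ^^ N) x = \<zero>\<^bsub>?U\<^esub>"
    then obtain y where y: "y \<in> carrier X" "x = (\<theta> ^^ N) y" by (auto simp: U_def)
    then have "y \<in> K (N + N)" using x by (simp add: K_def funpow_add)
    then have "y \<in> K N" using KN by simp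
    then show "x = \<zero>\<^bsub>?U\<^esub>" using y by (simp add: K_def)
  qed
  then have bij: "bij_betw (\<theta> ^^ N) (carrier ?U) (carrier ?U)" by (rule endo_inj_imp_bij[OF Um gUU])
  then obtain u where u: "u \<in> mod_hom \<Lambda> ?U ?U" "\<forall>x\<in>U. (\<theta> ^^ N) (u x) = x" "\<forall>x\<in>U. u ((\<theta> ^^ N) x) = x"
    using hom_inverse[OF modsD(1)[OF Um] modsD(1)[OF Um] gUU] by auto
  show thesis
  proof (rule that[of N U "\<lambda>x. u ((\<theta> ^^ N) x)"])
    show "(\<lambda>x. u ((\<theta> ^^ N) x)) \<in> mod_hom \<Lambda> X ?U" by (rule hom_comp[OF gU u(1)])
    show "u ((\<theta> ^^ N) x) = \<zero>\<^bsub>X\<^esub> \<longleftrightarrow> (\<theta> ^^ N) x = \<zero>\<^bsub>X\<^esub>" if "x \<in> carrier X" for x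
    proof
      assume "u ((\<theta> ^^ N) x) = \<zero>\<^bsub>X\<^esub>"
      moreover have "(\<theta> ^^ N) x \<in> U" using that by (simp add: U_def)
      ultimately show "(\<theta> ^^ N) x = \<zero>\<^bsub>X\<^esub>" using u(2) g.zero by metis
    next
      assume "(\<theta> ^^ N) x = \<zero>\<^bsub>X\<^esub>"
      then show "u ((\<theta> ^^ N) x) = \<zero>\<^bsub>X\<^esub>" using u(3) submodD(2)[OF U] g.zero by metis
    qed
  qed (use u U in \<open>auto simp: N_def U_def\<close>)
qed

end

context artin
begin

subsection \<open>The radical\<close>

lemma radicalD:
  "f \<in> radical \<Lambda> X Y \<Longrightarrow> f \<in> mod_hom \<Lambda> X Y"
  "f \<in> radical \<Lambda> X Y \<Longrightarrow> g \<in> mod_hom \<Lambda> Y X \<Longrightarrow> bij_betw (\<lambda>x. x \<ominus>\<^bsub>X\<^esub> g (f x)) (carrier X) (carrier X)"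
  by (auto simp: radical_def)

lemma one_minus_bijD:
  assumes "left_module \<Lambda> X" "\<theta> \<in> mod_hom \<Lambda> X X" "bij_betw (\<lambda>x. x \<ominus>\<^bsub>X\<^esub> \<theta> x) (carrier X) (carrier X)"
    "x \<in> carrier X" "\<theta> x = x"
  shows "x = \<zero>\<^bsub>X\<^esub>"
proof -
  interpret X: left_module \<Lambda> X by fact
  have "(\<lambda>x. x \<ominus>\<^bsub>X\<^esub> \<theta> x) \<in> mod_hom \<Lambda> X X" by (intro hom_diff hom_id assms)
  then show ?thesis
    using bij_trivial_ker[OF assms(1,1) _ assms(3,4)] assms(4,5) X.diff_zero_iff[of x x] by auto
qed

text \<open>In finite length an injective endomorphism is bijective, so \<open>1 - g f\<close> is an
  automorphism as soon as \<open>g f\<close> has no nonzero fixed point. The radical is handled in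
  this fixed-point form from here on.\<close>

lemma radicalI:
  assumes X: "X \<in> mods \<Lambda>" and f: "f \<in> mod_hom \<Lambda> X Y"
    and "\<And>g x. g \<in> mod_hom \<Lambda> Y X \<Longrightarrow> x \<in> carrier X \<Longrightarrow> g (f x) = x \<Longrightarrow> x = \<zero>\<^bsub>X\<^esub>"
  shows "f \<in> radical \<Lambda> X Y"
  unfolding radical_def using one_minus_bijI[OF X hom_comp[OF f]] assms(3) f by blast

lemma radical_fixD:
  assumes "X \<in> mods \<Lambda>" "f \<in> radical \<Lambda> X Y" "g \<in> mod_hom \<Lambda> Y X" "x \<in> carrier X" "g (f x) = x"
  shows "x = \<zero>\<^bsub>X\<^esub>"
  using one_minus_bijD[OF modsD(1)[OF assms(1)] hom_comp[OF radicalD(1)[OF assms(2)] assms(3)] radicalD(2)[OF assms(2,3)]] assms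
  by blast

lemma radical_cong:
  assumes X: "X \<in> mods \<Lambda>" and f: "f \<in> radical \<Lambda> X Y" and eq: "\<And>x. x \<in> carrier X \<Longrightarrow> g x = f x"
  shows "g \<in> radical \<Lambda> X Y"
  using radical_fixD[OF X f] eq
  by (intro radicalI X hom_cong[OF modsD(1)[OF X] radicalD(1)[OF f]]) auto

text \<open>A fixed point \<open>y\<close> of \<open>f g\<close> yields the fixed point
  \<open>g y\<close> of \<open>g f\<close>; this is the left-right symmetry of the radical.\<close>

lemma radical_fixD':
  assumes "X \<in> mods \<Lambda>" "Y \<in> mods \<Lambda>" "f \<in> radical \<Lambda> X Y" "g \<in> mod_hom \<Lambda> Y X" "y \<in> carrier Y" "f (g y) = y"
  shows "y = \<zero>\<^bsub>Y\<^esub>"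
proof -
  interpret f: module_hom \<Lambda> X Y f using assms by (intro module_homI modsD radicalD)
  have "g y = \<zero>\<^bsub>X\<^esub>"
    using assms hom_closed[OF assms(4,5)] by (intro radical_fixD[OF assms(1,3,4)]) auto
  then show ?thesis using assms(6) by simp
qed

lemma radical_comp_left:
  assumes "X \<in> mods \<Lambda>" "f \<in> radical \<Lambda> X Y" "g \<in> mod_hom \<Lambda> Y Z"
  shows "(\<lambda>x. g (f x)) \<in> radical \<Lambda> X Z"
  using radical_fixD[OF assms(1,2) hom_comp[OF assms(3)]]
  by (intro radicalI[OF assms(1)] hom_comp[OF radicalD(1)[OF assms(2)] assms(3)])

lemma radical_comp_right:
  assumes W: "W \<in> mods \<Lambda>" and X: "X \<in> mods \<Lambda>" and f: "f \<in> radical \<Lambda> X Y" and h: "h \<in> mod_hom \<Lambda> W X"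
  shows "(\<lambda>x. f (h x)) \<in> radical \<Lambda> W Y"
proof (intro radicalI W hom_comp[OF h radicalD(1)[OF f]])
  fix g w assume g: "g \<in> mod_hom \<Lambda> Y W" "w \<in> carrier W" "g (f (h w)) = w"
  interpret g: module_hom \<Lambda> X W "\<lambda>x. g (f x)"
    by (intro module_homI modsD X W hom_comp[OF radicalD(1)[OF f]] g)
  have "h w = \<zero>\<^bsub>X\<^esub>"
    using radical_fixD[OF X f hom_comp[OF g(1) h] hom_closed[OF h g(2)]] g(3) by simp
  then show "w = \<zero>\<^bsub>W\<^esub>" using g(3) g.zero by simp
qed

end

subsection \<open>Subcategories closed under direct summands\<close>

locale subcat = artin R \<Lambda> for R :: "('r, 'k) ring_scheme" and \<Lambda> :: "('r, 'a) module" +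
  fixes \<E> :: "'a modobj set"
  assumes additive: "additive_subcategory \<Lambda> \<E>"
    and summand: "\<And>X Y Z i p j q. \<lbrakk>X \<in> \<E>; Y \<in> mods \<Lambda>; Z \<in> mods \<Lambda>; biprod \<Lambda> X i p Y j q Z\<rbrakk> \<Longrightarrow> Y \<in> \<E>"
begin

lemma E_mods: "X \<in> \<E> \<Longrightarrow> X \<in> mods \<Lambda>"
  using additive by (auto simp: additive_subcategory_def)

lemma E_lm: "X \<in> \<E> \<Longrightarrow> left_module \<Lambda> X"
  using E_mods modsD by blast

lemma E_iso: "X \<in> \<E> \<Longrightarrow> Y \<in> mods \<Lambda> \<Longrightarrow> f \<in> mod_hom \<Lambda> X Y \<Longrightarrow> bij_betw f (carrier X) (carrier Y) \<Longrightarrow> Y \<in> \<E>"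
  using additive unfolding additive_subcategory_def mod_iso_def by blast

lemma E_dsum: "X \<in> mods \<Lambda> \<Longrightarrow> set Ys \<subseteq> \<E> \<Longrightarrow> is_direct_sum \<Lambda> X Ys \<Longrightarrow> X \<in> \<E>"
  using additive unfolding additive_subcategory_def by blast

lemma E_sum: "X \<in> mods \<Lambda> \<Longrightarrow> Y \<in> \<E> \<Longrightarrow> Z \<in> \<E> \<Longrightarrow> biprod \<Lambda> X i p Y j q Z \<Longrightarrow> X \<in> \<E>"
  using E_dsum[of X "[Y, Z]"] is_direct_sum_two_iff[OF modsD(1) E_lm E_lm] by auto

lemma E_zero: "X \<in> mods \<Lambda> \<Longrightarrow> carrier X = {\<zero>\<^bsub>X\<^esub>} \<Longrightarrow> X \<in> \<E>"
  using E_dsum[of X "[]"] is_direct_sum_Nil[OF modsD(1)] by auto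

lemma E_sumE:
  assumes "X \<in> \<E>" "Y \<in> \<E>"
  obtains S i p j q where "S \<in> \<E>" "biprod \<Lambda> S i p X j q Y"
  using sum_mods[OF E_mods[OF assms(1)] E_mods[OF assms(2)]] E_sum[OF _ assms] by metis

abbreviation ind :: "'a modobj \<Rightarrow> bool" where
  "ind \<equiv> indecomposable \<Lambda> \<E>"

lemma indD: "ind X \<Longrightarrow> X \<in> \<E>" "ind X \<Longrightarrow> carrier X \<noteq> {\<zero>\<^bsub>X\<^esub>}" "ind X \<Longrightarrow> X \<in> mods \<Lambda>" "ind X \<Longrightarrow> left_module \<Lambda> X"
  using E_mods E_lm by (auto simp: indecomposable_def)

lemma ind_nonzero:
  assumes "ind X" obtains x where "x \<in> carrier X" "x \<noteq> \<zero>\<^bsub>X\<^esub>"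
proof -
  interpret X: left_module \<Lambda> X using indD(4)[OF assms] .
  show thesis using that indD(2)[OF assms] X.M.zero_closed by blast
qed

lemma ind_biprod:
  assumes "ind X" "Y \<in> mods \<Lambda>" "Z \<in> mods \<Lambda>" "biprod \<Lambda> X i p Y j q Z"
  shows "carrier Y = {\<zero>\<^bsub>Y\<^esub>} \<or> carrier Z = {\<zero>\<^bsub>Z\<^esub>}"
proof -
  have "Y \<in> \<E>" using summand indD(1) assms by blast
  moreover have "Z \<in> \<E>" using summand indD(1) assms biprod_swap[OF indD(4)[OF assms(1)] assms(4)] by blast
  moreover have "is_direct_sum \<Lambda> X [Y, Z]"
    using is_direct_sum_two_iff[OF indD(4) modsD(1) modsD(1)] assms by blast
  ultimately show ?thesis using assms(1) unfolding indecomposable_def by blast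
qed

text \<open>Of the two Fitting summands of an indecomposable one is zero: either the image of a
  power vanishes, or its kernel does and \<open>\<theta>\<close> is injective.\<close>

lemma ind_endo:
  assumes X: "ind X" and \<theta>: "\<theta> \<in> mod_hom \<Lambda> X X" and nb: "\<not> inj_on \<theta> (carrier X)"
  obtains N where "\<And>x. x \<in> carrier X \<Longrightarrow> (\<theta> ^^ N) x = \<zero>\<^bsub>X\<^esub>"
proof -
  interpret X: left_module \<Lambda> X using indD(4)[OF X] .
  obtain N U p where N: "N > 0" "U = (\<theta> ^^ N) ` carrier X" "submod \<Lambda> X U" "p \<in> mod_hom \<Lambda> X (X\<lparr>carrier := U\<rparr>)"
    "\<And>x. x \<in> U \<Longrightarrow> p x = x" "\<And>x. x \<in> carrier X \<Longrightarrow> p x = \<zero>\<^bsub>X\<^esub> \<longleftrightarrow> (\<theta> ^^ N) x = \<zero>\<^bsub>X\<^esub>"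
    by (rule fitting[OF indD(3)[OF X] \<theta>]) (rule that)
  have Um: "X\<lparr>carrier := U\<rparr> \<in> mods \<Lambda>" using sub_mods[OF indD(3)[OF X] N(3)] .
  note r = retract_biprod[OF X.left_module_axioms modsD(1)[OF Um] hom_inclusion[OF N(3)] N(4)]
  have K: "submod \<Lambda> X {x \<in> carrier X. p x = \<zero>\<^bsub>X\<^esub>}" using r(1) N(5) by simp
  have "U = {\<zero>\<^bsub>X\<^esub>} \<or> {x \<in> carrier X. p x = \<zero>\<^bsub>X\<^esub>} = {\<zero>\<^bsub>X\<^esub>}"
    using ind_biprod[OF X Um _ r(2)] sub_mods[OF indD(3)[OF X] K] N(5) by simp
  then show thesis
  proof
    assume "U = {\<zero>\<^bsub>X\<^esub>}"
    then show thesis using N(2) that by blast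
  next
    assume *: "{x \<in> carrier X. p x = \<zero>\<^bsub>X\<^esub>} = {\<zero>\<^bsub>X\<^esub>}"
    interpret \<theta>: module_hom \<Lambda> X X \<theta> using \<theta> by (intro module_homI X.left_module_axioms)
    interpret \<theta>N: module_hom \<Lambda> X X "\<theta> ^^ n" for n using hom_funpow[OF \<theta>] by (intro module_homI X.left_module_axioms)
    have "inj_on \<theta> (carrier X)"
    proof (rule \<theta>.inj_onI_ker)
      fix x assume x: "x \<in> carrier X" "\<theta> x = \<zero>\<^bsub>X\<^esub>"
      have "(\<theta> ^^ N) x = (\<theta> ^^ (N - 1)) (\<theta> x)" using N(1) by (metis Suc_pred' comp_apply funpow_Suc_right)
      then have "(\<theta> ^^ N) x = \<zero>\<^bsub>X\<^esub>" using x by simp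
      then show "x = \<zero>\<^bsub>X\<^esub>" using N(6)[OF x(1)] * x(1) by blast
    qed
    then show thesis using nb by blast
  qed
qed

lemma ind_endo_fix:
  assumes X: "ind X" and \<theta>: "\<theta> \<in> mod_hom \<Lambda> X X" and nb: "\<not> inj_on \<theta> (carrier X)"
    and x: "x \<in> carrier X" "\<theta> x = x"
  shows "x = \<zero>\<^bsub>X\<^esub>"
proof -
  obtain N where N: "\<And>x. x \<in> carrier X \<Longrightarrow> (\<theta> ^^ N) x = \<zero>\<^bsub>X\<^esub>" by (rule ind_endo[OF X \<theta> nb]) (rule that)
  have "(\<theta> ^^ n) x = x" for n using x(2) by (induction n) auto
  then show ?thesis using N[OF x(1)] by simp
qed

text \<open>The endomorphism ring of an indecomposable is local, stated in the form in which it is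
  used. An element of the kernel of \<open>\<alpha>\<close> is fixed by \<open>\<beta>\<close>, and
  a noninjective \<open>\<beta>\<close> is nilpotent.\<close>

lemma ind_endo_sum:
  assumes X: "ind X" and \<alpha>: "\<alpha> \<in> mod_hom \<Lambda> X X" and \<beta>: "\<beta> \<in> mod_hom \<Lambda> X X"
    and sum: "\<And>x. x \<in> carrier X \<Longrightarrow> \<alpha> x \<oplus>\<^bsub>X\<^esub> \<beta> x = x"
  shows "inj_on \<alpha> (carrier X) \<or> inj_on \<beta> (carrier X)"
proof (rule disjCI)
  assume nb: "\<not> inj_on \<beta> (carrier X)"
  interpret X: left_module \<Lambda> X using indD(4)[OF X] .
  interpret \<alpha>: module_hom \<Lambda> X X \<alpha> using \<alpha> by (intro module_homI X.left_module_axioms)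
  interpret \<beta>: module_hom \<Lambda> X X \<beta> using \<beta> by (intro module_homI X.left_module_axioms)
  show "inj_on \<alpha> (carrier X)"
  proof (rule \<alpha>.inj_onI_ker)
    fix x assume x: "x \<in> carrier X" "\<alpha> x = \<zero>\<^bsub>X\<^esub>"
    then have "\<beta> x = x" using sum[OF x(1)] by simp
    then show "x = \<zero>\<^bsub>X\<^esub>" using ind_endo_fix[OF X \<beta> nb x(1)] by blast
  qed
qed

text \<open>Out of an indecomposable, the radical maps are those that are not split monomorphisms:
  if \<open>g f\<close> has a nonzero fixed point it is not nilpotent, hence bijective, and its
  inverse turns \<open>g\<close> into a retraction of \<open>f\<close>.\<close>

lemma radical_left_iff:
  assumes X: "ind X" and f: "f \<in> mod_hom \<Lambda> X Y"
  shows "f \<in> radical \<Lambda> X Y \<longleftrightarrow> (\<forall>g\<in>mod_hom \<Lambda> Y X. \<not> (\<forall>x\<in>carrier X. g (f x) = x))"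
proof (intro iffI ballI notI)
  fix g assume f: "f \<in> radical \<Lambda> X Y" and g: "g \<in> mod_hom \<Lambda> Y X" "\<forall>x\<in>carrier X. g (f x) = x"
  obtain x where "x \<in> carrier X" "x \<noteq> \<zero>\<^bsub>X\<^esub>" by (rule ind_nonzero[OF X])
  then show False using radical_fixD[OF indD(3)[OF X] f g(1)] g(2) by blast
next
  assume *: "\<forall>g\<in>mod_hom \<Lambda> Y X. \<not> (\<forall>x\<in>carrier X. g (f x) = x)"
  show "f \<in> radical \<Lambda> X Y"
  proof (rule radicalI[OF indD(3)[OF X] f])
    fix g x assume g: "g \<in> mod_hom \<Lambda> Y X" and x: "x \<in> carrier X" "g (f x) = x"
    have "\<not> inj_on (\<lambda>x. g (f x)) (carrier X)"
    proof
      assume "inj_on (\<lambda>x. g (f x)) (carrier X)"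
      then obtain u where u: "u \<in> mod_hom \<Lambda> X X" "\<forall>x\<in>carrier X. u (g (f x)) = x"
        using hom_inverse[OF indD(4)[OF X] indD(4)[OF X] hom_comp[OF f g]
            endo_inj_imp_bij[OF indD(3)[OF X] hom_comp[OF f g]]] by blast
      then show False using *[rule_format, OF hom_comp[OF g u(1)]] u(2) by simp
    qed
    then show "x = \<zero>\<^bsub>X\<^esub>" using ind_endo_fix[OF X hom_comp[OF f g]] x by blast
  qed
qed

lemma radical_right_iff:
  assumes X: "X \<in> mods \<Lambda>" and Y: "ind Y" and f: "f \<in> mod_hom \<Lambda> X Y"
  shows "f \<in> radical \<Lambda> X Y \<longleftrightarrow> (\<forall>g\<in>mod_hom \<Lambda> Y X. \<not> (\<forall>y\<in>carrier Y. f (g y) = y))"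
proof (intro iffI ballI notI)
  fix g assume f: "f \<in> radical \<Lambda> X Y" and g: "g \<in> mod_hom \<Lambda> Y X" "\<forall>x\<in>carrier Y. f (g x) = x"
  obtain y where "y \<in> carrier Y" "y \<noteq> \<zero>\<^bsub>Y\<^esub>" by (rule ind_nonzero[OF Y])
  then show False using radical_fixD'[OF X indD(3)[OF Y] f g(1)] g(2) by blast
next
  assume *: "\<forall>g\<in>mod_hom \<Lambda> Y X. \<not> (\<forall>x\<in>carrier Y. f (g x) = x)"
  show "f \<in> radical \<Lambda> X Y"
  proof (rule radicalI[OF X f])
    fix g x assume g: "g \<in> mod_hom \<Lambda> Y X" and x: "x \<in> carrier X" "g (f x) = x"
    interpret g: module_hom \<Lambda> Y X g by (intro module_homI modsD(1)[OF X] indD(4)[OF Y] g)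
    have "\<not> inj_on (\<lambda>x. f (g x)) (carrier Y)"
    proof
      assume "inj_on (\<lambda>x. f (g x)) (carrier Y)"
      then obtain u where u: "u \<in> mod_hom \<Lambda> Y Y" "\<forall>x\<in>carrier Y. f (g (u x)) = x"
        using hom_inverse[OF indD(4)[OF Y] indD(4)[OF Y] hom_comp[OF g f]
            endo_inj_imp_bij[OF indD(3)[OF Y] hom_comp[OF g f]]] by blast
      then show False using *[rule_format, OF hom_comp[OF u(1) g]] u(2) by simp
    qed
    then have "f x = \<zero>\<^bsub>Y\<^esub>" using ind_endo_fix[OF Y hom_comp[OF g f]] x hom_closed[OF f x(1)] by simp
    then show "x = \<zero>\<^bsub>X\<^esub>" using x by simp
  qed
qed

text \<open>The complement of a nonzero summand of an indecomposable is zero, so both the section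
  and the retraction are isomorphisms.\<close>

lemma split_mono_into_ind:
  assumes X: "X \<in> mods \<Lambda>" "carrier X \<noteq> {\<zero>\<^bsub>X\<^esub>}" and Y: "ind Y"
    and h: "h \<in> mod_hom \<Lambda> X Y" and p: "p \<in> mod_hom \<Lambda> Y X" and ph: "\<And>x. x \<in> carrier X \<Longrightarrow> p (h x) = x"
  shows "bij_betw h (carrier X) (carrier Y)" "bij_betw p (carrier Y) (carrier X)"
proof -
  interpret p: module_hom \<Lambda> Y X p by (intro module_homI modsD(1)[OF X(1)] indD(4)[OF Y] p)
  note r = retract_biprod[OF indD(4)[OF Y] modsD(1)[OF X(1)] h p ph]
  have "{y \<in> carrier Y. p y = \<zero>\<^bsub>X\<^esub>} = {\<zero>\<^bsub>Y\<^esub>}"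
    using ind_biprod[OF Y X(1) sub_mods[OF indD(3)[OF Y] r(1)] r(2)] X(2) by simp
  then have "inj_on p (carrier Y)" by (intro p.inj_onI_ker) blast
  moreover have "p ` carrier Y = carrier X"
    using ph hom_closed[OF h] hom_closed[OF p] by (auto simp: image_iff) metis
  ultimately show b: "bij_betw p (carrier Y) (carrier X)" by (simp add: bij_betw_def)
  have hp: "h (p y) = y" if "y \<in> carrier Y" for y
    using ph[of "p y"] that hom_closed[OF p that] hom_closed[OF h] b
    by (metis bij_betw_def inj_onD)
  show "bij_betw h (carrier X) (carrier Y)"
    by (rule bij_betw_byWitness[where f' = p]) (use ph hp hom_closed[OF h] hom_closed[OF p] in auto)
qed

lemma ind_radical_or_iso:
  assumes X: "ind X" and Y: "ind Y" and h: "h \<in> mod_hom \<Lambda> X Y" and niso: "\<not> mod_iso \<Lambda> X Y"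
  shows "h \<in> radical \<Lambda> X Y"
proof (rule ccontr)
  assume "h \<notin> radical \<Lambda> X Y"
  then obtain g where g: "g \<in> mod_hom \<Lambda> Y X" "\<And>x. x \<in> carrier X \<Longrightarrow> g (h x) = x"
    using radical_left_iff[OF X h] by blast
  then have "bij_betw h (carrier X) (carrier Y)"
    using split_mono_into_ind(1)[OF indD(3)[OF X] indD(2)[OF X] Y h] by blast
  then show False using niso h unfolding mod_iso_def by blast
qed

lemma mod_iso_sym: "left_module \<Lambda> X \<Longrightarrow> left_module \<Lambda> Y \<Longrightarrow> mod_iso \<Lambda> X Y \<Longrightarrow> mod_iso \<Lambda> Y X"
proof -
  assume *: "left_module \<Lambda> X" "left_module \<Lambda> Y" "mod_iso \<Lambda> X Y"
  then obtain f where f: "f \<in> mod_hom \<Lambda> X Y" "bij_betw f (carrier X) (carrier Y)" unfolding mod_iso_def by blast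
  obtain u where u: "u \<in> mod_hom \<Lambda> Y X" "\<forall>y\<in>carrier Y. f (u y) = y" "\<forall>x\<in>carrier X. u (f x) = x"
    using hom_inverse[OF *(1,2) f] by blast
  have "bij_betw u (carrier Y) (carrier X)"
    by (rule bij_betw_byWitness[where f' = f]) (use u f hom_closed[OF u(1)] hom_closed[OF f(1)] in auto)
  then show ?thesis using u(1) unfolding mod_iso_def by blast
qed

lemma mod_iso_trans: "mod_iso \<Lambda> X Y \<Longrightarrow> mod_iso \<Lambda> Y Z \<Longrightarrow> mod_iso \<Lambda> X Z"
  unfolding mod_iso_def
proof (elim bexE)
  fix f g assume *: "f \<in> mod_hom \<Lambda> X Y" "bij_betw f (carrier X) (carrier Y)"
    "g \<in> mod_hom \<Lambda> Y Z" "bij_betw g (carrier Y) (carrier Z)"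
  then have "bij_betw (\<lambda>x. g (f x)) (carrier X) (carrier Z)"
    using bij_betw_trans[OF *(2,4)] by (simp add: comp_def)
  then show "\<exists>h\<in>mod_hom \<Lambda> X Z. bij_betw h (carrier X) (carrier Z)"
    using hom_comp[OF *(1,3)] by (intro bexI)
qed

lemma mod_iso_refl: "mod_iso \<Lambda> X X"
  unfolding mod_iso_def using bij_betw_id[of "carrier X"] by (intro bexI[of _ "\<lambda>x. x"] hom_id) (simp add: id_def)

lemma iso_class_eq_iff:
  assumes "X \<in> \<E>" "Y \<in> \<E>"
  shows "iso_class \<Lambda> \<E> X = iso_class \<Lambda> \<E> Y \<longleftrightarrow> mod_iso \<Lambda> X Y"
proof
  assume "iso_class \<Lambda> \<E> X = iso_class \<Lambda> \<E> Y"
  then show "mod_iso \<Lambda> X Y" using assms mod_iso_refl unfolding iso_class_def by blast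
next
  assume "mod_iso \<Lambda> X Y"
  then show "iso_class \<Lambda> \<E> X = iso_class \<Lambda> \<E> Y"
    using mod_iso_trans mod_iso_sym[OF E_lm E_lm] assms unfolding iso_class_def by blast
qed

subsection \<open>The Krull--Schmidt theorem\<close>

text \<open>The length of \<open>Hom(W, X)\<close> modulo radical maps is additive in \<open>X\<close>, and on an indecomposable \<open>X\<close> it is
  nonzero only if \<open>X \<cong> W\<close>; so it recovers the multiplicity of \<open>W\<close> in \<open>X\<close>.\<close>

definition rad_hom :: "'a modobj \<Rightarrow> 'a modobj \<Rightarrow> ('a list \<Rightarrow> 'a list) set" where
  "rad_hom W X = {h \<in> carrier (homM W X). h \<in> radical \<Lambda> W X}"

definition mu :: "'a modobj \<Rightarrow> 'a modobj \<Rightarrow> nat" where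
  "mu W X = hl W X - len R (homM W X) (rad_hom W X)"

text \<open>If \<open>u\<close> were a retraction of the sum, then \<open>u f\<close> or
  \<open>u g\<close> would be bijective by locality of the endomorphism ring, making
  \<open>f\<close> or \<open>g\<close> a split monomorphism.\<close>

lemma radical_add:
  assumes W: "ind W" and X: "X \<in> mods \<Lambda>" and f: "f \<in> radical \<Lambda> W X" and g: "g \<in> radical \<Lambda> W X"
  shows "(\<lambda>w. f w \<oplus>\<^bsub>X\<^esub> g w) \<in> radical \<Lambda> W X"
proof -
  note fg = radicalD(1)[OF f] radicalD(1)[OF g]
  have h: "(\<lambda>w. f w \<oplus>\<^bsub>X\<^esub> g w) \<in> mod_hom \<Lambda> W X" by (intro hom_add modsD X fg)
  show ?thesis
    unfolding radical_left_iff[OF W h]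
  proof (intro ballI notI)
    fix u assume u: "u \<in> mod_hom \<Lambda> X W" "\<forall>w\<in>carrier W. u (f w \<oplus>\<^bsub>X\<^esub> g w) = w"
    interpret u: module_hom \<Lambda> X W u by (intro module_homI modsD(1)[OF X] indD(4)[OF W] u(1))
    have "inj_on (\<lambda>w. u (f w)) (carrier W) \<or> inj_on (\<lambda>w. u (g w)) (carrier W)"
      using u(2) fg hom_closed[of f \<Lambda> W X] hom_closed[of g \<Lambda> W X]
      by (intro ind_endo_sum[OF W] hom_comp[OF _ u(1)]) (auto simp: u.add)
    moreover have "\<not> inj_on (\<lambda>w. u (f w)) (carrier W)" if f: "f \<in> radical \<Lambda> W X" for f
    proof
      assume "inj_on (\<lambda>w. u (f w)) (carrier W)"
      then obtain v where v: "v \<in> mod_hom \<Lambda> W W" "\<forall>x\<in>carrier W. v (u (f x)) = x"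
        using hom_inverse[OF indD(4)[OF W] indD(4)[OF W] hom_comp[OF radicalD(1)[OF f] u(1)]
            endo_inj_imp_bij[OF indD(3)[OF W] hom_comp[OF radicalD(1)[OF f] u(1)]]] by blast
      then show False
        using f[unfolded radical_left_iff[OF W radicalD(1)[OF f]], rule_format, OF hom_comp[OF u(1) v(1)]] v(2) by simp
    qed
    ultimately show False using f g by blast
  qed
qed

lemma submod_rad_hom:
  assumes W: "ind W" and X: "X \<in> mods \<Lambda>"
  shows "submod R (homM W X) (rad_hom W X)"
proof -
  interpret H: left_module R "homM W X" by (intro left_module_homM modsD(1)[OF X] indD(4)[OF W])
  interpret X: left_module \<Lambda> X using modsD X by blast
  have res: "restrict h (carrier W) \<in> rad_hom W X" if "h \<in> radical \<Lambda> W X" for h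
    using radical_cong[OF indD(3)[OF W] that] restrict_homM[OF indD(4)[OF W] radicalD(1)[OF that]]
    by (simp add: rad_hom_def)
  show ?thesis
    unfolding submod_def
  proof (intro conjI ballI)
    show "rad_hom W X \<subseteq> carrier (homM W X)" by (auto simp: rad_hom_def)
    have "(\<lambda>x. \<zero>\<^bsub>X\<^esub>) \<in> radical \<Lambda> W X"
    proof (rule radicalI[OF indD(3)[OF W] hom_zero[OF X.left_module_axioms]])
      fix g x assume "g \<in> mod_hom \<Lambda> X W" "g \<zero>\<^bsub>X\<^esub> = x"
      then show "x = \<zero>\<^bsub>W\<^esub>" using module_hom.zero[OF module_homI[OF X.left_module_axioms indD(4)[OF W]]] by metis
    qed
    then show "\<zero>\<^bsub>homM W X\<^esub> \<in> rad_hom W X" using res by simp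
    show "f \<oplus>\<^bsub>homM W X\<^esub> g \<in> rad_hom W X" if "f \<in> rad_hom W X" "g \<in> rad_hom W X" for f g
      using res[OF radical_add[OF W X, of f g]] that by (simp add: rad_hom_def)
    show "r \<odot>\<^bsub>homM W X\<^esub> f \<in> rad_hom W X" if "r \<in> carrier R" "f \<in> rad_hom W X" for r f
      using res[OF radical_comp_left[OF indD(3)[OF W] _ scal_hom[OF X.left_module_axioms that(1)], of f]] that(2)
      by (simp add: rad_hom_def)
  qed
qed

lemma mu_additive:
  assumes W: "ind W"
  shows "additive_fn (mu W)"
proof -
  have 1: "additive_fn (\<lambda>X. len R (homM W X) (rad_hom W X))"
  proof (rule additive_len_hom_ideal[OF indD(3)[OF W] submod_rad_hom[OF W]])
    fix X Y :: "'a modobj" and h g assume *: "X \<in> mods \<Lambda>" "h \<in> rad_hom W X" "g \<in> mod_hom \<Lambda> X Y"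
    then have "(\<lambda>x. g (h x)) \<in> radical \<Lambda> W Y"
      by (intro radical_comp_left[OF indD(3)[OF W] _ *(3)]) (simp add: rad_hom_def)
    then have "post W g h \<in> radical \<Lambda> W Y" by (rule radical_cong[OF indD(3)[OF W]]) simp
    then show "post W g h \<in> rad_hom W Y" using radicalD(1) by (auto simp: rad_hom_def)
  qed
  \<comment> \<open>The subtraction in \<open>mu\<close> is truncated; this inequality makes it
    exact, so that additivity survives.\<close>
  have le: "len R (homM W X) (rad_hom W X) \<le> hl W X" if "X \<in> mods \<Lambda>" for X
    unfolding hl_def using submod_rad_hom[OF W that] that
      left_module.submod_carrier[OF left_module_homM[OF indD(4)[OF W] modsD(1)[OF that]]]
    by (intro len_mono finlen_homM indD(3)[OF W]) (auto simp: rad_hom_def)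
  show ?thesis
    unfolding additive_fn_def
  proof (intro ballI allI impI)
    fix X Y Z i p j q assume X: "X \<in> mods \<Lambda>" "Y \<in> mods \<Lambda>" "Z \<in> mods \<Lambda>" "biprod \<Lambda> X i p Y j q Z"
    show "mu W X = mu W Y + mu W Z"
      using additive_fnD[OF 1 X(4,1-3)] additive_fnD[OF hl_additive[OF indD(3)[OF W]] X(4,1-3)] le[OF X(2)] le[OF X(3)]
      by (simp add: mu_def)
  qed
qed

lemma mu_self: "ind W \<Longrightarrow> mu W W > 0"
proof -
  assume W: "ind W"
  have "restrict (\<lambda>x. x) (carrier W) \<notin> radical \<Lambda> W W"
    using radical_left_iff[OF W hom_restrict[OF indD(4)[OF W] hom_id]] hom_id by fastforce
  then have "rad_hom W W \<subset> carrier (homM W W)"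
    using restrict_homM[OF indD(4)[OF W] hom_id] unfolding rad_hom_def by blast
  then show ?thesis
    using len_strict[OF finlen_homM[OF indD(3)[OF W] indD(3)[OF W]] submod_rad_hom[OF W indD(3)[OF W]]]
      left_module.submod_carrier[OF left_module_homM[OF indD(4)[OF W] indD(4)[OF W]]] by (simp add: mu_def hl_def)
qed

lemma mu_other: "ind W \<Longrightarrow> ind X \<Longrightarrow> \<not> mod_iso \<Lambda> W X \<Longrightarrow> mu W X = 0"
proof -
  assume "ind W" "ind X" "\<not> mod_iso \<Lambda> W X"
  then have "rad_hom W X = carrier (homM W X)"
    using ind_radical_or_iso by (auto simp: rad_hom_def)
  then show ?thesis by (simp add: mu_def hl_def)
qed

lemma additive_fn_zero:
  assumes "additive_fn d" "Z \<in> mods \<Lambda>" "carrier Z = {\<zero>\<^bsub>Z\<^esub>}"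
  shows "d Z = 0"
proof -
  interpret Z: left_module \<Lambda> Z using modsD assms by blast
  have "biprod \<Lambda> Z (\<lambda>x. x) (\<lambda>x. x) Z (\<lambda>x. x) (\<lambda>x. x) Z"
    using assms(3) by (auto simp: biprod_def hom_id)
  from additive_fnD[OF assms(1) this assms(2,2,2)] show ?thesis by simp
qed

text \<open>An isomorphism exhibits \<open>X\<close> as a biproduct of \<open>Y\<close> with a zero
  module, on which additive functions vanish.\<close>

lemma additive_fn_iso:
  assumes d: "additive_fn d" and XY: "X \<in> mods \<Lambda>" "Y \<in> mods \<Lambda>" "mod_iso \<Lambda> X Y"
  shows "d X = d Y"
proof -
  obtain Z where Z: "Z \<in> mods \<Lambda>" "carrier Z = {\<zero>\<^bsub>Z\<^esub>}" by (rule zero_mods)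
  interpret Z: left_module \<Lambda> Z using modsD Z by blast
  interpret X: left_module \<Lambda> X using modsD XY by blast
  obtain f where f: "f \<in> mod_hom \<Lambda> X Y" "bij_betw f (carrier X) (carrier Y)" using XY(3) unfolding mod_iso_def by blast
  obtain u where u: "u \<in> mod_hom \<Lambda> Y X" "\<forall>y\<in>carrier Y. f (u y) = y" "\<forall>x\<in>carrier X. u (f x) = x"
    using hom_inverse[OF modsD(1)[OF XY(1)] modsD(1)[OF XY(2)] f] by blast
  interpret f: module_hom \<Lambda> X Y f using f XY by (intro module_homI modsD)
  have "biprod \<Lambda> X u f Y (\<lambda>_. \<zero>\<^bsub>X\<^esub>) (\<lambda>_. \<zero>\<^bsub>Z\<^esub>) Z"
    unfolding biprod_def using u f(1) Z(2) hom_zero[OF X.left_module_axioms, of Z] hom_zero[OF Z.left_module_axioms, of X]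
    by (auto simp: hom_closed[OF u(1)])
  from additive_fnD[OF d this XY(1,2) Z(1)] show ?thesis using additive_fn_zero[OF d Z] by simp
qed

lemma additive_fn_sum:
  assumes d: "additive_fn d" and X: "X \<in> mods \<Lambda>" and Ys: "set Ys \<subseteq> mods \<Lambda>" and ds: "is_direct_sum \<Lambda> X Ys"
  shows "d X = (\<Sum>Y\<leftarrow>Ys. d Y)"
  using X Ys ds
proof (induction Ys arbitrary: X)
  case Nil
  interpret X: left_module \<Lambda> X using modsD Nil by blast
  have "carrier X = {\<zero>\<^bsub>X\<^esub>}" using Nil is_direct_sum_Nil[OF X.left_module_axioms] X.M.zero_closed by blast
  then show ?case using additive_fn_zero[OF d Nil(1)] by simp
next
  case (Cons Y Ys)
  have lm: "\<And>Y'. Y' \<in> set (Y # Ys) \<Longrightarrow> left_module \<Lambda> Y'" using Cons.prems(2) modsD(1) by blast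
  obtain U i p j q where U: "submod \<Lambda> X U" "biprod \<Lambda> X i p Y j q (X\<lparr>carrier := U\<rparr>)"
    "is_direct_sum \<Lambda> (X\<lparr>carrier := U\<rparr>) Ys"
    by (rule is_direct_sum_ConsD[OF modsD(1)[OF Cons.prems(1)] lm Cons.prems(3)])
  have Um: "X\<lparr>carrier := U\<rparr> \<in> mods \<Lambda>" by (rule sub_mods[OF Cons.prems(1) U(1)])
  then show ?case using additive_fnD[OF d U(2) Cons.prems(1) _ Um] Cons.IH[OF Um _ U(3)] Cons.prems(2) by simp
qed

text \<open>Induction on the first list: its head \<open>Y1\<close> is split off from
  \<open>Y\<close> and thereby from \<open>X\<close>, and the complement in \<open>X\<close> is a
  biproduct of the rest of \<open>Y\<close> with \<open>Z\<close>. When the first list is empty,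
  \<open>Y\<close> is zero and \<open>j\<close>, \<open>q\<close> are mutually inverse.\<close>

lemma is_direct_sum_append:
  assumes "X \<in> mods \<Lambda>" "Y \<in> mods \<Lambda>" "Z \<in> mods \<Lambda>" "biprod \<Lambda> X i p Y j q Z"
    "set Ys \<subseteq> mods \<Lambda>" "set Zs \<subseteq> mods \<Lambda>" "is_direct_sum \<Lambda> Y Ys" "is_direct_sum \<Lambda> Z Zs"
  shows "is_direct_sum \<Lambda> X (Ys @ Zs)"
  using assms
proof (induction Ys arbitrary: X Y i p j q)
  case Nil
  interpret X: left_module \<Lambda> X using modsD Nil by blast
  interpret Y: left_module \<Lambda> Y using modsD Nil by blast
  interpret Z: left_module \<Lambda> Z using modsD Nil by blast
  note B = biprodD[OF Nil(4)]
  note cl = biprod_closed[OF Nil(4)]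
  interpret i: module_hom \<Lambda> Y X i by (intro module_homI X.left_module_axioms Y.left_module_axioms B)
  interpret j: module_hom \<Lambda> Z X j by (intro module_homI X.left_module_axioms Z.left_module_axioms B)
  interpret q: module_hom \<Lambda> X Z q by (intro module_homI X.left_module_axioms Z.left_module_axioms B)
  have Y0: "carrier Y = {\<zero>\<^bsub>Y\<^esub>}" using Nil is_direct_sum_Nil[OF Y.left_module_axioms] Y.M.zero_closed by blast
  have jq: "j (q x) = x" if x: "x \<in> carrier X" for x
    using B(9)[OF x] cl(2)[OF x] Y0 x by simp
  show ?case
  proof (cases Zs)
    case Nil': Nil
    then have "carrier Z = {\<zero>\<^bsub>Z\<^esub>}" using Nil is_direct_sum_Nil[OF Z.left_module_axioms] Z.M.zero_closed by blast
    then have "carrier X \<subseteq> {\<zero>\<^bsub>X\<^esub>}" using jq by (metis insertI1 j.zero q.closed singletonD subsetI)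
    then show ?thesis using Nil' is_direct_sum_Nil[OF X.left_module_axioms] by simp
  next
    case (Cons Z1 Zs')
    have lm: "\<And>Y'. Y' \<in> set (Z1 # Zs') \<Longrightarrow> left_module \<Lambda> Y'" using Nil(6) modsD(1) Cons by blast
    obtain U i' p' j' q' where U: "submod \<Lambda> Z U" "biprod \<Lambda> Z i' p' Z1 j' q' (Z\<lparr>carrier := U\<rparr>)"
      "is_direct_sum \<Lambda> (Z\<lparr>carrier := U\<rparr>) Zs'"
      by (rule is_direct_sum_ConsD[OF Z.left_module_axioms lm Nil(8)[unfolded Cons]])
    note C = biprodD[OF U(2)]
    note cl' = biprod_closed[OF U(2)]
    have "biprod \<Lambda> X (\<lambda>x. j (i' x)) (\<lambda>x. p' (q x)) Z1 (\<lambda>x. j (j' x)) (\<lambda>x. q' (q x)) (Z\<lparr>carrier := U\<rparr>)"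
      unfolding biprod_def using hom_comp[OF C(1) B(3)] hom_comp[OF B(4) C(2)] hom_comp[OF C(3) B(3)] hom_comp[OF B(4) C(4)]
        B(6) C(5-8) cl' cl jq j.add[symmetric] C(9) by auto
    then show ?thesis
      using is_direct_sum_ConsI[OF X.left_module_axioms Z.left_module_submod[OF U(1)] lm _ U(3)] Cons by simp
  qed
next
  case (Cons Y1 Ys)
  interpret X: left_module \<Lambda> X using modsD Cons by blast
  interpret Y: left_module \<Lambda> Y using modsD Cons by blast
  interpret Z: left_module \<Lambda> Z using modsD Cons by blast
  note B = biprodD[OF Cons.prems(4)]
  note cl = biprod_closed[OF Cons.prems(4)]
  have lm: "\<And>Y'. Y' \<in> set (Y1 # Ys) \<Longrightarrow> left_module \<Lambda> Y'" using Cons.prems(5) modsD(1) by blast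
  obtain U i' p' j' q' where U: "submod \<Lambda> Y U" "biprod \<Lambda> Y i' p' Y1 j' q' (Y\<lparr>carrier := U\<rparr>)"
    "is_direct_sum \<Lambda> (Y\<lparr>carrier := U\<rparr>) Ys"
    by (rule is_direct_sum_ConsD[OF Y.left_module_axioms lm Cons.prems(7)])
  note C = biprodD[OF U(2)]
  note cl' = biprod_closed[OF U(2)]
  let ?Y' = "Y\<lparr>carrier := U\<rparr>"
  have Y': "?Y' \<in> mods \<Lambda>" by (rule sub_mods[OF Cons.prems(2) U(1)])
  have Y1: "Y1 \<in> mods \<Lambda>" using Cons.prems(5) by simp
  interpret Y1: left_module \<Lambda> Y1 using modsD Y1 by blast
  interpret i: module_hom \<Lambda> Y X i by (intro module_homI X.left_module_axioms Y.left_module_axioms B)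
  interpret p: module_hom \<Lambda> X Y p by (intro module_homI X.left_module_axioms Y.left_module_axioms B)
  interpret p': module_hom \<Lambda> Y Y1 p' by (intro module_homI Y1.left_module_axioms Y.left_module_axioms C)
  have h: "(\<lambda>x. i (i' x)) \<in> mod_hom \<Lambda> Y1 X" "(\<lambda>x. p' (p x)) \<in> mod_hom \<Lambda> X Y1"
    by (rule hom_comp[OF C(1) B(1)], rule hom_comp[OF B(2) C(2)])
  have hh: "p' (p (i (i' y))) = y" if "y \<in> carrier Y1" for y using that B(5) C(5) cl' by simp
  note r = retract_biprod[OF X.left_module_axioms Y1.left_module_axioms h hh]
  let ?V = "{x \<in> carrier X. p' (p x) = \<zero>\<^bsub>Y1\<^esub>}"
  have V: "X\<lparr>carrier := ?V\<rparr> \<in> mods \<Lambda>" by (rule sub_mods[OF Cons.prems(1) r(1)])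
  have B': "biprod \<Lambda> (X\<lparr>carrier := ?V\<rparr>) (\<lambda>y. i (j' y)) (\<lambda>x. q' (p x)) ?Y' j q Z"
  proof -
    have 1: "(\<lambda>y. i (j' y)) \<in> mod_hom \<Lambda> ?Y' (X\<lparr>carrier := ?V\<rparr>)"
      using B(5) C(8) cl cl' by (intro hom_into_submod hom_comp[OF C(3) B(1)]) auto
    have 2: "(\<lambda>x. q' (p x)) \<in> mod_hom \<Lambda> (X\<lparr>carrier := ?V\<rparr>) ?Y'"
      by (intro hom_on_submod[OF _ r(1)] hom_comp[OF B(2) C(4)])
    have 3: "j \<in> mod_hom \<Lambda> Z (X\<lparr>carrier := ?V\<rparr>)"
      using B(8) cl by (intro hom_into_submod B(3)) auto
    have 4: "q \<in> mod_hom \<Lambda> (X\<lparr>carrier := ?V\<rparr>) Z" by (intro hom_on_submod[OF _ r(1)] B(4))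
    have 5: "i (j' (q' (p x))) \<oplus>\<^bsub>X\<^esub> j (q x) = x" if x: "x \<in> carrier X" "p' (p x) = \<zero>\<^bsub>Y1\<^esub>" for x
    proof -
      interpret i': module_hom \<Lambda> Y1 Y i' by (intro module_homI Y1.left_module_axioms Y.left_module_axioms C)
      have "j' (q' (p x)) = p x" using C(9)[OF cl(2)[OF x(1)]] x(2) cl'(3)[OF cl'(4)[OF cl(2)[OF x(1)]]] by simp
      then show ?thesis using B(9)[OF x(1)] by simp
    qed
    have 6: "q' (p (j z)) = \<zero>\<^bsub>Y\<^esub>" if "z \<in> carrier Z" for z
      using B(8)[OF that] module_hom.zero[OF module_homI[OF Y.left_module_axioms modsD(1)[OF Y'] C(4)]] by simp
    have 7: "q' (p (i (j' y))) = y" if "y \<in> U" for y using that B(5) C(6) cl' by simp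
    have 8: "q (i (j' y)) = \<zero>\<^bsub>Z\<^esub>" if "y \<in> U" for y using that B(7) cl' by simp
    show ?thesis unfolding biprod_def using 1 2 3 4 5 6 7 8 B(6) by simp
  qed
  have "is_direct_sum \<Lambda> (X\<lparr>carrier := ?V\<rparr>) (Ys @ Zs)"
    using Cons.prems by (intro Cons.IH[OF V Y' _ B' _ _ U(3)]) auto
  moreover have "\<And>Y'. Y' \<in> set (Y1 # Ys @ Zs) \<Longrightarrow> left_module \<Lambda> Y'"
    using Cons.prems(5,6) modsD(1) by auto
  ultimately have "is_direct_sum \<Lambda> X (Y1 # (Ys @ Zs))"
    by (intro is_direct_sum_ConsI[OF X.left_module_axioms modsD(1)[OF V] _ r(2)]) auto
  then show ?case by simp
qed

text \<open>A nonzero complement makes a summand strictly shorter over \<open>R\<close>, so repeated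
  splitting ends.\<close>

lemma decomposition_exists:
  "X \<in> \<E> \<Longrightarrow> \<exists>Xs. (\<forall>Y\<in>set Xs. ind Y) \<and> is_direct_sum \<Lambda> X Xs"
proof (induction "rl X (carrier X)" arbitrary: X rule: less_induct)
  case less
  note X = less.prems
  interpret X: left_module \<Lambda> X using E_lm X by blast
  show ?case
  proof (cases "carrier X = {\<zero>\<^bsub>X\<^esub>}")
    case True
    then show ?thesis using is_direct_sum_Nil[OF X.left_module_axioms] by (intro exI[of _ "[]"]) simp
  next
    case nz: False
    show ?thesis
    proof (cases "ind X")
      case True
      have "is_direct_sum \<Lambda> X [X]"
        unfolding is_direct_sum_def by (intro exI[of _ "\<lambda>_ x. x"]) (auto simp: hom_id lessThan_Suc)
      then show ?thesis using True by (intro exI[of _ "[X]"]) simp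
    next
      case False
      then obtain Y Z where YZ: "Y \<in> \<E>" "Z \<in> \<E>" "is_direct_sum \<Lambda> X [Y, Z]" "carrier Y \<noteq> {\<zero>\<^bsub>Y\<^esub>}" "carrier Z \<noteq> {\<zero>\<^bsub>Z\<^esub>}"
        using X nz unfolding indecomposable_def by blast
      interpret Y: left_module \<Lambda> Y using E_lm YZ by blast
      interpret Z: left_module \<Lambda> Z using E_lm YZ by blast
      obtain i p j q where b: "biprod \<Lambda> X i p Y j q Z"
        using YZ(3) is_direct_sum_two_iff[OF X.left_module_axioms Y.left_module_axioms Z.left_module_axioms] by blast
      have smaller: "rl Y (carrier Y) < rl X (carrier X)"
        if Y: "Y \<in> \<E>" "Z \<in> \<E>" "carrier Z \<noteq> {\<zero>\<^bsub>Z\<^esub>}" and b: "biprod \<Lambda> X i p Y j q Z" for Y Z i p j q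
      proof -
        note B = biprodD[OF b]
        note cl = biprod_closed[OF b]
        interpret i: module_hom R "res Y" "res X" i using Y X B by (intro module_homI left_module_res E_lm hom_res)
        interpret Z: left_module \<Lambda> Z using E_lm Y by blast
        have "inj_on i (carrier Y)" using B(5) by (metis inj_onI)
        then have eq: "rl X (i ` carrier Y) = rl Y (carrier Y)"
          using i.len_inj_image'[OF i.M.submod_carrier] finlen_mods[OF E_mods[OF Y(1)]] by simp
        obtain z where z: "z \<in> carrier Z" "z \<noteq> \<zero>\<^bsub>Z\<^esub>" using Y(3) Z.M.zero_closed by blast
        have "j z \<notin> i ` carrier Y" using B(6,7) z by (metis imageE)
        then have "i ` carrier Y \<subset> carrier X" using cl z(1) by blast
        then show ?thesis
          using eq len_strict[OF finlen_mods[OF E_mods[OF X] order_refl] _ _] i.submod_image[OF i.M.submod_carrier]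
            i.N.submod_carrier by (metis res_simps(1))
      qed
      obtain Ys where Ys: "\<forall>Y\<in>set Ys. ind Y" "is_direct_sum \<Lambda> Y Ys"
        using less.hyps[OF smaller[OF YZ(1,2,5) b] YZ(1)] by blast
      obtain Zs where Zs: "\<forall>Y\<in>set Zs. ind Y" "is_direct_sum \<Lambda> Z Zs"
        using less.hyps[OF smaller[OF YZ(2,1,4) biprod_swap[OF X.left_module_axioms b]] YZ(2)] by blast
      have "is_direct_sum \<Lambda> X (Ys @ Zs)"
        using Ys Zs indD(3) by (intro is_direct_sum_append[OF E_mods[OF X] E_mods[OF YZ(1)] E_mods[OF YZ(2)] b]) auto
      then show ?thesis using Ys Zs by (intro exI[of _ "Ys @ Zs"]) auto
    qed
  qed
qed

abbreviation cls :: "'a modobj \<Rightarrow> 'a modobj set" where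
  "cls \<equiv> iso_class \<Lambda> \<E>"

definition is_class :: "'a modobj \<Rightarrow> ('a modobj set \<Rightarrow>\<^sub>0 int) \<Rightarrow> bool" where
  "is_class X c \<longleftrightarrow> (\<exists>Xs. (\<forall>Y\<in>set Xs. ind Y) \<and> is_direct_sum \<Lambda> X Xs \<and> c = (\<Sum>Y\<leftarrow>Xs. frag_of (cls Y)))"

lemma is_class_keys: "is_class X c \<Longrightarrow> Poly_Mapping.keys c \<subseteq> cls ` {X. ind X}"
proof -
  have "Poly_Mapping.keys (\<Sum>Y\<leftarrow>Xs. frag_of (cls Y)) \<subseteq> cls ` set Xs" for Xs
  proof (induction Xs)
    case (Cons X Xs)
    then show ?case
      using keys_add[of "frag_of (cls X)" "\<Sum>Y\<leftarrow>Xs. frag_of (cls Y)"] by auto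
  qed simp
  then show "is_class X c \<Longrightarrow> Poly_Mapping.keys c \<subseteq> cls ` {X. ind X}"
    unfolding is_class_def by blast
qed

text \<open>Every summand isomorphic to \<open>W\<close> contributes \<open>mu W W\<close> to
  \<open>mu W X\<close> and every other summand contributes nothing. As \<open>mu W W\<close> is
  positive, the coefficients do not depend on the decomposition.\<close>

lemma is_class_lookup:
  assumes X: "X \<in> \<E>" and c: "is_class X c" and W: "ind W"
  shows "Poly_Mapping.lookup c (cls W) * int (mu W W) = int (mu W X)"
proof -
  obtain Xs where Xs: "\<forall>Y\<in>set Xs. ind Y" "is_direct_sum \<Lambda> X Xs" "c = (\<Sum>Y\<leftarrow>Xs. frag_of (cls Y))"
    using c unfolding is_class_def by blast
  have "Poly_Mapping.lookup (\<Sum>Y\<leftarrow>Xs. frag_of (cls Y)) (cls W) * int (mu W W) = int (\<Sum>Y\<leftarrow>Xs. mu W Y)"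
    using Xs(1)
  proof (induction Xs)
    case (Cons Y Ys)
    have "Poly_Mapping.lookup (frag_of (cls Y)) (cls W) * int (mu W W) = int (mu W Y)"
    proof (cases "mod_iso \<Lambda> W Y")
      case True
      then have "cls Y = cls W" using iso_class_eq_iff[of W Y] W Cons.prems indD(1) by simp
      then show ?thesis
        using additive_fn_iso[OF mu_additive[OF W] indD(3)[OF W] indD(3)] True Cons.prems by simp
    next
      case False
      then have "cls Y \<noteq> cls W" using iso_class_eq_iff[of W Y] W Cons.prems indD(1) by fastforce
      then show ?thesis using mu_other[OF W] False Cons.prems by (simp add: lookup_frag_of)
    qed
    then show ?case using Cons by (simp add: lookup_add algebra_simps)
  qed simp
  moreover have "mu W X = (\<Sum>Y\<leftarrow>Xs. mu W Y)"
    using Xs indD(3) by (intro additive_fn_sum[OF mu_additive[OF W] E_mods[OF X]]) auto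
  ultimately show ?thesis using Xs(3) by simp
qed

lemma is_class_unique:
  assumes "X \<in> \<E>" "is_class X c" "is_class X c'"
  shows "c = c'"
proof (rule poly_mapping_eqI)
  fix \<kappa>
  show "Poly_Mapping.lookup c \<kappa> = Poly_Mapping.lookup c' \<kappa>"
  proof (cases "\<kappa> \<in> cls ` {X. ind X}")
    case True
    then obtain W where W: "ind W" "\<kappa> = cls W" by blast
    have "Poly_Mapping.lookup c (cls W) * int (mu W W) = Poly_Mapping.lookup c' (cls W) * int (mu W W)"
      using is_class_lookup[OF assms(1,2) W(1)] is_class_lookup[OF assms(1,3) W(1)] by simp
    then show ?thesis using mu_self[OF W(1)] W(2) by simp
  next
    case False
    then have "\<kappa> \<notin> Poly_Mapping.keys c" "\<kappa> \<notin> Poly_Mapping.keys c'"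
      using is_class_keys[OF assms(2)] is_class_keys[OF assms(3)] by blast+
    then show ?thesis by (simp add: in_keys_iff)
  qed
qed

abbreviation kc :: "'a modobj \<Rightarrow> 'a modobj set \<Rightarrow>\<^sub>0 int" where
  "kc \<equiv> K0_class \<Lambda> \<E>"

lemma kc_eqI: "X \<in> \<E> \<Longrightarrow> is_class X c \<Longrightarrow> kc X = c"
  unfolding K0_class_def is_class_def[symmetric] using is_class_unique by (intro the_equality) auto

lemma kc_is_class: "X \<in> \<E> \<Longrightarrow> is_class X (kc X)"
  using decomposition_exists[of X] kc_eqI[of X] unfolding is_class_def by blast

lemma kc_keys: "X \<in> \<E> \<Longrightarrow> Poly_Mapping.keys (kc X) \<subseteq> cls ` {X. ind X}"
  using kc_is_class is_class_keys by blast

lemma kc_biprod: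
  assumes X: "X \<in> mods \<Lambda>" and Y: "Y \<in> \<E>" and Z: "Z \<in> \<E>" and b: "biprod \<Lambda> X i p Y j q Z"
  shows "kc X = kc Y + kc Z"
proof (rule kc_eqI)
  show XE: "X \<in> \<E>" by (rule E_sum[OF X Y Z b])
  obtain Ys where Ys: "\<forall>Y\<in>set Ys. ind Y" "is_direct_sum \<Lambda> Y Ys" "kc Y = (\<Sum>Y\<leftarrow>Ys. frag_of (cls Y))"
    using kc_is_class[OF Y] unfolding is_class_def by blast
  obtain Zs where Zs: "\<forall>Y\<in>set Zs. ind Y" "is_direct_sum \<Lambda> Z Zs" "kc Z = (\<Sum>Y\<leftarrow>Zs. frag_of (cls Y))"
    using kc_is_class[OF Z] unfolding is_class_def by blast
  have "is_direct_sum \<Lambda> X (Ys @ Zs)"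
    using Ys Zs indD(3) by (intro is_direct_sum_append[OF X E_mods[OF Y] E_mods[OF Z] b]) auto
  then show "is_class X (kc Y + kc Z)"
    unfolding is_class_def using Ys Zs by (intro exI[of _ "Ys @ Zs"]) auto
qed

text \<open>An additive function on objects extends to the split Grothendieck group; its values are
  encoded in the free abelian group on one generator.\<close>

definition ext_fn :: "('a modobj \<Rightarrow> nat) \<Rightarrow> ('a modobj set \<Rightarrow>\<^sub>0 int) \<Rightarrow> unit \<Rightarrow>\<^sub>0 int" where
  "ext_fn d = frag_extend (\<lambda>\<kappa>. frag_cmul (int (d (SOME X. X \<in> \<E> \<and> cls X = \<kappa>))) (frag_of ()))"

lemma ext_fn_kc:
  assumes d: "additive_fn d" and X: "X \<in> \<E>"
  shows "ext_fn d (kc X) = frag_cmul (int (d X)) (frag_of ())"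
proof -
  obtain Xs where Xs: "\<forall>Y\<in>set Xs. ind Y" "is_direct_sum \<Lambda> X Xs" "kc X = (\<Sum>Y\<leftarrow>Xs. frag_of (cls Y))"
    using kc_is_class[OF X] unfolding is_class_def by blast
  have "ext_fn d (\<Sum>Y\<leftarrow>Xs. frag_of (cls Y)) = frag_cmul (int (\<Sum>Y\<leftarrow>Xs. d Y)) (frag_of ())"
    using Xs(1)
  proof (induction Xs)
    case Nil
    then show ?case by (simp add: ext_fn_def)
  next
    case (Cons Y Ys)
    \<comment> \<open>The representative chosen in \<open>ext_fn\<close> may differ from
      \<open>Y\<close>, but it is isomorphic to \<open>Y\<close>, and \<open>d\<close> cannot tell
      them apart.\<close>
    let ?Y = "SOME Z. Z \<in> \<E> \<and> cls Z = cls Y"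
    have "?Y \<in> \<E> \<and> cls ?Y = cls Y" by (rule someI[of _ Y]) (use Cons.prems indD in auto)
    then have "d ?Y = d Y"
      using iso_class_eq_iff[of ?Y Y] Cons.prems indD by (intro additive_fn_iso[OF d] E_mods) auto
    then show ?case using Cons by (simp add: ext_fn_def frag_extend_add frag_cmul_distrib)
  qed
  moreover have "d X = (\<Sum>Y\<leftarrow>Xs. d Y)"
    using Xs indD(3) by (intro additive_fn_sum[OF d E_mods[OF X]]) auto
  ultimately show ?thesis using Xs(3) by simp
qed

end

section \<open>Pullbacks and pushouts of short exact sequences\<close>

context artin
begin

lemma short_exactI:
  assumes "f \<in> mod_hom \<Lambda> X Y" "g \<in> mod_hom \<Lambda> Y Z" "inj_on f (carrier X)" "g ` carrier Y = carrier Z"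
    "\<And>y. y \<in> carrier Y \<Longrightarrow> g y = \<zero>\<^bsub>Z\<^esub> \<Longrightarrow> y \<in> f ` carrier X" "\<And>x. x \<in> carrier X \<Longrightarrow> g (f x) = \<zero>\<^bsub>Z\<^esub>"
  shows "short_exact \<Lambda> X f Y g Z"
  using assms hom_closed[OF assms(1)] unfolding short_exact_def a_kernel_def' by blast

text \<open>The pullback \<open>K\<close> is the kernel of the difference map \<open>d\<close> on
  the biproduct of \<open>W\<close> and \<open>Y\<close>. This yields two exact sequences at once:
  the one pulled back to \<open>W\<close>, and the one that presents \<open>Z\<close> as a quotient
  of the biproduct by \<open>K\<close>.\<close>

lemma pullback:
  assumes XYZ: "X \<in> mods \<Lambda>" "Y \<in> mods \<Lambda>" "Z \<in> mods \<Lambda>" and W: "W \<in> mods \<Lambda>"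
    and ex: "short_exact \<Lambda> X f Y g Z" and h: "h \<in> mod_hom \<Lambda> W Z"
  obtains S i p j q K f' d where "S \<in> mods \<Lambda>" "biprod \<Lambda> S i p W j q Y" "submod \<Lambda> S K"
    "K = {s \<in> carrier S. h (p s) = g (q s)}" "short_exact \<Lambda> X f' (S\<lparr>carrier := K\<rparr>) p W"
    "d \<in> mod_hom \<Lambda> S Z" "short_exact \<Lambda> (S\<lparr>carrier := K\<rparr>) (\<lambda>x. x) S d Z"
    "\<And>s. s \<in> carrier S \<Longrightarrow> d s = h (p s) \<ominus>\<^bsub>Z\<^esub> g (q s)"
proof -
  note E = short_exactD[OF ex]
  obtain S i p j q where S: "S \<in> mods \<Lambda>" and b: "biprod \<Lambda> S i p W j q Y" by (rule sum_mods[OF W XYZ(2)])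
  note B = biprodD[OF b] and cl = biprod_closed[OF b]
  interpret S: left_module \<Lambda> S using modsD S by blast
  interpret Y: left_module \<Lambda> Y using modsD XYZ by blast
  interpret Z: left_module \<Lambda> Z using modsD XYZ by blast
  interpret g: module_hom \<Lambda> Y Z g by (intro module_homI modsD XYZ E)
  interpret f: module_hom \<Lambda> X Y f by (intro module_homI modsD XYZ E)
  interpret h: module_hom \<Lambda> W Z h by (intro module_homI modsD XYZ W h)
  interpret p: module_hom \<Lambda> S W p by (intro module_homI modsD S W B)
  interpret q: module_hom \<Lambda> S Y q by (intro module_homI modsD S XYZ B)
  define d where "d s = h (p s) \<ominus>\<^bsub>Z\<^esub> g (q s)" for s
  have d: "d \<in> mod_hom \<Lambda> S Z"
    unfolding d_def by (intro hom_diff Z.left_module_axioms hom_comp[OF B(2) h] hom_comp[OF B(4) E(2)])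
  interpret d: module_hom \<Lambda> S Z d by (intro module_homI modsD S XYZ d)
  define K where "K = {s \<in> carrier S. h (p s) = g (q s)}"
  have dK: "s \<in> carrier S \<Longrightarrow> d s = \<zero>\<^bsub>Z\<^esub> \<longleftrightarrow> s \<in> K" for s
    by (auto simp: d_def K_def Z.diff_zero_iff)
  then have K_eq: "{s \<in> carrier S. d s = \<zero>\<^bsub>Z\<^esub>} = K" by (auto simp: K_def)
  have K: "submod \<Lambda> S K" using d.submod_ker unfolding K_eq .
  show thesis
  proof (rule that[OF S b K K_def _ d])
    show "short_exact \<Lambda> X (\<lambda>x. j (f x)) (S\<lparr>carrier := K\<rparr>) p W"
    proof (rule short_exactI)
      show "(\<lambda>x. j (f x)) \<in> mod_hom \<Lambda> X (S\<lparr>carrier := K\<rparr>)"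
        using B(6,8) cl E(6) by (intro hom_into_submod hom_comp[OF E(1) B(3)]) (auto simp: K_def)
      show "p \<in> mod_hom \<Lambda> (S\<lparr>carrier := K\<rparr>) W" by (rule hom_on_submod[OF B(2) K])
      show "inj_on (\<lambda>x. j (f x)) (carrier X)"
        using E(3) B(6) f.closed by (metis (no_types, lifting) inj_on_def)
      show "p ` carrier (S\<lparr>carrier := K\<rparr>) = carrier W"
      proof
        show "p ` carrier (S\<lparr>carrier := K\<rparr>) \<subseteq> carrier W" using submodD(5)[OF K] by auto
        show "carrier W \<subseteq> p ` carrier (S\<lparr>carrier := K\<rparr>)"
        proof
          fix w assume w: "w \<in> carrier W"
          then obtain y where y: "y \<in> carrier Y" "g y = h w" using E(4) h.closed by (metis imageE)
          have "p (i w \<oplus>\<^bsub>S\<^esub> j y) = w" "q (i w \<oplus>\<^bsub>S\<^esub> j y) = y"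
            using w y cl B by (simp_all add: p.add q.add)
          then show "w \<in> p ` carrier (S\<lparr>carrier := K\<rparr>)"
            using w y cl by (intro image_eqI[of _ _ "i w \<oplus>\<^bsub>S\<^esub> j y"]) (simp_all add: K_def)
        qed
      qed
      show "y \<in> (\<lambda>x. j (f x)) ` carrier X" if "y \<in> carrier (S\<lparr>carrier := K\<rparr>)" "p y = \<zero>\<^bsub>W\<^esub>" for y
      proof -
        have y: "y \<in> carrier S" "g (q y) = \<zero>\<^bsub>Z\<^esub>" using that by (auto simp: K_def)
        then obtain x where x: "x \<in> carrier X" "q y = f x" using E(5)[of "q y"] by auto
        interpret i: module_hom \<Lambda> W S i by (intro module_homI modsD S W B)
        have "y = j (q y)" using B(9)[OF y(1)] that(2) cl(3)[OF q.closed[OF y(1)]] by simp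
        then show ?thesis using x by auto
      qed
      show "p (j (f x)) = \<zero>\<^bsub>W\<^esub>" if "x \<in> carrier X" for x using that B(8) by simp
    qed
    show "short_exact \<Lambda> (S\<lparr>carrier := K\<rparr>) (\<lambda>x. x) S d Z"
    proof (rule short_exactI[OF hom_inclusion[OF K] d])
      show "d ` carrier S = carrier Z"
      proof
        show "carrier Z \<subseteq> d ` carrier S"
        proof
          fix z assume z: "z \<in> carrier Z"
          \<comment> \<open>The sign is forced by \<open>d\<close>, which restricts to
            \<open>-g\<close> on the summand \<open>Y\<close>.\<close>
          then obtain y where y: "y \<in> carrier Y" "g y = \<ominus>\<^bsub>Z\<^esub> z" using E(4) by (metis imageE Z.M.a_inv_closed)
          then have "d (j y) = z" using z B(6,8) by (simp add: d_def a_minus_def)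
          then show "z \<in> d ` carrier S" using cl(3)[OF y(1)] by blast
        qed
      qed auto
    qed (use dK submodD(5)[OF K] in auto)
  qed (simp add: d_def)
qed

text \<open>The pushout is the biproduct of \<open>V\<close> and \<open>Y\<close> modulo the image
  of \<open>e\<close>, the antidiagonal copy of \<open>X\<close>. Injectivity of \<open>f\<close> is
  what keeps \<open>V\<close> embedded.\<close>

lemma pushout:
  assumes XYZ: "X \<in> mods \<Lambda>" "Y \<in> mods \<Lambda>" "Z \<in> mods \<Lambda>" and V: "V \<in> mods \<Lambda>"
    and ex: "short_exact \<Lambda> X f Y g Z" and u: "u \<in> mod_hom \<Lambda> X V"
  obtains P a b c where "P \<in> mods \<Lambda>" "a \<in> mod_hom \<Lambda> V P" "b \<in> mod_hom \<Lambda> Y P"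
    "short_exact \<Lambda> V a P c Z" "\<And>x. x \<in> carrier X \<Longrightarrow> b (f x) = a (u x)" "\<And>y. y \<in> carrier Y \<Longrightarrow> c (b y) = g y"
proof -
  note E = short_exactD[OF ex]
  obtain S i p j q where S: "S \<in> mods \<Lambda>" and b: "biprod \<Lambda> S i p V j q Y" by (rule sum_mods[OF V XYZ(2)])
  note B = biprodD[OF b] and cl = biprod_closed[OF b]
  interpret S: left_module \<Lambda> S using modsD S by blast
  interpret X: left_module \<Lambda> X using modsD XYZ by blast
  interpret Y: left_module \<Lambda> Y using modsD XYZ by blast
  interpret Z: left_module \<Lambda> Z using modsD XYZ by blast
  interpret V: left_module \<Lambda> V using modsD V by blast
  interpret g: module_hom \<Lambda> Y Z g by (intro module_homI modsD XYZ E)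
  interpret f: module_hom \<Lambda> X Y f by (intro module_homI modsD XYZ E)
  interpret u: module_hom \<Lambda> X V u by (intro module_homI modsD XYZ V u)
  interpret p: module_hom \<Lambda> S V p by (intro module_homI modsD S V B)
  interpret q: module_hom \<Lambda> S Y q by (intro module_homI modsD S XYZ B)
  interpret i: module_hom \<Lambda> V S i by (intro module_homI modsD S V B)
  define e where "e x = i (u x) \<ominus>\<^bsub>S\<^esub> j (f x)" for x
  have e: "e \<in> mod_hom \<Lambda> X S"
    unfolding e_def by (intro hom_diff S.left_module_axioms hom_comp[OF u B(1)] hom_comp[OF E(1) B(3)])
  interpret e: module_hom \<Lambda> X S e by (intro module_homI modsD S XYZ e)
  have pe: "p (e x) = u x" "q (e x) = \<ominus>\<^bsub>Y\<^esub> f x" if "x \<in> carrier X" for x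
    using that B cl by (simp_all add: e_def p.diff q.diff) (simp add: a_minus_def)
  obtain P \<pi> where P: "P \<in> mods \<Lambda>" "\<pi> \<in> mod_hom \<Lambda> S P" "\<pi> ` carrier S = carrier P"
    "\<And>x. x \<in> carrier S \<Longrightarrow> \<pi> x = \<zero>\<^bsub>P\<^esub> \<longleftrightarrow> x \<in> e ` carrier X"
    by (rule quo_mods[OF S e.submod_image[OF X.submod_carrier]]) (rule that)
  interpret \<pi>: module_hom \<Lambda> S P \<pi> by (intro module_homI modsD S P)
  have kill: "g (q s) = \<zero>\<^bsub>Z\<^esub>" if s: "s \<in> carrier S" "\<pi> s = \<zero>\<^bsub>P\<^esub>" for s
  proof -
    obtain x where x: "x \<in> carrier X" "s = e x" using P(4) s by blast
    show ?thesis using pe[OF x(1)] x E(6)[OF x(1)] by (simp add: g.neg)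
  qed
  obtain c where c: "c \<in> mod_hom \<Lambda> P Z" "\<And>s. s \<in> carrier S \<Longrightarrow> c (\<pi> s) = g (q s)"
    using hom_factor_surj[OF S.left_module_axioms modsD(1)[OF P(1)] Z.left_module_axioms P(2,3) hom_comp[OF B(4) E(2)] kill]
    by blast
  have bf: "\<pi> (j (f x)) = \<pi> (i (u x))" if x: "x \<in> carrier X" for x
    using P(4)[of "e x"] x cl \<pi>.eq_iff[of "i (u x)" "j (f x)"] by (simp add: e_def)
  show thesis
  proof (rule that[OF P(1) hom_comp[OF B(1) P(2)] hom_comp[OF B(3) P(2)]])
    show "short_exact \<Lambda> V (\<lambda>v. \<pi> (i v)) P c Z"
    proof (rule short_exactI[OF hom_comp[OF B(1) P(2)] c(1)])
      interpret a: module_hom \<Lambda> V P "\<lambda>v. \<pi> (i v)" by (intro module_homI modsD V P hom_comp[OF B(1) P(2)])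
      show "inj_on (\<lambda>v. \<pi> (i v)) (carrier V)"
      proof (rule a.inj_onI_ker)
        fix v assume v: "v \<in> carrier V" "\<pi> (i v) = \<zero>\<^bsub>P\<^esub>"
        then obtain x where x: "x \<in> carrier X" "i v = e x" using P(4)[of "i v"] cl by auto
        have "\<ominus>\<^bsub>Y\<^esub> f x = \<zero>\<^bsub>Y\<^esub>" using pe(2)[OF x(1)] x(2) B(7)[OF v(1)] by simp
        then have "f x = \<zero>\<^bsub>Y\<^esub>" using x(1) Y.M.l_neg[of "f x"] by simp
        then have "x = \<zero>\<^bsub>X\<^esub>" using f.inj_onD_ker[OF E(3) x(1)] by simp
        then show "v = \<zero>\<^bsub>V\<^esub>" using pe(1)[OF x(1)] x(2) B(5)[OF v(1)] by simp
      qed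
      show "c ` carrier P = carrier Z"
      proof
        show "c ` carrier P \<subseteq> carrier Z" using hom_closed[OF c(1)] by blast
        show "carrier Z \<subseteq> c ` carrier P"
        proof
          fix z assume "z \<in> carrier Z"
          then obtain y where y: "y \<in> carrier Y" "z = g y" using E(4) by blast
          then have "c (\<pi> (j y)) = z" using c(2) cl B(6) by simp
          then show "z \<in> c ` carrier P" using cl(3)[OF y(1)] by (metis \<pi>.closed imageI)
        qed
      qed
      show "t \<in> (\<lambda>v. \<pi> (i v)) ` carrier V" if t: "t \<in> carrier P" "c t = \<zero>\<^bsub>Z\<^esub>" for t
      proof -
        obtain s where s: "s \<in> carrier S" "t = \<pi> s" using P(3) t(1) by blast
        then have "g (q s) = \<zero>\<^bsub>Z\<^esub>" using c(2) t(2) by simp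
        then obtain x where x: "x \<in> carrier X" "q s = f x" using E(5)[of "q s"] s by auto
        have "\<pi> s = \<pi> (i (p s) \<oplus>\<^bsub>S\<^esub> j (f x))" using B(9)[OF s(1)] x(2) by simp
        also have "\<dots> = \<pi> (i (p s)) \<oplus>\<^bsub>P\<^esub> \<pi> (i (u x))" using s x cl bf by (simp add: \<pi>.add)
        also have "\<dots> = \<pi> (i (p s \<oplus>\<^bsub>V\<^esub> u x))" using s x cl by (simp add: \<pi>.add i.add)
        finally show ?thesis using s x by (intro image_eqI[of _ _ "p s \<oplus>\<^bsub>V\<^esub> u x"]) simp_all
      qed
      show "c (\<pi> (i v)) = \<zero>\<^bsub>Z\<^esub>" if "v \<in> carrier V" for v using that c(2) cl B(7) by simp
    qed
    show "c (\<pi> (j y)) = g y" if "y \<in> carrier Y" for y using that c(2) cl B(6) by simp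
  qed (rule bf)
qed

lemma split_epi_biprod:
  assumes XYZ: "X \<in> mods \<Lambda>" "Y \<in> mods \<Lambda>" "Z \<in> mods \<Lambda>"
    and ex: "short_exact \<Lambda> X f Y g Z" and s: "s \<in> mod_hom \<Lambda> Z Y" "\<And>z. z \<in> carrier Z \<Longrightarrow> g (s z) = z"
  obtains r where "biprod \<Lambda> Y f r X s g Z"
proof -
  note E = short_exactD[OF ex]
  interpret X: left_module \<Lambda> X using modsD XYZ by blast
  interpret Y: left_module \<Lambda> Y using modsD XYZ by blast
  interpret Z: left_module \<Lambda> Z using modsD XYZ by blast
  interpret g: module_hom \<Lambda> Y Z g by (intro module_homI modsD XYZ E)
  interpret f: module_hom \<Lambda> X Y f by (intro module_homI modsD XYZ E)
  interpret s: module_hom \<Lambda> Z Y s by (intro module_homI modsD XYZ s)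
  have "(\<lambda>y. y \<ominus>\<^bsub>Y\<^esub> s (g y)) \<in> mod_hom \<Lambda> Y Y"
    by (intro hom_diff Y.left_module_axioms hom_id hom_comp[OF E(2) s(1)])
  moreover have "y \<ominus>\<^bsub>Y\<^esub> s (g y) \<in> f ` carrier X" if "y \<in> carrier Y" for y
    using that E(5)[of "y \<ominus>\<^bsub>Y\<^esub> s (g y)"] s(2)[of "g y"] by (simp add: g.diff Z.diff_zero_iff)
  ultimately obtain r where r: "r \<in> mod_hom \<Lambda> Y X" "\<And>y. y \<in> carrier Y \<Longrightarrow> f (r y) = y \<ominus>\<^bsub>Y\<^esub> s (g y)"
    using hom_factor_inj[OF X.left_module_axioms Y.left_module_axioms Y.left_module_axioms E(1,3)] by blast
  have rf: "r (f x) = x" if x: "x \<in> carrier X" for x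
    using r(2)[of "f x"] E(6)[OF x] x hom_closed[OF r(1), of "f x"] inj_onD[OF E(3), of "r (f x)" x] by simp
  have rs: "r (s z) = \<zero>\<^bsub>X\<^esub>" if z: "z \<in> carrier Z" for z
    using r(2)[of "s z"] z s(2)[OF z] hom_closed[OF r(1), of "s z"] f.inj_onD_ker[OF E(3)] by (simp add: Y.diff_zero_iff)
  have "biprod \<Lambda> Y f r X s g Z"
    unfolding biprod_def using E r s rf rs Y.diff_add[of _ "s (g _)"] by simp
  then show thesis using that by blast
qed

text \<open>The map \<open>1 - f r\<close> kills the image of \<open>f\<close>, which is the kernel
  of \<open>g\<close>, so it factors through \<open>g\<close> and the factor is a section.\<close>

lemma split_mono_imp_split_epi:
  assumes XYZ: "X \<in> mods \<Lambda>" "Y \<in> mods \<Lambda>" "Z \<in> mods \<Lambda>"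
    and ex: "short_exact \<Lambda> X f Y g Z" and r: "r \<in> mod_hom \<Lambda> Y X" "\<And>x. x \<in> carrier X \<Longrightarrow> r (f x) = x"
  obtains s where "s \<in> mod_hom \<Lambda> Z Y" "\<And>z. z \<in> carrier Z \<Longrightarrow> g (s z) = z"
proof -
  note E = short_exactD[OF ex]
  interpret Y: left_module \<Lambda> Y using modsD XYZ by blast
  interpret Z: left_module \<Lambda> Z using modsD XYZ by blast
  interpret g: module_hom \<Lambda> Y Z g by (intro module_homI modsD XYZ E)
  interpret f: module_hom \<Lambda> X Y f by (intro module_homI modsD XYZ E)
  interpret r: module_hom \<Lambda> Y X r by (intro module_homI modsD XYZ r)
  have "(\<lambda>y. y \<ominus>\<^bsub>Y\<^esub> f (r y)) \<in> mod_hom \<Lambda> Y Y"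
    by (intro hom_diff Y.left_module_axioms hom_id hom_comp[OF r(1) E(1)])
  moreover have "y \<ominus>\<^bsub>Y\<^esub> f (r y) = \<zero>\<^bsub>Y\<^esub>" if y: "y \<in> carrier Y" "g y = \<zero>\<^bsub>Z\<^esub>" for y
  proof -
    obtain x where "x \<in> carrier X" "y = f x" using E(5)[OF y(1)] y(2) by auto
    then show ?thesis using r(2) Y.diff_zero_iff by simp
  qed
  ultimately obtain s where s: "s \<in> mod_hom \<Lambda> Z Y" "\<And>y. y \<in> carrier Y \<Longrightarrow> s (g y) = y \<ominus>\<^bsub>Y\<^esub> f (r y)"
    using hom_factor_surj[OF Y.left_module_axioms Z.left_module_axioms Y.left_module_axioms E(2,4)] by blast
  have "g (s z) = z" if z: "z \<in> carrier Z" for z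
  proof -
    obtain y where y: "y \<in> carrier Y" "z = g y" using E(4) z by blast
    have "g (s z) = g y \<ominus>\<^bsub>Z\<^esub> g (f (r y))" using y s(2) by (simp add: g.diff)
    then show ?thesis using y E(6)[of "r y"] by simp
  qed
  then show thesis using that s(1) by blast
qed

section \<open>Factoring through a fixed map, tested on direct summands\<close>

definition fac :: "'a modobj \<Rightarrow> ('a list \<Rightarrow> 'a list) \<Rightarrow> 'a modobj \<Rightarrow> ('a list \<Rightarrow> 'a list) \<Rightarrow> bool" where
  "fac V h D d \<longleftrightarrow> (\<exists>k\<in>mod_hom \<Lambda> V D. \<forall>x\<in>carrier V. h x = d (k x))"

lemma facI: "k \<in> mod_hom \<Lambda> V D \<Longrightarrow> (\<And>x. x \<in> carrier V \<Longrightarrow> h x = d (k x)) \<Longrightarrow> fac V h D d"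
  unfolding fac_def by blast

lemma facE: assumes "fac V h D d" obtains k where "k \<in> mod_hom \<Lambda> V D" "\<And>x. x \<in> carrier V \<Longrightarrow> h x = d (k x)"
  using assms unfolding fac_def by blast

lemma fac_direct_sum:
  assumes "V \<in> mods \<Lambda>" "D \<in> mods \<Lambda>" "Z \<in> mods \<Lambda>" "d \<in> mod_hom \<Lambda> D Z"
    and "set Ys \<subseteq> mods \<Lambda>" "is_direct_sum \<Lambda> V Ys" "h \<in> mod_hom \<Lambda> V Z"
    and "\<And>Y s. Y \<in> set Ys \<Longrightarrow> s \<in> mod_hom \<Lambda> Y V \<Longrightarrow> fac Y (\<lambda>x. h (s x)) D d"
  shows "fac V h D d"
  using assms(1,5-8)
proof (induction Ys arbitrary: V h)
  case Nil
  interpret V: left_module \<Lambda> V using modsD Nil by blast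
  interpret D: left_module \<Lambda> D using modsD assms by blast
  interpret h: module_hom \<Lambda> V Z h using Nil assms by (intro module_homI modsD)
  interpret d: module_hom \<Lambda> D Z d using assms by (intro module_homI modsD)
  have "carrier V \<subseteq> {\<zero>\<^bsub>V\<^esub>}" using Nil is_direct_sum_Nil[OF V.left_module_axioms] by blast
  then show ?case using hom_zero[OF D.left_module_axioms] by (intro facI[where k = "\<lambda>_. \<zero>\<^bsub>D\<^esub>"]) auto
next
  case (Cons Y Ys)
  have lm: "\<And>Y'. Y' \<in> set (Y # Ys) \<Longrightarrow> left_module \<Lambda> Y'" using Cons.prems(2) modsD(1) by blast
  obtain U i p j q where U: "submod \<Lambda> V U" "biprod \<Lambda> V i p Y j q (V\<lparr>carrier := U\<rparr>)"
    "is_direct_sum \<Lambda> (V\<lparr>carrier := U\<rparr>) Ys"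
    by (rule is_direct_sum_ConsD[OF modsD(1)[OF Cons.prems(1)] lm Cons.prems(3)])
  have Um: "V\<lparr>carrier := U\<rparr> \<in> mods \<Lambda>" by (rule sub_mods[OF Cons.prems(1) U(1)])
  note B = biprodD[OF U(2)] and cl = biprod_closed[OF U(2)]
  interpret V: left_module \<Lambda> V using modsD Cons.prems by blast
  interpret D: left_module \<Lambda> D using modsD assms by blast
  interpret h: module_hom \<Lambda> V Z h using Cons.prems assms by (intro module_homI modsD)
  interpret d: module_hom \<Lambda> D Z d using assms by (intro module_homI modsD)
  have "fac (V\<lparr>carrier := U\<rparr>) (\<lambda>x. h (j x)) D d"
  proof (rule Cons.IH[OF Um _ U(3) hom_comp[OF B(3) Cons.prems(4)]])
    show "fac Y' (\<lambda>x. h (j (s x))) D d" if "Y' \<in> set Ys" "s \<in> mod_hom \<Lambda> Y' (V\<lparr>carrier := U\<rparr>)" for Y' s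
      using that Cons.prems(5)[OF _ hom_comp[OF that(2) B(3)]] by simp
  qed (use Cons.prems in simp)
  then obtain k1 where k1: "k1 \<in> mod_hom \<Lambda> (V\<lparr>carrier := U\<rparr>) D" "\<And>x. x \<in> U \<Longrightarrow> h (j x) = d (k1 x)"
    by (rule facE) simp
  obtain k2 where k2: "k2 \<in> mod_hom \<Lambda> Y D" "\<And>x. x \<in> carrier Y \<Longrightarrow> h (i x) = d (k2 x)"
    using Cons.prems(5)[OF _ B(1)] by (auto elim: facE)
  show ?case
  proof (rule facI)
    show "(\<lambda>x. k2 (p x) \<oplus>\<^bsub>D\<^esub> k1 (q x)) \<in> mod_hom \<Lambda> V D"
      by (intro hom_add D.left_module_axioms hom_comp[OF B(2) k2(1)] hom_comp[OF B(4) k1(1)])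
    fix x assume x: "x \<in> carrier V"
    have "h x = h (i (p x) \<oplus>\<^bsub>V\<^esub> j (q x))" using B(9)[OF x] by simp
    also have "\<dots> = d (k2 (p x)) \<oplus>\<^bsub>Z\<^esub> d (k1 (q x))" using x cl k1(2) k2(2) by (simp add: h.add)
    also have "\<dots> = d (k2 (p x) \<oplus>\<^bsub>D\<^esub> k1 (q x))"
      using x cl hom_closed[OF k2(1), of "p x"] hom_closed[OF k1(1), of "q x"] by (simp add: d.add)
    finally show "h x = d (k2 (p x) \<oplus>\<^bsub>D\<^esub> k1 (q x))" .
  qed
qed

end

section \<open>Finite type implies that conflations are generated by Auslander--Reiten conflations\<close>

locale exact_subcat = subcat R \<Lambda> \<E>
  for R :: "('r, 'k) ring_scheme" and \<Lambda> :: "('r, 'a) module" and \<E> :: "'a modobj set" +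
  assumes extension: "extension_closed \<Lambda> \<E>"
begin

lemma E_ext: "X \<in> \<E> \<Longrightarrow> Z \<in> \<E> \<Longrightarrow> Y \<in> mods \<Lambda> \<Longrightarrow> short_exact \<Lambda> X f Y g Z \<Longrightarrow> Y \<in> \<E>"
  using extension unfolding extension_closed_def by blast

lemma kc_zero: "Z \<in> mods \<Lambda> \<Longrightarrow> carrier Z = {\<zero>\<^bsub>Z\<^esub>} \<Longrightarrow> kc Z = 0"
proof -
  assume Z: "Z \<in> mods \<Lambda>" "carrier Z = {\<zero>\<^bsub>Z\<^esub>}"
  interpret Z: left_module \<Lambda> Z using modsD Z by blast
  have b: "biprod \<Lambda> Z (\<lambda>x. x) (\<lambda>x. x) Z (\<lambda>x. x) (\<lambda>x. x) Z"
    using Z(2) by (auto simp: biprod_def hom_id)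
  show ?thesis using kc_biprod[OF Z(1) E_zero[OF Z] E_zero[OF Z] b] by simp
qed

lemma kc_iso:
  assumes X: "X \<in> \<E>" and Y: "Y \<in> mods \<Lambda>" and iso: "mod_iso \<Lambda> X Y"
  shows "kc X = kc Y"
proof -
  obtain f where f: "f \<in> mod_hom \<Lambda> X Y" "bij_betw f (carrier X) (carrier Y)" using iso unfolding mod_iso_def by blast
  have YE: "Y \<in> \<E>" by (rule E_iso[OF X Y f])
  obtain Z where Z: "Z \<in> mods \<Lambda>" "carrier Z = {\<zero>\<^bsub>Z\<^esub>}" by (rule zero_mods)
  interpret Z: left_module \<Lambda> Z using modsD Z by blast
  interpret X: left_module \<Lambda> X using E_lm X by blast
  obtain u where u: "u \<in> mod_hom \<Lambda> Y X" "\<forall>y\<in>carrier Y. f (u y) = y" "\<forall>x\<in>carrier X. u (f x) = x"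
    using hom_inverse[OF E_lm[OF X] modsD(1)[OF Y] f] by blast
  interpret f: module_hom \<Lambda> X Y f by (intro module_homI modsD(1)[OF Y] E_lm[OF X] f(1))
  have "biprod \<Lambda> X u f Y (\<lambda>_. \<zero>\<^bsub>X\<^esub>) (\<lambda>_. \<zero>\<^bsub>Z\<^esub>) Z"
    unfolding biprod_def using u f(1) Z(2) hom_zero[OF X.left_module_axioms, of Z] hom_zero[OF Z.left_module_axioms, of X]
    by (auto simp: hom_closed[OF u(1)])
  from kc_biprod[OF E_mods[OF X] YE E_zero[OF Z] this] show ?thesis using kc_zero[OF Z] by simp
qed

text \<open>A right almost split deflation that is also right minimal has a left almost split
  inflation. The maps out of \<open>X\<close> are tested by pushing the conflation out along them,
  which stays inside \<open>\<E>\<close> because \<open>\<E>\<close> is closed under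
  extensions.\<close>

lemma AR_conflation_of_minimal:
  assumes con: "conflation \<Lambda> \<E> X f K g W" and W: "ind W"
    and ns: "\<And>s. s \<in> mod_hom \<Lambda> W K \<Longrightarrow> \<not> (\<forall>w\<in>carrier W. g (s w) = w)"
    and ras: "\<And>V h. V \<in> \<E> \<Longrightarrow> h \<in> radical \<Lambda> V W \<Longrightarrow> fac V h K g"
    and minimal: "\<And>\<theta>. \<theta> \<in> mod_hom \<Lambda> K K \<Longrightarrow> (\<And>x. x \<in> carrier K \<Longrightarrow> g (\<theta> x) = g x) \<Longrightarrow> inj_on \<theta> (carrier K)"
  shows "AR_conflation \<Lambda> \<E> X f K g W"
proof -
  have XKW: "X \<in> \<E>" "K \<in> \<E>" "W \<in> \<E>" and ex: "short_exact \<Lambda> X f K g W" using con by (auto simp: conflation_def)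
  note E = short_exactD[OF ex]
  note M = E_mods[OF XKW(1)] E_mods[OF XKW(2)] E_mods[OF XKW(3)]
  interpret X: left_module \<Lambda> X by (rule modsD(1)[OF M(1)])
  interpret K: left_module \<Lambda> K by (rule modsD(1)[OF M(2)])
  interpret f: module_hom \<Lambda> X K f by (intro module_homI modsD M E)
  interpret g: module_hom \<Lambda> K W g by (intro module_homI modsD M E)
  have f_ns: "\<not> (\<forall>x\<in>carrier X. r (f x) = x)" if "r \<in> mod_hom \<Lambda> K X" for r
    using split_mono_imp_split_epi[OF M ex that] ns by metis
  have ext: "\<exists>k\<in>mod_hom \<Lambda> K V. \<forall>x\<in>carrier X. u x = k (f x)"
    if V: "V \<in> \<E>" and u: "u \<in> mod_hom \<Lambda> X V" and u_ns: "\<And>w. w \<in> mod_hom \<Lambda> V X \<Longrightarrow> \<not> (\<forall>x\<in>carrier X. w (u x) = x)" for V u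
  proof -
    obtain P a b c where P: "P \<in> mods \<Lambda>" "a \<in> mod_hom \<Lambda> V P" "b \<in> mod_hom \<Lambda> K P"
      "short_exact \<Lambda> V a P c W" "\<And>x. x \<in> carrier X \<Longrightarrow> b (f x) = a (u x)" "\<And>y. y \<in> carrier K \<Longrightarrow> c (b y) = g y"
      by (rule pushout[OF M E_mods[OF V] ex u]) (rule that)
    note C = short_exactD[OF P(4)]
    have PE: "P \<in> \<E>" by (rule E_ext[OF V XKW(3) P(1,4)])
    show ?thesis
    \<comment> \<open>If \<open>c\<close> is not radical, the pushout splits and its retraction onto
      \<open>V\<close> extends \<open>u\<close>. If \<open>c\<close> is radical, it lifts through
      \<open>g\<close>; minimality makes the composite
      \<open>K \<rightarrow> P \<rightarrow> K\<close> injective, its restriction to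
      \<open>X\<close> factors through \<open>u\<close>, and \<open>u\<close> would be a split
      monomorphism.\<close>
    proof (cases "c \<in> radical \<Lambda> P W")
      case False
      then obtain s where s: "s \<in> mod_hom \<Lambda> W P" "\<And>w. w \<in> carrier W \<Longrightarrow> c (s w) = w"
        using radical_right_iff[OF P(1) W C(2)] by blast
      obtain r where r: "biprod \<Lambda> P a r V s c W" by (rule split_epi_biprod[OF E_mods[OF V] P(1) M(3) P(4) s])
      have "u x = r (b (f x))" if "x \<in> carrier X" for x
        using P(5)[OF that] biprodD(5)[OF r hom_closed[OF u that]] by simp
      then show ?thesis by (intro bexI[OF _ hom_comp[OF P(3) biprodD(2)[OF r]]]) simp
    next
      case True
      obtain v where v: "v \<in> mod_hom \<Lambda> P K" "\<And>x. x \<in> carrier P \<Longrightarrow> c x = g (v x)"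
        using ras[OF PE True] by (auto elim: facE)
      have \<theta>: "(\<lambda>x. v (b x)) \<in> mod_hom \<Lambda> K K" by (rule hom_comp[OF P(3) v(1)])
      have inj: "inj_on (\<lambda>x. v (b x)) (carrier K)"
        using v(2) P(6) hom_closed[OF P(3)] by (intro minimal[OF \<theta>]) metis
      have "v (a y) \<in> f ` carrier X" if "y \<in> carrier V" for y
        using E(5)[of "v (a y)"] v(2)[of "a y"] C(6)[OF that] hom_closed[OF P(2) that] hom_closed[OF v(1)] by metis
      then obtain w where w: "w \<in> mod_hom \<Lambda> V X" "\<And>y. y \<in> carrier V \<Longrightarrow> f (w y) = v (a y)"
        using hom_factor_inj[OF X.left_module_axioms K.left_module_axioms E_lm[OF V] E(1,3) hom_comp[OF P(2) v(1)]] by blast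
      have wu: "(\<lambda>x. w (u x)) \<in> mod_hom \<Lambda> X X" by (rule hom_comp[OF u w(1)])
      have fwu: "f (w (u x)) = v (b (f x))" if "x \<in> carrier X" for x
        using that w(2)[OF hom_closed[OF u that]] P(5) by simp
      have "inj_on (\<lambda>x. w (u x)) (carrier X)"
      proof (rule inj_onI)
        fix x y assume xy: "x \<in> carrier X" "y \<in> carrier X" "w (u x) = w (u y)"
        then have "v (b (f x)) = v (b (f y))" using fwu by metis
        then have "f x = f y" using inj_onD[OF inj] xy by simp
        then show "x = y" using inj_onD[OF E(3)] xy by simp
      qed
      then obtain t where t: "t \<in> mod_hom \<Lambda> X X" "\<forall>x\<in>carrier X. t (w (u x)) = x"
        using hom_inverse[OF X.left_module_axioms X.left_module_axioms wu endo_inj_imp_bij[OF M(1) wu]] by blast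
      then show ?thesis using u_ns[OF hom_comp[OF w(1) t(1)]] by blast
    qed
  qed
  have Xnz: "carrier X \<noteq> {\<zero>\<^bsub>X\<^esub>}"
  proof
    assume X0: "carrier X = {\<zero>\<^bsub>X\<^esub>}"
    have "(\<lambda>_. \<zero>\<^bsub>X\<^esub>) \<in> mod_hom \<Lambda> K X" by (rule hom_zero[OF X.left_module_axioms])
    from f_ns[OF this] show False using X0 by simp
  qed
  have Xind: "ind X"
    unfolding indecomposable_def
  proof (intro conjI XKW Xnz ballI impI)
    fix A B assume AB: "A \<in> \<E>" "B \<in> \<E>" "is_direct_sum \<Lambda> X [A, B]"
    interpret A: left_module \<Lambda> A by (rule E_lm[OF AB(1)])
    interpret B: left_module \<Lambda> B by (rule E_lm[OF AB(2)])
    obtain i p j q where b: "biprod \<Lambda> X i p A j q B"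
      using AB(3) is_direct_sum_two_iff[OF X.left_module_axioms A.left_module_axioms B.left_module_axioms] by blast
    \<comment> \<open>With both summands nonzero, neither projection of \<open>X\<close> is a split
      monomorphism, so both extend along \<open>f\<close>; the two extensions assemble to a
      retraction of \<open>f\<close>, which does not exist.\<close>
    have key: "\<exists>k\<in>mod_hom \<Lambda> K A. \<forall>x\<in>carrier X. p x = k (f x)"
      if AB: "A \<in> \<E>" "B \<in> \<E>" and b: "biprod \<Lambda> X i p A j q B" and nz: "carrier B \<noteq> {\<zero>\<^bsub>B\<^esub>}" for A B i p j q
    proof (rule ext[OF AB(1) biprodD(2)[OF b]])
      fix w assume w: "w \<in> mod_hom \<Lambda> A X"
      interpret w: module_hom \<Lambda> A X w by (intro module_homI E_lm AB X.left_module_axioms w)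
      interpret B: left_module \<Lambda> B by (rule E_lm[OF AB(2)])
      interpret q: module_hom \<Lambda> X B q by (intro module_homI E_lm AB X.left_module_axioms biprodD[OF b])
      obtain y where y: "y \<in> carrier B" "y \<noteq> \<zero>\<^bsub>B\<^esub>" using nz B.M.zero_closed by blast
      have "w (p (j y)) \<noteq> j y"
        using y biprodD(6)[OF b y(1)] biprodD(8)[OF b y(1)] w.zero q.zero by metis
      then show "\<not> (\<forall>x\<in>carrier X. w (p x) = x)" using biprod_closed(3)[OF b y(1)] by blast
    qed
    show "carrier A = {\<zero>\<^bsub>A\<^esub>} \<or> carrier B = {\<zero>\<^bsub>B\<^esub>}"
    proof (rule ccontr)
      assume "\<not> ?thesis"
      then have nz: "carrier A \<noteq> {\<zero>\<^bsub>A\<^esub>}" "carrier B \<noteq> {\<zero>\<^bsub>B\<^esub>}" by auto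
      obtain k where k: "k \<in> mod_hom \<Lambda> K A" "\<forall>x\<in>carrier X. p x = k (f x)" using key[OF AB(1,2) b nz(2)] by blast
      obtain l where l: "l \<in> mod_hom \<Lambda> K B" "\<forall>x\<in>carrier X. q x = l (f x)"
        using key[OF AB(2,1) biprod_swap[OF X.left_module_axioms b] nz(1)] by blast
      have "(\<lambda>y. i (k y) \<oplus>\<^bsub>X\<^esub> j (l y)) \<in> mod_hom \<Lambda> K X"
        by (intro hom_add X.left_module_axioms hom_comp[OF k(1) biprodD(1)[OF b]] hom_comp[OF l(1) biprodD(3)[OF b]])
      from f_ns[OF this] show False using k(2) l(2) biprodD(9)[OF b] by simp
    qed
  qed
  have "f \<in> radical \<Lambda> X K" using radical_left_iff[OF Xind E(1)] f_ns by blast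
  moreover have "g \<in> radical \<Lambda> K W" using radical_right_iff[OF M(2) W E(2)] ns by blast
  moreover have "\<exists>k\<in>mod_hom \<Lambda> K V. \<forall>x\<in>carrier X. h x = k (f x)" if "V \<in> \<E>" "h \<in> radical \<Lambda> X V" for V h
    using that radical_left_iff[OF Xind radicalD(1)[OF that(2)]] by (intro ext radicalD(1)) auto
  ultimately show ?thesis
    unfolding AR_conflation_def left_almost_split_def right_almost_split_def
    using con XKW Xind W ras unfolding fac_def by blast
qed

abbreviation K0 :: "('a modobj set \<Rightarrow>\<^sub>0 int) monoid" where
  "K0 \<equiv> K0_split \<Lambda> \<E>"

definition AR_gens :: "('a modobj set \<Rightarrow>\<^sub>0 int) set" where
  "AR_gens = {kc X - kc Y + kc Z | X f Y g Z. AR_conflation \<Lambda> \<E> X f Y g Z}"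

definition Ex_gens :: "('a modobj set \<Rightarrow>\<^sub>0 int) set" where
  "Ex_gens = {kc X - kc Y + kc Z | X f Y g Z. conflation \<Lambda> \<E> X f Y g Z}"

lemma AR_subgroup_eq: "AR_subgroup \<Lambda> \<E> = generate K0 AR_gens"
  by (simp add: AR_subgroup_def AR_gens_def)

lemma Ex_subgroup_eq: "Ex_subgroup \<Lambda> \<E> = generate K0 Ex_gens"
  by (simp add: Ex_subgroup_def Ex_gens_def)

lemma group_K0: "group K0"
  by (simp add: K0_split_def)

lemma kc_comb_carrier:
  assumes "X \<in> \<E>" "Y \<in> \<E>" "Z \<in> \<E>"
  shows "kc X - kc Y + kc Z \<in> carrier K0"
proof -
  have "Poly_Mapping.keys (kc X - kc Y + kc Z) \<subseteq> Poly_Mapping.keys (kc X) \<union> Poly_Mapping.keys (kc Y) \<union> Poly_Mapping.keys (kc Z)"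
    using keys_add[of "kc X - kc Y" "kc Z"] keys_diff[of "kc X" "kc Y"] by blast
  then show ?thesis
    using kc_keys[OF assms(1)] kc_keys[OF assms(2)] kc_keys[OF assms(3)]
    by (simp add: K0_split_def) blast
qed

lemma gens_carrier: "AR_gens \<subseteq> Ex_gens" "Ex_gens \<subseteq> carrier K0" "AR_gens \<subseteq> carrier K0"
proof -
  show 1: "AR_gens \<subseteq> Ex_gens" unfolding AR_gens_def Ex_gens_def AR_conflation_def by blast
  show 2: "Ex_gens \<subseteq> carrier K0" unfolding Ex_gens_def conflation_def using kc_comb_carrier by blast
  show "AR_gens \<subseteq> carrier K0" using 1 2 by blast
qed

lemma subgroup_AR: "subgroup (AR_subgroup \<Lambda> \<E>) K0"
  unfolding AR_subgroup_eq by (intro group.generate_is_subgroup group_K0 gens_carrier)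

lemma AR_add: "a \<in> AR_subgroup \<Lambda> \<E> \<Longrightarrow> b \<in> AR_subgroup \<Lambda> \<E> \<Longrightarrow> a + b \<in> AR_subgroup \<Lambda> \<E>"
  using subgroup.m_closed[OF subgroup_AR, of a b] by (simp add: K0_split_def)

lemma AR_zero: "0 \<in> AR_subgroup \<Lambda> \<E>"
  using subgroup.one_closed[OF subgroup_AR] by (simp add: K0_split_def)

lemma AR_subset_Ex: "AR_subgroup \<Lambda> \<E> \<subseteq> Ex_subgroup \<Lambda> \<E>"
  unfolding AR_subgroup_eq Ex_subgroup_eq by (intro group.mono_generate group_K0 gens_carrier)

text \<open>If \<open>K\<close> has an endomorphism over \<open>W\<close> that is not injective, its Fitting decomposition splits off a
  common direct summand of \<open>X\<close> and \<open>K\<close>, which cancels in the class.\<close>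

lemma almost_split_in_AR:
  assumes "conflation \<Lambda> \<E> X f K g W" "ind W"
    "\<And>s. s \<in> mod_hom \<Lambda> W K \<Longrightarrow> \<not> (\<forall>w\<in>carrier W. g (s w) = w)"
    "\<And>V h. V \<in> \<E> \<Longrightarrow> h \<in> radical \<Lambda> V W \<Longrightarrow> fac V h K g"
  shows "kc X - kc K + kc W \<in> AR_subgroup \<Lambda> \<E>"
  using assms
proof (induction "rl K (carrier K)" arbitrary: X f K g rule: less_induct)
  case less
  note con = less.prems(1) and W = less.prems(2) and ns = less.prems(3) and ras = less.prems(4)
  show ?case
  \<comment> \<open>The first case is right minimality, where the conflation is already an AR
    conflation.\<close>
  proof (cases "\<forall>\<theta>\<in>mod_hom \<Lambda> K K. (\<forall>x\<in>carrier K. g (\<theta> x) = g x) \<longrightarrow> inj_on \<theta> (carrier K)")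
    case True
    then have "AR_conflation \<Lambda> \<E> X f K g W" using AR_conflation_of_minimal[OF con W ns ras] by blast
    then have "kc X - kc K + kc W \<in> AR_gens" unfolding AR_gens_def by blast
    then show ?thesis unfolding AR_subgroup_eq by (rule generate.incl)
  next
    case False
    then obtain \<theta> where \<theta>: "\<theta> \<in> mod_hom \<Lambda> K K" "\<And>x. x \<in> carrier K \<Longrightarrow> g (\<theta> x) = g x" "\<not> inj_on \<theta> (carrier K)" by blast
    have XKW: "X \<in> \<E>" "K \<in> \<E>" "W \<in> \<E>" and ex: "short_exact \<Lambda> X f K g W" using con by (auto simp: conflation_def)
    note E = short_exactD[OF ex]
    note M = E_mods[OF XKW(1)] E_mods[OF XKW(2)] E_mods[OF XKW(3)]
    interpret X: left_module \<Lambda> X by (rule modsD(1)[OF M(1)])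
    interpret K: left_module \<Lambda> K by (rule modsD(1)[OF M(2)])
    interpret W: left_module \<Lambda> W by (rule modsD(1)[OF M(3)])
    interpret f: module_hom \<Lambda> X K f by (intro module_homI modsD M E)
    interpret g: module_hom \<Lambda> K W g by (intro module_homI modsD M E)
    interpret \<theta>: module_hom \<Lambda> K K \<theta> by (intro module_homI modsD M \<theta>)
    obtain N U p where N: "N > 0" "U = (\<theta> ^^ N) ` carrier K" "submod \<Lambda> K U" "p \<in> mod_hom \<Lambda> K (K\<lparr>carrier := U\<rparr>)"
      "\<And>x. x \<in> U \<Longrightarrow> p x = x" "\<And>x. x \<in> carrier K \<Longrightarrow> p x = \<zero>\<^bsub>K\<^esub> \<longleftrightarrow> (\<theta> ^^ N) x = \<zero>\<^bsub>K\<^esub>"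
      by (rule fitting[OF M(2) \<theta>(1)]) (rule that)
    interpret \<theta>N: module_hom \<Lambda> K K "\<theta> ^^ n" for n using hom_funpow[OF \<theta>(1)] by (intro module_homI modsD M)
    have g\<theta>N: "g ((\<theta> ^^ n) x) = g x" if x: "x \<in> carrier K" for n x
      using x \<theta>(2) by (induction n) auto
    let ?U = "K\<lparr>carrier := U\<rparr>"
    have Um: "?U \<in> mods \<Lambda>" by (rule sub_mods[OF M(2) N(3)])
    let ?V = "{x \<in> carrier K. p x = \<zero>\<^bsub>?U\<^esub>}"
    have r: "submod \<Lambda> K ?V"
       "biprod \<Lambda> K (\<lambda>x. x) p ?U (\<lambda>x. x) (\<lambda>x. x \<ominus>\<^bsub>K\<^esub> p x) (K\<lparr>carrier := ?V\<rparr>)"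
      using retract_biprod[OF K.left_module_axioms modsD(1)[OF Um] hom_inclusion[OF N(3)] N(4)] N(5) by simp_all
    have Vm: "K\<lparr>carrier := ?V\<rparr> \<in> mods \<Lambda>" by (rule sub_mods[OF M(2) r(1)])
    note B = biprodD[OF r(2)]
    \<comment> \<open>Since \<open>\<theta>\<close> lies over \<open>W\<close>, so do its powers;
      hence whatever a power kills is killed by \<open>g\<close>.\<close>
    have gV: "g x = \<zero>\<^bsub>W\<^esub>" if "x \<in> ?V" for x
      using that N(6)[of x] g\<theta>N[of x N] by auto
    have pK: "p x \<in> U" if "x \<in> carrier K" for x using hom_closed[OF N(4) that] by simp
    have pK': "p x \<in> carrier K" if "x \<in> carrier K" for x using pK[OF that] submodD(5)[OF N(3)] by blast
    have gp: "g (p x) = g x" if x: "x \<in> carrier K" for x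
    proof -
      have "x \<ominus>\<^bsub>K\<^esub> p x \<in> ?V" using hom_closed[OF B(4) x] by simp
      then have "g (x \<ominus>\<^bsub>K\<^esub> p x) = \<zero>\<^bsub>W\<^esub>" by (rule gV)
      then have "g x \<ominus>\<^bsub>W\<^esub> g (p x) = \<zero>\<^bsub>W\<^esub>" using g.diff[OF x pK'[OF x]] by simp
      then show ?thesis using x pK'[OF x] W.diff_zero_iff[of "g x" "g (p x)"] by simp
    qed
    define X' where "X' = {x \<in> carrier X. f x \<in> U}"
    have X'sub: "submod \<Lambda> X X'" unfolding X'_def by (rule f.submod_vimage[OF N(3)])
    let ?X' = "X\<lparr>carrier := X'\<rparr>"
    have X'm: "?X' \<in> mods \<Lambda>" by (rule sub_mods[OF M(1) X'sub])
    have "(\<lambda>x. p (f x)) \<in> mod_hom \<Lambda> X K"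
      using hom_comp[OF hom_comp[OF E(1) N(4)] hom_inclusion[OF N(3)]] .
    moreover have "p (f x) \<in> f ` carrier X" if x: "x \<in> carrier X" for x
      using E(5)[of "p (f x)"] gp[of "f x"] E(6)[OF x] pK'[of "f x"] x by simp
    \<comment> \<open>As \<open>p\<close> commutes with \<open>g\<close>, it preserves the kernel of
      \<open>g\<close>; \<open>t\<close> is the resulting idempotent on \<open>X\<close>, with image
      \<open>X'\<close>.\<close>
    ultimately obtain t where t: "t \<in> mod_hom \<Lambda> X X" "\<And>x. x \<in> carrier X \<Longrightarrow> f (t x) = p (f x)"
      using hom_factor_inj[OF X.left_module_axioms K.left_module_axioms X.left_module_axioms E(1,3)] by blast
    have t': "t \<in> mod_hom \<Lambda> X ?X'"
      using t hom_closed[OF t(1)] pK by (intro hom_into_submod) (auto simp: X'_def)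
    have tx: "t x = x" if "x \<in> X'" for x
      using that t(2)[of x] N(5)[of "f x"] hom_closed[OF t(1), of x] inj_onD[OF E(3), of "t x" x] by (auto simp: X'_def)
    let ?Y = "{x \<in> carrier X. t x = \<zero>\<^bsub>?X'\<^esub>}"
    have r': "submod \<Lambda> X ?Y" "biprod \<Lambda> X (\<lambda>x. x) t ?X' (\<lambda>x. x) (\<lambda>x. x \<ominus>\<^bsub>X\<^esub> t x) (X\<lparr>carrier := ?Y\<rparr>)"
      using retract_biprod[OF X.left_module_axioms modsD(1)[OF X'm] hom_inclusion[OF X'sub] t'] tx by simp_all
    have Ym: "X\<lparr>carrier := ?Y\<rparr> \<in> mods \<Lambda>" by (rule sub_mods[OF M(1) r'(1)])
    have X'E: "?X' \<in> \<E>" by (rule summand[OF XKW(1) X'm Ym r'(2)])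
    have UE: "?U \<in> \<E>" by (rule summand[OF XKW(2) Um Vm r(2)])
    have YE: "X\<lparr>carrier := ?Y\<rparr> \<in> \<E>" by (rule summand[OF XKW(1) Ym X'm biprod_swap[OF X.left_module_axioms r'(2)]])
    have VE: "K\<lparr>carrier := ?V\<rparr> \<in> \<E>" by (rule summand[OF XKW(2) Vm Um biprod_swap[OF K.left_module_axioms r(2)]])
    have fY: "f \<in> mod_hom \<Lambda> (X\<lparr>carrier := ?Y\<rparr>) (K\<lparr>carrier := ?V\<rparr>)"
      using t(2) by (intro hom_into_submod hom_on_submod[OF E(1) r'(1)]) (auto, metis f.zero)
    \<comment> \<open>The complement \<open>?V\<close> lies in the kernel of \<open>g\<close>, that
      is in the image of \<open>f\<close>, and there \<open>t\<close> and \<open>p\<close>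
      correspond. So \<open>f\<close> identifies the two complements, whose classes cancel.\<close>
    have "bij_betw f ?Y ?V"
      unfolding bij_betw_def
    proof
      show "inj_on f ?Y" using E(3) by (rule inj_on_subset) auto
      show "f ` ?Y = ?V"
      proof
        show "f ` ?Y \<subseteq> ?V" using hom_closed[OF fY] by auto
        show "?V \<subseteq> f ` ?Y"
        proof
          fix y assume y: "y \<in> ?V"
          then obtain x where x: "x \<in> carrier X" "y = f x" using E(5)[of y] gV[OF y] by auto
          then have "f (t x) = \<zero>\<^bsub>K\<^esub>" using t(2)[OF x(1)] y by simp
          then have "t x = \<zero>\<^bsub>X\<^esub>" using f.inj_onD_ker[OF E(3)] hom_closed[OF t(1) x(1)] by blast
          then show "y \<in> f ` ?Y" using x by simp
        qed
      qed
    qed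
    then have "mod_iso \<Lambda> (X\<lparr>carrier := ?Y\<rparr>) (K\<lparr>carrier := ?V\<rparr>)" using fY unfolding mod_iso_def by auto
    then have kcYV: "kc (X\<lparr>carrier := ?Y\<rparr>) = kc (K\<lparr>carrier := ?V\<rparr>)" by (rule kc_iso[OF YE Vm])
    have kcX: "kc X = kc ?X' + kc (X\<lparr>carrier := ?Y\<rparr>)" by (rule kc_biprod[OF M(1) X'E YE r'(2)])
    have kcK: "kc K = kc ?U + kc (K\<lparr>carrier := ?V\<rparr>)" by (rule kc_biprod[OF M(2) UE VE r(2)])
    have ex': "short_exact \<Lambda> ?X' f ?U g W"
    proof (rule short_exactI)
      show "f \<in> mod_hom \<Lambda> ?X' ?U"
        by (intro hom_into_submod hom_on_submod[OF E(1) X'sub]) (auto simp: X'_def)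
      show "g \<in> mod_hom \<Lambda> ?U W" by (rule hom_on_submod[OF E(2) N(3)])
      show "inj_on f (carrier ?X')" using E(3) by (rule inj_on_subset) (auto simp: X'_def)
      show "g ` carrier ?U = carrier W"
      proof
        show "g ` carrier ?U \<subseteq> carrier W" using submodD(5)[OF N(3)] by auto
        show "carrier W \<subseteq> g ` carrier ?U"
        proof
          fix w assume "w \<in> carrier W"
          then obtain y where y: "y \<in> carrier K" "w = g y" using E(4) by blast
          then have "w = g (p y)" using gp by simp
          then show "w \<in> g ` carrier ?U" using pK[OF y(1)] by simp
        qed
      qed
      show "y \<in> f ` carrier ?X'" if "y \<in> carrier ?U" "g y = \<zero>\<^bsub>W\<^esub>" for y
        using that E(5)[of y] submodD(5)[OF N(3)] by (auto simp: X'_def)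
      show "g (f x) = \<zero>\<^bsub>W\<^esub>" if "x \<in> carrier ?X'" for x using that E(6) by (simp add: X'_def)
    qed
    have "kc ?X' - kc ?U + kc W \<in> AR_subgroup \<Lambda> \<E>"
    proof (rule less.hyps[OF _ _ W])
      show "conflation \<Lambda> \<E> ?X' f ?U g W" using X'E UE XKW ex' by (simp add: conflation_def)
      show "\<not> (\<forall>w\<in>carrier W. g (s w) = w)" if "s \<in> mod_hom \<Lambda> W ?U" for s
        using ns[OF hom_comp[OF that hom_inclusion[OF N(3)]]] .
      show "fac V h ?U g" if V: "V \<in> \<E>" "h \<in> radical \<Lambda> V W" for V h
      proof (rule facE[OF ras[OF V]])
        fix k assume k: "k \<in> mod_hom \<Lambda> V K" "\<And>x. x \<in> carrier V \<Longrightarrow> h x = g (k x)"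
        then show ?thesis using gp hom_closed[OF k(1)] by (intro facI[OF hom_comp[OF k(1) N(4)]]) simp
      qed
      interpret U: module_hom R "res ?U" "res K" "\<lambda>x. x"
        by (intro module_homI left_module_res modsD Um M hom_res hom_inclusion N)
      have "rl ?U U = rl K U"
        using U.len_inj_image'[OF U.M.submod_carrier] finlen_mods[OF Um order_refl] by simp
      \<comment> \<open>A nonzero element killed by \<open>\<theta>\<close> is killed by
        \<open>p\<close>, which is the identity on \<open>U\<close>. So the middle term has become
        strictly shorter.\<close>
      moreover have "U \<subset> carrier K"
      proof -
        obtain x where x: "x \<in> carrier K" "\<theta> x = \<zero>\<^bsub>K\<^esub>" "x \<noteq> \<zero>\<^bsub>K\<^esub>" using \<theta>(3) \<theta>.inj_onI_ker by blast
        have "(\<theta> ^^ N) x = (\<theta> ^^ (N - 1)) (\<theta> x)" using N(1) by (metis Suc_pred' comp_apply funpow_Suc_right)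
        then have "p x = \<zero>\<^bsub>K\<^esub>" using N(6)[OF x(1)] x(2) by simp
        then have "x \<notin> U" using N(5) x(3) by metis
        then show ?thesis using x(1) submodD(1)[OF N(3)] by blast
      qed
      ultimately show "rl ?U (carrier ?U) < rl K (carrier K)"
        using len_strict[OF finlen_mods[OF M(2) order_refl] submod_res[OF N(3)] submod_res[OF K.submod_carrier]] by simp
    qed
    then show ?thesis using kcX kcK kcYV by (simp add: algebra_simps)
  qed
qed

end

section \<open>Shortening the defect with the help of a generator\<close>

context exact_subcat
begin

text \<open>Since \<open>V\<close> is a summand of a finite sum of copies of \<open>G\<close>,
  factorisations on each copy of \<open>G\<close> add up to one on that sum and restrict to
  \<open>V\<close>. Factoring questions thus become comparisons of submodules of
  \<open>Hom(G, Z)\<close>.\<close>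

lemma fac_add_generator:
  assumes G: "G \<in> \<E>" "\<E> = add_closure \<Lambda> G" and V: "V \<in> \<E>" and DZ: "D \<in> mods \<Lambda>" "Z \<in> mods \<Lambda>" "d \<in> mod_hom \<Lambda> D Z"
    and h: "h \<in> mod_hom \<Lambda> V Z" and fac: "\<And>s. s \<in> mod_hom \<Lambda> G V \<Longrightarrow> fac G (\<lambda>x. h (s x)) D d"
  shows "fac V h D d"
proof -
  obtain n S X' where S: "S \<in> mods \<Lambda>" "X' \<in> mods \<Lambda>" "is_direct_sum \<Lambda> S (replicate n G)" "is_direct_sum \<Lambda> S [V, X']"
    using V G(2) unfolding add_closure_def by blast
  obtain i p j q where b: "biprod \<Lambda> S i p V j q X'"
    using S(4) is_direct_sum_two_iff[OF modsD(1)[OF S(1)] E_lm[OF V] modsD(1)[OF S(2)]] by blast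
  note B = biprodD[OF b]
  have "fac S (\<lambda>x. h (p x)) D d"
  proof (rule fac_direct_sum[OF S(1) DZ _ S(3) hom_comp[OF B(2) h]])
    show "set (replicate n G) \<subseteq> mods \<Lambda>" using E_mods[OF G(1)] by auto
    fix Y s assume "Y \<in> set (replicate n G)" "s \<in> mod_hom \<Lambda> Y S"
    then show "fac Y (\<lambda>x. h (p (s x))) D d" using fac[OF hom_comp[OF _ B(2)], of s] by auto
  qed
  then obtain k where k: "k \<in> mod_hom \<Lambda> S D" "\<And>x. x \<in> carrier S \<Longrightarrow> h (p x) = d (k x)" by (rule facE) (rule that)
  show ?thesis
    using k(2) B(5) hom_closed[OF B(1)] by (intro facI[OF hom_comp[OF B(1) k(1)]]) metis
qed

text \<open>The image of \<open>Hom(G, D)\<close> in \<open>Hom(G, Z)\<close>; for a deflation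
  \<open>d\<close> the cokernel is its defect evaluated at \<open>G\<close>.\<close>

definition img :: "'a modobj \<Rightarrow> 'a modobj \<Rightarrow> ('a list \<Rightarrow> 'a list) \<Rightarrow> ('a list \<Rightarrow> 'a list) set" where
  "img G D d = post G d ` carrier (homM G D)"

lemma fac_iff_img:
  assumes "G \<in> mods \<Lambda>"
  shows "fac G s D d \<longleftrightarrow> restrict s (carrier G) \<in> img G D d"
proof
  assume "fac G s D d"
  then obtain k where k: "k \<in> mod_hom \<Lambda> G D" "\<And>x. x \<in> carrier G \<Longrightarrow> s x = d (k x)" by (rule facE) (rule that)
  have "post G d (restrict k (carrier G)) = restrict s (carrier G)"
    using k(2) by (intro homM_eqI[where X = G]) auto
  then show "restrict s (carrier G) \<in> img G D d"
    using restrict_homM[OF modsD(1)[OF assms] k(1)] unfolding img_def by (metis imageI)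
next
  assume "restrict s (carrier G) \<in> img G D d"
  then obtain k where k: "k \<in> mod_hom \<Lambda> G D" "restrict s (carrier G) = post G d k" by (auto simp: img_def)
  have "s x = d (k x)" if "x \<in> carrier G" for x
    using fun_cong[OF k(2), of x] that by simp
  then show "fac G s D d" by (intro facI[OF k(1)])
qed

lemma submod_img:
  assumes "G \<in> mods \<Lambda>" "D \<in> mods \<Lambda>" "Z \<in> mods \<Lambda>" "d \<in> mod_hom \<Lambda> D Z"
  shows "submod R (homM G Z) (img G D d)"
proof -
  interpret P: module_hom R "homM G D" "homM G Z" "post G d" by (intro post_hom modsD(1) assms)
  show ?thesis unfolding img_def by (rule P.submod_image[OF P.M.submod_carrier])
qed

lemma img_mono:
  assumes "G \<in> mods \<Lambda>" "fac D d D' d'"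
  shows "img G D d \<subseteq> img G D' d'"
proof
  fix s assume "s \<in> img G D d"
  then obtain k where k: "k \<in> mod_hom \<Lambda> G D" "k \<in> extensional (carrier G)" "s = post G d k" by (auto simp: img_def)
  obtain l where l: "l \<in> mod_hom \<Lambda> D D'" "\<And>x. x \<in> carrier D \<Longrightarrow> d x = d' (l x)" using assms(2) by (rule facE) (rule that)
  have "fac G s D' d'"
    using k(3) l(2) hom_closed[OF k(1)] by (intro facI[OF hom_comp[OF k(1) l(1)]]) simp
  moreover have "restrict s (carrier G) = s" using k(3) by (intro homM_eqI[where X = G]) auto
  ultimately show "s \<in> img G D' d'" using fac_iff_img[OF assms(1)] by metis
qed

text \<open>If a nonfactoring \<open>h\<close> does not have the required property, it can be replaced by some \<open>h \<circ> u\<close> with \<open>u\<close>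
  radical; this shrinks the image of \<open>Hom(G, W \<oplus> Y)\<close> in \<open>Hom(G, Z)\<close>, as \<open>1 - u \<circ> a\<close> is invertible for
  every \<open>a\<close>.\<close>

lemma minimal_nonfactoring:
  assumes G: "G \<in> \<E>" "\<E> = add_closure \<Lambda> G" and YZ: "Y \<in> mods \<Lambda>" "Z \<in> mods \<Lambda>" and g: "g \<in> mod_hom \<Lambda> Y Z"
  shows "\<lbrakk>ind W; h \<in> mod_hom \<Lambda> W Z; \<not> fac W h Y g; S \<in> mods \<Lambda>; biprod \<Lambda> S i p W j q Y\<rbrakk> \<Longrightarrow>
    \<exists>W h. ind W \<and> h \<in> mod_hom \<Lambda> W Z \<and> \<not> fac W h Y g \<and>
      (\<forall>V\<in>\<E>. \<forall>u\<in>radical \<Lambda> V W. fac V (\<lambda>x. h (u x)) Y g)"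
proof (induction "len R (homM G Z) (img G S (\<lambda>s. h (p s) \<ominus>\<^bsub>Z\<^esub> g (q s)))" arbitrary: W h S i p j q rule: less_induct)
  case less
  note W = less.prems(1) and h = less.prems(2) and nf = less.prems(3) and S = less.prems(4) and b = less.prems(5)
  note B = biprodD[OF b] and cl = biprod_closed[OF b]
  note Gm = E_mods[OF G(1)]
  note Wm = indD(3)[OF W]
  show ?case
  proof (cases "\<forall>V\<in>\<E>. \<forall>u\<in>radical \<Lambda> V W. fac V (\<lambda>x. h (u x)) Y g")
    case True
    then show ?thesis using W h nf by blast
  next
    case False
    then obtain V u where V: "V \<in> \<E>" "u \<in> radical \<Lambda> V W" "\<not> fac V (\<lambda>x. h (u x)) Y g" by blast
    obtain Vs where Vs: "\<forall>V'\<in>set Vs. ind V'" "is_direct_sum \<Lambda> V Vs" using decomposition_exists[OF V(1)] by blast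
    \<comment> \<open>The induction needs an indecomposable source again, and some indecomposable
      summand of \<open>V\<close> inherits the failure to factor.\<close>
    have "\<exists>V'\<in>set Vs. \<exists>s\<in>mod_hom \<Lambda> V' V. \<not> fac V' (\<lambda>x. h (u (s x))) Y g"
    proof (rule ccontr)
      assume "\<not> ?thesis"
      then have "fac V (\<lambda>x. h (u x)) Y g"
        using Vs indD(3)
        by (intro fac_direct_sum[OF E_mods[OF V(1)] YZ g _ Vs(2) hom_comp[OF radicalD(1)[OF V(2)] h]]) auto
      then show False using V(3) by simp
    qed
    then obtain V' s where V': "V' \<in> set Vs" "s \<in> mod_hom \<Lambda> V' V" "\<not> fac V' (\<lambda>x. h (u (s x))) Y g" by blast
    have V'i: "ind V'" using Vs V' by blast
    note V'm = indD(3)[OF V'i]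
    have u': "(\<lambda>x. u (s x)) \<in> radical \<Lambda> V' W" by (rule radical_comp_right[OF V'm E_mods[OF V(1)] V(2) V'(2)])
    have hu': "(\<lambda>x. h (u (s x))) \<in> mod_hom \<Lambda> V' Z" by (rule hom_comp[OF radicalD(1)[OF u'] h])
    obtain S' i' p' j' q' where S': "S' \<in> mods \<Lambda>" and b': "biprod \<Lambda> S' i' p' V' j' q' Y" by (rule sum_mods[OF V'm YZ(1)])
    note B' = biprodD[OF b'] and cl' = biprod_closed[OF b']
    interpret S: left_module \<Lambda> S using modsD S by blast
    interpret W: left_module \<Lambda> W using modsD Wm by blast
    interpret Z: left_module \<Lambda> Z using modsD YZ by blast
    interpret Y: left_module \<Lambda> Y using modsD YZ by blast
    interpret g: module_hom \<Lambda> Y Z g by (intro module_homI modsD YZ g)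
    interpret h: module_hom \<Lambda> W Z h by (intro module_homI modsD YZ Wm h)
    interpret p: module_hom \<Lambda> S W p by (intro module_homI modsD S Wm B)
    interpret q: module_hom \<Lambda> S Y q by (intro module_homI modsD S YZ B)
    let ?d = "\<lambda>s. h (p s) \<ominus>\<^bsub>Z\<^esub> g (q s)"
    let ?d' = "\<lambda>t. h (u (s (p' t))) \<ominus>\<^bsub>Z\<^esub> g (q' t)"
    have d: "?d \<in> mod_hom \<Lambda> S Z"
      by (intro hom_diff Z.left_module_axioms hom_comp[OF B(2) h] hom_comp[OF B(4) g])
    have d': "?d' \<in> mod_hom \<Lambda> S' Z"
      by (intro hom_diff Z.left_module_axioms hom_comp[OF B'(2) hu'] hom_comp[OF B'(4) g])
    have usc: "u (s x) \<in> carrier W" if "x \<in> carrier V'" for x using hom_closed[OF radicalD(1)[OF u'] that] .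
    \<comment> \<open>The new map is the old one preceded by \<open>u s\<close> on the first summand
      and the identity on \<open>Y\<close>, so its image can only shrink.\<close>
    have "fac S' ?d' S ?d"
    proof (rule facI)
      show "(\<lambda>t. i (u (s (p' t))) \<oplus>\<^bsub>S\<^esub> j (q' t)) \<in> mod_hom \<Lambda> S' S"
        by (intro hom_add S.left_module_axioms hom_comp[OF B'(4) B(3)]
            hom_comp[OF hom_comp[OF B'(2) radicalD(1)[OF u']] B(1)])
      show "?d' t = ?d (i (u (s (p' t))) \<oplus>\<^bsub>S\<^esub> j (q' t))" if "t \<in> carrier S'" for t
        using that cl cl' usc B by (simp add: p.add q.add)
    qed
    then have sub: "img G S' ?d' \<subseteq> img G S ?d" by (rule img_mono[OF Gm])
    have "img G S' ?d' \<noteq> img G S ?d"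
    proof
      assume eq: "img G S' ?d' = img G S ?d"
      \<comment> \<open>Were the images equal, all composites of \<open>h\<close> with maps from
        \<open>G\<close> would factor through \<open>?d'\<close>, and hence \<open>h\<close> itself,
        since \<open>W\<close> is built from \<open>G\<close>.\<close>
      have "fac W h S' ?d'"
      proof (rule fac_add_generator[OF G indD(1)[OF W] S' YZ(2) d' h])
        fix t assume t: "t \<in> mod_hom \<Lambda> G W"
        have "fac G (\<lambda>x. h (t x)) S ?d"
          using hom_closed[OF t] B cl by (intro facI[OF hom_comp[OF t B(1)]]) simp
        then show "fac G (\<lambda>x. h (t x)) S' ?d'" unfolding fac_iff_img[OF Gm] eq .
      qed
      then obtain k where k: "k \<in> mod_hom \<Lambda> W S'" "\<And>x. x \<in> carrier W \<Longrightarrow> h x = ?d' (k x)" by (rule facE) (rule that)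
      define a where "a x = p' (k x)" for x
      define c where "c x = q' (k x)" for x
      have a: "a \<in> mod_hom \<Lambda> W V'" unfolding a_def by (rule hom_comp[OF k(1) B'(2)])
      have c: "c \<in> mod_hom \<Lambda> W Y" unfolding c_def by (rule hom_comp[OF k(1) B'(4)])
      have usa: "(\<lambda>x. u (s (a x))) \<in> mod_hom \<Lambda> W W" by (rule hom_comp[OF a radicalD(1)[OF u']])
      have oma: "(\<lambda>x. x \<ominus>\<^bsub>W\<^esub> u (s (a x))) \<in> mod_hom \<Lambda> W W" by (intro hom_diff hom_id usa W.left_module_axioms)
      have "bij_betw (\<lambda>x. x \<ominus>\<^bsub>W\<^esub> u (s (a x))) (carrier W) (carrier W)"
        using radical_fixD'[OF V'm Wm u' a] by (intro one_minus_bijI[OF Wm usa]) blast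
      then obtain v where v: "v \<in> mod_hom \<Lambda> W W" "\<forall>y\<in>carrier W. v y \<ominus>\<^bsub>W\<^esub> u (s (a (v y))) = y"
        using hom_inverse[OF W.left_module_axioms W.left_module_axioms oma] by blast
      \<comment> \<open>The factorisation reads \<open>h = h u s a - g c\<close>, so
        \<open>h (1 - u s a) = -g c\<close>. Composing with the inverse \<open>v\<close> of
        \<open>1 - u s a\<close> makes \<open>h\<close> factor through \<open>g\<close>, a
        contradiction.\<close>
      have hc: "h (x \<ominus>\<^bsub>W\<^esub> u (s (a x))) = g (\<ominus>\<^bsub>Y\<^esub> c x)" if x: "x \<in> carrier W" for x
      proof -
        have xc: "h (u (s (a x))) \<in> carrier Z" "g (c x) \<in> carrier Z" "c x \<in> carrier Y" "u (s (a x)) \<in> carrier W"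
          using hom_closed[OF usa x] hom_closed[OF c x] by simp_all
        have "h (x \<ominus>\<^bsub>W\<^esub> u (s (a x))) = h x \<ominus>\<^bsub>Z\<^esub> h (u (s (a x)))" using x xc by (simp add: h.diff)
        also have "h x = h (u (s (a x))) \<ominus>\<^bsub>Z\<^esub> g (c x)" using k(2)[OF x] by (simp add: a_def c_def)
        also have "\<dots> \<ominus>\<^bsub>Z\<^esub> h (u (s (a x))) = \<ominus>\<^bsub>Z\<^esub> g (c x)"
          using xc by (simp add: a_minus_def Z.M.a_ac Z.M.r_neg2 Z.M.r_neg1 Z.M.r_neg)
        finally show ?thesis using xc by (simp add: g.neg)
      qed
      have "fac W h Y g"
      proof (rule facI)
        show "(\<lambda>x. \<ominus>\<^bsub>Y\<^esub> c (v x)) \<in> mod_hom \<Lambda> W Y" by (intro hom_neg Y.left_module_axioms hom_comp[OF v(1) c])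
        show "h x = g (\<ominus>\<^bsub>Y\<^esub> c (v x))" if "x \<in> carrier W" for x
          using hc[OF hom_closed[OF v(1) that]] v(2) that by simp
      qed
      then show False using nf by simp
    qed
    then have "len R (homM G Z) (img G S' ?d') < len R (homM G Z) (img G S ?d)"
      using sub submodD(1)[OF submod_img[OF Gm S YZ(2) d]]
      by (intro len_strict finlen_homM' submod_img Gm S S' YZ d d') auto
    from less.hyps[OF this V'i hu' V'(3) S' b'] show ?thesis .
  qed
qed

text \<open>With \<open>h : W \<rightarrow> Z\<close> minimal among the maps not factoring through \<open>g\<close>, the pullback \<open>K\<close> of \<open>g\<close> and \<open>h\<close> yields
  conflations \<open>X \<rightarrow> K \<rightarrow> W\<close>, whose deflation is almost split up to minimality, and \<open>K \<rightarrow> W \<oplus> Y \<rightarrow> Z\<close>, whose defect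
  \<open>coker (Hom(G, W \<oplus> Y) \<rightarrow> Hom(G, Z))\<close> is shorter than that of \<open>g\<close>.\<close>

lemma conflation_in_AR:
  assumes G: "G \<in> \<E>" "\<E> = add_closure \<Lambda> G"
  shows "conflation \<Lambda> \<E> X f Y g Z \<Longrightarrow> kc X - kc Y + kc Z \<in> AR_subgroup \<Lambda> \<E>"
proof (induction "hl G Z - len R (homM G Z) (img G Y g)" arbitrary: X f Y g rule: less_induct)
  case less
  have XYZ: "X \<in> \<E>" "Y \<in> \<E>" "Z \<in> \<E>" and ex: "short_exact \<Lambda> X f Y g Z" using less.prems by (auto simp: conflation_def)
  note E = short_exactD[OF ex]
  note M = E_mods[OF XYZ(1)] E_mods[OF XYZ(2)] E_mods[OF XYZ(3)]
  note Gm = E_mods[OF G(1)]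
  show ?case
  \<comment> \<open>A factorisation of the identity is a section of \<open>g\<close>; a split
    conflation has class zero.\<close>
  proof (cases "fac Z (\<lambda>x. x) Y g")
    case True
    then obtain s where s: "s \<in> mod_hom \<Lambda> Z Y" "\<And>z. z \<in> carrier Z \<Longrightarrow> g (s z) = z" by (rule facE) metis
    obtain r where "biprod \<Lambda> Y f r X s g Z" by (rule split_epi_biprod[OF M ex s])
    then have "kc Y = kc X + kc Z" by (rule kc_biprod[OF M(2) XYZ(1,3)])
    then show ?thesis using AR_zero by simp
  next
    case False
    obtain Zs where Zs: "\<forall>V'\<in>set Zs. ind V'" "is_direct_sum \<Lambda> Z Zs" using decomposition_exists[OF XYZ(3)] by blast
    have "\<exists>W\<in>set Zs. \<exists>s\<in>mod_hom \<Lambda> W Z. \<not> fac W s Y g"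
    proof (rule ccontr)
      assume "\<not> ?thesis"
      then have "fac Z (\<lambda>x. x) Y g"
        using Zs indD(3) by (intro fac_direct_sum[OF M(3,2,3) E(2) _ Zs(2) hom_id]) auto
      then show False using False by simp
    qed
    then obtain W0 h0 where W0: "ind W0" "h0 \<in> mod_hom \<Lambda> W0 Z" "\<not> fac W0 h0 Y g" using Zs by blast
    obtain S0 i0 p0 j0 q0 where "S0 \<in> mods \<Lambda>" "biprod \<Lambda> S0 i0 p0 W0 j0 q0 Y" by (rule sum_mods[OF indD(3)[OF W0(1)] M(2)])
    from minimal_nonfactoring[OF G M(2,3) E(2) W0 this]
    obtain W h where W: "ind W" and h: "h \<in> mod_hom \<Lambda> W Z" and nf: "\<not> fac W h Y g"
      and ras: "\<And>V u. V \<in> \<E> \<Longrightarrow> u \<in> radical \<Lambda> V W \<Longrightarrow> fac V (\<lambda>x. h (u x)) Y g" by blast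
    obtain S i p j q K f' d where P: "S \<in> mods \<Lambda>" "biprod \<Lambda> S i p W j q Y" "submod \<Lambda> S K"
      "K = {s \<in> carrier S. h (p s) = g (q s)}" "short_exact \<Lambda> X f' (S\<lparr>carrier := K\<rparr>) p W"
      "d \<in> mod_hom \<Lambda> S Z" "short_exact \<Lambda> (S\<lparr>carrier := K\<rparr>) (\<lambda>x. x) S d Z"
      "\<And>s. s \<in> carrier S \<Longrightarrow> d s = h (p s) \<ominus>\<^bsub>Z\<^esub> g (q s)"
      by (rule pullback[OF M indD(3)[OF W] ex h]) (rule that)
    note B = biprodD[OF P(2)] and cl = biprod_closed[OF P(2)]
    let ?K = "S\<lparr>carrier := K\<rparr>"
    have Km: "?K \<in> mods \<Lambda>" by (rule sub_mods[OF P(1,3)])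
    have KE: "?K \<in> \<E>" by (rule E_ext[OF XYZ(1) indD(1)[OF W] Km P(5)])
    have SE: "S \<in> \<E>" by (rule E_sum[OF P(1) indD(1)[OF W] XYZ(2) P(2)])
    interpret S: left_module \<Lambda> S using modsD P(1) by blast
    interpret Z: left_module \<Lambda> Z using modsD M by blast
    interpret Y: left_module \<Lambda> Y using modsD M by blast
    interpret g: module_hom \<Lambda> Y Z g by (intro module_homI modsD M E)
    interpret h: module_hom \<Lambda> W Z h by (intro module_homI modsD M indD(3)[OF W] h)
    have 1: "kc X - kc ?K + kc W \<in> AR_subgroup \<Lambda> \<E>"
    proof (rule almost_split_in_AR[OF _ W])
      show "conflation \<Lambda> \<E> X f' ?K p W" using XYZ KE indD(1)[OF W] P(5) by (simp add: conflation_def)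
      \<comment> \<open>A section of the pulled back deflation, followed by the projection to
        \<open>Y\<close>, would be a factorisation of \<open>h\<close> through
        \<open>g\<close>.\<close>
      show "\<not> (\<forall>w\<in>carrier W. p (s w) = w)" if s: "s \<in> mod_hom \<Lambda> W ?K" for s
      proof
        assume ps: "\<forall>w\<in>carrier W. p (s w) = w"
        have "h w = g (q (s w))" if w: "w \<in> carrier W" for w
          using hom_closed[OF s w] ps w P(4) by simp
        then have "fac W h Y g"
          by (intro facI[OF hom_comp[OF hom_comp[OF s hom_inclusion[OF P(3)]] B(4)]])
        then show False using nf by simp
      qed
      \<comment> \<open>A lift of \<open>h u\<close> to \<open>Y\<close> pairs with \<open>u\<close>
        to a map into the pullback.\<close>
      show "fac V u ?K p" if V: "V \<in> \<E>" "u \<in> radical \<Lambda> V W" for V u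
      proof -
        obtain k where k: "k \<in> mod_hom \<Lambda> V Y" "\<And>x. x \<in> carrier V \<Longrightarrow> h (u x) = g (k x)" using ras[OF V] by (rule facE) (rule that)
        note uh = radicalD(1)[OF V(2)]
        have pq: "p (i (u x) \<oplus>\<^bsub>S\<^esub> j (k x)) = u x" "q (i (u x) \<oplus>\<^bsub>S\<^esub> j (k x)) = k x" if x: "x \<in> carrier V" for x
        proof -
          interpret p: module_hom \<Lambda> S W p by (intro module_homI modsD P(1) indD(3)[OF W] B)
          interpret q: module_hom \<Lambda> S Y q by (intro module_homI modsD P(1) M B)
          interpret W: left_module \<Lambda> W using indD(4)[OF W] .
          show "p (i (u x) \<oplus>\<^bsub>S\<^esub> j (k x)) = u x" "q (i (u x) \<oplus>\<^bsub>S\<^esub> j (k x)) = k x"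
            using hom_closed[OF uh x] hom_closed[OF k(1) x] cl B by (simp_all add: p.add q.add)
        qed
        have "(\<lambda>x. i (u x) \<oplus>\<^bsub>S\<^esub> j (k x)) \<in> mod_hom \<Lambda> V ?K"
        proof (rule hom_into_submod)
          show "(\<lambda>x. i (u x) \<oplus>\<^bsub>S\<^esub> j (k x)) \<in> mod_hom \<Lambda> V S"
            by (intro hom_add S.left_module_axioms hom_comp[OF uh B(1)] hom_comp[OF k(1) B(3)])
          show "i (u x) \<oplus>\<^bsub>S\<^esub> j (k x) \<in> K" if x: "x \<in> carrier V" for x
            using pq[OF x] k(2)[OF x] hom_closed[OF uh x] hom_closed[OF k(1) x] cl by (simp add: P(4))
        qed
        then show ?thesis using pq by (intro facI) auto
      qed
    qed
    have "fac Y g S d"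
    proof (rule facI)
      show "(\<lambda>y. j (\<ominus>\<^bsub>Y\<^esub> y)) \<in> mod_hom \<Lambda> Y S" by (rule hom_comp[OF hom_neg[OF Y.left_module_axioms hom_id] B(3)])
      show "g y = d (j (\<ominus>\<^bsub>Y\<^esub> y))" if "y \<in> carrier Y" for y
        using that B cl P(8) by (simp add: g.neg a_minus_def)
    qed
    then have sub: "img G Y g \<subseteq> img G S d" by (rule img_mono[OF Gm])
    \<comment> \<open>The defect really drops: since \<open>h\<close> does not factor through
      \<open>g\<close>, some composite \<open>h s\<close> with \<open>s\<close> from
      \<open>G\<close> does not either, while \<open>h s\<close> does factor through
      \<open>d\<close>.\<close>
    obtain s where s: "s \<in> mod_hom \<Lambda> G W" "\<not> fac G (\<lambda>x. h (s x)) Y g"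
      using fac_add_generator[OF G indD(1)[OF W] M(2,3) E(2) h] nf by blast
    have "fac G (\<lambda>x. h (s x)) S d"
      using hom_closed[OF s(1)] B cl P(8) by (intro facI[OF hom_comp[OF s(1) B(1)]]) simp
    then have "img G Y g \<noteq> img G S d" using s(2) fac_iff_img[OF Gm] by metis
    then have lt: "len R (homM G Z) (img G Y g) < len R (homM G Z) (img G S d)"
      using sub submodD(1)[OF submod_img[OF Gm P(1) M(3) P(6)]]
      by (intro len_strict finlen_homM' submod_img Gm M P(1,6) E(2)) auto
    \<comment> \<open>The induction measure is a truncated difference; this bound ensures that it
      decreases strictly.\<close>
    have "len R (homM G Z) (img G S d) \<le> hl G Z"
      unfolding hl_def using submod_img[OF Gm P(1) M(3) P(6)]
        left_module.submod_carrier[OF left_module_homM[OF modsD(1)[OF Gm] modsD(1)[OF M(3)]]]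
      by (intro len_mono finlen_homM Gm M submodD(1)[OF submod_img[OF Gm P(1) M(3) P(6)]]) auto
    then have lt': "hl G Z - len R (homM G Z) (img G S d) < hl G Z - len R (homM G Z) (img G Y g)" using lt by linarith
    have 2: "kc ?K - kc S + kc Z \<in> AR_subgroup \<Lambda> \<E>"
      using KE SE XYZ P(7) by (intro less.hyps[OF lt']) (simp add: conflation_def)
    \<comment> \<open>This makes the two conflations telescope: \<open>K\<close> cancels, and
      \<open>W\<close> cancels against its share of the biproduct.\<close>
    have "kc S = kc W + kc Y" by (rule kc_biprod[OF P(1) indD(1)[OF W] XYZ(2) P(2)])
    then have "(kc X - kc ?K + kc W) + (kc ?K - kc S + kc Z) = kc X - kc Y + kc Z" by (simp add: algebra_simps)
    then show ?thesis using AR_add[OF 1 2] by metis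
  qed
qed

theorem finite_type_imp_AR_eq_Ex:
  assumes "finite_type \<Lambda> \<E>"
  shows "AR_subgroup \<Lambda> \<E> = Ex_subgroup \<Lambda> \<E>"
proof
  obtain G where G: "G \<in> \<E>" "\<E> = add_closure \<Lambda> G" using assms unfolding finite_type_def by blast
  have "Ex_gens \<subseteq> AR_subgroup \<Lambda> \<E>" using conflation_in_AR[OF G] unfolding Ex_gens_def by blast
  then show "Ex_subgroup \<Lambda> \<E> \<subseteq> AR_subgroup \<Lambda> \<E>"
    unfolding Ex_subgroup_eq by (intro group.generate_subgroup_incl group_K0 subgroup_AR)
qed (rule AR_subset_Ex)

section \<open>The converse: a finiteness criterion\<close>

lemma ext_fn_comb:
  assumes d: "additive_fn d" and XYZ: "X \<in> \<E>" "Y \<in> \<E>" "Z \<in> \<E>"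
  shows "ext_fn d (kc X - kc Y + kc Z) = frag_cmul (int (d X) - int (d Y) + int (d Z)) (frag_of ())"
proof -
  have "ext_fn d (kc X - kc Y + kc Z) = ext_fn d (kc X) - ext_fn d (kc Y) + ext_fn d (kc Z)"
    by (simp add: ext_fn_def frag_extend_add frag_extend_diff)
  then show ?thesis
    using XYZ by (simp add: ext_fn_kc[OF d] frag_cmul_distrib frag_cmul_diff_distrib left_diff_distrib)
qed

lemma frag_cmul_eq_0_iff': "frag_cmul n (frag_of ()) = 0 \<longleftrightarrow> n = 0"
  by simp

text \<open>Between nonisomorphic indecomposables every map is radical, so it factors through the
  almost split map at that end. Hence the Hom functor of \<open>W\<close> is exact on the
  conflation, and lengths add up.\<close>

lemma AR_vanish:
  assumes AR: "AR_conflation \<Lambda> \<E> X f Y g Z" and W: "ind W"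
  shows "\<not> mod_iso \<Lambda> W Z \<Longrightarrow> ext_fn (hl W) (kc X - kc Y + kc Z) = 0"
    "\<not> mod_iso \<Lambda> W X \<Longrightarrow> ext_fn (\<lambda>V. hl V W) (kc X - kc Y + kc Z) = 0"
proof -
  have XYZ: "X \<in> \<E>" "Y \<in> \<E>" "Z \<in> \<E>" and ex: "short_exact \<Lambda> X f Y g Z"
    using AR by (auto simp: AR_conflation_def conflation_def)
  note M = E_mods[OF XYZ(1)] E_mods[OF XYZ(2)] E_mods[OF XYZ(3)]
  note E = short_exactD[OF ex]
  note Wm = indD(3)[OF W]
  have X: "ind X" and Z: "ind Z" using AR by (auto simp: AR_conflation_def left_almost_split_def right_almost_split_def)
  {
    assume niso: "\<not> mod_iso \<Lambda> W Z"
    have "post W g ` carrier (homM W Y) = carrier (homM W Z)"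
    proof
      interpret P: module_hom R "homM W Y" "homM W Z" "post W g" by (intro post_hom modsD(1) M Wm E)
      show "post W g ` carrier (homM W Y) \<subseteq> carrier (homM W Z)" using P.closed by blast
      show "carrier (homM W Z) \<subseteq> post W g ` carrier (homM W Y)"
      proof
        fix h assume h: "h \<in> carrier (homM W Z)"
        then have "h \<in> radical \<Lambda> W Z" using ind_radical_or_iso[OF W Z _ niso] by simp
        then have "fac W h Y g" using AR indD(1)[OF W] unfolding AR_conflation_def right_almost_split_def fac_def by blast
        moreover have "restrict h (carrier W) = h" using h by (intro homM_eqI[where X = W]) auto
        ultimately show "h \<in> post W g ` carrier (homM W Y)" using fac_iff_img[OF Wm] unfolding img_def by metis
      qed
    qed
    then have "hl W Y = hl W X + hl W Z" using hl_exact[OF M Wm ex] by (simp add: hl_def)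
    then show "ext_fn (hl W) (kc X - kc Y + kc Z) = 0" using ext_fn_comb[OF hl_additive[OF Wm] XYZ] by simp
  }
  {
    assume niso: "\<not> mod_iso \<Lambda> W X"
    then have niso': "\<not> mod_iso \<Lambda> X W" using mod_iso_sym[OF indD(4)[OF X] indD(4)[OF W]] by blast
    have "pre X f ` carrier (homM Y W) = carrier (homM X W)"
    proof
      interpret P: module_hom R "homM Y W" "homM X W" "pre X f" by (intro pre_hom modsD(1) M Wm E)
      show "pre X f ` carrier (homM Y W) \<subseteq> carrier (homM X W)" using P.closed by blast
      show "carrier (homM X W) \<subseteq> pre X f ` carrier (homM Y W)"
      proof
        fix h assume h: "h \<in> carrier (homM X W)"
        then have "h \<in> radical \<Lambda> X W" using ind_radical_or_iso[OF X W _ niso'] by simp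
        then obtain k where k: "k \<in> mod_hom \<Lambda> Y W" "\<forall>x\<in>carrier X. h x = k (f x)"
          using AR indD(1)[OF W] unfolding AR_conflation_def left_almost_split_def by blast
        have "pre X f (restrict k (carrier Y)) = h"
          using h k(2) hom_closed[OF E(1)] by (intro homM_eqI[where X = X]) auto
        then show "h \<in> pre X f ` carrier (homM Y W)"
          using restrict_homM[OF modsD(1)[OF M(2)] k(1)] by (metis imageI)
      qed
    qed
    then have "hl Y W = hl Z W + hl X W" using hl_exact'[OF M Wm ex] by (simp add: hl_def)
    then show "ext_fn (\<lambda>V. hl V W) (kc X - kc Y + kc Z) = 0" using ext_fn_comb[OF hl_additive'[OF Wm] XYZ] by simp
  }
qed

text \<open>A generator is supported on its two end terms by \<open>AR_vanish\<close>, and the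
  induction over the generated subgroup only takes finite unions, as \<open>ext_fn\<close> is
  additive.\<close>

lemma AR_subgroup_finite_support:
  assumes "c \<in> AR_subgroup \<Lambda> \<E>"
  shows "\<exists>F. finite F \<and> F \<subseteq> \<E> \<and> (\<forall>W. ind W \<longrightarrow> (\<forall>Q\<in>F. \<not> mod_iso \<Lambda> W Q) \<longrightarrow>
    ext_fn (hl W) c = 0 \<and> ext_fn (\<lambda>V. hl V W) c = 0)"
proof -
  have gen: "\<exists>F. finite F \<and> F \<subseteq> \<E> \<and> (\<forall>W. ind W \<longrightarrow> (\<forall>Q\<in>F. \<not> mod_iso \<Lambda> W Q) \<longrightarrow>
    ext_fn (hl W) c = 0 \<and> ext_fn (\<lambda>V. hl V W) c = 0)" if "c \<in> AR_gens" for c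
  proof -
    from that[unfolded AR_gens_def] obtain X f Y g Z where c: "c = kc X - kc Y + kc Z" "AR_conflation \<Lambda> \<E> X f Y g Z"
      by (elim CollectE exE conjE) metis
    show ?thesis
      using AR_vanish[OF c(2)] c(2) unfolding c(1) AR_conflation_def conflation_def
      by (intro exI[of _ "{X, Z}"]) auto
  qed
  have "c \<in> generate K0 AR_gens" using assms unfolding AR_subgroup_eq .
  then show ?thesis
  proof (induction rule: generate.induct)
    case one
    then show ?case by (intro exI[of _ "{}"]) (simp add: K0_split_def ext_fn_def)
  next
    case (incl c)
    then show ?case by (rule gen)
  next
    case (inv c)
    have "c \<in> carrier K0" using inv gens_carrier(3) by blast
    then have "Poly_Mapping.keys c \<subseteq> cls ` {X. ind X}" by (simp add: K0_split_def)
    then have "inv\<^bsub>K0\<^esub> c = - c" by (simp add: K0_split_def)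
    then show ?case using gen[OF inv] by (simp add: ext_fn_def frag_extend_minus)
  next
    case (eng c c')
    then obtain F F' where F: "finite F" "F \<subseteq> \<E>" "\<forall>W. ind W \<longrightarrow> (\<forall>Q\<in>F. \<not> mod_iso \<Lambda> W Q) \<longrightarrow> ext_fn (hl W) c = 0 \<and> ext_fn (\<lambda>V. hl V W) c = 0"
      "finite F'" "F' \<subseteq> \<E>" "\<forall>W. ind W \<longrightarrow> (\<forall>Q\<in>F'. \<not> mod_iso \<Lambda> W Q) \<longrightarrow> ext_fn (hl W) c' = 0 \<and> ext_fn (\<lambda>V. hl V W) c' = 0" by blast
    then show ?case
      by (intro exI[of _ "F \<union> F'"]) (auto simp: K0_split_def ext_fn_def frag_extend_add)
  qed
qed

text \<open>By \<open>hl_exact\<close> and \<open>hl_exact'\<close> the value of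
  \<open>ext_fn\<close> on a conflation is the length of a cokernel, so its vanishing means
  surjectivity.\<close>

lemma vanish_imp_exact:
  assumes con: "conflation \<Lambda> \<E> X f Y g Z" and W: "ind W"
  shows "ext_fn (hl W) (kc X - kc Y + kc Z) = 0 \<Longrightarrow> h \<in> mod_hom \<Lambda> W Z \<Longrightarrow> fac W h Y g"
    "ext_fn (\<lambda>V. hl V W) (kc X - kc Y + kc Z) = 0 \<Longrightarrow> k \<in> mod_hom \<Lambda> X W \<Longrightarrow>
      \<exists>l\<in>mod_hom \<Lambda> Y W. \<forall>x\<in>carrier X. k x = l (f x)"
proof -
  have XYZ: "X \<in> \<E>" "Y \<in> \<E>" "Z \<in> \<E>" and ex: "short_exact \<Lambda> X f Y g Z"
    using con by (auto simp: conflation_def)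
  note M = E_mods[OF XYZ(1)] E_mods[OF XYZ(2)] E_mods[OF XYZ(3)]
  note E = short_exactD[OF ex]
  note Wm = indD(3)[OF W]
  {
    assume v: "ext_fn (hl W) (kc X - kc Y + kc Z) = 0" and h: "h \<in> mod_hom \<Lambda> W Z"
    interpret P: module_hom R "homM W Y" "homM W Z" "post W g" by (intro post_hom modsD(1) M Wm E)
    have "len R (homM W Z) (post W g ` carrier (homM W Y)) = hl W Z"
      using v hl_exact[OF M Wm ex] unfolding ext_fn_comb[OF hl_additive[OF Wm] XYZ] frag_cmul_eq_0_iff' by linarith
    then have "post W g ` carrier (homM W Y) = carrier (homM W Z)"
      using submodD(1)[OF P.submod_image[OF P.M.submod_carrier]]
      by (intro len_eqD[OF finlen_homM[OF Wm M(3)] P.submod_image[OF P.M.submod_carrier] P.N.submod_carrier])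
        (simp_all add: hl_def)
    then show "fac W h Y g"
      unfolding fac_iff_img[OF Wm] img_def using restrict_homM[OF modsD(1)[OF Wm] h] by simp
  }
  {
    assume v: "ext_fn (\<lambda>V. hl V W) (kc X - kc Y + kc Z) = 0" and k: "k \<in> mod_hom \<Lambda> X W"
    interpret P: module_hom R "homM Y W" "homM X W" "pre X f" by (intro pre_hom modsD(1) M Wm E)
    have "len R (homM X W) (pre X f ` carrier (homM Y W)) = hl X W"
      using v hl_exact'[OF M Wm ex] unfolding ext_fn_comb[OF hl_additive'[OF Wm] XYZ] frag_cmul_eq_0_iff' by linarith
    then have "pre X f ` carrier (homM Y W) = carrier (homM X W)"
      using submodD(1)[OF P.submod_image[OF P.M.submod_carrier]]
      by (intro len_eqD[OF finlen_homM[OF M(1) Wm] P.submod_image[OF P.M.submod_carrier] P.N.submod_carrier])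
        (simp_all add: hl_def)
    moreover have "restrict k (carrier X) \<in> carrier (homM X W)" by (rule restrict_homM[OF modsD(1)[OF M(1)] k])
    ultimately obtain l where l: "l \<in> carrier (homM Y W)" "restrict k (carrier X) = pre X f l" by (metis imageE)
    have "k x = l (f x)" if "x \<in> carrier X" for x using fun_cong[OF l(2), of x] that by simp
    then show "\<exists>l\<in>mod_hom \<Lambda> Y W. \<forall>x\<in>carrier X. k x = l (f x)" using l(1) by (intro bexI[of _ l]) auto
  }
qed

lemma dsum_exists: "set Ys \<subseteq> mods \<Lambda> \<Longrightarrow> \<exists>S\<in>mods \<Lambda>. is_direct_sum \<Lambda> S Ys"
proof (induction Ys)
  case Nil
  obtain Z where Z: "Z \<in> mods \<Lambda>" "carrier Z = {\<zero>\<^bsub>Z\<^esub>}" by (rule zero_mods)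
  then show ?case using is_direct_sum_Nil[OF modsD(1)[OF Z(1)]] by auto
next
  case (Cons Y Ys)
  then obtain S where S: "S \<in> mods \<Lambda>" "is_direct_sum \<Lambda> S Ys" by auto
  have Y: "Y \<in> mods \<Lambda>" using Cons.prems by simp
  obtain T i p j q where T: "T \<in> mods \<Lambda>" "biprod \<Lambda> T i p Y j q S" by (rule sum_mods[OF Y S(1)])
  have "is_direct_sum \<Lambda> T (Y # Ys)"
    using Cons.prems modsD(1) by (intro is_direct_sum_ConsI[OF modsD(1)[OF T(1)] modsD(1)[OF S(1)] _ T(2) S(2)]) auto
  then show ?case using T(1) by blast
qed

text \<open>The generator is the direct sum \<open>G\<close> of the given representatives.\<close>

lemma finite_type_criterion:
  assumes F: "finite F" "F \<subseteq> \<E>" and cover: "\<And>W. ind W \<Longrightarrow> \<exists>Q\<in>F. mod_iso \<Lambda> W Q"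
  shows "finite_type \<Lambda> \<E>"
proof -
  obtain Fs where Fs: "set Fs = F" using finite_list[OF F(1)] by blast
  have Fm: "set Fs \<subseteq> mods \<Lambda>" using Fs F(2) E_mods by blast
  obtain G where G: "G \<in> mods \<Lambda>" "is_direct_sum \<Lambda> G Fs" using dsum_exists[OF Fm] by blast
  have GE: "G \<in> \<E>" using E_dsum[OF G(1) _ G(2)] Fs F(2) by simp
  interpret G: left_module \<Lambda> G using modsD(1)[OF G(1)] .
  have retract: "\<exists>i\<in>mod_hom \<Lambda> W G. \<exists>p\<in>mod_hom \<Lambda> G W. \<forall>x\<in>carrier W. p (i x) = x" if W: "ind W" for W
  proof -
    obtain Q where Q: "Q \<in> F" "mod_iso \<Lambda> W Q" using cover[OF W] by blast
    obtain f where f: "f \<in> mod_hom \<Lambda> W Q" "bij_betw f (carrier W) (carrier Q)" using Q(2) unfolding mod_iso_def by blast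
    have Qm: "Q \<in> mods \<Lambda>" using Q F(2) E_mods by blast
    obtain v where v: "v \<in> mod_hom \<Lambda> Q W" "\<forall>x\<in>carrier W. v (f x) = x"
      using hom_inverse[OF indD(4)[OF W] modsD(1)[OF Qm] f] by blast
    obtain n where n: "n < length Fs" "Fs ! n = Q" using Q(1) Fs by (metis in_set_conv_nth)
    obtain \<iota> \<pi> where ip: "\<iota> \<in> mod_hom \<Lambda> Q G" "\<pi> \<in> mod_hom \<Lambda> G Q" "\<And>y. y \<in> carrier Q \<Longrightarrow> \<pi> (\<iota> y) = y"
    proof (rule is_direct_sumE[OF G(2)])
      fix \<iota>' \<pi>' assume *: "\<And>i. i < length Fs \<Longrightarrow> \<iota>' i \<in> mod_hom \<Lambda> (Fs ! i) G"
        "\<And>i. i < length Fs \<Longrightarrow> \<pi>' i \<in> mod_hom \<Lambda> G (Fs ! i)"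
        "\<And>i j y. i < length Fs \<Longrightarrow> j < length Fs \<Longrightarrow> y \<in> carrier (Fs ! i) \<Longrightarrow> \<pi>' j (\<iota>' i y) = (if i = j then y else \<zero>\<^bsub>Fs ! j\<^esub>)"
      show thesis using *(1)[OF n(1)] *(2)[OF n(1)] *(3)[OF n(1) n(1)] n(2) by (intro that[of "\<iota>' n" "\<pi>' n"]) auto
    qed
    show ?thesis
      using ip(3) v(2) hom_closed[OF f(1)] by (intro bexI[OF _ hom_comp[OF f(1) ip(1)]] bexI[OF _ hom_comp[OF ip(2) v(1)]]) simp
  qed
  \<comment> \<open>Each indecomposable summand of \<open>X\<close> is a retract of one copy of
    \<open>G\<close>, so as many copies suffice as \<open>X\<close> has summands.\<close>
  have sum: "\<exists>S\<in>mods \<Lambda>. is_direct_sum \<Lambda> S (replicate (length Xs) G) \<and>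
      (\<exists>i\<in>mod_hom \<Lambda> X S. \<exists>p\<in>mod_hom \<Lambda> S X. \<forall>x\<in>carrier X. p (i x) = x)"
    if "X \<in> mods \<Lambda>" "\<forall>Y\<in>set Xs. ind Y" "is_direct_sum \<Lambda> X Xs" for X Xs
    using that
  proof (induction Xs arbitrary: X)
    case Nil
    then show ?case by (intro bexI[of _ X] conjI bexI[of _ "\<lambda>x. x"] hom_id) auto
  next
    case (Cons Y Xs)
    have lm: "\<And>Y'. Y' \<in> set (Y # Xs) \<Longrightarrow> left_module \<Lambda> Y'" using Cons.prems(2) indD(4) by blast
    obtain U i p j q where U: "submod \<Lambda> X U" "biprod \<Lambda> X i p Y j q (X\<lparr>carrier := U\<rparr>)"
      "is_direct_sum \<Lambda> (X\<lparr>carrier := U\<rparr>) Xs"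
      by (rule is_direct_sum_ConsD[OF modsD(1)[OF Cons.prems(1)] lm Cons.prems(3)])
    note B = biprodD[OF U(2)] and cl = biprod_closed[OF U(2)]
    have Um: "X\<lparr>carrier := U\<rparr> \<in> mods \<Lambda>" by (rule sub_mods[OF Cons.prems(1) U(1)])
    obtain S a b where S: "S \<in> mods \<Lambda>" "is_direct_sum \<Lambda> S (replicate (length Xs) G)"
      "a \<in> mod_hom \<Lambda> (X\<lparr>carrier := U\<rparr>) S" "b \<in> mod_hom \<Lambda> S (X\<lparr>carrier := U\<rparr>)" "\<forall>x\<in>U. b (a x) = x"
      using Cons.IH[OF Um _ U(3)] Cons.prems(2) by auto
    obtain a' b' where ab': "a' \<in> mod_hom \<Lambda> Y G" "b' \<in> mod_hom \<Lambda> G Y" "\<forall>x\<in>carrier Y. b' (a' x) = x"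
      using retract[of Y] Cons.prems(2) by auto
    obtain T i' p' j' q' where T: "T \<in> mods \<Lambda>" "biprod \<Lambda> T i' p' G j' q' S" by (rule sum_mods[OF G(1) S(1)])
    note C = biprodD[OF T(2)] and cl' = biprod_closed[OF T(2)]
    interpret T: left_module \<Lambda> T using modsD(1)[OF T(1)] .
    interpret S: left_module \<Lambda> S using modsD(1)[OF S(1)] .
    interpret X: left_module \<Lambda> X using modsD(1)[OF Cons.prems(1)] .
    interpret p': module_hom \<Lambda> T G p' by (intro module_homI T.left_module_axioms G.left_module_axioms C)
    interpret q': module_hom \<Lambda> T S q' by (intro module_homI T.left_module_axioms S.left_module_axioms C)
    have h0: "is_direct_sum \<Lambda> T (G # replicate (length Xs) G)"
      using G.left_module_axioms
      by (intro is_direct_sum_ConsI[OF T.left_module_axioms S.left_module_axioms _ T(2) S(2)]) auto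
    have h1: "(\<lambda>x. i' (a' (p x)) \<oplus>\<^bsub>T\<^esub> j' (a (q x))) \<in> mod_hom \<Lambda> X T"
      by (intro hom_add T.left_module_axioms hom_comp[OF hom_comp[OF B(2) ab'(1)] C(1)] hom_comp[OF hom_comp[OF B(4) S(3)] C(3)])
    have h2: "(\<lambda>t. i (b' (p' t)) \<oplus>\<^bsub>X\<^esub> j (b (q' t))) \<in> mod_hom \<Lambda> T X"
      by (intro hom_add X.left_module_axioms hom_comp[OF hom_comp[OF C(2) ab'(2)] B(1)] hom_comp[OF hom_comp[OF C(4) S(4)] B(3)])
    have h3: "i (b' (p' (i' (a' (p x)) \<oplus>\<^bsub>T\<^esub> j' (a (q x))))) \<oplus>\<^bsub>X\<^esub> j (b (q' (i' (a' (p x)) \<oplus>\<^bsub>T\<^esub> j' (a (q x))))) = x"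
      if x: "x \<in> carrier X" for x
    proof -
      have c: "a' (p x) \<in> carrier G" "a (q x) \<in> carrier S" "q x \<in> U" "p x \<in> carrier Y"
        using hom_closed[OF ab'(1) cl(2)[OF x]] hom_closed[OF S(3) cl(4)[OF x]] cl(2,4)[OF x] by simp_all
      then have "p' (i' (a' (p x)) \<oplus>\<^bsub>T\<^esub> j' (a (q x))) = a' (p x)" "q' (i' (a' (p x)) \<oplus>\<^bsub>T\<^esub> j' (a (q x))) = a (q x)"
        using C cl' by (simp_all add: p'.add q'.add)
      then show ?thesis using c ab'(3) S(5) B(9)[OF x] by simp
    qed
    show ?case
      using h0 h3 by (intro bexI[OF _ T(1)] conjI bexI[OF _ h1] bexI[OF _ h2] ballI) simp_all
  qed
  have "\<E> = add_closure \<Lambda> G"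
  proof
    show "\<E> \<subseteq> add_closure \<Lambda> G"
    proof
      fix X assume X: "X \<in> \<E>"
      obtain Xs where Xs: "\<forall>Y\<in>set Xs. ind Y" "is_direct_sum \<Lambda> X Xs" using decomposition_exists[OF X] by blast
      obtain S i p where S: "S \<in> mods \<Lambda>" "is_direct_sum \<Lambda> S (replicate (length Xs) G)"
        "i \<in> mod_hom \<Lambda> X S" "p \<in> mod_hom \<Lambda> S X" "\<And>x. x \<in> carrier X \<Longrightarrow> p (i x) = x"
        using sum[OF E_mods[OF X] Xs] by blast
      note r = retract_biprod[OF modsD(1)[OF S(1)] E_lm[OF X] S(3,4,5)]
      let ?X' = "S\<lparr>carrier := {x \<in> carrier S. p x = \<zero>\<^bsub>X\<^esub>}\<rparr>"
      have X'm: "?X' \<in> mods \<Lambda>" by (rule sub_mods[OF S(1) r(1)])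
      then have "is_direct_sum \<Lambda> S [X, ?X']"
        using is_direct_sum_two_iff[OF modsD(1)[OF S(1)] E_lm[OF X] modsD(1)[OF X'm]] r(2) by blast
      then show "X \<in> add_closure \<Lambda> G" unfolding add_closure_def using S(1,2) X'm E_mods[OF X] by blast
    qed
    show "add_closure \<Lambda> G \<subseteq> \<E>"
    proof
      fix X assume "X \<in> add_closure \<Lambda> G"
      then obtain n S X' where X: "X \<in> mods \<Lambda>" "S \<in> mods \<Lambda>" "X' \<in> mods \<Lambda>" "is_direct_sum \<Lambda> S (replicate n G)" "is_direct_sum \<Lambda> S [X, X']"
        unfolding add_closure_def by blast
      have "S \<in> \<E>" using E_dsum[OF X(2) _ X(4)] GE by (auto simp: set_replicate_conv_if)
      moreover obtain i p j q where "biprod \<Lambda> S i p X j q X'"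
        using X(5) is_direct_sum_two_iff[OF modsD(1)[OF X(2)] modsD(1)[OF X(1)] modsD(1)[OF X(3)]] by blast
      ultimately show "X \<in> \<E>" using summand X by blast
    qed
  qed
  then show ?thesis unfolding finite_type_def using GE by blast
qed

text \<open>The class of each test conflation lies in \<open>AR_subgroup\<close> and so has finite
  support. An indecomposable outside these finitely many supports is exact for every test, and
  \<open>detect\<close> then places it in \<open>H\<close>.\<close>

theorem AR_eq_Ex_imp_finite_type:
  assumes eq: "AR_subgroup \<Lambda> \<E> = Ex_subgroup \<Lambda> \<E>"
    and D: "finite D" "\<And>X f Y g Z. (X, f, Y, g, Z) \<in> D \<Longrightarrow> conflation \<Lambda> \<E> X f Y g Z"
    and H: "finite H" "H \<subseteq> \<E>"
    and detect: "\<And>W. \<lbrakk>ind W; \<And>X f Y g Z h. (X, f, Y, g, Z) \<in> D \<Longrightarrow> h \<in> mod_hom \<Lambda> W Z \<Longrightarrow> fac W h Y g;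
      \<And>X f Y g Z k. (X, f, Y, g, Z) \<in> D \<Longrightarrow> k \<in> mod_hom \<Lambda> X W \<Longrightarrow> \<exists>l\<in>mod_hom \<Lambda> Y W. \<forall>x\<in>carrier X. k x = l (f x)\<rbrakk>
      \<Longrightarrow> \<exists>Q\<in>H. mod_iso \<Lambda> W Q"
  shows "finite_type \<Lambda> \<E>"
proof -
  have "\<exists>F. finite F \<and> F \<subseteq> \<E> \<and> (\<forall>W. ind W \<longrightarrow> (\<forall>Q\<in>F. \<not> mod_iso \<Lambda> W Q) \<longrightarrow>
    ext_fn (hl W) (kc X - kc Y + kc Z) = 0 \<and> ext_fn (\<lambda>V. hl V W) (kc X - kc Y + kc Z) = 0)"
    if "(X, f, Y, g, Z) \<in> D" for X f Y g Z
  proof (rule AR_subgroup_finite_support)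
    have "kc X - kc Y + kc Z \<in> Ex_gens" using D(2)[OF that] unfolding Ex_gens_def by blast
    then show "kc X - kc Y + kc Z \<in> AR_subgroup \<Lambda> \<E>" unfolding eq Ex_subgroup_eq by (rule generate.incl)
  qed
  then have "\<forall>t\<in>D. \<exists>F. finite F \<and> F \<subseteq> \<E> \<and> (case t of (X, f, Y, g, Z) \<Rightarrow> (\<forall>W. ind W \<longrightarrow> (\<forall>Q\<in>F. \<not> mod_iso \<Lambda> W Q) \<longrightarrow>
    ext_fn (hl W) (kc X - kc Y + kc Z) = 0 \<and> ext_fn (\<lambda>V. hl V W) (kc X - kc Y + kc Z) = 0))"
    by auto
  from bchoice[OF this] obtain F where "\<forall>t\<in>D. finite (F t) \<and> F t \<subseteq> \<E> \<and> (case t of (X, f, Y, g, Z) \<Rightarrow> (\<forall>W. ind W \<longrightarrow> (\<forall>Q\<in>F t. \<not> mod_iso \<Lambda> W Q) \<longrightarrow>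
    ext_fn (hl W) (kc X - kc Y + kc Z) = 0 \<and> ext_fn (\<lambda>V. hl V W) (kc X - kc Y + kc Z) = 0))" by (elim exE)
  note F = this[rule_format]
  let ?F = "(\<Union>t\<in>D. F t) \<union> H"
  show ?thesis
  proof (rule finite_type_criterion)
    show "finite ?F" using D(1) H(1) F by simp
    show "?F \<subseteq> \<E>" using H(2) F by blast
    fix W assume W: "ind W"
    show "\<exists>Q\<in>?F. mod_iso \<Lambda> W Q"
    proof (cases "\<exists>Q\<in>\<Union>t\<in>D. F t. mod_iso \<Lambda> W Q")
      case True
      then show ?thesis by blast
    next
      case False
      have v: "ext_fn (hl W) (kc X - kc Y + kc Z) = 0" "ext_fn (\<lambda>V. hl V W) (kc X - kc Y + kc Z) = 0"
        if t: "(X, f, Y, g, Z) \<in> D" for X f Y g Z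
        using F[OF t] False W t by auto
      have "\<exists>Q\<in>H. mod_iso \<Lambda> W Q"
      proof (rule detect[OF W])
        show "fac W h Y g" if t: "(X, f, Y, g, Z) \<in> D" and h: "h \<in> mod_hom \<Lambda> W Z" for X f Y g Z h
          by (rule vanish_imp_exact(1)[OF D(2)[OF t] W v(1)[OF t] h])
        show "\<exists>l\<in>mod_hom \<Lambda> Y W. \<forall>x\<in>carrier X. k x = l (f x)"
          if t: "(X, f, Y, g, Z) \<in> D" and k: "k \<in> mod_hom \<Lambda> X W" for X f Y g Z k
          by (rule vanish_imp_exact(2)[OF D(2)[OF t] W v(2)[OF t] k])
      qed
      then show ?thesis by blast
    qed
  qed
qed

end

section \<open>Projective covers of simple modules\<close>

lemma hom_eq_on_generator:
  assumes "left_module A B" "left_module A X" "f \<in> mod_hom A B X" "g \<in> mod_hom A B X"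
    and gen: "\<And>U. submod A B U \<Longrightarrow> b\<^sub>0 \<in> U \<Longrightarrow> U = carrier B" and b0: "b\<^sub>0 \<in> carrier B" "f b\<^sub>0 = g b\<^sub>0"
    and b: "b \<in> carrier B"
  shows "f b = g b"
proof -
  interpret X: left_module A X by fact
  interpret d: module_hom A B X "\<lambda>b. f b \<ominus>\<^bsub>X\<^esub> g b" by (intro module_homI hom_diff assms)
  have cl: "f b \<in> carrier X" "g b \<in> carrier X" if "b \<in> carrier B" for b
    using hom_closed[OF assms(3) that] hom_closed[OF assms(4) that] .
  have "{b \<in> carrier B. f b \<ominus>\<^bsub>X\<^esub> g b = \<zero>\<^bsub>X\<^esub>} = carrier B"
    using b0 cl X.diff_zero_iff by (intro gen d.submod_ker) auto
  then have "f b \<ominus>\<^bsub>X\<^esub> g b = \<zero>\<^bsub>X\<^esub>" using b by blast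
  then show ?thesis using cl[OF b] X.diff_zero_iff by simp
qed

text \<open>Besides torsionfree classes, the category \<open>mods \<Lambda>\<close> itself is an
  instance; in the torsion case it supplies the simple modules.\<close>

locale sub_subcat = subcat R \<Lambda> \<E>
  for R :: "('r, 'k) ring_scheme" and \<Lambda> :: "('r, 'a) module" and \<E> :: "'a modobj set" +
  assumes sub_closed: "\<And>X U. X \<in> \<E> \<Longrightarrow> submod \<Lambda> X U \<Longrightarrow> X\<lparr>carrier := U\<rparr> \<in> \<E>"
begin

text \<open>A cyclic object of maximal length is the largest quotient of \<open>\<Lambda>\<close> in the subcategory: in
  \<open>B \<oplus> X\<close>, the submodule generated by \<open>(b\<^sub>0, x)\<close> cannot be longer than \<open>B\<close>, so it is the graph of
  a homomorphism.\<close>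

lemma universal_cyclic:
  obtains B b\<^sub>0 where "B \<in> \<E>" "b\<^sub>0 \<in> carrier B" "\<And>U. submod \<Lambda> B U \<Longrightarrow> b\<^sub>0 \<in> U \<Longrightarrow> U = carrier B"
    "\<And>X x. X \<in> \<E> \<Longrightarrow> x \<in> carrier X \<Longrightarrow> \<exists>h\<in>mod_hom \<Lambda> B X. h b\<^sub>0 = x"
proof -
  define cand where "cand t \<longleftrightarrow> (case t of (B, b) \<Rightarrow> B \<in> \<E> \<and> b \<in> carrier B \<and> (\<forall>U. submod \<Lambda> B U \<longrightarrow> b \<in> U \<longrightarrow> U = carrier B))"
    for t :: "'a modobj \<times> 'a list"
  obtain Z where Z: "Z \<in> mods \<Lambda>" "carrier Z = {\<zero>\<^bsub>Z\<^esub>}" by (rule zero_mods)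
  have c0: "cand (Z, \<zero>\<^bsub>Z\<^esub>)" using E_zero[OF Z] Z(2) submodD(1) by (fastforce simp: cand_def)
  \<comment> \<open>A cyclic object is the image of \<open>\<Lambda>\<close> under the orbit map of
    its generator, so it is not longer than \<open>\<Lambda>\<close>.\<close>
  have bound: "\<forall>t. cand t \<longrightarrow> rl (fst t) (carrier (fst t)) < Suc (len R \<Lambda> (carrier \<Lambda>))"
  proof (intro allI impI)
    fix t assume "cand t"
    then obtain B b where t: "t = (B, b)" "B \<in> \<E>" "b \<in> carrier B" "\<And>U. submod \<Lambda> B U \<Longrightarrow> b \<in> U \<Longrightarrow> U = carrier B"
      by (cases t) (auto simp: cand_def)
    interpret B: left_module \<Lambda> B by (rule E_lm[OF t(2)])
    interpret o: module_hom R \<Lambda> "res B" "\<lambda>a. a \<odot>\<^bsub>B\<^esub> b"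
      by (intro module_homI left_module_R\<Lambda> left_module_res B.left_module_axioms orbit_hom_res t)
    have "(\<lambda>a. a \<odot>\<^bsub>B\<^esub> b) ` carrier \<Lambda> = carrier B" using t(4) B.orbit_submod[OF t(3)] by blast
    then show "rl (fst t) (carrier (fst t)) < Suc (len R \<Lambda> (carrier \<Lambda>))"
      using o.len_hom'[OF o.M.submod_carrier finlen_\<Lambda>] t(1) by simp
  qed
  obtain t where t: "cand t" "\<And>t'. cand t' \<Longrightarrow> rl (fst t') (carrier (fst t')) \<le> rl (fst t) (carrier (fst t))"
    using ex_has_greatest_nat[OF c0 bound] by blast
  obtain B b\<^sub>0 where Bb: "t = (B, b\<^sub>0)" by (cases t)
  have B: "B \<in> \<E>" "b\<^sub>0 \<in> carrier B" "\<And>U. submod \<Lambda> B U \<Longrightarrow> b\<^sub>0 \<in> U \<Longrightarrow> U = carrier B"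
    using t(1) unfolding Bb cand_def by auto
  have "\<exists>h\<in>mod_hom \<Lambda> B X. h b\<^sub>0 = x" if X: "X \<in> \<E>" "x \<in> carrier X" for X x
  proof -
    obtain S i p j q where S: "S \<in> \<E>" "biprod \<Lambda> S i p B j q X" by (rule E_sumE[OF B(1) X(1)])
    note P = biprodD[OF S(2)] and cl = biprod_closed[OF S(2)]
    interpret S: left_module \<Lambda> S by (rule E_lm[OF S(1)])
    interpret B: left_module \<Lambda> B by (rule E_lm[OF B(1)])
    interpret X: left_module \<Lambda> X by (rule E_lm[OF X(1)])
    interpret p: module_hom \<Lambda> S B p by (intro module_homI S.left_module_axioms B.left_module_axioms P)
    interpret q: module_hom \<Lambda> S X q by (intro module_homI S.left_module_axioms X.left_module_axioms P)
    define s where "s = i b\<^sub>0 \<oplus>\<^bsub>S\<^esub> j x"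
    have s: "s \<in> carrier S" "p s = b\<^sub>0" "q s = x"
      using cl B(2) X(2) P by (simp_all add: s_def p.add q.add)
    let ?C = "(\<lambda>a. a \<odot>\<^bsub>S\<^esub> s) ` carrier \<Lambda>"
    note C = S.orbit_submod[OF s(1)]
    let ?SC = "S\<lparr>carrier := ?C\<rparr>"
    have SCE: "?SC \<in> \<E>" by (rule sub_closed[OF S(1) C(1)])
    have gen: "U = ?C" if U: "submod \<Lambda> ?SC U" "s \<in> U" for U
    proof
      show "U \<subseteq> ?C" using submodD(1)[OF U(1)] by simp
      show "?C \<subseteq> U" using submodD(4)[OF U(1)] U(2) by auto
    qed
    then have "cand (?SC, s)" using SCE C(2) by (simp add: cand_def)
    then have le: "rl ?SC ?C \<le> rl B (carrier B)" using t(2)[of "(?SC, s)"] Bb by simp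
    have pC: "p \<in> mod_hom \<Lambda> ?SC B" by (rule hom_on_submod[OF P(2) C(1)])
    interpret pC: module_hom \<Lambda> ?SC B p by (intro module_homI E_lm SCE B pC)
    interpret rp: module_hom R "res ?SC" "res B" p by (rule module_hom_res[OF pC.module_hom_axioms])
    \<comment> \<open>The projection of the submodule generated by \<open>s\<close> contains the
      generator of \<open>B\<close>. By maximality of the length of \<open>B\<close> this surjection
      is injective; following its inverse by \<open>q\<close> gives the homomorphism that sends the
      generator to \<open>x\<close>.\<close>
    have surj: "p ` ?C = carrier B"
      using B(3)[OF pC.submod_image[OF pC.M.submod_carrier]] s(2) C(2) by auto
    have "rl ?SC ?C = rl ?SC (?C \<inter> {x \<in> ?C. p x = \<zero>\<^bsub>B\<^esub>}) + rl B (carrier B)"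
      using rp.len_hom'[OF rp.M.submod_carrier] finlen_mods[OF E_mods[OF SCE] order_refl] surj by simp
    then have "rl ?SC (?C \<inter> {x \<in> ?C. p x = \<zero>\<^bsub>B\<^esub>}) = 0" using le by linarith
    then have "?C \<inter> {x \<in> ?C. p x = \<zero>\<^bsub>B\<^esub>} = {\<zero>\<^bsub>S\<^esub>}"
      using rp.M.len_eq_0D[OF finlen_mods[OF E_mods[OF SCE]] submod_Int[OF rp.M.submod_carrier rp.submod_ker]] by auto
    then have "inj_on p (carrier ?SC)" by (intro pC.inj_onI_ker) auto
    then have "bij_betw p (carrier ?SC) (carrier B)" using surj by (simp add: bij_betw_def)
    then obtain u where u: "u \<in> mod_hom \<Lambda> B ?SC" "\<forall>x\<in>carrier ?SC. u (p x) = x"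
      using hom_inverse[OF E_lm[OF SCE] B.left_module_axioms pC] by blast
    have "u b\<^sub>0 = s" using u(2) s(2) C(2) by (metis partial_object.select_convs(1) partial_object.update_convs(1) partial_object.surjective)
    then show ?thesis
      using s(3) by (intro bexI[OF _ hom_comp[OF hom_comp[OF u(1) hom_inclusion[OF C(1)]] P(4)]]) simp
  qed
  then show thesis using that B by blast
qed

text \<open>The set \<open>M\<close> is the radical of \<open>P\<close>: a proper submodule that
  contains all others. The last clause is projectivity relative to \<open>\<E>\<close>, in the form
  that surjections onto \<open>P\<close> split.\<close>

definition local_proj :: "'a modobj \<Rightarrow> 'a list set \<Rightarrow> bool" where
  "local_proj P M \<longleftrightarrow> ind P \<and> submod \<Lambda> P M \<and> M \<noteq> carrier P \<and> (\<forall>U. submod \<Lambda> P U \<longrightarrow> U \<noteq> carrier P \<longrightarrow> U \<subseteq> M) \<and>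
    (\<forall>V v. V \<in> \<E> \<longrightarrow> v \<in> mod_hom \<Lambda> V P \<longrightarrow> v ` carrier V = carrier P \<longrightarrow> (\<exists>s\<in>mod_hom \<Lambda> P V. \<forall>x\<in>carrier P. v (s x) = x))"

text \<open>The list consists of the indecomposable summands of the universal cyclic object
  \<open>B\<close>, which inherit its lifting property. The second conclusion says that together
  they generate every object of \<open>\<E>\<close>.\<close>

lemma local_projectives:
  obtains Ps where "\<And>P. P \<in> set Ps \<Longrightarrow> \<exists>M. local_proj P M"
    "\<And>X X'. X \<in> \<E> \<Longrightarrow> submod \<Lambda> X X' \<Longrightarrow> X' \<noteq> carrier X \<Longrightarrow> \<exists>P\<in>set Ps. \<exists>\<theta>\<in>mod_hom \<Lambda> P X. \<not> \<theta> ` carrier P \<subseteq> X'"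
proof -
  obtain B b\<^sub>0 where B: "B \<in> \<E>" "b\<^sub>0 \<in> carrier B" "\<And>U. submod \<Lambda> B U \<Longrightarrow> b\<^sub>0 \<in> U \<Longrightarrow> U = carrier B"
    "\<And>X x. X \<in> \<E> \<Longrightarrow> x \<in> carrier X \<Longrightarrow> \<exists>h\<in>mod_hom \<Lambda> B X. h b\<^sub>0 = x"
    by (rule universal_cyclic) (rule that)
  interpret B: left_module \<Lambda> B by (rule E_lm[OF B(1)])
  obtain Ps where Ps: "\<forall>P\<in>set Ps. ind P" "is_direct_sum \<Lambda> B Ps" using decomposition_exists[OF B(1)] by blast
  have retr: "\<exists>\<iota>\<in>mod_hom \<Lambda> P B. \<exists>\<pi>\<in>mod_hom \<Lambda> B P. \<forall>y\<in>carrier P. \<pi> (\<iota> y) = y" if P: "P \<in> set Ps" for P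
  proof -
    obtain n where n: "n < length Ps" "Ps ! n = P" using P by (metis in_set_conv_nth)
    show ?thesis
    proof (rule is_direct_sumE[OF Ps(2)])
      fix \<iota>' \<pi>' assume *: "\<And>i. i < length Ps \<Longrightarrow> \<iota>' i \<in> mod_hom \<Lambda> (Ps ! i) B"
        "\<And>i. i < length Ps \<Longrightarrow> \<pi>' i \<in> mod_hom \<Lambda> B (Ps ! i)"
        "\<And>i j y. i < length Ps \<Longrightarrow> j < length Ps \<Longrightarrow> y \<in> carrier (Ps ! i) \<Longrightarrow> \<pi>' j (\<iota>' i y) = (if i = j then y else \<zero>\<^bsub>Ps ! j\<^esub>)"
      show ?thesis using *(1)[OF n(1)] *(2)[OF n(1)] *(3)[OF n(1) n(1)] n(2)
        by (intro bexI[of _ "\<iota>' n"] bexI[of _ "\<pi>' n"]) auto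
    qed
  qed
  have "\<exists>M. local_proj P M" if P: "P \<in> set Ps" for P
  proof -
    have Pi: "ind P" using Ps P by blast
    note PE = indD(1)[OF Pi] and Pm = indD(3)[OF Pi]
    interpret P: left_module \<Lambda> P by (rule indD(4)[OF Pi])
    obtain \<iota> \<pi> where ip: "\<iota> \<in> mod_hom \<Lambda> P B" "\<pi> \<in> mod_hom \<Lambda> B P" "\<And>y. y \<in> carrier P \<Longrightarrow> \<pi> (\<iota> y) = y"
      using retr[OF P] by blast
    have pb: "\<pi> b\<^sub>0 \<in> carrier P" by (rule hom_closed[OF ip(2) B(2)])
    have lift: "\<exists>s\<in>mod_hom \<Lambda> P V. \<forall>x\<in>carrier P. v (s x) = x"
      if V: "V \<in> \<E>" "v \<in> mod_hom \<Lambda> V P" "v ` carrier V = carrier P" for V v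
    proof -
      obtain w where w: "w \<in> carrier V" "v w = \<pi> b\<^sub>0" using V(3) pb by (metis imageE)
      obtain h where h: "h \<in> mod_hom \<Lambda> B V" "h b\<^sub>0 = w" using B(4)[OF V(1) w(1)] by blast
      have "v (h b) = \<pi> b" if "b \<in> carrier B" for b
        using h(2) w(2)
        by (intro hom_eq_on_generator[OF B.left_module_axioms P.left_module_axioms hom_comp[OF h(1) V(2)] ip(2) B(3) B(2) _ that]) auto
      then show ?thesis using ip(3) hom_closed[OF ip(1)] by (intro bexI[OF _ hom_comp[OF ip(1) h(1)]]) simp
    qed
    \<comment> \<open>If \<open>U\<close> and \<open>V\<close> together fill \<open>P\<close>, the
      generator image splits as \<open>u \<oplus> v\<close>; lifting both parts gives endomorphisms
      with sum the identity, with images in \<open>U\<close> and in \<open>V\<close>. One of them is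
      bijective because \<open>P\<close> is indecomposable.\<close>
    have local: "U = carrier P \<or> V = carrier P"
      if U: "submod \<Lambda> P U" and V: "submod \<Lambda> P V" and UV: "submod_sum P U V = carrier P" for U V
    proof -
      obtain u v where uv: "u \<in> U" "v \<in> V" "\<pi> b\<^sub>0 = u \<oplus>\<^bsub>P\<^esub> v" using pb UV unfolding submod_sum_def by blast
      obtain \<phi> where \<phi>: "\<phi> \<in> mod_hom \<Lambda> B (P\<lparr>carrier := U\<rparr>)" "\<phi> b\<^sub>0 = u" using B(4)[OF sub_closed[OF PE U]] uv(1) by auto
      obtain \<psi> where \<psi>: "\<psi> \<in> mod_hom \<Lambda> B (P\<lparr>carrier := V\<rparr>)" "\<psi> b\<^sub>0 = v" using B(4)[OF sub_closed[OF PE V]] uv(2) by auto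
      note \<phi>' = hom_comp[OF \<phi>(1) hom_inclusion[OF U]] and \<psi>' = hom_comp[OF \<psi>(1) hom_inclusion[OF V]]
      have sum: "\<phi> b \<oplus>\<^bsub>P\<^esub> \<psi> b = \<pi> b" if "b \<in> carrier B" for b
        using \<phi>(2) \<psi>(2) uv(3)
        by (intro hom_eq_on_generator[OF B.left_module_axioms P.left_module_axioms hom_add[OF P.left_module_axioms \<phi>' \<psi>'] ip(2) B(3) B(2) _ that]) auto
      have h: "(\<lambda>x. \<phi> (\<iota> x)) \<in> mod_hom \<Lambda> P P" "(\<lambda>x. \<psi> (\<iota> x)) \<in> mod_hom \<Lambda> P P"
        using hom_comp[OF ip(1) \<phi>'] hom_comp[OF ip(1) \<psi>'] .
      have "inj_on (\<lambda>x. \<phi> (\<iota> x)) (carrier P) \<or> inj_on (\<lambda>x. \<psi> (\<iota> x)) (carrier P)"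
        using sum ip(3) hom_closed[OF ip(1)] by (intro ind_endo_sum[OF Pi h]) simp
      then have "bij_betw (\<lambda>x. \<phi> (\<iota> x)) (carrier P) (carrier P) \<or> bij_betw (\<lambda>x. \<psi> (\<iota> x)) (carrier P) (carrier P)"
        using endo_inj_imp_bij[OF Pm] h by blast
      moreover have "(\<lambda>x. \<phi> (\<iota> x)) ` carrier P \<subseteq> U" "(\<lambda>x. \<psi> (\<iota> x)) ` carrier P \<subseteq> V"
        using hom_closed[OF hom_comp[OF ip(1) \<phi>(1)]] hom_closed[OF hom_comp[OF ip(1) \<psi>(1)]] by auto
      ultimately show ?thesis using submodD(1)[OF U] submodD(1)[OF V] unfolding bij_betw_def by blast
    qed
    have M0: "submod \<Lambda> P {\<zero>\<^bsub>P\<^esub>} \<and> {\<zero>\<^bsub>P\<^esub>} \<noteq> carrier P" using indD(2)[OF Pi] by auto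
    have bound: "\<forall>U. submod \<Lambda> P U \<and> U \<noteq> carrier P \<longrightarrow> rl P U < Suc (rl P (carrier P))"
      using len_mono[OF finlen_mods[OF Pm order_refl] submod_res submod_res[OF P.submod_carrier]] submodD(1)
      by (metis le_imp_less_Suc)
    obtain M where M: "submod \<Lambda> P M" "M \<noteq> carrier P" "\<And>U. submod \<Lambda> P U \<Longrightarrow> U \<noteq> carrier P \<Longrightarrow> rl P U \<le> rl P M"
      using ex_has_greatest_nat[of "\<lambda>U. submod \<Lambda> P U \<and> U \<noteq> carrier P", OF M0 bound] by blast
    \<comment> \<open>The sum of \<open>M\<close> with a proper submodule is proper by
      \<open>local\<close>, so it cannot exceed \<open>M\<close>, which has the greatest
      length.\<close>
    have "U \<subseteq> M" if U: "submod \<Lambda> P U" "U \<noteq> carrier P" for U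
    proof -
      note S = P.submod_sum[OF M(1) U(1)]
      have "submod_sum P M U \<noteq> carrier P" using local[OF M(1) U(1)] M(2) U(2) by blast
      then have "M = submod_sum P M U"
        using M(3)[OF S(1)] by (intro len_eqD[OF finlen_mods[OF Pm submodD(1)[OF S(1)]] submod_res[OF M(1)] submod_res[OF S(1)] S(2)]) simp
      then show ?thesis using S(3) by simp
    qed
    then show ?thesis unfolding local_proj_def using Pi M(1,2) lift by blast
  qed
  moreover have "\<exists>P\<in>set Ps. \<exists>\<theta>\<in>mod_hom \<Lambda> P X. \<not> \<theta> ` carrier P \<subseteq> X'"
    if X: "X \<in> \<E>" "submod \<Lambda> X X'" "X' \<noteq> carrier X" for X X'
  proof (rule ccontr)
    assume not: "\<not> ?thesis"
    have nt: "\<theta> ` carrier P \<subseteq> X'" if "P \<in> set Ps" "\<theta> \<in> mod_hom \<Lambda> P X" for P \<theta> using not that by blast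
    obtain x where x: "x \<in> carrier X" "x \<notin> X'" using X(3) submodD(1)[OF X(2)] by blast
    obtain h where h: "h \<in> mod_hom \<Lambda> B X" "h b\<^sub>0 = x" using B(4)[OF X(1) x(1)] by blast
    \<comment> \<open>If all maps from the summands land in \<open>X'\<close>, so does every map
      from \<open>B\<close>; but \<open>B\<close> has a map that hits \<open>x\<close>.\<close>
    have "fac B h (X\<lparr>carrier := X'\<rparr>) (\<lambda>x. x)"
    proof (rule fac_direct_sum[OF E_mods[OF B(1)] sub_mods[OF E_mods[OF X(1)] X(2)] E_mods[OF X(1)] hom_inclusion[OF X(2)] _ Ps(2) h(1)])
      show "set Ps \<subseteq> mods \<Lambda>" using Ps(1) indD(3) by blast
      fix P s assume P: "P \<in> set Ps" "s \<in> mod_hom \<Lambda> P B"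
      have hs: "(\<lambda>x. h (s x)) \<in> mod_hom \<Lambda> P X" by (rule hom_comp[OF P(2) h(1)])
      have "(\<lambda>x. h (s x)) ` carrier P \<subseteq> X'" by (rule nt[OF P(1) hs])
      then show "fac P (\<lambda>x. h (s x)) (X\<lparr>carrier := X'\<rparr>) (\<lambda>x. x)"
        by (intro facI[OF hom_into_submod[OF hs]]) auto
    qed
    then obtain k where "k \<in> mod_hom \<Lambda> B (X\<lparr>carrier := X'\<rparr>)" "\<And>x. x \<in> carrier B \<Longrightarrow> h x = k x" by (rule facE) (rule that)
    then show False using hom_closed[of k \<Lambda> B "X\<lparr>carrier := X'\<rparr>" b\<^sub>0] B(2) h(2) x(2) by simp
  qed
  ultimately show thesis using that by blast
qed

end

section \<open>Torsionfree classes\<close>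

context exact_subcat
begin

text \<open>This is the exactness enforced by vanishing values of \<open>ext_fn\<close>: it holds
  for all but finitely many \<open>W\<close> once the classes of the finitely many conflations in
  \<open>D\<close> lie in \<open>AR_subgroup\<close>.\<close>

definition passes :: "'a modobj \<Rightarrow> ('a modobj \<times> ('a list \<Rightarrow> 'a list) \<times> 'a modobj \<times> ('a list \<Rightarrow> 'a list) \<times> 'a modobj) set \<Rightarrow> bool" where
  "passes W D \<longleftrightarrow> (\<forall>(X, f, Y, g, Z)\<in>D. (\<forall>h\<in>mod_hom \<Lambda> W Z. fac W h Y g) \<and>
     (\<forall>k\<in>mod_hom \<Lambda> X W. \<exists>l\<in>mod_hom \<Lambda> Y W. \<forall>x\<in>carrier X. k x = l (f x)))"

lemma passes_mono: "passes W D \<Longrightarrow> D' \<subseteq> D \<Longrightarrow> passes W D'"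
  unfolding passes_def by blast

text \<open>The predicate \<open>A\<close> singles out the indecomposables to which the test
  conflations \<open>D\<close> apply, and \<open>H\<close> lists the candidates that may pass all
  tests.\<close>

definition detects where
  "detects D H A \<longleftrightarrow> finite D \<and> (\<forall>(X, f, Y, g, Z)\<in>D. conflation \<Lambda> \<E> X f Y g Z) \<and> finite H \<and> H \<subseteq> \<E> \<and>
    (\<forall>W. ind W \<longrightarrow> A W \<longrightarrow> passes W D \<longrightarrow> (\<exists>Q\<in>H. mod_iso \<Lambda> W Q))"

lemma finite_type_of_detection:
  assumes eq: "AR_subgroup \<Lambda> \<E> = Ex_subgroup \<Lambda> \<E>"
    and I: "finite I" "\<And>i. i \<in> I \<Longrightarrow> \<exists>D H. detects D H (A i)" "\<And>W. ind W \<Longrightarrow> \<exists>i\<in>I. A i W"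
  shows "finite_type \<Lambda> \<E>"
proof -
  have "\<forall>i\<in>I. \<exists>t. detects (fst t) (snd t) (A i)" using I(2) by simp
  from bchoice[OF this] obtain t where t: "\<forall>i\<in>I. detects (fst (t i)) (snd (t i)) (A i)" by (elim exE)
  let ?D = "\<Union>i\<in>I. fst (t i)" and ?H = "\<Union>i\<in>I. snd (t i)"
  show ?thesis
  proof (rule AR_eq_Ex_imp_finite_type[OF eq, of ?D ?H])
    show "finite ?D" "finite ?H" using I(1) t by (auto simp: detects_def)
    show "?H \<subseteq> \<E>" using t unfolding detects_def by blast
    show "conflation \<Lambda> \<E> X f Y g Z" if "(X, f, Y, g, Z) \<in> ?D" for X f Y g Z
      using that t by (fastforce simp: detects_def)
    fix W assume W: "ind W" and p: "\<And>X f Y g Z h. (X, f, Y, g, Z) \<in> ?D \<Longrightarrow> h \<in> mod_hom \<Lambda> W Z \<Longrightarrow> fac W h Y g"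
      "\<And>X f Y g Z k. (X, f, Y, g, Z) \<in> ?D \<Longrightarrow> k \<in> mod_hom \<Lambda> X W \<Longrightarrow> \<exists>l\<in>mod_hom \<Lambda> Y W. \<forall>x\<in>carrier X. k x = l (f x)"
    have pD: "passes W ?D" unfolding passes_def
    proof (intro ballI)
      fix u assume u: "u \<in> ?D"
      obtain X f Y g Z where uu: "u = (X, f, Y, g, Z)" by (cases u)
      show "case u of (X, f, Y, g, Z) \<Rightarrow> (\<forall>h\<in>mod_hom \<Lambda> W Z. fac W h Y g) \<and>
        (\<forall>k\<in>mod_hom \<Lambda> X W. \<exists>l\<in>mod_hom \<Lambda> Y W. \<forall>x\<in>carrier X. k x = l (f x))"
        using p(1)[OF u[unfolded uu]] p(2)[OF u[unfolded uu]] unfolding uu by simp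
    qed
    obtain i where i: "i \<in> I" "A i W" using I(3)[OF W] by blast
    have "passes W (fst (t i))" by (rule passes_mono[OF pD]) (use i(1) in blast)
    then have "\<exists>Q\<in>snd (t i). mod_iso \<Lambda> W Q" using t[rule_format, OF i(1)] i(2) W unfolding detects_def by blast
    then show "\<exists>Q\<in>?H. mod_iso \<Lambda> W Q" using i(1) by blast
  qed
qed

text \<open>The conflation is the pullback of \<open>M \<rightarrow> P \<rightarrow> P/M\<close> along the approximation of the simple \<open>P/M\<close>: if \<open>W\<close> maps onto
  \<open>P/M\<close> and passes it, this map lifts to a surjection \<open>W \<rightarrow> P\<close>, which splits.\<close>

lemma local_proj_detects:
  assumes sub: "sub_subcat R \<Lambda> \<E>" and cf: "contravariantly_finite \<Lambda> \<E>" and P: "sub_subcat.local_proj \<Lambda> \<E> P M"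
  shows "\<exists>D H. detects D H (\<lambda>W. \<exists>W'. submod \<Lambda> W W' \<and> (\<forall>U. submod \<Lambda> W U \<longrightarrow> W' \<subseteq> U \<longrightarrow> U = W' \<or> U = carrier W) \<and>
    (\<exists>\<theta>\<in>mod_hom \<Lambda> P W. \<not> \<theta> ` carrier P \<subseteq> W'))"
proof -
  interpret sub_subcat R \<Lambda> \<E> by (rule sub)
  have Pi: "ind P" and M: "submod \<Lambda> P M" "M \<noteq> carrier P" "\<And>U. submod \<Lambda> P U \<Longrightarrow> U \<noteq> carrier P \<Longrightarrow> U \<subseteq> M"
    and lift: "\<And>V v. V \<in> \<E> \<Longrightarrow> v \<in> mod_hom \<Lambda> V P \<Longrightarrow> v ` carrier V = carrier P \<Longrightarrow> \<exists>s\<in>mod_hom \<Lambda> P V. \<forall>x\<in>carrier P. v (s x) = x"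
    using P unfolding local_proj_def by blast+
  note PE = indD(1)[OF Pi] and Pm = indD(3)[OF Pi]
  interpret P: left_module \<Lambda> P by (rule indD(4)[OF Pi])
  obtain S \<sigma> where S: "S \<in> mods \<Lambda>" "\<sigma> \<in> mod_hom \<Lambda> P S" "\<sigma> ` carrier P = carrier S"
    "\<And>x. x \<in> carrier P \<Longrightarrow> \<sigma> x = \<zero>\<^bsub>S\<^esub> \<longleftrightarrow> x \<in> M" by (rule quo_mods[OF Pm M(1)]) (rule that)
  let ?M = "P\<lparr>carrier := M\<rparr>"
  have ME: "?M \<in> \<E>" by (rule sub_closed[OF PE M(1)])
  have exP: "short_exact \<Lambda> ?M (\<lambda>x. x) P \<sigma> S"
    using S submodD(5)[OF M(1)] by (intro short_exactI hom_inclusion[OF M(1)]) auto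
  obtain C c where C: "C \<in> \<E>" "c \<in> mod_hom \<Lambda> C S"
    "\<And>E h. E \<in> \<E> \<Longrightarrow> h \<in> mod_hom \<Lambda> E S \<Longrightarrow> \<exists>k\<in>mod_hom \<Lambda> E C. \<forall>x\<in>carrier E. h x = c (k x)"
    using cf S(1) unfolding contravariantly_finite_def by blast
  obtain T i p j q K f d where T: "T \<in> mods \<Lambda>" "biprod \<Lambda> T i p C j q P" "submod \<Lambda> T K"
    "K = {s \<in> carrier T. c (p s) = \<sigma> (q s)}" "short_exact \<Lambda> ?M f (T\<lparr>carrier := K\<rparr>) p C"
    "d \<in> mod_hom \<Lambda> T S" "short_exact \<Lambda> (T\<lparr>carrier := K\<rparr>) (\<lambda>x. x) T d S"
    "\<And>s. s \<in> carrier T \<Longrightarrow> d s = c (p s) \<ominus>\<^bsub>S\<^esub> \<sigma> (q s)"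
    by (rule pullback[OF E_mods[OF ME] Pm S(1) E_mods[OF C(1)] exP C(2)]) (rule that)
  let ?K = "T\<lparr>carrier := K\<rparr>"
  have KE: "?K \<in> \<E>" by (rule E_ext[OF ME C(1) sub_mods[OF T(1,3)] T(5)])
  have con: "conflation \<Lambda> \<E> ?M f ?K p C" using ME KE C(1) T(5) by (simp add: conflation_def)
  interpret \<sigma>: module_hom \<Lambda> P S \<sigma> by (intro module_homI modsD Pm S)
  have iso: "mod_iso \<Lambda> W P"
    if W: "ind W" and fc: "\<And>h. h \<in> mod_hom \<Lambda> W C \<Longrightarrow> fac W h ?K p"
      and W': "submod \<Lambda> W W'" "\<And>U. submod \<Lambda> W U \<Longrightarrow> W' \<subseteq> U \<Longrightarrow> U = W' \<or> U = carrier W"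
      and \<theta>: "\<theta> \<in> mod_hom \<Lambda> P W" "\<not> \<theta> ` carrier P \<subseteq> W'" for W W' \<theta>
  proof -
    interpret W: left_module \<Lambda> W by (rule indD(4)[OF W])
    obtain Q \<omega> where Q: "Q \<in> mods \<Lambda>" "\<omega> \<in> mod_hom \<Lambda> W Q" "\<omega> ` carrier W = carrier Q"
      "\<And>x. x \<in> carrier W \<Longrightarrow> \<omega> x = \<zero>\<^bsub>Q\<^esub> \<longleftrightarrow> x \<in> W'" by (rule quo_mods[OF indD(3)[OF W] W'(1)]) (rule that)
    have \<omega>\<theta>: "(\<lambda>x. \<omega> (\<theta> x)) \<in> mod_hom \<Lambda> P Q" by (rule hom_comp[OF \<theta>(1) Q(2)])
    interpret \<omega>: module_hom \<Lambda> W Q \<omega> by (intro module_homI indD(4)[OF W] modsD(1)[OF Q(1)] Q)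
    interpret \<omega>\<theta>: module_hom \<Lambda> P Q "\<lambda>x. \<omega> (\<theta> x)" by (intro module_homI indD(4)[OF Pi] modsD(1)[OF Q(1)] \<omega>\<theta>)
    \<comment> \<open>The preimage \<open>?V\<close> of this image contains \<open>W'\<close> and an
      element outside it, so it is all of \<open>W\<close> by maximality of \<open>W'\<close>; hence
      \<open>P\<close> maps onto the simple quotient of \<open>W\<close>.\<close>
    let ?I = "(\<lambda>x. \<omega> (\<theta> x)) ` carrier P"
    have I: "submod \<Lambda> Q ?I" by (rule \<omega>\<theta>.submod_image[OF P.submod_carrier])
    let ?V = "{w \<in> carrier W. \<omega> w \<in> ?I}"
    have V: "submod \<Lambda> W ?V" by (rule \<omega>.submod_vimage[OF I])
    have W'V: "W' \<subseteq> ?V"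
    proof
      fix w assume w: "w \<in> W'"
      then have wc: "w \<in> carrier W" using submodD(5)[OF W'(1)] by blast
      have "\<omega> w = \<zero>\<^bsub>Q\<^esub>" using Q(4)[OF wc] w by simp
      then show "w \<in> ?V" using wc submodD(2)[OF I] by simp
    qed
    obtain y where y: "y \<in> carrier P" "\<theta> y \<notin> W'" using \<theta>(2) by blast
    have "\<theta> y \<in> ?V" using y(1) hom_closed[OF \<theta>(1)] by auto
    then have "?V = carrier W" using W'(2)[OF V W'V] y(2) by auto
    then have VW: "\<omega> w \<in> ?I" if "w \<in> carrier W" for w using that by (metis (no_types, lifting) mem_Collect_eq)
    have surj: "?I = carrier Q"
    proof
      show "?I \<subseteq> carrier Q" by (rule submodD(1)[OF I])
      show "carrier Q \<subseteq> ?I" unfolding Q(3)[symmetric] using VW by (rule image_subsetI)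
    qed
    have ker: "\<sigma> x = \<zero>\<^bsub>S\<^esub>" if x: "x \<in> carrier P" "\<omega> (\<theta> x) = \<zero>\<^bsub>Q\<^esub>" for x
    proof -
      have "\<omega> (\<theta> y) \<noteq> \<zero>\<^bsub>Q\<^esub>" using Q(4) y hom_closed[OF \<theta>(1) y(1)] by simp
      then have "{x \<in> carrier P. \<omega> (\<theta> x) = \<zero>\<^bsub>Q\<^esub>} \<noteq> carrier P" using y(1) by blast
      then have "{x \<in> carrier P. \<omega> (\<theta> x) = \<zero>\<^bsub>Q\<^esub>} \<subseteq> M" by (rule M(3)[OF \<omega>\<theta>.submod_ker])
      then show ?thesis using S(4) x by blast
    qed
    \<comment> \<open>The kernel of the map to \<open>Q\<close> is a proper submodule of
      \<open>P\<close>, hence inside \<open>M\<close>; this identifies the simple quotient of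
      \<open>W\<close> with the simple top of \<open>P\<close> far enough to map \<open>W\<close> to
      \<open>S\<close>.\<close>
    obtain \<tau> where \<tau>: "\<tau> \<in> mod_hom \<Lambda> Q S" "\<And>x. x \<in> carrier P \<Longrightarrow> \<tau> (\<omega> (\<theta> x)) = \<sigma> x"
      using hom_factor_surj[OF P.left_module_axioms modsD(1)[OF Q(1)] modsD(1)[OF S(1)] \<omega>\<theta> surj S(2) ker] by blast
    have h: "(\<lambda>w. \<tau> (\<omega> w)) \<in> mod_hom \<Lambda> W S" by (rule hom_comp[OF Q(2) \<tau>(1)])
    obtain k where k: "k \<in> mod_hom \<Lambda> W C" "\<forall>w\<in>carrier W. \<tau> (\<omega> w) = c (k w)" using C(3)[OF indD(1)[OF W] h] by blast
    obtain k' where k': "k' \<in> mod_hom \<Lambda> W ?K" "\<And>w. w \<in> carrier W \<Longrightarrow> k w = p (k' w)" using fc[OF k(1)] by (rule facE) (rule that)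
    define v where "v w = q (k' w)" for w
    have v: "v \<in> mod_hom \<Lambda> W P"
      unfolding v_def by (rule hom_comp[OF hom_comp[OF k'(1) hom_inclusion[OF T(3)]] biprodD(4)[OF T(2)]])
    have \<sigma>v: "\<sigma> (v w) = \<tau> (\<omega> w)" if w: "w \<in> carrier W" for w
      using hom_closed[OF k'(1) w] k(2) k'(2)[OF w] w T(4) by (simp add: v_def)
    interpret v: module_hom \<Lambda> W P v by (intro module_homI indD(4)[OF W] indD(4)[OF Pi] v)
    \<comment> \<open>A lift that is not surjective has its image in the radical \<open>M\<close>
      and dies in \<open>S\<close>, although it has to induce \<open>\<sigma>\<close> along
      \<open>\<theta>\<close>.\<close>
    have "v ` carrier W = carrier P"
    proof (rule ccontr)
      assume "v ` carrier W \<noteq> carrier P"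
      then have vM: "v ` carrier W \<subseteq> M" by (rule M(3)[OF v.submod_image[OF W.submod_carrier]])
      obtain x where x: "x \<in> carrier P" "x \<notin> M" using M(2) submodD(1)[OF M(1)] by blast
      have tx: "\<theta> x \<in> carrier W" by (rule hom_closed[OF \<theta>(1) x(1)])
      have "\<sigma> (v (\<theta> x)) = \<zero>\<^bsub>S\<^esub>" using S(4)[of "v (\<theta> x)"] vM tx by auto
      then show False using \<sigma>v[OF tx] \<tau>(2)[OF x(1)] S(4)[OF x(1)] x(2) by simp
    qed
    then obtain s where s: "s \<in> mod_hom \<Lambda> P W" "\<And>x. x \<in> carrier P \<Longrightarrow> v (s x) = x" using lift[OF indD(1)[OF W] v] by blast
    have "bij_betw v (carrier W) (carrier P)"
      by (rule split_mono_into_ind(2)[OF Pm indD(2)[OF Pi] W s(1) v s(2)])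
    then show ?thesis using v unfolding mod_iso_def by blast
  qed
  show ?thesis
  proof (intro exI[of _ "{(?M, f, ?K, p, C)}"] exI[of _ "{P}"], unfold detects_def, intro conjI allI impI)
    fix W assume W: "ind W" and A: "\<exists>W'. submod \<Lambda> W W' \<and> (\<forall>U. submod \<Lambda> W U \<longrightarrow> W' \<subseteq> U \<longrightarrow> U = W' \<or> U = carrier W) \<and>
      (\<exists>\<theta>\<in>mod_hom \<Lambda> P W. \<not> \<theta> ` carrier P \<subseteq> W')" and pass: "passes W {(?M, f, ?K, p, C)}"
    have "fac W h ?K p" if "h \<in> mod_hom \<Lambda> W C" for h using pass that by (simp add: passes_def)
    from iso[OF W this] A have "mod_iso \<Lambda> W P" by metis
    then show "\<exists>Q\<in>{P}. mod_iso \<Lambda> W Q" by simp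
  qed (use con PE in auto)
qed

theorem torsionfree_finite_type:
  assumes sub: "sub_subcat R \<Lambda> \<E>" and cf: "contravariantly_finite \<Lambda> \<E>" and eq: "AR_subgroup \<Lambda> \<E> = Ex_subgroup \<Lambda> \<E>"
  shows "finite_type \<Lambda> \<E>"
proof -
  interpret sub_subcat R \<Lambda> \<E> by (rule sub)
  obtain Ps where Ps: "\<And>P. P \<in> set Ps \<Longrightarrow> \<exists>M. local_proj P M"
    "\<And>X X'. X \<in> \<E> \<Longrightarrow> submod \<Lambda> X X' \<Longrightarrow> X' \<noteq> carrier X \<Longrightarrow> \<exists>P\<in>set Ps. \<exists>\<theta>\<in>mod_hom \<Lambda> P X. \<not> \<theta> ` carrier P \<subseteq> X'"
    by (rule local_projectives) (rule that)
  show ?thesis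
  proof (rule finite_type_of_detection[OF eq, of "set Ps" "\<lambda>P W. \<exists>W'. submod \<Lambda> W W' \<and>
      (\<forall>U. submod \<Lambda> W U \<longrightarrow> W' \<subseteq> U \<longrightarrow> U = W' \<or> U = carrier W) \<and> (\<exists>\<theta>\<in>mod_hom \<Lambda> P W. \<not> \<theta> ` carrier P \<subseteq> W')"])
    show "finite (set Ps)" by simp
    fix P assume "P \<in> set Ps"
    then obtain M where "local_proj P M" using Ps(1) by blast
    then show "\<exists>D H. detects D H (\<lambda>W. \<exists>W'. submod \<Lambda> W W' \<and>
      (\<forall>U. submod \<Lambda> W U \<longrightarrow> W' \<subseteq> U \<longrightarrow> U = W' \<or> U = carrier W) \<and> (\<exists>\<theta>\<in>mod_hom \<Lambda> P W. \<not> \<theta> ` carrier P \<subseteq> W'))"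
      by (rule local_proj_detects[OF sub cf])
  next
    fix W assume W: "ind W"
    note Wm = indD(3)[OF W]
    interpret W: left_module \<Lambda> W by (rule indD(4)[OF W])
    have M0: "submod \<Lambda> W {\<zero>\<^bsub>W\<^esub>} \<and> {\<zero>\<^bsub>W\<^esub>} \<noteq> carrier W" using indD(2)[OF W] by auto
    have bound: "\<forall>U. submod \<Lambda> W U \<and> U \<noteq> carrier W \<longrightarrow> rl W U < Suc (rl W (carrier W))"
      using len_mono[OF finlen_mods[OF Wm order_refl] submod_res submod_res[OF W.submod_carrier]] submodD(1)
      by (metis le_imp_less_Suc)
    \<comment> \<open>A proper submodule of greatest length is maximal, and some \<open>P\<close>
      has a map to \<open>W\<close> that leaves it.\<close>
    obtain W' where W': "submod \<Lambda> W W'" "W' \<noteq> carrier W" "\<And>U. submod \<Lambda> W U \<Longrightarrow> U \<noteq> carrier W \<Longrightarrow> rl W U \<le> rl W W'"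
      using ex_has_greatest_nat[of "\<lambda>U. submod \<Lambda> W U \<and> U \<noteq> carrier W", OF M0 bound] by blast
    have "U = W' \<or> U = carrier W" if U: "submod \<Lambda> W U" "W' \<subseteq> U" for U
    proof (rule disjCI)
      assume "U \<noteq> carrier W"
      then have "W' = U"
        using W'(3)[OF U(1)] by (intro len_eqD[OF finlen_mods[OF Wm submodD(1)[OF U(1)]] submod_res[OF W'(1)] submod_res[OF U(1)] U(2)]) simp
      then show "U = W'" by simp
    qed
    then show "\<exists>P\<in>set Ps. \<exists>W'. submod \<Lambda> W W' \<and>
      (\<forall>U. submod \<Lambda> W U \<longrightarrow> W' \<subseteq> U \<longrightarrow> U = W' \<or> U = carrier W) \<and> (\<exists>\<theta>\<in>mod_hom \<Lambda> P W. \<not> \<theta> ` carrier P \<subseteq> W')"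
      using Ps(2)[OF indD(1)[OF W] W'(1,2)] W'(1) by blast
  qed
qed

end

section \<open>Essential extensions have bounded length\<close>

context module_hom
begin

lemma len_subset_image_le:
  assumes U: "submod A M U" "finlen A M U" and W: "submod A N W" "finlen A N W" "f ` U \<subseteq> W"
  shows "len A M U \<le> len A M (U \<inter> {x \<in> carrier M. f x = \<zero>\<^bsub>N\<^esub>}) + len A N W"
  using len_hom'[OF U] len_mono[OF W(2) submod_image[OF U(1)] W(1,3)] by simp

end

text \<open>Each map costs at most the length of \<open>W\<close>, so imposing the vanishing of all
  maps in \<open>T\<close> lowers the length by at most \<open>card T\<close> times that
  amount.\<close>

lemma len_joint_kernel:
  assumes "left_module A M" "left_module A N" and T: "finite T" "\<And>t. t \<in> T \<Longrightarrow> \<phi> t \<in> mod_hom A M N"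
    and U: "submod A M U" "finlen A M U" and W: "submod A N W" "finlen A N W" "\<And>t. t \<in> T \<Longrightarrow> \<phi> t ` U \<subseteq> W"
  shows "submod A M (U \<inter> {x. \<forall>t\<in>T. \<phi> t x = \<zero>\<^bsub>N\<^esub>}) \<and>
    len A M U \<le> len A M (U \<inter> {x. \<forall>t\<in>T. \<phi> t x = \<zero>\<^bsub>N\<^esub>}) + card T * len A N W"
  using T W(3)
proof (induction T)
  case empty
  then show ?case using U(1) by simp
next
  case (insert t T)
  let ?U = "U \<inter> {x. \<forall>t\<in>T. \<phi> t x = \<zero>\<^bsub>N\<^esub>}"
  have IH: "submod A M ?U" "len A M U \<le> len A M ?U + card T * len A N W" using insert by auto
  interpret t: module_hom A M N "\<phi> t" using insert.prems(1)[of t] by (intro module_homI assms(1,2)) simp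
  have eq: "?U \<inter> {x \<in> carrier M. \<phi> t x = \<zero>\<^bsub>N\<^esub>} = U \<inter> {x. \<forall>t\<in>insert t T. \<phi> t x = \<zero>\<^bsub>N\<^esub>}"
    using submodD(1)[OF U(1)] by auto
  have "len A M ?U \<le> len A M (U \<inter> {x. \<forall>t\<in>insert t T. \<phi> t x = \<zero>\<^bsub>N\<^esub>}) + len A N W"
    unfolding eq[symmetric] using insert.prems(2)[of t]
    by (intro t.len_subset_image_le IH finlen_subset[OF U(2)] W(1,2)) auto
  moreover have "submod A M (U \<inter> {x. \<forall>t\<in>insert t T. \<phi> t x = \<zero>\<^bsub>N\<^esub>})"
    unfolding eq[symmetric] by (intro submod_Int IH t.submod_ker)
  ultimately show ?case using IH(2) insert.hyps by simp
qed

context artinian_local_ring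
begin

text \<open>An essential submodule meets the multiples of \<open>x\<close> in some nonzero
  \<open>r x\<close>. As \<open>maxi\<close> kills \<open>x\<close>, the coefficient
  \<open>r\<close> is a unit, and \<open>x\<close> itself lies in \<open>S\<close>.\<close>

lemma soc_one_subset:
  assumes V: "left_module R V" and S: "submod R V S" "\<And>U. submod R V U \<Longrightarrow> U \<inter> S \<subseteq> {\<zero>\<^bsub>V\<^esub>} \<Longrightarrow> U = {\<zero>\<^bsub>V\<^esub>}"
  shows "soc V 1 \<subseteq> S"
proof
  interpret V: left_module R V by (rule V)
  fix x assume x: "x \<in> soc V 1"
  show "x \<in> S"
  proof (cases "x = \<zero>\<^bsub>V\<^esub>")
    case True
    then show ?thesis using submodD(2)[OF S(1)] by simp
  next
    case False
    have xc: "x \<in> carrier V" using x by simp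
    note O = V.orbit_submod[OF xc]
    have "\<not> (\<lambda>a. a \<odot>\<^bsub>V\<^esub> x) ` carrier R \<inter> S \<subseteq> {\<zero>\<^bsub>V\<^esub>}" using S(2)[OF O(1)] O(2) False by blast
    then obtain r where r: "r \<in> carrier R" "r \<odot>\<^bsub>V\<^esub> x \<in> S" "r \<odot>\<^bsub>V\<^esub> x \<noteq> \<zero>\<^bsub>V\<^esub>" by blast
    have "r \<notin> maxi" using x r(3) by auto
    then obtain s where s: "s \<in> carrier R" "s \<otimes> r = \<one>" using notin_maxi_unit[OF r(1)] by blast
    have "x = s \<odot>\<^bsub>V\<^esub> (r \<odot>\<^bsub>V\<^esub> x)" using s r(1) xc by (simp add: V.smult_assoc[symmetric])
    then show ?thesis using submodD(4)[OF S(1) s(1) r(2)] by simp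
  qed
qed

text \<open>Multiplication by generators of \<open>maxi\<close> sends each level of the socle series
  into the preceding one, and the joint kernel lies in the socle, hence in \<open>S\<close>. The
  number of levels and of generators depends on \<open>R\<close> alone.\<close>

lemma essential_length_bound:
  "\<exists>B :: nat \<Rightarrow> nat. \<forall>(V :: ('a, 'c, 'l) module_scheme) S. left_module R V \<longrightarrow> finlen R V (carrier V) \<longrightarrow> submod R V S \<longrightarrow>
    (\<forall>U. submod R V U \<longrightarrow> U \<inter> S \<subseteq> {\<zero>\<^bsub>V\<^esub>} \<longrightarrow> U = {\<zero>\<^bsub>V\<^esub>}) \<longrightarrow> len R V (carrier V) \<le> B (len R V S)"
proof -
  interpret reg: left_module R "regular_module R" by (rule left_module_regular)
  obtain n where n: "\<forall>V. left_module R (V :: ('a, 'c, 'l) module_scheme) \<longrightarrow> soc V n = carrier V" using soc_exhausts by blast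
  obtain T where T: "finite T" "T \<subseteq> maxi" "\<And>V. submod R (regular_module R) V \<Longrightarrow> T \<subseteq> V \<Longrightarrow> maxi \<subseteq> V"
    by (rule reg.finlen_imp_generated[OF maxi_submod finlen_subset[OF finlen_regular]]) (use maxi_carrier in blast)+
  \<comment> \<open>The recursion mirrors one level of the series: at most \<open>l\<close> for the
    joint kernel, and at most \<open>b\<close> for each generator in \<open>T\<close>.\<close>
  define B where "B l j = rec_nat 0 (\<lambda>_ b. l + card T * b) j" for l j
  have "len R V (carrier V) \<le> B (len R V S) n"
    if V: "left_module R V" and fin: "finlen R V (carrier V)" and S: "submod R V S"
      and ess: "\<And>U. submod R V U \<Longrightarrow> U \<inter> S \<subseteq> {\<zero>\<^bsub>V\<^esub>} \<Longrightarrow> U = {\<zero>\<^bsub>V\<^esub>}" for V :: "('a, 'c, 'l) module_scheme" and S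
  proof -
    interpret V: left_module R V by (rule V)
    have fin': "finlen R V U" if "submod R V U" for U using finlen_subset[OF fin submodD(1)[OF that]] .
    have "len R V (soc V j) \<le> B (len R V S) j" for j
    proof (induction j)
      case 0
      then show ?case by (simp add: V.len_zero B_def)
    next
      case (Suc j)
      have hom: "(\<lambda>x. r \<odot>\<^bsub>V\<^esub> x) \<in> mod_hom R V V" if "r \<in> T" for r
        using that T(2) maxi_carrier
        by (auto simp: mod_hom_def V.smult_r_distr V.smult_assoc[symmetric] m_comm subset_iff)
      have im: "(\<lambda>x. r \<odot>\<^bsub>V\<^esub> x) ` soc V (Suc j) \<subseteq> soc V j" if "r \<in> T" for r using that T(2) by auto
      let ?K = "soc V (Suc j) \<inter> {x. \<forall>r\<in>T. r \<odot>\<^bsub>V\<^esub> x = \<zero>\<^bsub>V\<^esub>}"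
      have K: "submod R V ?K" "len R V (soc V (Suc j)) \<le> len R V ?K + card T * len R V (soc V j)"
        using len_joint_kernel[where U = "soc V (Suc j)" and W = "soc V j" and \<phi> = "\<lambda>r x. r \<odot>\<^bsub>V\<^esub> x", OF V V T(1) hom
            submod_soc[OF V] fin'[OF submod_soc[OF V]] submod_soc[OF V] fin'[OF submod_soc[OF V]] im] by auto
      have "?K \<subseteq> soc V 1"
      proof
        fix x assume x: "x \<in> ?K"
        then have xc: "x \<in> carrier V" by simp
        interpret o: module_hom R "regular_module R" V "\<lambda>a. a \<odot>\<^bsub>V\<^esub> x"
          by (intro module_homI left_module_regular V hom_orbit xc)
        have "maxi \<subseteq> {a \<in> carrier (regular_module R). a \<odot>\<^bsub>V\<^esub> x = \<zero>\<^bsub>V\<^esub>}"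
          using x T(2) maxi_carrier by (intro T(3) o.submod_ker) auto
        then show "x \<in> soc V 1" using xc by auto
      qed
      then have "?K \<subseteq> S" using soc_one_subset[OF V S ess] by blast
      then have "len R V ?K \<le> len R V S" by (intro len_mono fin' S K)
      then have "len R V (soc V (Suc j)) \<le> len R V S + card T * B (len R V S) j"
        using K(2) Suc.IH by (meson add_mono mult_le_mono2 order_trans)
      then show ?case by (simp add: B_def)
    qed
    then show ?thesis using n V by metis
  qed
  then show ?thesis by (intro exI[of _ "\<lambda>l. B l n"]) blast
qed

end

context artin
begin

definition essential :: "'a modobj \<Rightarrow> 'a modobj \<Rightarrow> ('a list \<Rightarrow> 'a list) \<Rightarrow> bool" where
  "essential S M j \<longleftrightarrow> j \<in> mod_hom \<Lambda> S M \<and> inj_on j (carrier S) \<and>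
    (\<forall>U. submod \<Lambda> M U \<longrightarrow> U \<inter> j ` carrier S \<subseteq> {\<zero>\<^bsub>M\<^esub>} \<longrightarrow> U = {\<zero>\<^bsub>M\<^esub>})"

lemma essentialD:
  assumes "essential S M j"
  shows "j \<in> mod_hom \<Lambda> S M" "inj_on j (carrier S)" "submod \<Lambda> M U \<Longrightarrow> U \<inter> j ` carrier S \<subseteq> {\<zero>\<^bsub>M\<^esub>} \<Longrightarrow> U = {\<zero>\<^bsub>M\<^esub>}"
  using assms unfolding essential_def by blast+

text \<open>The family \<open>P\<close> may be narrower than all submodules over \<open>A\<close>:
  with \<open>A\<close> equal to \<open>R\<close> it is also applied to submodules over
  \<open>\<Lambda>\<close>.\<close>

lemma maximal_submod:
  assumes M: "left_module A M" and fin: "finlen A M (carrier M)" and P: "\<And>U. P U \<Longrightarrow> submod A M U"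
    and U: "P U\<^sub>0"
  obtains N where "P N" "\<And>U. P U \<Longrightarrow> N \<subseteq> U \<Longrightarrow> U = N"
proof -
  interpret M: left_module A M by (rule M)
  have "\<forall>U. P U \<longrightarrow> len A M U < Suc (len A M (carrier M))"
    using len_mono[OF fin P M.submod_carrier] submodD(1)[OF P] by (metis le_imp_less_Suc)
  from ex_has_greatest_nat[of P, OF U this]
  obtain N where N: "P N" "\<And>U. P U \<Longrightarrow> len A M U \<le> len A M N" by blast
  have "U = N" if U: "P U" "N \<subseteq> U" for U
    using len_eqD[OF finlen_subset[OF fin submodD(1)[OF P[OF U(1)]]] P[OF N(1)] P[OF U(1)] U(2) N(2)[OF U(1)]] by simp
  then show thesis using that N(1) by blast
qed

text \<open>Let \<open>N\<close> be a maximal \<open>R\<close>-submodule of \<open>M\<close> disjoint from \<open>S\<close>. The set of all \<open>x\<close> with \<open>\<Lambda>x \<subseteq> N\<close> is a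
  \<open>\<Lambda>\<close>-submodule disjoint from \<open>S\<close>, hence zero, so \<open>M\<close> embeds into copies of \<open>M/N\<close> indexed by generators
  of \<open>\<Lambda>\<close> over \<open>R\<close>, and \<open>M/N\<close> is an essential extension of \<open>S\<close> over \<open>R\<close>.\<close>

lemma essential_bounded:
  "\<exists>b. \<forall>M\<in>mods \<Lambda>. \<forall>j. essential S M j \<longrightarrow> rl M (carrier M) \<le> b" if S: "S \<in> mods \<Lambda>" for S
proof -
  interpret R\<Lambda>: left_module R \<Lambda> by (rule left_module_R\<Lambda>)
  obtain T where T: "finite T" "T \<subseteq> carrier \<Lambda>" "\<And>U. submod R \<Lambda> U \<Longrightarrow> T \<subseteq> U \<Longrightarrow> carrier \<Lambda> \<subseteq> U"
    by (rule R\<Lambda>.finlen_imp_generated[OF R\<Lambda>.submod_carrier finlen_\<Lambda>]) (rule that)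
  obtain B :: "nat \<Rightarrow> nat" where B: "\<forall>(V :: ('r, 'a list) module) S. left_module R V \<longrightarrow> finlen R V (carrier V) \<longrightarrow> submod R V S \<longrightarrow>
    (\<forall>U. submod R V U \<longrightarrow> U \<inter> S \<subseteq> {\<zero>\<^bsub>V\<^esub>} \<longrightarrow> U = {\<zero>\<^bsub>V\<^esub>}) \<longrightarrow> len R V (carrier V) \<le> B (len R V S)"
    using AR.essential_length_bound by blast
  \<comment> \<open>Nothing is assumed about monotonicity of \<open>B\<close>, so the maximum over
    all possible lengths of the image of \<open>S\<close> is taken. The factor \<open>card T\<close>
    counts the copies of the quotient of \<open>M\<close> by \<open>N\<close> that receive
    \<open>M\<close>.\<close>
  define b where "b = card T * Max (B ` {..rl S (carrier S)})"
  have "rl M (carrier M) \<le> b" if M: "M \<in> mods \<Lambda>" and j: "essential S M j" for M j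
  proof -
    note J = essentialD[OF j]
    interpret M: left_module \<Lambda> M by (rule modsD(1)[OF M])
    interpret rM: left_module R "res M" by (rule left_module_res[OF M.left_module_axioms])
    interpret j: module_hom \<Lambda> S M j by (intro module_homI modsD S M J)
    interpret rj: module_hom R "res S" "res M" j by (rule module_hom_res[OF j.module_hom_axioms])
    have finM: "finlen R (res M) (carrier (res M))" using finlen_mods[OF M order_refl] by simp
    have z: "submod R (res M) {\<zero>\<^bsub>res M\<^esub>}" "{\<zero>\<^bsub>res M\<^esub>} \<inter> j ` carrier S \<subseteq> {\<zero>\<^bsub>M\<^esub>}" using rM.submod_zero by auto
    obtain N where N: "submod R (res M) N" "N \<inter> j ` carrier S \<subseteq> {\<zero>\<^bsub>M\<^esub>}"
      "\<And>U. submod R (res M) U \<Longrightarrow> U \<inter> j ` carrier S \<subseteq> {\<zero>\<^bsub>M\<^esub>} \<Longrightarrow> N \<subseteq> U \<Longrightarrow> U = N"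
    proof (rule maximal_submod[OF rM.left_module_axioms finM, of "\<lambda>U. submod R (res M) U \<and> U \<inter> j ` carrier S \<subseteq> {\<zero>\<^bsub>M\<^esub>}"])
      show "submod R (res M) {\<zero>\<^bsub>res M\<^esub>} \<and> {\<zero>\<^bsub>res M\<^esub>} \<inter> j ` carrier S \<subseteq> {\<zero>\<^bsub>M\<^esub>}" using z by (rule conjI)
    qed auto
    from rM.quotient_module_exists[OF N(1)]
    obtain V :: "('r, 'a list) module" and q where V: "left_module R V" "q \<in> mod_hom R (res M) V" "q ` carrier (res M) = carrier V"
      "{x \<in> carrier (res M). q x = \<zero>\<^bsub>V\<^esub>} = N" by (elim exE conjE bexE)
    interpret q: module_hom R "res M" V q by (intro module_homI rM.left_module_axioms V)
    have qN: "q x = \<zero>\<^bsub>V\<^esub> \<longleftrightarrow> x \<in> N" if "x \<in> carrier M" for x using V(4) that by auto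
    have finV: "finlen R V (carrier V)" using q.finlen_image[OF rM.submod_carrier finM] V(3) by simp
    let ?S = "q ` (j ` carrier S)"
    have jS: "submod R (res M) (j ` carrier S)" using rj.submod_image[OF rj.M.submod_carrier] by simp
    have S': "submod R V ?S" by (rule q.submod_image[OF jS])
    \<comment> \<open>The preimage of a submodule that misses the image of \<open>S\<close> contains
      \<open>N\<close> and still misses \<open>S\<close>, so it equals \<open>N\<close> by
      maximality.\<close>
    have essV: "U = {\<zero>\<^bsub>V\<^esub>}" if U: "submod R V U" "U \<inter> ?S \<subseteq> {\<zero>\<^bsub>V\<^esub>}" for U
    proof -
      let ?U = "{x \<in> carrier (res M). q x \<in> U}"
      have "x = \<zero>\<^bsub>M\<^esub>" if x: "x \<in> ?U" "x \<in> j ` carrier S" for x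
      proof -
        have "q x = \<zero>\<^bsub>V\<^esub>" using x U(2) by blast
        then have "x \<in> N" using qN x(1) by simp
        then show ?thesis using N(2) x(2) by blast
      qed
      then have "?U \<inter> j ` carrier S \<subseteq> {\<zero>\<^bsub>M\<^esub>}" by blast
      moreover have "N \<subseteq> ?U" using V(4) submodD(2)[OF U(1)] by auto
      ultimately have UN: "?U = N" by (rule N(3)[OF q.submod_vimage[OF U(1)]])
      have "u = \<zero>\<^bsub>V\<^esub>" if u: "u \<in> U" for u
      proof -
        obtain x where x: "x \<in> carrier (res M)" "u = q x" using V(3) submodD(5)[OF U(1) u] by (metis imageE)
        then have "x \<in> N" using UN u by blast
        then show ?thesis using qN x by simp
      qed
      then show ?thesis using submodD(2)[OF U(1)] by blast
    qed
    have "len R V (carrier V) \<le> B (len R V ?S)" using B V(1) finV S' essV by blast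
    moreover have "len R V ?S \<le> rl S (carrier S)"
    proof -
      have "len R V ?S \<le> rl M (j ` carrier S)" using q.len_hom'[OF jS finlen_subset[OF finM submodD(1)[OF jS]]] by simp
      also have "\<dots> \<le> rl S (carrier S)" using rj.len_hom'[OF rj.M.submod_carrier] finlen_mods[OF S order_refl] by simp
      finally show ?thesis .
    qed
    ultimately have lenV: "len R V (carrier V) \<le> Max (B ` {..rl S (carrier S)})"
      by (meson Max_ge atMost_iff finite_atMost finite_imageI imageI order_trans)
    let ?\<phi> = "\<lambda>a x. q (a \<odot>\<^bsub>M\<^esub> x)"
    have \<phi>: "?\<phi> a \<in> mod_hom R (res M) V" if "a \<in> T" for a
      using that T(2) by (intro hom_comp[OF mult_hom_res[OF M.left_module_axioms] V(2)]) auto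
    let ?K = "carrier (res M) \<inter> {x. \<forall>a\<in>T. ?\<phi> a x = \<zero>\<^bsub>V\<^esub>}"
    have im: "?\<phi> a ` carrier (res M) \<subseteq> carrier V" if "a \<in> T" for a using hom_closed[OF \<phi>[OF that]] by blast
    have K: "submod R (res M) ?K" "rl M (carrier M) \<le> rl M ?K + card T * len R V (carrier V)"
      using len_joint_kernel[OF rM.left_module_axioms V(1) T(1) \<phi> rM.submod_carrier finM q.N.submod_carrier finV im] by auto
    \<comment> \<open>The elements of \<open>\<Lambda>\<close> that multiply \<open>x\<close> into
      \<open>N\<close> form an \<open>R\<close>-submodule; it contains the generators
      \<open>T\<close> and is therefore all of \<open>\<Lambda>\<close>.\<close>
    have KN: "a \<odot>\<^bsub>M\<^esub> x \<in> N" if x: "x \<in> ?K" and a: "a \<in> carrier \<Lambda>" for a x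
    proof -
      have xc: "x \<in> carrier M" using x by simp
      interpret o: module_hom R \<Lambda> "res M" "\<lambda>a. a \<odot>\<^bsub>M\<^esub> x"
        by (intro module_homI left_module_R\<Lambda> rM.left_module_axioms orbit_hom_res M.left_module_axioms xc)
      have "carrier \<Lambda> \<subseteq> {a \<in> carrier \<Lambda>. a \<odot>\<^bsub>M\<^esub> x \<in> N}"
      proof (rule T(3)[OF o.submod_vimage[OF N(1)]], rule subsetI)
        fix c assume c: "c \<in> T"
        then have "c \<in> carrier \<Lambda>" using T(2) by blast
        then show "c \<in> {a \<in> carrier \<Lambda>. a \<odot>\<^bsub>M\<^esub> x \<in> N}" using qN[of "c \<odot>\<^bsub>M\<^esub> x"] x c xc by simp
      qed
      then show ?thesis using a by blast
    qed
    have "a \<odot>\<^bsub>M\<^esub> x \<in> ?K" if x: "x \<in> ?K" and a: "a \<in> carrier \<Lambda>" for a x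
    proof -
      have xc: "x \<in> carrier M" using x by simp
      have "c \<odot>\<^bsub>M\<^esub> (a \<odot>\<^bsub>M\<^esub> x) \<in> N" if "c \<in> T" for c
        using KN[OF x, of "c \<otimes>\<^bsub>\<Lambda>\<^esub> a"] that a xc T(2) by (auto simp: M.smult_assoc)
      then show ?thesis using a xc qN T(2) by auto
    qed
    then have "submod \<Lambda> M ?K" using submodD(1-3)[OF K(1)] by (simp add: submod_def)
    moreover have "?K \<inter> j ` carrier S \<subseteq> {\<zero>\<^bsub>M\<^esub>}"
    proof
      fix x assume x: "x \<in> ?K \<inter> j ` carrier S"
      then have "x \<in> N" using KN[of x "\<one>\<^bsub>\<Lambda>\<^esub>"] by auto
      then show "x \<in> {\<zero>\<^bsub>M\<^esub>}" using x N(2) by blast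
    qed
    ultimately have "?K = {\<zero>\<^bsub>M\<^esub>}" by (rule J(3))
    then have "rl M ?K = 0" using rM.len_zero by simp
    then show "rl M (carrier M) \<le> b"
      using K(2) mult_le_mono2[OF lenV, of "card T"] unfolding b_def by linarith
  qed
  then show ?thesis by blast
qed

text \<open>Dividing by a maximal submodule disjoint from the image of \<open>S\<close> makes the
  embedding essential: any submodule of the quotient that misses \<open>S\<close> would enlarge the
  chosen one.\<close>

lemma essential_quotient:
  assumes S: "S \<in> mods \<Lambda>" and W: "W \<in> mods \<Lambda>" and \<tau>: "\<tau> \<in> mod_hom \<Lambda> S W" "inj_on \<tau> (carrier S)"
  obtains Q \<omega> where "Q \<in> mods \<Lambda>" "\<omega> \<in> mod_hom \<Lambda> W Q" "\<omega> ` carrier W = carrier Q" "essential S Q (\<lambda>x. \<omega> (\<tau> x))"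
proof -
  interpret W: left_module \<Lambda> W by (rule modsD(1)[OF W])
  interpret \<tau>: module_hom \<Lambda> S W \<tau> by (intro module_homI modsD S W \<tau>)
  interpret rW: left_module R "res W" by (rule left_module_res[OF W.left_module_axioms])
  have fin: "finlen R (res W) (carrier (res W))" using finlen_mods[OF W order_refl] by simp
  have z: "submod \<Lambda> W {\<zero>\<^bsub>res W\<^esub>}" "{\<zero>\<^bsub>res W\<^esub>} \<inter> \<tau> ` carrier S \<subseteq> {\<zero>\<^bsub>W\<^esub>}" using W.submod_zero by auto
  obtain N where N: "submod \<Lambda> W N" "N \<inter> \<tau> ` carrier S \<subseteq> {\<zero>\<^bsub>W\<^esub>}"
      "\<And>U. submod \<Lambda> W U \<Longrightarrow> U \<inter> \<tau> ` carrier S \<subseteq> {\<zero>\<^bsub>W\<^esub>} \<Longrightarrow> N \<subseteq> U \<Longrightarrow> U = N"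
  proof (rule maximal_submod[OF rW.left_module_axioms fin, of "\<lambda>U. submod \<Lambda> W U \<and> U \<inter> \<tau> ` carrier S \<subseteq> {\<zero>\<^bsub>W\<^esub>}"])
    show "submod \<Lambda> W {\<zero>\<^bsub>res W\<^esub>} \<and> {\<zero>\<^bsub>res W\<^esub>} \<inter> \<tau> ` carrier S \<subseteq> {\<zero>\<^bsub>W\<^esub>}" using z by (rule conjI)
  qed (auto intro: submod_res)
  obtain Q \<omega> where Q: "Q \<in> mods \<Lambda>" "\<omega> \<in> mod_hom \<Lambda> W Q" "\<omega> ` carrier W = carrier Q"
    "\<And>x. x \<in> carrier W \<Longrightarrow> \<omega> x = \<zero>\<^bsub>Q\<^esub> \<longleftrightarrow> x \<in> N" by (rule quo_mods[OF W N(1)]) (rule that)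
  interpret \<omega>: module_hom \<Lambda> W Q \<omega> by (intro module_homI modsD W Q)
  have \<omega>\<tau>: "(\<lambda>x. \<omega> (\<tau> x)) \<in> mod_hom \<Lambda> S Q" by (rule hom_comp[OF \<tau>(1) Q(2)])
  interpret \<omega>\<tau>: module_hom \<Lambda> S Q "\<lambda>x. \<omega> (\<tau> x)" by (intro module_homI modsD S Q \<omega>\<tau>)
  have "inj_on (\<lambda>x. \<omega> (\<tau> x)) (carrier S)"
  proof (rule \<omega>\<tau>.inj_onI_ker)
    fix x assume x: "x \<in> carrier S" "\<omega> (\<tau> x) = \<zero>\<^bsub>Q\<^esub>"
    then have "\<tau> x \<in> N \<inter> \<tau> ` carrier S" using Q(4) by simp
    then show "x = \<zero>\<^bsub>S\<^esub>" using N(2) \<tau>.inj_onD_ker[OF \<tau>(2) x(1)] by blast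
  qed
  moreover have "U = {\<zero>\<^bsub>Q\<^esub>}" if U: "submod \<Lambda> Q U" "U \<inter> (\<lambda>x. \<omega> (\<tau> x)) ` carrier S \<subseteq> {\<zero>\<^bsub>Q\<^esub>}" for U
  proof -
    let ?U = "{x \<in> carrier W. \<omega> x \<in> U}"
    have "?U \<inter> \<tau> ` carrier S \<subseteq> {\<zero>\<^bsub>W\<^esub>}"
    proof
      fix x assume x: "x \<in> ?U \<inter> \<tau> ` carrier S"
      then have "\<omega> x = \<zero>\<^bsub>Q\<^esub>" using U(2) by blast
      then have "x \<in> N" using Q(4) x by simp
      then show "x \<in> {\<zero>\<^bsub>W\<^esub>}" using N(2) x by blast
    qed
    moreover have "N \<subseteq> ?U"
    proof
      fix x assume x: "x \<in> N"
      then have xc: "x \<in> carrier W" using submodD(5)[OF N(1)] by blast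
      then show "x \<in> ?U" using Q(4)[OF xc] x submodD(2)[OF U(1)] by simp
    qed
    ultimately have UN: "?U = N" by (rule N(3)[OF \<omega>.submod_vimage[OF U(1)]])
    have "u = \<zero>\<^bsub>Q\<^esub>" if u: "u \<in> U" for u
    proof -
      obtain x where x: "x \<in> carrier W" "u = \<omega> x" using Q(3) submodD(5)[OF U(1) u] by (metis imageE)
      then have "x \<in> N" using UN u by blast
      then show ?thesis using Q(4) x by simp
    qed
    then show ?thesis using submodD(2)[OF U(1)] by blast
  qed
  ultimately show thesis using that Q \<omega>\<tau> unfolding essential_def by blast
qed

lemma essential_trans:
  assumes mods: "S \<in> mods \<Lambda>" "I \<in> mods \<Lambda>" "Q \<in> mods \<Lambda>" and j: "essential S I j" and e: "essential I Q e"
  shows "essential S Q (\<lambda>x. e (j x))"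
proof -
  note J = essentialD[OF j] and E = essentialD[OF e]
  interpret e: module_hom \<Lambda> I Q e by (intro module_homI modsD mods E)
  have "inj_on (\<lambda>x. e (j x)) (carrier S)"
    using J(2) E(2) hom_closed[OF J(1)] by (auto simp: inj_on_def)
  moreover have "U = {\<zero>\<^bsub>Q\<^esub>}" if U: "submod \<Lambda> Q U" "U \<inter> (\<lambda>x. e (j x)) ` carrier S \<subseteq> {\<zero>\<^bsub>Q\<^esub>}" for U
  proof (rule E(3)[OF U(1)])
    have "{x \<in> carrier I. e x \<in> U} \<inter> j ` carrier S \<subseteq> {\<zero>\<^bsub>I\<^esub>}"
    proof
      fix x assume x: "x \<in> {x \<in> carrier I. e x \<in> U} \<inter> j ` carrier S"
      then have "e x = \<zero>\<^bsub>Q\<^esub>" using U(2) by blast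
      then show "x \<in> {\<zero>\<^bsub>I\<^esub>}" using e.inj_onD_ker[OF E(2)] x by blast
    qed
    then have I0: "{x \<in> carrier I. e x \<in> U} = {\<zero>\<^bsub>I\<^esub>}" by (rule J(3)[OF e.submod_vimage[OF U(1)]])
    show "U \<inter> e ` carrier I \<subseteq> {\<zero>\<^bsub>Q\<^esub>}"
    proof
      fix y assume "y \<in> U \<inter> e ` carrier I"
      then obtain x where "x \<in> carrier I" "e x \<in> U" "y = e x" by blast
      then have "x \<in> {\<zero>\<^bsub>I\<^esub>}" unfolding I0[symmetric] by simp
      then show "y \<in> {\<zero>\<^bsub>Q\<^esub>}" using \<open>y = e x\<close> by simp
    qed
  qed
  ultimately show ?thesis unfolding essential_def using hom_comp[OF J(1) E(1)] by blast
qed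

end

section \<open>Torsion classes\<close>

text \<open>The module \<open>S\<close> is \<open>P\<close> modulo its radical \<open>M\<close>. A
  nonzero map to a simple \<open>T\<close> has its kernel inside \<open>M\<close> and cannot map
  \<open>M\<close> onto \<open>T\<close>, as then \<open>M\<close> would be all of \<open>P\<close>;
  so it kills exactly \<open>M\<close> and embeds \<open>S\<close> into \<open>T\<close>.\<close>

lemma (in sub_subcat) simple_top:
  assumes P: "local_proj P M"
  obtains S where "S \<in> mods \<Lambda>" "carrier S \<noteq> {\<zero>\<^bsub>S\<^esub>}"
    "\<And>T \<theta>. T \<in> mods \<Lambda> \<Longrightarrow> (\<And>U. submod \<Lambda> T U \<Longrightarrow> U = {\<zero>\<^bsub>T\<^esub>} \<or> U = carrier T) \<Longrightarrow> \<theta> \<in> mod_hom \<Lambda> P T \<Longrightarrow>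
      \<not> \<theta> ` carrier P \<subseteq> {\<zero>\<^bsub>T\<^esub>} \<Longrightarrow> \<exists>\<tau>\<in>mod_hom \<Lambda> S T. inj_on \<tau> (carrier S)"
proof -
  have Pi: "ind P" and M: "submod \<Lambda> P M" "M \<noteq> carrier P" "\<And>U. submod \<Lambda> P U \<Longrightarrow> U \<noteq> carrier P \<Longrightarrow> U \<subseteq> M"
    using P unfolding local_proj_def by blast+
  note Pm = indD(3)[OF Pi]
  interpret P: left_module \<Lambda> P by (rule indD(4)[OF Pi])
  obtain S \<sigma> where S: "S \<in> mods \<Lambda>" "\<sigma> \<in> mod_hom \<Lambda> P S" "\<sigma> ` carrier P = carrier S"
    "\<And>x. x \<in> carrier P \<Longrightarrow> \<sigma> x = \<zero>\<^bsub>S\<^esub> \<longleftrightarrow> x \<in> M" by (rule quo_mods[OF Pm M(1)]) (rule that)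
  have "carrier S \<noteq> {\<zero>\<^bsub>S\<^esub>}"
  proof
    assume S0: "carrier S = {\<zero>\<^bsub>S\<^esub>}"
    obtain x where x: "x \<in> carrier P" "x \<notin> M" using M(2) submodD(1)[OF M(1)] by blast
    have "\<sigma> x \<in> {\<zero>\<^bsub>S\<^esub>}" using hom_closed[OF S(2) x(1)] unfolding S0 .
    then show False using S(4)[OF x(1)] x(2) by simp
  qed
  moreover have "\<exists>\<tau>\<in>mod_hom \<Lambda> S T. inj_on \<tau> (carrier S)"
    if T: "T \<in> mods \<Lambda>" and simple: "\<And>U. submod \<Lambda> T U \<Longrightarrow> U = {\<zero>\<^bsub>T\<^esub>} \<or> U = carrier T"
      and \<theta>: "\<theta> \<in> mod_hom \<Lambda> P T" "\<not> \<theta> ` carrier P \<subseteq> {\<zero>\<^bsub>T\<^esub>}" for T \<theta>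
  proof -
    interpret \<theta>: module_hom \<Lambda> P T \<theta> by (intro module_homI modsD Pm T \<theta>)
    have "{x \<in> carrier P. \<theta> x = \<zero>\<^bsub>T\<^esub>} \<noteq> carrier P" using \<theta>(2) by blast
    then have ker: "{x \<in> carrier P. \<theta> x = \<zero>\<^bsub>T\<^esub>} \<subseteq> M" by (rule M(3)[OF \<theta>.submod_ker])
    have "\<theta> ` M \<noteq> carrier T"
    proof
      assume MT: "\<theta> ` M = carrier T"
      have "x \<in> M" if x: "x \<in> carrier P" for x
      proof -
        obtain m where m: "m \<in> M" "\<theta> x = \<theta> m" using MT \<theta>.closed[OF x] by (metis imageE)
        have mc: "m \<in> carrier P" by (rule submodD(5)[OF M(1) m(1)])
        have "x \<ominus>\<^bsub>P\<^esub> m \<in> M" using ker \<theta>.eq_iff[OF x mc] m(2) x mc by auto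
        then show "x \<in> M" using submodD(3)[OF M(1) _ m(1)] P.diff_add[OF x mc] by metis
      qed
      then show False using M(2) submodD(1)[OF M(1)] by blast
    qed
    then have "\<theta> ` M = {\<zero>\<^bsub>T\<^esub>}" using simple[OF \<theta>.submod_image[OF M(1)]] by blast
    then have "\<theta> x = \<zero>\<^bsub>T\<^esub>" if "x \<in> carrier P" "\<sigma> x = \<zero>\<^bsub>S\<^esub>" for x using S(4) that by blast
    then obtain \<tau> where \<tau>: "\<tau> \<in> mod_hom \<Lambda> S T" "\<forall>x\<in>carrier P. \<tau> (\<sigma> x) = \<theta> x"
      using hom_factor_surj[OF P.left_module_axioms modsD(1)[OF S(1)] modsD(1)[OF T] S(2,3) \<theta>(1)] by blast
    interpret \<tau>: module_hom \<Lambda> S T \<tau> by (intro module_homI modsD S T \<tau>)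
    have "inj_on \<tau> (carrier S)"
    proof (rule \<tau>.inj_onI_ker)
      fix y assume y: "y \<in> carrier S" "\<tau> y = \<zero>\<^bsub>T\<^esub>"
      then obtain x where x: "x \<in> carrier P" "y = \<sigma> x" using S(3) by blast
      then have "x \<in> M" using \<tau>(2) y(2) ker by auto
      then show "y = \<zero>\<^bsub>S\<^esub>" using S(4)[OF x(1)] x(2) by simp
    qed
    then show ?thesis using \<tau>(1) by blast
  qed
  ultimately show thesis using that S(1) by blast
qed

lemma (in artin) sub_subcat_mods: "sub_subcat R \<Lambda> (mods \<Lambda>)"
proof (intro sub_subcat.intro subcat.intro subcat_axioms.intro sub_subcat_axioms.intro artin_axioms)
  show "additive_subcategory \<Lambda> (mods \<Lambda>)" by (auto simp: additive_subcategory_def)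
qed (auto intro: sub_mods)

context exact_subcat
begin

text \<open>The conflation is the pushout of \<open>S \<rightarrow> I \<rightarrow> I/S\<close> along the approximation of \<open>S\<close>, for an essential extension
  \<open>I\<close> of \<open>S\<close> of maximal length: if \<open>S\<close> embeds into \<open>W\<close> and \<open>W\<close> passes it, the embedding extends to \<open>I \<rightarrow> W\<close>, and
  modulo a complement this is an essential extension of \<open>S\<close>, hence not longer than \<open>I\<close>.\<close>

lemma simple_sub_detects:
  assumes quot: "\<And>X Y f. X \<in> \<E> \<Longrightarrow> Y \<in> mods \<Lambda> \<Longrightarrow> f \<in> mod_hom \<Lambda> X Y \<Longrightarrow> f ` carrier X = carrier Y \<Longrightarrow> Y \<in> \<E>"
    and cov: "covariantly_finite \<Lambda> \<E>" and S: "S \<in> mods \<Lambda>" "carrier S \<noteq> {\<zero>\<^bsub>S\<^esub>}"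
  shows "\<exists>D H. detects D H (\<lambda>W. \<exists>\<tau>\<in>mod_hom \<Lambda> S W. inj_on \<tau> (carrier S))"
proof (cases "\<exists>I\<in>\<E>. \<exists>j. essential S I j")
  case False
  \<comment> \<open>Dividing \<open>W\<close> by a complement of an embedded \<open>S\<close> gives
    an essential extension that is still in the torsion class, contrary to the case assumption. So
    the predicate never holds, and the empty test set will do.\<close>
  have no: "\<not> inj_on \<tau> (carrier S)" if W: "ind W" and \<tau>: "\<tau> \<in> mod_hom \<Lambda> S W" for W \<tau>
  proof
    assume inj: "inj_on \<tau> (carrier S)"
    obtain Q \<omega> where Q: "Q \<in> mods \<Lambda>" "\<omega> \<in> mod_hom \<Lambda> W Q" "\<omega> ` carrier W = carrier Q" "essential S Q (\<lambda>x. \<omega> (\<tau> x))"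
      by (rule essential_quotient[OF S(1) indD(3)[OF W] \<tau> inj])
    have "Q \<in> \<E>" by (rule quot[OF indD(1)[OF W] Q(1-3)])
    then show False using False Q(4) by blast
  qed
  show ?thesis
    by (intro exI[of _ "{}"]) (use no in \<open>auto simp: detects_def\<close>)
next
  case True
  then obtain I0 j0 where 0: "I0 \<in> \<E>" "essential S I0 j0" by blast
  obtain b where b: "\<forall>M\<in>mods \<Lambda>. \<forall>j. essential S M j \<longrightarrow> rl M (carrier M) \<le> b" using essential_bounded[OF S(1)] by blast
  have "\<forall>t. fst t \<in> \<E> \<and> essential S (fst t) (snd t) \<longrightarrow> rl (fst t) (carrier (fst t)) < Suc b"
    using b E_mods by (simp add: le_imp_less_Suc)
  from ex_has_greatest_nat[of "\<lambda>t. fst t \<in> \<E> \<and> essential S (fst t) (snd t)" "(I0, j0)", OF _ this] 0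
  obtain t where t: "fst t \<in> \<E>" "essential S (fst t) (snd t)"
    "\<forall>t'. fst t' \<in> \<E> \<and> essential S (fst t') (snd t') \<longrightarrow> rl (fst t') (carrier (fst t')) \<le> rl (fst t) (carrier (fst t))" by auto
  define I where "I = fst t"
  define j where "j = snd t"
  have I: "I \<in> \<E>" "essential S I j" using t by (simp_all add: I_def j_def)
  \<comment> \<open>Maximality is over all pairs of an object and an embedding, since different
    embeddings of \<open>S\<close> may yield essential extensions of different length.\<close>
  have max: "rl I' (carrier I') \<le> rl I (carrier I)" if "I' \<in> \<E>" "essential S I' j'" for I' j'
    using t(3)[rule_format, of "(I', j')"] that by (simp add: I_def)
  note J = essentialD[OF I(2)]
  note Im = E_mods[OF I(1)]
  interpret S: left_module \<Lambda> S by (rule modsD(1)[OF S(1)])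
  interpret I: left_module \<Lambda> I by (rule modsD(1)[OF Im])
  interpret j: module_hom \<Lambda> S I j by (intro module_homI modsD S Im J)
  obtain A a where A: "A \<in> \<E>" "a \<in> mod_hom \<Lambda> S A"
    "\<And>E h. E \<in> \<E> \<Longrightarrow> h \<in> mod_hom \<Lambda> S E \<Longrightarrow> \<exists>k\<in>mod_hom \<Lambda> A E. \<forall>x\<in>carrier S. h x = k (a x)"
    using cov S(1) unfolding covariantly_finite_def by blast
  obtain C \<rho> where C: "C \<in> mods \<Lambda>" "\<rho> \<in> mod_hom \<Lambda> I C" "\<rho> ` carrier I = carrier C"
    "\<And>x. x \<in> carrier I \<Longrightarrow> \<rho> x = \<zero>\<^bsub>C\<^esub> \<longleftrightarrow> x \<in> j ` carrier S"
    by (rule quo_mods[OF Im j.submod_image[OF S.submod_carrier]]) (rule that)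
  have CE: "C \<in> \<E>" by (rule quot[OF I(1) C(1-3)])
  have exS: "short_exact \<Lambda> S j I \<rho> C"
    using C(4) by (intro short_exactI J(1,2) C(2,3)) auto
  obtain P a' \<beta> c where P: "P \<in> mods \<Lambda>" "a' \<in> mod_hom \<Lambda> A P" "\<beta> \<in> mod_hom \<Lambda> I P"
    "short_exact \<Lambda> A a' P c C" "\<And>x. x \<in> carrier S \<Longrightarrow> \<beta> (j x) = a' (a x)" "\<And>y. y \<in> carrier I \<Longrightarrow> c (\<beta> y) = \<rho> y"
    by (rule pushout[OF S(1) Im C(1) E_mods[OF A(1)] exS A(2)]) (rule that)
  have PE: "P \<in> \<E>" by (rule E_ext[OF A(1) CE P(1,4)])
  have con: "conflation \<Lambda> \<E> A a' P c C" using A(1) PE CE P(4) by (simp add: conflation_def)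
  have iso: "mod_iso \<Lambda> W I"
    if W: "ind W" and \<tau>: "\<tau> \<in> mod_hom \<Lambda> S W" "inj_on \<tau> (carrier S)"
      and extend: "\<And>k. k \<in> mod_hom \<Lambda> A W \<Longrightarrow> \<exists>l\<in>mod_hom \<Lambda> P W. \<forall>x\<in>carrier A. k x = l (a' x)" for W \<tau>
  proof -
    note Wm = indD(3)[OF W]
    interpret \<tau>: module_hom \<Lambda> S W \<tau> by (intro module_homI modsD S Wm \<tau>)
    obtain k where k: "k \<in> mod_hom \<Lambda> A W" "\<forall>x\<in>carrier S. \<tau> x = k (a x)" using A(3)[OF indD(1)[OF W] \<tau>(1)] by blast
    obtain l where l: "l \<in> mod_hom \<Lambda> P W" "\<forall>x\<in>carrier A. k x = l (a' x)" using extend[OF k(1)] by blast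
    define e where "e x = l (\<beta> x)" for x
    have e: "e \<in> mod_hom \<Lambda> I W" unfolding e_def by (rule hom_comp[OF P(3) l(1)])
    interpret e: module_hom \<Lambda> I W e by (intro module_homI modsD Im Wm e)
    \<comment> \<open>The route through the approximation \<open>A\<close> and the pushout
      \<open>P\<close> recovers the given embedding on \<open>S\<close>; so \<open>e\<close> is an
      extension of it to \<open>I\<close>.\<close>
    have ej: "e (j x) = \<tau> x" if "x \<in> carrier S" for x
      using that P(5) k(2) l(2) hom_closed[OF A(2)] by (simp add: e_def)
    have "{x \<in> carrier I. e x = \<zero>\<^bsub>W\<^esub>} \<inter> j ` carrier S \<subseteq> {\<zero>\<^bsub>I\<^esub>}"
    proof
      fix x assume x: "x \<in> {x \<in> carrier I. e x = \<zero>\<^bsub>W\<^esub>} \<inter> j ` carrier S"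
      then obtain s where s: "s \<in> carrier S" "x = j s" by blast
      then have "\<tau> s = \<zero>\<^bsub>W\<^esub>" using x ej by simp
      then have "s = \<zero>\<^bsub>S\<^esub>" by (rule \<tau>.inj_onD_ker[OF \<tau>(2) s(1)])
      then show "x \<in> {\<zero>\<^bsub>I\<^esub>}" using s(2) by simp
    qed
    \<comment> \<open>As \<open>S\<close> is essential in \<open>I\<close>, a map that is injective
      on \<open>S\<close> is injective on \<open>I\<close>.\<close>
    then have ker: "{x \<in> carrier I. e x = \<zero>\<^bsub>W\<^esub>} = {\<zero>\<^bsub>I\<^esub>}" by (rule J(3)[OF e.submod_ker])
    have inj: "inj_on e (carrier I)"
    proof (rule e.inj_onI_ker)
      fix x assume "x \<in> carrier I" "e x = \<zero>\<^bsub>W\<^esub>"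
      then have "x \<in> {x \<in> carrier I. e x = \<zero>\<^bsub>W\<^esub>}" by simp
      then show "x = \<zero>\<^bsub>I\<^esub>" unfolding ker by simp
    qed
    obtain Q \<omega> where Q: "Q \<in> mods \<Lambda>" "\<omega> \<in> mod_hom \<Lambda> W Q" "\<omega> ` carrier W = carrier Q" "essential I Q (\<lambda>x. \<omega> (e x))"
      by (rule essential_quotient[OF Im Wm e inj])
    have QE: "Q \<in> \<E>" by (rule quot[OF indD(1)[OF W] Q(1-3)])
    have le: "rl Q (carrier Q) \<le> rl I (carrier I)"
      by (rule max[OF QE essential_trans[OF S(1) Im Q(1) I(2) Q(4)]])
    note K = essentialD[OF Q(4)]
    interpret \<omega>e: module_hom \<Lambda> I Q "\<lambda>x. \<omega> (e x)" by (intro module_homI modsD Im Q(1) K)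
    interpret r\<omega>e: module_hom R "res I" "res Q" "\<lambda>x. \<omega> (e x)" by (rule module_hom_res[OF \<omega>e.module_hom_axioms])
    have "rl Q ((\<lambda>x. \<omega> (e x)) ` carrier I) = rl I (carrier I)"
      using r\<omega>e.len_inj_image'[OF r\<omega>e.M.submod_carrier] finlen_mods[OF Im order_refl] K(2) by simp
    moreover have sub: "(\<lambda>x. \<omega> (e x)) ` carrier I \<subseteq> carrier Q" using \<omega>e.closed by blast
    ultimately have "(\<lambda>x. \<omega> (e x)) ` carrier I = carrier Q"
      using le submod_res[OF \<omega>e.submod_image[OF I.submod_carrier]] submod_res[OF \<omega>e.N.submod_carrier]
      by (intro len_eqD[OF finlen_mods[OF Q(1) order_refl]]) simp_all
    \<comment> \<open>The quotient \<open>Q\<close> of \<open>W\<close> is an essential extension of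
      \<open>I\<close>, hence of \<open>S\<close>; it lies in \<open>\<E>\<close> and cannot be
      longer than \<open>I\<close>. So \<open>I\<close> fills \<open>Q\<close> and is a retract of
      \<open>W\<close>.\<close>
    then have "bij_betw (\<lambda>x. \<omega> (e x)) (carrier I) (carrier Q)" using K(2) by (simp add: bij_betw_def)
    then obtain u where u: "u \<in> mod_hom \<Lambda> Q I" "\<forall>x\<in>carrier I. u (\<omega> (e x)) = x"
      using hom_inverse[OF I.left_module_axioms modsD(1)[OF Q(1)] K(1)] by blast
    have Inz: "carrier I \<noteq> {\<zero>\<^bsub>I\<^esub>}"
    proof
      assume I0: "carrier I = {\<zero>\<^bsub>I\<^esub>}"
      have "s = \<zero>\<^bsub>S\<^esub>" if s: "s \<in> carrier S" for s
      proof -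
        have "j s \<in> {\<zero>\<^bsub>I\<^esub>}" using j.closed[OF s] unfolding I0 .
        then show ?thesis using j.inj_onD_ker[OF J(2) s] by simp
      qed
      then show False using S(2) S.M.zero_closed by blast
    qed
    have p: "(\<lambda>w. u (\<omega> w)) \<in> mod_hom \<Lambda> W I" by (rule hom_comp[OF Q(2) u(1)])
    have "bij_betw (\<lambda>w. u (\<omega> w)) (carrier W) (carrier I)"
      by (rule split_mono_into_ind(2)[OF Im Inz W e p]) (use u(2) in simp)
    then show ?thesis using p unfolding mod_iso_def by blast
  qed
  show ?thesis
  proof (intro exI[of _ "{(A, a', P, c, C)}"] exI[of _ "{I}"], unfold detects_def, intro conjI allI impI)
    fix W assume W: "ind W" and ex: "\<exists>\<tau>\<in>mod_hom \<Lambda> S W. inj_on \<tau> (carrier S)" and pass: "passes W {(A, a', P, c, C)}"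
    have ext: "\<exists>l\<in>mod_hom \<Lambda> P W. \<forall>x\<in>carrier A. k x = l (a' x)" if "k \<in> mod_hom \<Lambda> A W" for k
      using pass that by (simp add: passes_def)
    obtain \<tau> where \<tau>: "\<tau> \<in> mod_hom \<Lambda> S W" "inj_on \<tau> (carrier S)" using ex by blast
    have "mod_iso \<Lambda> W I" by (rule iso[OF W \<tau> ext])
    then show "\<exists>Q\<in>{I}. mod_iso \<Lambda> W Q" by simp
  qed (use con I(1) in auto)
qed

text \<open>The tests are indexed by the tops of the local projectives in
  \<open>mods \<Lambda>\<close>, which cover all simple modules; every indecomposable contains one
  of them.\<close>

theorem torsion_finite_type:
  assumes quot: "\<And>X Y f. X \<in> \<E> \<Longrightarrow> Y \<in> mods \<Lambda> \<Longrightarrow> f \<in> mod_hom \<Lambda> X Y \<Longrightarrow> f ` carrier X = carrier Y \<Longrightarrow> Y \<in> \<E>"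
    and cov: "covariantly_finite \<Lambda> \<E>" and eq: "AR_subgroup \<Lambda> \<E> = Ex_subgroup \<Lambda> \<E>"
  shows "finite_type \<Lambda> \<E>"
proof -
  interpret Mo: sub_subcat R \<Lambda> "mods \<Lambda>" by (rule sub_subcat_mods)
  obtain Ps where Ps: "\<And>P. P \<in> set Ps \<Longrightarrow> \<exists>M. Mo.local_proj P M"
    "\<And>X X'. X \<in> mods \<Lambda> \<Longrightarrow> submod \<Lambda> X X' \<Longrightarrow> X' \<noteq> carrier X \<Longrightarrow> \<exists>P\<in>set Ps. \<exists>\<theta>\<in>mod_hom \<Lambda> P X. \<not> \<theta> ` carrier P \<subseteq> X'"
    by (rule Mo.local_projectives) (rule that)
  have "\<forall>P\<in>set Ps. \<exists>S. S \<in> mods \<Lambda> \<and> carrier S \<noteq> {\<zero>\<^bsub>S\<^esub>} \<and>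
    (\<forall>T \<theta>. T \<in> mods \<Lambda> \<longrightarrow> (\<forall>U. submod \<Lambda> T U \<longrightarrow> U = {\<zero>\<^bsub>T\<^esub>} \<or> U = carrier T) \<longrightarrow> \<theta> \<in> mod_hom \<Lambda> P T \<longrightarrow>
      \<not> \<theta> ` carrier P \<subseteq> {\<zero>\<^bsub>T\<^esub>} \<longrightarrow> (\<exists>\<tau>\<in>mod_hom \<Lambda> S T. inj_on \<tau> (carrier S)))"
  proof
    fix P assume "P \<in> set Ps"
    then obtain M where M: "Mo.local_proj P M" using Ps(1) by blast
    show "\<exists>S. S \<in> mods \<Lambda> \<and> carrier S \<noteq> {\<zero>\<^bsub>S\<^esub>} \<and>
      (\<forall>T \<theta>. T \<in> mods \<Lambda> \<longrightarrow> (\<forall>U. submod \<Lambda> T U \<longrightarrow> U = {\<zero>\<^bsub>T\<^esub>} \<or> U = carrier T) \<longrightarrow> \<theta> \<in> mod_hom \<Lambda> P T \<longrightarrow>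
      \<not> \<theta> ` carrier P \<subseteq> {\<zero>\<^bsub>T\<^esub>} \<longrightarrow> (\<exists>\<tau>\<in>mod_hom \<Lambda> S T. inj_on \<tau> (carrier S)))"
    proof (rule Mo.simple_top[OF M])
      fix S assume "S \<in> mods \<Lambda>" "carrier S \<noteq> {\<zero>\<^bsub>S\<^esub>}"
        "\<And>T \<theta>. T \<in> mods \<Lambda> \<Longrightarrow> (\<And>U. submod \<Lambda> T U \<Longrightarrow> U = {\<zero>\<^bsub>T\<^esub>} \<or> U = carrier T) \<Longrightarrow> \<theta> \<in> mod_hom \<Lambda> P T \<Longrightarrow>
          \<not> \<theta> ` carrier P \<subseteq> {\<zero>\<^bsub>T\<^esub>} \<Longrightarrow> \<exists>\<tau>\<in>mod_hom \<Lambda> S T. inj_on \<tau> (carrier S)"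
      then show ?thesis by (intro exI[of _ S]) simp
    qed
  qed
  from bchoice[OF this] obtain S where S: "\<forall>P\<in>set Ps. S P \<in> mods \<Lambda> \<and> carrier (S P) \<noteq> {\<zero>\<^bsub>S P\<^esub>} \<and>
    (\<forall>T \<theta>. T \<in> mods \<Lambda> \<longrightarrow> (\<forall>U. submod \<Lambda> T U \<longrightarrow> U = {\<zero>\<^bsub>T\<^esub>} \<or> U = carrier T) \<longrightarrow> \<theta> \<in> mod_hom \<Lambda> P T \<longrightarrow>
      \<not> \<theta> ` carrier P \<subseteq> {\<zero>\<^bsub>T\<^esub>} \<longrightarrow> (\<exists>\<tau>\<in>mod_hom \<Lambda> (S P) T. inj_on \<tau> (carrier (S P))))" by (elim exE)
  show ?thesis
  proof (rule finite_type_of_detection[OF eq, of "set Ps" "\<lambda>P W. \<exists>\<tau>\<in>mod_hom \<Lambda> (S P) W. inj_on \<tau> (carrier (S P))"])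
    show "finite (set Ps)" by simp
    show "\<exists>D H. detects D H (\<lambda>W. \<exists>\<tau>\<in>mod_hom \<Lambda> (S P) W. inj_on \<tau> (carrier (S P)))" if "P \<in> set Ps" for P
      using S that by (intro simple_sub_detects[OF quot cov]) auto
  next
    fix W assume W: "ind W"
    note Wm = indD(3)[OF W]
    interpret W: left_module \<Lambda> W by (rule indD(4)[OF W])
    \<comment> \<open>A nonzero submodule of least length is simple.\<close>
    obtain U where U: "submod \<Lambda> W U" "U \<noteq> {\<zero>\<^bsub>W\<^esub>}" "\<And>V. submod \<Lambda> W V \<Longrightarrow> V \<noteq> {\<zero>\<^bsub>W\<^esub>} \<Longrightarrow> rl W U \<le> rl W V"
      using ex_has_least_nat[of "\<lambda>U. submod \<Lambda> W U \<and> U \<noteq> {\<zero>\<^bsub>W\<^esub>}" "carrier W" "rl W"] indD(2)[OF W] by auto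
    let ?T = "W\<lparr>carrier := U\<rparr>"
    have T: "?T \<in> mods \<Lambda>" by (rule sub_mods[OF Wm U(1)])
    have simple: "V = {\<zero>\<^bsub>?T\<^esub>} \<or> V = carrier ?T" if V: "submod \<Lambda> ?T V" for V
    proof (rule disjCI)
      assume nV: "V \<noteq> carrier ?T"
      have VW: "submod \<Lambda> W V" "V \<subseteq> U" using V submod_submod_iff[OF U(1)] by auto
      show "V = {\<zero>\<^bsub>?T\<^esub>}"
      proof (rule ccontr)
        assume "V \<noteq> {\<zero>\<^bsub>?T\<^esub>}"
        then have "rl W U \<le> rl W V" using U(3)[OF VW(1)] by simp
        then have "V = U"
          using len_eqD[OF finlen_mods[OF Wm submodD(1)[OF U(1)]] submod_res[OF VW(1)] submod_res[OF U(1)] VW(2)] by simp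
        then show False using nV by simp
      qed
    qed
    have z: "submod \<Lambda> ?T {\<zero>\<^bsub>?T\<^esub>}" by (rule left_module.submod_zero[OF modsD(1)[OF T]])
    have "{\<zero>\<^bsub>?T\<^esub>} \<noteq> carrier ?T" using U(2) by auto
    \<comment> \<open>Applying the generating property to the zero submodule gives a nonzero map
      from some \<open>P\<close> to the simple submodule, which then contains a copy of the top of
      \<open>P\<close>.\<close>
    from Ps(2)[OF T z this] obtain P \<theta> where P: "P \<in> set Ps" "\<theta> \<in> mod_hom \<Lambda> P ?T" "\<not> \<theta> ` carrier P \<subseteq> {\<zero>\<^bsub>?T\<^esub>}" by blast
    have "\<exists>\<tau>\<in>mod_hom \<Lambda> (S P) ?T. inj_on \<tau> (carrier (S P))" using S P T simple by blast
    then obtain \<tau> where \<tau>: "\<tau> \<in> mod_hom \<Lambda> (S P) ?T" "inj_on \<tau> (carrier (S P))" by blast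
    have "\<tau> \<in> mod_hom \<Lambda> (S P) W" using hom_comp[OF \<tau>(1) hom_inclusion[OF U(1)]] .
    then show "\<exists>P\<in>set Ps. \<exists>\<tau>\<in>mod_hom \<Lambda> (S P) W. inj_on \<tau> (carrier (S P))" using P(1) \<tau>(2) by blast
  qed
qed

end

theorem mainTheorem4:
  fixes R :: "('r, 'k) ring_scheme"
    and \<Lambda> :: "('r, 'a) module"
    and \<E> :: "('a, 'a list) module set"
  assumes "artin_algebra R \<Lambda>"
    and "torsionfree_class \<Lambda> \<E> \<or> torsion_class \<Lambda> \<E>"
    and "functorially_finite \<Lambda> \<E>"
  shows "finite_type \<Lambda> \<E> \<longleftrightarrow> AR_subgroup \<Lambda> \<E> = Ex_subgroup \<Lambda> \<E>"
  using assms(2)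
proof
  assume tf: "torsionfree_class \<Lambda> \<E>"
  interpret artin R \<Lambda> by (rule artin.intro[OF assms(1)])
  have sub: "X \<in> \<E>" if "X \<in> mods \<Lambda>" "Y \<in> \<E>" "f \<in> mod_hom \<Lambda> X Y" "inj_on f (carrier X)" for X Y f
    using tf that unfolding torsionfree_class_def by blast
  have Em: "\<E> \<subseteq> mods \<Lambda>" using tf unfolding torsionfree_class_def additive_subcategory_def by blast
  interpret exact_subcat R \<Lambda> \<E>
  proof
    show "additive_subcategory \<Lambda> \<E>" "extension_closed \<Lambda> \<E>" using tf unfolding torsionfree_class_def by blast+
    show "Y \<in> \<E>" if X: "X \<in> \<E>" "Y \<in> mods \<Lambda>" and b: "biprod \<Lambda> X i p Y j q Z" for X Y Z i p j q
    \<comment> \<open>A direct summand embeds by its injection, so closure under submodules covers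
      it; in the torsion case the projection does the same for quotients.\<close>
    proof (rule sub[OF X(2,1) biprodD(1)[OF b]])
      show "inj_on i (carrier Y)" using biprodD(5)[OF b] by (metis inj_onI)
    qed
  qed
  have "sub_subcat R \<Lambda> \<E>"
  proof
    show "X\<lparr>carrier := U\<rparr> \<in> \<E>" if "X \<in> \<E>" "submod \<Lambda> X U" for X U
      using that Em by (intro sub[OF sub_mods _ hom_inclusion[OF that(2)]]) auto
  qed
  then show ?thesis
    using finite_type_imp_AR_eq_Ex torsionfree_finite_type assms(3) unfolding functorially_finite_def by blast
next
  assume tc: "torsion_class \<Lambda> \<E>"
  interpret artin R \<Lambda> by (rule artin.intro[OF assms(1)])
  have quot: "Y \<in> \<E>" if "X \<in> \<E>" "Y \<in> mods \<Lambda>" "f \<in> mod_hom \<Lambda> X Y" "f ` carrier X = carrier Y" for X Y f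
    using tc that unfolding torsion_class_def by blast
  interpret exact_subcat R \<Lambda> \<E>
  proof
    show "additive_subcategory \<Lambda> \<E>" "extension_closed \<Lambda> \<E>" using tc unfolding torsion_class_def by blast+
    show "Y \<in> \<E>" if X: "X \<in> \<E>" "Y \<in> mods \<Lambda>" and b: "biprod \<Lambda> X i p Y j q Z" for X Y Z i p j q
    proof (rule quot[OF X biprodD(2)[OF b]])
      have "y \<in> p ` carrier X" if "y \<in> carrier Y" for y
        using biprodD(5)[OF b that] biprod_closed(1)[OF b that] by (metis imageI)
      then show "p ` carrier X = carrier Y" using biprod_closed(2)[OF b] by blast
    qed
  qed
  have "finite_type \<Lambda> \<E>" if eq: "AR_subgroup \<Lambda> \<E> = Ex_subgroup \<Lambda> \<E>"
  proof (rule torsion_finite_type[OF _ _ eq])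
    show "covariantly_finite \<Lambda> \<E>" using assms(3) unfolding functorially_finite_def by blast
  qed (rule quot)
  then show ?thesis using finite_type_imp_AR_eq_Ex by blast
qed

end
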